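(* Let $(M,g,\nabla,\nabla^* )$ be a statistical manifold and $U\subset M$ a dually convex set. Then the canonical divergence $\mathcal D(p,q)$ and the Phi-function $\varphi(p,q)$ are both non-negative in a neighbourhood of the diagonal $\Delta$ of $U\times U$ and vanish there only on $\Delta$. Furthermore, each $F\in\{\mathcal D,\varphi\}$ induces the dual structure $(g,\nabla,\nabla^* )$, i.e. in any local coordinates $$g_{ij}(p)=-\partial_i\partial'_jF(\xi_p,\xi_q)\big|_{p=q}=\partial'_i\partial'_jF(\xi_p,\xi_q)\big|_{p=q},$$ $$\Gamma_{ijk}(p)=-\partial_i\partial_j\partial'_kF(\xi_p,\xi_q)\big|_{p=q},\qquad \Gamma^*_{ijk}(p)=-\partial'_i\partial'_j\partial_kF(\xi_p,\xi_q)\big|_{p=q},$$ where $\partial_i=\partial/\partial\xi_p^i$, $\partial'_i=\partial/\partial\xi_q^i$, $\Gamma_{ijk}=g(\nabla_{\partial_i}\partial_j,\partial_k)$ and $\Gamma^*_{ijk}=g(\nabla^*_{\partial_i}\partial_j,\partial_k)$.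
   Context: Statistical manifold: $M$ is a smooth manifold, $g=\langle\cdot,\cdot\rangle$ a Riemannian metric, and $\nabla,\nabla^*$ are torsion-free affine connections on $TM$, dual with respect to $g$: $X g(Y,Z)=g(\nabla_XY,Z)+g(Y,\nabla^*_XZ)$ for all vector fields $X,Y,Z$. $\exp$ and $\exp^*$ denote the exponential maps of $\nabla$ and $\nabla^*$. $\xi_p=(\xi_p^1,\dots,\xi_p^n)$ and $\xi_q$ denote the coordinates of $p$ and $q$ in a common local chart. Dually convex set: $U\subset M$ such that for all $p,q\in U$ there are a unique $\nabla$-geodesic $\sigma:[0,1]\to U$ and a unique $\nabla^*$-geodesic $\sigma^*:[0,1]\to U$ with $\sigma(0)=\sigma^*(0)=p$, $\sigma(1)=\sigma^*(1)=q$. One writes $\exp_p^{-1}(q):=\dot\sigma(0)$ and $(\exp^*_p)^{-1}(q):=\dot\sigma^*(0)$. Standing convention: $U$ is open and for each $p\in U$ there is a neighbourhood $\mathcal E_p$ of $0$ in $T_pM$ on which $\exp_p$ and $\exp^*_p$ are diffeomorphisms onto images containing $U$, their inverses on $U$ being given respectively by the initial velocities $\dot\sigma(0)$ and $\dot\sigma^*(0)$ of the $\nabla$-geodesic $\sigma$ and the $\nabla^*$-geodesic $\sigma^*$ in $U$ from $p$ to $q$, which depend smoothly on $(p,q)\in U\times U$. For $p,q\in U$ with $\sigma,\sigma^*:[0,1]\to U$ the unique $\nabla$-geodesic and the unique $\nabla^*$-geodesic in $U$ from $p$ to $q$, $\Pi_q(p)\in T_qM$ is the $\nabla$-parallel transport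 of $\exp_p^{-1}(q)=\dot\sigma(0)$ along the $\nabla^*$-geodesic $\sigma^*$ from $p$ to $q$. The canonical divergence and the Phi-function are $$\mathcal D(p,q):=\int_0^1\langle \Pi_{\sigma(t)}(p),\dot\sigma(t)\rangle_{\sigma(t)}\,dt,\qquad \varphi(p,q):=\int_0^1\langle \Pi_{\sigma^*(t)}(p),\dot\sigma^*(t)\rangle_{\sigma^*(t)}\,dt .$$ *)

theory Defs
  imports "HOL-Analysis.Analysis"
begin

section \<open>Smooth maps between Euclidean spaces\<close>

text \<open>Differentiability is two-sided (\<open>at x\<close>), so these notions are meant for open sets \<open>S\<close>.\<close>

primrec Ck_on ::
  "nat \<Rightarrow> 'v::real_normed_vector set \<Rightarrow> ('v \<Rightarrow> 'w::real_normed_vector) \<Rightarrow> bool" where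
  "Ck_on 0 S f \<longleftrightarrow> continuous_on S f"
| "Ck_on (Suc k) S f \<longleftrightarrow>
     (\<forall>x\<in>S. f differentiable (at x)) \<and> (\<forall>v. Ck_on k S (\<lambda>x. frechet_derivative f (at x) v))"

definition smooth_on ::
  "'v::real_normed_vector set \<Rightarrow> ('v \<Rightarrow> 'w::real_normed_vector) \<Rightarrow> bool" where
  "smooth_on S f \<longleftrightarrow> (\<forall>k. Ck_on k S f)"

text \<open>\<open>has_iter_pd [v\<^sub>1, \<dots>, v\<^sub>m] f z d\<close>: the iterated directional derivative
  \<open>\<partial>\<^bsub>v\<^sub>1\<^esub> \<dots> \<partial>\<^bsub>v\<^sub>m\<^esub> f\<close> (with \<open>v\<^sub>m\<close> applied first) exists at \<open>z\<close> and equals \<open>d\<close>; the inner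
  derivatives are required to exist on a whole neighbourhood of \<open>z\<close>.\<close>

primrec has_iter_pd ::
  "'v::real_normed_vector list \<Rightarrow> ('v \<Rightarrow> real) \<Rightarrow> 'v \<Rightarrow> real \<Rightarrow> bool" where
  "has_iter_pd [] f z d \<longleftrightarrow> d = f z"
| "has_iter_pd (v # vs) f z d \<longleftrightarrow>
     (\<exists>h. (\<forall>\<^sub>F y in nhds z. has_iter_pd vs f y (h y)) \<and>
          ((\<lambda>t. h (z + t *\<^sub>R v)) has_real_derivative d) (at 0))"


section \<open>Smooth manifolds\<close>

text \<open>The manifold is the whole type \<open>'a\<close>; its dimension is \<open>CARD('n)\<close>. A chart is a pair of an
  open domain and a coordinate map, whose values off the domain are irrelevant. A smooth structure
  is a maximal atlas, so its members are all the local coordinate systems.\<close>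

type_synonym ('a, 'n) chart = "'a set \<times> ('a \<Rightarrow> real^'n)"

abbreviation cdom :: "('a, 'n) chart \<Rightarrow> 'a set" where "cdom \<equiv> fst"

abbreviation cmap :: "('a, 'n) chart \<Rightarrow> 'a \<Rightarrow> real^'n" where "cmap \<equiv> snd"

definition cinv :: "('a, 'n) chart \<Rightarrow> real^'n \<Rightarrow> 'a" where
  "cinv c = inv_into (cdom c) (cmap c)"

definition is_chart :: "('a::topological_space, 'n::finite) chart \<Rightarrow> bool" where
  "is_chart c \<longleftrightarrow> open (cdom c) \<and> open (cmap c ` cdom c) \<and>
     homeomorphism (cdom c) (cmap c ` cdom c) (cmap c) (cinv c)"

definition compatible :: "('a::topological_space, 'n::finite) chart \<Rightarrow> ('a, 'n) chart \<Rightarrow> bool" where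
  "compatible c c' \<longleftrightarrow>
     smooth_on (cmap c ` (cdom c \<inter> cdom c')) (cmap c' \<circ> cinv c) \<and>
     smooth_on (cmap c' ` (cdom c \<inter> cdom c')) (cmap c \<circ> cinv c')"

definition smooth_structure :: "('a::topological_space, 'n::finite) chart set \<Rightarrow> bool" where
  "smooth_structure A \<longleftrightarrow>
     (\<forall>c\<in>A. is_chart c) \<and> (\<Union>c\<in>A. cdom c) = UNIV \<and>
     (\<forall>c\<in>A. \<forall>c'\<in>A. compatible c c') \<and>
     (\<forall>c. is_chart c \<and> (\<forall>c'\<in>A. compatible c c') \<longrightarrow> c \<in> A)"

definition charts_at :: "('a, 'n) chart set \<Rightarrow> 'a \<Rightarrow> ('a, 'n) chart set" where
  "charts_at A p = {c \<in> A. p \<in> cdom c}"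

definition smooth_fun_on ::
  "('a::topological_space, 'n::finite) chart set \<Rightarrow> 'a set \<Rightarrow> ('a \<Rightarrow> real) \<Rightarrow> bool" where
  "smooth_fun_on A W f \<longleftrightarrow> (\<forall>c\<in>A. smooth_on (cmap c ` (W \<inter> cdom c)) (f \<circ> cinv c))"


section \<open>Tangent vectors and vector fields\<close>

text \<open>A tangent vector at \<open>p\<close> is the family of its component vectors in all charts around \<open>p\<close>,
  related by the Jacobians of the coordinate changes. Components at the remaining indices are set
  to \<open>0\<close>, so that equal tangent vectors are equal functions; the vector space operations are
  pointwise.\<close>

type_synonym ('a, 'n) tvec = "('a, 'n) chart \<Rightarrow> real^'n"

type_synonym ('a, 'n) vfield = "'a \<Rightarrow> ('a, 'n) tvec"

definition tangent_space ::
  "('a::topological_space, 'n::finite) chart set \<Rightarrow> 'a \<Rightarrow> ('a, 'n) tvec set" where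
  "tangent_space A p = {v.
     (\<forall>c\<in>charts_at A p. \<forall>c'\<in>charts_at A p.
        v c' = frechet_derivative (cmap c' \<circ> cinv c) (at (cmap c p)) (v c)) \<and>
     (\<forall>c. c \<notin> charts_at A p \<longrightarrow> v c = 0)}"

text \<open>The tangent vector at \<open>p\<close> with components \<open>u\<close> in the chart \<open>c\<close>.\<close>

definition tvec_of ::
  "('a::topological_space, 'n::finite) chart set \<Rightarrow> ('a, 'n) chart \<Rightarrow> 'a \<Rightarrow> real^'n \<Rightarrow> ('a, 'n) tvec"
  where
  "tvec_of A c p u = (\<lambda>c'.
     if c' \<in> charts_at A p then frechet_derivative (cmap c' \<circ> cinv c) (at (cmap c p)) u else 0)"

definition coord_field ::
  "('a::topological_space, 'n::finite) chart set \<Rightarrow> ('a, 'n) chart \<Rightarrow> 'n \<Rightarrow> ('a, 'n) vfield" where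
  "coord_field A c i = (\<lambda>p. tvec_of A c p (axis i 1))"

definition smooth_vfield_on ::
  "('a::topological_space, 'n::finite) chart set \<Rightarrow> 'a set \<Rightarrow> ('a, 'n) vfield \<Rightarrow> bool" where
  "smooth_vfield_on A W X \<longleftrightarrow>
     (\<forall>p\<in>W. X p \<in> tangent_space A p) \<and>
     (\<forall>c\<in>A. smooth_on (cmap c ` (W \<inter> cdom c)) (\<lambda>x. X (cinv c x) c))"

text \<open>The derivative \<open>v f\<close> of a function in the direction of \<open>v \<in> T\<^sub>pM\<close>; it does not depend on
  the chart.\<close>

definition dir_deriv ::
  "('a::topological_space, 'n::finite) chart set \<Rightarrow> 'a \<Rightarrow> ('a, 'n) tvec \<Rightarrow> ('a \<Rightarrow> real) \<Rightarrow> real" where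
  "dir_deriv A p v f =
     (let c = (SOME c. c \<in> charts_at A p)
      in frechet_derivative (f \<circ> cinv c) (at (cmap c p)) (v c))"

definition lie_bracket ::
  "('a::topological_space, 'n::finite) chart set \<Rightarrow> ('a, 'n) vfield \<Rightarrow> ('a, 'n) vfield
    \<Rightarrow> ('a, 'n) vfield" where
  "lie_bracket A X Y = (\<lambda>p c.
     if c \<in> charts_at A p
     then frechet_derivative (\<lambda>x. Y (cinv c x) c) (at (cmap c p)) (X p c)
        - frechet_derivative (\<lambda>x. X (cinv c x) c) (at (cmap c p)) (Y p c)
     else 0)"


section \<open>Statistical manifolds\<close>

definition riemannian_metric ::
  "('a::topological_space, 'n::finite) chart set
    \<Rightarrow> ('a \<Rightarrow> ('a, 'n) tvec \<Rightarrow> ('a, 'n) tvec \<Rightarrow> real) \<Rightarrow> bool" where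
  "riemannian_metric A g \<longleftrightarrow>
     (\<forall>p. \<forall>u\<in>tangent_space A p. \<forall>v\<in>tangent_space A p.
        g p u v = g p v u \<and>
        (u \<noteq> (\<lambda>c. 0) \<longrightarrow> g p u u > 0) \<and>
        (\<forall>w\<in>tangent_space A p. \<forall>a b.
           g p (\<lambda>c. a *\<^sub>R u c + b *\<^sub>R v c) w = a * g p u w + b * g p v w)) \<and>
     (\<forall>W X Y. open W \<and> smooth_vfield_on A W X \<and> smooth_vfield_on A W Y \<longrightarrow>
        smooth_fun_on A W (\<lambda>p. g p (X p) (Y p)))"

text \<open>A connection is given by its action \<open>(X, Y) \<mapsto> \<nabla>\<^sub>X Y\<close> on smooth vector fields, globally
  (\<open>W = UNIV\<close>) and over every open \<open>W \<subseteq> M\<close>. As fields over \<open>W\<close> are encoded by total functions,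
  the third conjunct says that their values off \<open>W\<close> do not matter and that the action is
  compatible with restriction to smaller open sets. By locality every connection on global fields
  extends uniquely to this format.\<close>

definition affine_connection ::
  "('a::topological_space, 'n::finite) chart set
    \<Rightarrow> (('a, 'n) vfield \<Rightarrow> ('a, 'n) vfield \<Rightarrow> ('a, 'n) vfield) \<Rightarrow> bool" where
  "affine_connection A nabla \<longleftrightarrow>
     (\<forall>W X X' Y Y' f.
        open W \<and> smooth_vfield_on A W X \<and> smooth_vfield_on A W X' \<and>
        smooth_vfield_on A W Y \<and> smooth_vfield_on A W Y' \<and> smooth_fun_on A W f \<longrightarrow>
        smooth_vfield_on A W (nabla X Y) \<and>
        ((\<forall>p\<in>W. X p = X' p \<and> Y p = Y' p) \<longrightarrow> (\<forall>p\<in>W. nabla X Y p = nabla X' Y' p)) \<and>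
        (\<forall>p\<in>W.
           nabla (\<lambda>q c. X q c + X' q c) Y p = (\<lambda>c. nabla X Y p c + nabla X' Y p c) \<and>
           nabla (\<lambda>q c. f q *\<^sub>R X q c) Y p = (\<lambda>c. f p *\<^sub>R nabla X Y p c) \<and>
           nabla X (\<lambda>q c. Y q c + Y' q c) p = (\<lambda>c. nabla X Y p c + nabla X Y' p c) \<and>
           nabla X (\<lambda>q c. f q *\<^sub>R Y q c) p =
             (\<lambda>c. dir_deriv A p (X p) f *\<^sub>R Y p c + f p *\<^sub>R nabla X Y p c)))"

definition torsion_free ::
  "('a::topological_space, 'n::finite) chart set
    \<Rightarrow> (('a, 'n) vfield \<Rightarrow> ('a, 'n) vfield \<Rightarrow> ('a, 'n) vfield) \<Rightarrow> bool" where
  "torsion_free A nabla \<longleftrightarrow>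
     (\<forall>W X Y. open W \<and> smooth_vfield_on A W X \<and> smooth_vfield_on A W Y \<longrightarrow>
        (\<forall>p\<in>W. (\<lambda>c. nabla X Y p c - nabla Y X p c) = lie_bracket A X Y p))"

definition dual_connections ::
  "('a::topological_space, 'n::finite) chart set
    \<Rightarrow> ('a \<Rightarrow> ('a, 'n) tvec \<Rightarrow> ('a, 'n) tvec \<Rightarrow> real)
    \<Rightarrow> (('a, 'n) vfield \<Rightarrow> ('a, 'n) vfield \<Rightarrow> ('a, 'n) vfield)
    \<Rightarrow> (('a, 'n) vfield \<Rightarrow> ('a, 'n) vfield \<Rightarrow> ('a, 'n) vfield) \<Rightarrow> bool" where
  "dual_connections A g nabla nabla' \<longleftrightarrow>
     (\<forall>W X Y Z. open W \<and> smooth_vfield_on A W X \<and> smooth_vfield_on A W Y \<and>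
        smooth_vfield_on A W Z \<longrightarrow>
        (\<forall>p\<in>W. dir_deriv A p (X p) (\<lambda>q. g q (Y q) (Z q)) =
                 g p (nabla X Y p) (Z p) + g p (Y p) (nabla' X Z p)))"

definition statistical_manifold ::
  "('a::topological_space, 'n::finite) chart set
    \<Rightarrow> ('a \<Rightarrow> ('a, 'n) tvec \<Rightarrow> ('a, 'n) tvec \<Rightarrow> real)
    \<Rightarrow> (('a, 'n) vfield \<Rightarrow> ('a, 'n) vfield \<Rightarrow> ('a, 'n) vfield)
    \<Rightarrow> (('a, 'n) vfield \<Rightarrow> ('a, 'n) vfield \<Rightarrow> ('a, 'n) vfield) \<Rightarrow> bool" where
  "statistical_manifold A g nabla nabla' \<longleftrightarrow>
     smooth_structure A \<and> riemannian_metric A g \<and>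
     affine_connection A nabla \<and> torsion_free A nabla \<and>
     affine_connection A nabla' \<and> torsion_free A nabla' \<and>
     dual_connections A g nabla nabla'"


section \<open>Parallel transport, geodesics, exponential maps\<close>

definition velocity ::
  "('a::topological_space, 'n::finite) chart set \<Rightarrow> (real \<Rightarrow> 'a) \<Rightarrow> real \<Rightarrow> ('a, 'n) tvec" where
  "velocity A \<sigma> t = (\<lambda>c.
     if c \<in> charts_at A (\<sigma> t) then vector_derivative (cmap c \<circ> \<sigma>) (at t within {0..1}) else 0)"

text \<open>The vector with components \<open>\<Sum>\<^sub>i\<^sub>j \<Gamma>\<^sup>k\<^sub>i\<^sub>j u\<^sup>i w\<^sup>j\<close>, where \<open>\<nabla>\<^bsub>\<partial>\<^sub>i\<^esub> \<partial>\<^sub>j = \<Sum>\<^sub>k \<Gamma>\<^sup>k\<^sub>i\<^sub>j \<partial>\<^sub>k\<close>.\<close>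

definition christoffel ::
  "('a::topological_space, 'n::finite) chart set
    \<Rightarrow> (('a, 'n) vfield \<Rightarrow> ('a, 'n) vfield \<Rightarrow> ('a, 'n) vfield)
    \<Rightarrow> ('a, 'n) chart \<Rightarrow> 'a \<Rightarrow> real^'n \<Rightarrow> real^'n \<Rightarrow> real^'n" where
  "christoffel A nabla c p u w =
     (\<Sum>i\<in>UNIV. \<Sum>j\<in>UNIV.
        (u $ i * w $ j) *\<^sub>R nabla (coord_field A c i) (coord_field A c j) p c)"

definition C1_curve :: "('a::topological_space, 'n::finite) chart set \<Rightarrow> (real \<Rightarrow> 'a) \<Rightarrow> bool" where
  "C1_curve A \<sigma> \<longleftrightarrow> continuous_on {0..1} \<sigma> \<and>
     (\<forall>c\<in>A. (\<forall>t\<in>{0..1}. \<sigma> t \<in> cdom c \<longrightarrow> (cmap c \<circ> \<sigma>) differentiable (at t within {0..1})) \<and>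
        continuous_on {t\<in>{0..1}. \<sigma> t \<in> cdom c} (\<lambda>t. velocity A \<sigma> t c))"

text \<open>The equation \<open>\<nabla>\<^bsub>\<sigma>'\<^esub> V = 0\<close> along \<open>\<sigma>\<close>, in local coordinates.\<close>

definition parallel_along ::
  "('a::topological_space, 'n::finite) chart set
    \<Rightarrow> (('a, 'n) vfield \<Rightarrow> ('a, 'n) vfield \<Rightarrow> ('a, 'n) vfield)
    \<Rightarrow> (real \<Rightarrow> 'a) \<Rightarrow> (real \<Rightarrow> ('a, 'n) tvec) \<Rightarrow> bool" where
  "parallel_along A nabla \<sigma> V \<longleftrightarrow>
     (\<forall>t\<in>{0..1}. V t \<in> tangent_space A (\<sigma> t) \<and>
        (\<forall>c\<in>charts_at A (\<sigma> t).
           ((\<lambda>s. V s c) has_vector_derivative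
              - christoffel A nabla c (\<sigma> t) (velocity A \<sigma> t c) (V t c)) (at t within {0..1})))"

definition parallel_transport ::
  "('a::topological_space, 'n::finite) chart set
    \<Rightarrow> (('a, 'n) vfield \<Rightarrow> ('a, 'n) vfield \<Rightarrow> ('a, 'n) vfield)
    \<Rightarrow> (real \<Rightarrow> 'a) \<Rightarrow> ('a, 'n) tvec \<Rightarrow> ('a, 'n) tvec" where
  "parallel_transport A nabla \<sigma> v =
     (THE w. \<exists>V. parallel_along A nabla \<sigma> V \<and> V 0 = v \<and> V 1 = w)"

definition geodesic ::
  "('a::topological_space, 'n::finite) chart set
    \<Rightarrow> (('a, 'n) vfield \<Rightarrow> ('a, 'n) vfield \<Rightarrow> ('a, 'n) vfield) \<Rightarrow> (real \<Rightarrow> 'a) \<Rightarrow> bool" where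
  "geodesic A nabla \<sigma> \<longleftrightarrow> C1_curve A \<sigma> \<and> parallel_along A nabla \<sigma> (velocity A \<sigma>)"

definition exp_domain ::
  "('a::topological_space, 'n::finite) chart set
    \<Rightarrow> (('a, 'n) vfield \<Rightarrow> ('a, 'n) vfield \<Rightarrow> ('a, 'n) vfield) \<Rightarrow> 'a \<Rightarrow> ('a, 'n) tvec set" where
  "exp_domain A nabla p =
     {v \<in> tangent_space A p. \<exists>\<sigma>. geodesic A nabla \<sigma> \<and> \<sigma> 0 = p \<and> velocity A \<sigma> 0 = v}"

definition exp_map ::
  "('a::topological_space, 'n::finite) chart set
    \<Rightarrow> (('a, 'n) vfield \<Rightarrow> ('a, 'n) vfield \<Rightarrow> ('a, 'n) vfield) \<Rightarrow> 'a \<Rightarrow> ('a, 'n) tvec \<Rightarrow> 'a" where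
  "exp_map A nabla p v =
     (THE q. \<exists>\<sigma>. geodesic A nabla \<sigma> \<and> \<sigma> 0 = p \<and> velocity A \<sigma> 0 = v \<and> \<sigma> 1 = q)"

text \<open>\<open>exp\<^sub>p\<close> is a diffeomorphism from the open neighbourhood \<open>E\<close> of \<open>0\<close> in \<open>T\<^sub>pM\<close> onto its
  (open) image; the vector space \<open>T\<^sub>pM\<close> is identified with \<open>real^'n\<close> by a chart \<open>c\<close> around \<open>p\<close>.\<close>

definition exp_diffeo_on ::
  "('a::topological_space, 'n::finite) chart set
    \<Rightarrow> (('a, 'n) vfield \<Rightarrow> ('a, 'n) vfield \<Rightarrow> ('a, 'n) vfield)
    \<Rightarrow> 'a \<Rightarrow> ('a, 'n) tvec set \<Rightarrow> bool" where
  "exp_diffeo_on A nabla p E \<longleftrightarrow>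
     E \<subseteq> exp_domain A nabla p \<and> (\<lambda>c. 0) \<in> E \<and>
     inj_on (exp_map A nabla p) E \<and> open (exp_map A nabla p ` E) \<and>
     (\<forall>c\<in>charts_at A p.
        open ((\<lambda>v. v c) ` E) \<and>
        continuous_on ((\<lambda>v. v c) ` E) (\<lambda>u. exp_map A nabla p (tvec_of A c p u)) \<and>
        (\<forall>c'\<in>A.
           smooth_on {u \<in> (\<lambda>v. v c) ` E. exp_map A nabla p (tvec_of A c p u) \<in> cdom c'}
             (\<lambda>u. cmap c' (exp_map A nabla p (tvec_of A c p u))) \<and>
           smooth_on (cmap c' ` (exp_map A nabla p ` E \<inter> cdom c'))
             (\<lambda>y. inv_into E (exp_map A nabla p) (cinv c' y) c)))"


section \<open>Dually convex sets, the canonical divergence and the Phi-function\<close>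

text \<open>Curves \<open>[0,1] \<rightarrow> U\<close> are extensional functions, so that uniqueness is uniqueness on \<open>[0,1]\<close>.\<close>

definition geodesic_from_to ::
  "('a::topological_space, 'n::finite) chart set
    \<Rightarrow> (('a, 'n) vfield \<Rightarrow> ('a, 'n) vfield \<Rightarrow> ('a, 'n) vfield)
    \<Rightarrow> 'a set \<Rightarrow> 'a \<Rightarrow> 'a \<Rightarrow> (real \<Rightarrow> 'a) \<Rightarrow> bool" where
  "geodesic_from_to A nabla U p q \<sigma> \<longleftrightarrow>
     \<sigma> \<in> {0..1} \<rightarrow>\<^sub>E U \<and> geodesic A nabla \<sigma> \<and> \<sigma> 0 = p \<and> \<sigma> 1 = q"

definition dually_convex ::
  "('a::topological_space, 'n::finite) chart set
    \<Rightarrow> (('a, 'n) vfield \<Rightarrow> ('a, 'n) vfield \<Rightarrow> ('a, 'n) vfield)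
    \<Rightarrow> (('a, 'n) vfield \<Rightarrow> ('a, 'n) vfield \<Rightarrow> ('a, 'n) vfield) \<Rightarrow> 'a set \<Rightarrow> bool" where
  "dually_convex A nabla nabla' U \<longleftrightarrow>
     (\<forall>p\<in>U. \<forall>q\<in>U. (\<exists>!\<sigma>. geodesic_from_to A nabla U p q \<sigma>) \<and>
                  (\<exists>!\<sigma>. geodesic_from_to A nabla' U p q \<sigma>))"

definition the_geodesic ::
  "('a::topological_space, 'n::finite) chart set
    \<Rightarrow> (('a, 'n) vfield \<Rightarrow> ('a, 'n) vfield \<Rightarrow> ('a, 'n) vfield)
    \<Rightarrow> 'a set \<Rightarrow> 'a \<Rightarrow> 'a \<Rightarrow> real \<Rightarrow> 'a" where
  "the_geodesic A nabla U p q = (THE \<sigma>. geodesic_from_to A nabla U p q \<sigma>)"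

text \<open>The initial velocity written \<open>exp\<^sub>p\<^sup>-\<^sup>1(q)\<close>.\<close>

definition exp_inv ::
  "('a::topological_space, 'n::finite) chart set
    \<Rightarrow> (('a, 'n) vfield \<Rightarrow> ('a, 'n) vfield \<Rightarrow> ('a, 'n) vfield)
    \<Rightarrow> 'a set \<Rightarrow> 'a \<Rightarrow> 'a \<Rightarrow> ('a, 'n) tvec" where
  "exp_inv A nabla U p q = velocity A (the_geodesic A nabla U p q) 0"

definition smooth_exp_inv ::
  "('a::topological_space, 'n::finite) chart set
    \<Rightarrow> (('a, 'n) vfield \<Rightarrow> ('a, 'n) vfield \<Rightarrow> ('a, 'n) vfield) \<Rightarrow> 'a set \<Rightarrow> bool" where
  "smooth_exp_inv A nabla U \<longleftrightarrow>
     (\<forall>c\<in>A. \<forall>c'\<in>A.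
        smooth_on ((cmap c ` (U \<inter> cdom c)) \<times> (cmap c' ` (U \<inter> cdom c')))
          (\<lambda>(x, y). exp_inv A nabla U (cinv c x) (cinv c' y) c))"

text \<open>The standing regularity convention on dually convex sets.\<close>

definition regular_dually_convex ::
  "('a::topological_space, 'n::finite) chart set
    \<Rightarrow> (('a, 'n) vfield \<Rightarrow> ('a, 'n) vfield \<Rightarrow> ('a, 'n) vfield)
    \<Rightarrow> (('a, 'n) vfield \<Rightarrow> ('a, 'n) vfield \<Rightarrow> ('a, 'n) vfield) \<Rightarrow> 'a set \<Rightarrow> bool" where
  "regular_dually_convex A nabla nabla' U \<longleftrightarrow>
     open U \<and> dually_convex A nabla nabla' U \<and>
     (\<forall>p\<in>U. \<exists>E.
        (\<forall>D\<in>{nabla, nabla'}.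
           exp_diffeo_on A D p E \<and> U \<subseteq> exp_map A D p ` E \<and>
           (\<forall>q\<in>U. inv_into E (exp_map A D p) q = exp_inv A D U p q))) \<and>
     (\<forall>D\<in>{nabla, nabla'}. smooth_exp_inv A D U)"

text \<open>\<open>Pi_vec A nabla nabla' U p q\<close> is \<open>\<Pi>\<^sub>q(p) \<in> T\<^sub>qM\<close>.\<close>

definition Pi_vec ::
  "('a::topological_space, 'n::finite) chart set
    \<Rightarrow> (('a, 'n) vfield \<Rightarrow> ('a, 'n) vfield \<Rightarrow> ('a, 'n) vfield)
    \<Rightarrow> (('a, 'n) vfield \<Rightarrow> ('a, 'n) vfield \<Rightarrow> ('a, 'n) vfield)
    \<Rightarrow> 'a set \<Rightarrow> 'a \<Rightarrow> 'a \<Rightarrow> ('a, 'n) tvec" where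
  "Pi_vec A nabla nabla' U p q =
     parallel_transport A nabla (the_geodesic A nabla' U p q) (exp_inv A nabla U p q)"

definition canonical_divergence ::
  "('a::topological_space, 'n::finite) chart set
    \<Rightarrow> ('a \<Rightarrow> ('a, 'n) tvec \<Rightarrow> ('a, 'n) tvec \<Rightarrow> real)
    \<Rightarrow> (('a, 'n) vfield \<Rightarrow> ('a, 'n) vfield \<Rightarrow> ('a, 'n) vfield)
    \<Rightarrow> (('a, 'n) vfield \<Rightarrow> ('a, 'n) vfield \<Rightarrow> ('a, 'n) vfield)
    \<Rightarrow> 'a set \<Rightarrow> 'a \<Rightarrow> 'a \<Rightarrow> real" where
  "canonical_divergence A g nabla nabla' U p q =
     (let \<sigma> = the_geodesic A nabla U p q
      in integral {0..1} (\<lambda>t. g (\<sigma> t) (Pi_vec A nabla nabla' U p (\<sigma> t)) (velocity A \<sigma> t)))"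

definition phi_function ::
  "('a::topological_space, 'n::finite) chart set
    \<Rightarrow> ('a \<Rightarrow> ('a, 'n) tvec \<Rightarrow> ('a, 'n) tvec \<Rightarrow> real)
    \<Rightarrow> (('a, 'n) vfield \<Rightarrow> ('a, 'n) vfield \<Rightarrow> ('a, 'n) vfield)
    \<Rightarrow> (('a, 'n) vfield \<Rightarrow> ('a, 'n) vfield \<Rightarrow> ('a, 'n) vfield)
    \<Rightarrow> 'a set \<Rightarrow> 'a \<Rightarrow> 'a \<Rightarrow> real" where
  "phi_function A g nabla nabla' U p q =
     (let \<sigma>' = the_geodesic A nabla' U p q
      in integral {0..1} (\<lambda>t. g (\<sigma>' t) (Pi_vec A nabla nabla' U p (\<sigma>' t)) (velocity A \<sigma>' t)))"


section \<open>The dual structure induced by a two-point function\<close>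

definition metric_coeff ::
  "('a::topological_space, 'n::finite) chart set
    \<Rightarrow> ('a \<Rightarrow> ('a, 'n) tvec \<Rightarrow> ('a, 'n) tvec \<Rightarrow> real)
    \<Rightarrow> ('a, 'n) chart \<Rightarrow> 'a \<Rightarrow> 'n \<Rightarrow> 'n \<Rightarrow> real" where
  "metric_coeff A g c p i j = g p (coord_field A c i p) (coord_field A c j p)"

text \<open>\<open>\<Gamma>\<^sub>i\<^sub>j\<^sub>k = g(\<nabla>\<^bsub>\<partial>\<^sub>i\<^esub> \<partial>\<^sub>j, \<partial>\<^sub>k)\<close>\<close>

definition connection_coeff ::
  "('a::topological_space, 'n::finite) chart set
    \<Rightarrow> ('a \<Rightarrow> ('a, 'n) tvec \<Rightarrow> ('a, 'n) tvec \<Rightarrow> real)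
    \<Rightarrow> (('a, 'n) vfield \<Rightarrow> ('a, 'n) vfield \<Rightarrow> ('a, 'n) vfield)
    \<Rightarrow> ('a, 'n) chart \<Rightarrow> 'a \<Rightarrow> 'n \<Rightarrow> 'n \<Rightarrow> 'n \<Rightarrow> real" where
  "connection_coeff A g nabla c p i j k =
     g p (nabla (coord_field A c i) (coord_field A c j) p) (coord_field A c k p)"

text \<open>The coordinate directions \<open>\<partial>\<^sub>i = \<partial>/\<partial>\<xi>\<^sub>p\<^sup>i\<close> and \<open>\<partial>'\<^sub>i = \<partial>/\<partial>\<xi>\<^sub>q\<^sup>i\<close> for functions of
  \<open>(\<xi>\<^sub>p, \<xi>\<^sub>q)\<close>.\<close>

definition dir1 :: "'n::finite \<Rightarrow> (real^'n) \<times> (real^'n)" where "dir1 i = (axis i 1, 0)"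

definition dir2 :: "'n::finite \<Rightarrow> (real^'n) \<times> (real^'n)" where "dir2 i = (0, axis i 1)"

definition induces_dual_structure ::
  "('a::topological_space, 'n::finite) chart set
    \<Rightarrow> ('a \<Rightarrow> ('a, 'n) tvec \<Rightarrow> ('a, 'n) tvec \<Rightarrow> real)
    \<Rightarrow> (('a, 'n) vfield \<Rightarrow> ('a, 'n) vfield \<Rightarrow> ('a, 'n) vfield)
    \<Rightarrow> (('a, 'n) vfield \<Rightarrow> ('a, 'n) vfield \<Rightarrow> ('a, 'n) vfield)
    \<Rightarrow> 'a set \<Rightarrow> ('a \<Rightarrow> 'a \<Rightarrow> real) \<Rightarrow> bool" where
  "induces_dual_structure A g nabla nabla' U F \<longleftrightarrow>
     (\<forall>c\<in>A. \<forall>p \<in> U \<inter> cdom c. \<forall>i j k.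
        let f = (\<lambda>(x, y). F (cinv c x) (cinv c y)); z = (cmap c p, cmap c p)
        in has_iter_pd [dir1 i, dir2 j] f z (- metric_coeff A g c p i j) \<and>
           has_iter_pd [dir2 i, dir2 j] f z (metric_coeff A g c p i j) \<and>
           has_iter_pd [dir1 i, dir1 j, dir2 k] f z (- connection_coeff A g nabla c p i j k) \<and>
           has_iter_pd [dir2 i, dir2 j, dir1 k] f z (- connection_coeff A g nabla' c p i j k))"

end

theory Submission
  imports Defs
begin

text \<open>Write \<open>X\<close> and \<open>X*\<close> for the two inverse exponential maps in a chart. Dual convexity gives
  \<open>X (x, \<sigma> t) = t X (x, y)\<close> along the geodesic \<open>\<sigma>\<close> from \<open>x\<close> to \<open>y\<close>; since \<open>X (x, \<cdot>)\<close> is injective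
  with derivative \<open>1\<close> at \<open>x\<close>, invariance of domain turns it into a smooth local inverse \<open>e\<close> with
  \<open>\<sigma> t = e (x, t X (x, y))\<close>. Parallel transport is a linear ODE whose solution depends smoothly on
  \<open>(x, y)\<close>, so both functions are \<open>C\<^sup>3\<close> near the diagonal. Along \<open>\<gamma> t = e (x, t v)\<close> one has
  \<open>d/dt F (x, \<gamma> t) = \<langle>\<Pi>(x), \<gamma>'\<rangle>\<close>, and expanding this to second order yields for either function
  \<open>D\<^sub>2\<^sup>2 F (v, v) = g (v, v)\<close> and \<open>D\<^sub>2\<^sup>3 F (v, v, v) = (\<Gamma> + 2 \<Gamma>*) (v, v, v)\<close> on the diagonal: the
  acceleration of \<open>\<gamma>\<close>, the only trace of the choice of geodesic, cancels. The mixed derivatives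
  follow by polarization and by differentiating these identities along the diagonal, and
  \<open>F \<ge> 0\<close> near the diagonal because \<open>D\<^sub>2\<^sup>2 F\<close> is positive definite there.\<close>

section \<open>Calculus of functions of class \<open>C\<^sup>k\<close>\<close>

text \<open>No geodesic equation is solved: how geodesics depend on their endpoints is read off the
  smooth inverse exponential maps of the standing convention, and the only ODE solved is the linear
  one of parallel transport. The obstacle is that a geodesic of \<open>U\<close> joining two points
  of a chart may leave that chart. Close to the diagonal a comparison settles this:
  \<open>s \<mapsto> e (x, s X (x, y))\<close> stays in the chart and has at each time the same
  inverse exponential \<open>s X (x, y)\<close> as the geodesic, so injectivity identifies the two.
  The weights in \<open>\<Gamma> + 2 \<Gamma>*\<close> are a balance along \<open>\<gamma>\<close>
  with acceleration \<open>w\<close>: the inverse exponential of the first connection has second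
  derivative \<open>\<Gamma> v v + w\<close>, the transport contributes
  \<open>-2 \<Gamma> v v\<close>, and the derivative of the metric adds \<open>\<Gamma>\<close> and
  \<open>\<Gamma>*\<close> twice each. Polarization recovers only the symmetric part of this cubic
  form; that is enough, because vanishing torsion and duality make the lowered tensor
  \<open>\<Gamma> - \<Gamma>*\<close> symmetric in all three arguments.\<close>

lemma Ck_on_cong:
  assumes "open S" "Ck_on k S f" "\<And>x. x \<in> S \<Longrightarrow> f x = g x"
  shows "Ck_on k S g"
  using assms(2,3)
proof (induction k arbitrary: f g)
  case 0 then show ?case using continuous_on_cong[of S S f g] by simp
next
  case (Suc k)
  have d: "(g has_derivative frechet_derivative f (at x)) (at x)" if "x \<in> S" for x
  proof -
    have "(f has_derivative frechet_derivative f (at x)) (at x)"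
      using Suc.prems that by (simp add: frechet_derivative_works[symmetric])
    then show ?thesis
      by (rule has_derivative_transform_within_open[OF _ assms(1) that]) (use Suc.prems in auto)
  qed
  have e: "frechet_derivative g (at x) = frechet_derivative f (at x)" if "x \<in> S" for x
    using frechet_derivative_at[OF d[OF that]] by simp
  show ?case
    using d Suc.IH[of "\<lambda>x. frechet_derivative f (at x) v" "\<lambda>x. frechet_derivative g (at x) v" for v] Suc.prems e
    by (auto simp: differentiable_def)
qed

lemma Ck_on_subset: "Ck_on k S f \<Longrightarrow> T \<subseteq> S \<Longrightarrow> Ck_on k T f"
  by (induction k arbitrary: f) (auto intro: continuous_on_subset)

lemma Ck_on_SucD: "Ck_on (Suc k) S f \<Longrightarrow> Ck_on k S f"
  by (induction k arbitrary: f)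
    (auto intro!: continuous_at_imp_continuous_on differentiable_imp_continuous_within)

lemma Ck_on_le: "Ck_on k S f \<Longrightarrow> j \<le> k \<Longrightarrow> Ck_on j S f"
  by (induction k) (auto simp: le_Suc_eq simp del: Ck_on.simps dest: Ck_on_SucD)

lemma Ck_on_imp_continuous_on: "Ck_on k S f \<Longrightarrow> continuous_on S f"
  using Ck_on_le[of k S f 0] by simp

lemma Ck_on_has_derivative:
  "Ck_on (Suc k) S f \<Longrightarrow> x \<in> S \<Longrightarrow> (f has_derivative frechet_derivative f (at x)) (at x)"
  by (simp add: frechet_derivative_works[symmetric])

lemma Ck_on_frechet: "Ck_on (Suc k) S f \<Longrightarrow> Ck_on k S (\<lambda>x. frechet_derivative f (at x) v)"
  by simp

lemma Ck_on_Suc_I: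
  assumes "open S" "\<And>x. x \<in> S \<Longrightarrow> (f has_derivative f' x) (at x)"
    and "\<And>v. Ck_on k S (\<lambda>x. f' x v)"
  shows "Ck_on (Suc k) S f"
proof -
  have "frechet_derivative f (at x) = f' x" if "x \<in> S" for x
    using frechet_derivative_at[OF assms(2)[OF that]] by simp
  moreover have "f differentiable at x" if "x \<in> S" for x
    using assms(2)[OF that] differentiable_def by blast
  ultimately show ?thesis
    using Ck_on_cong[OF assms(1,3)] by simp
qed

lemma Ck_on_const [intro, simp]: "Ck_on k S (\<lambda>x. c)"
  by (induction k arbitrary: c) auto

lemma Ck_on_linear:
  assumes "bounded_linear f" "open S" shows "Ck_on k S f"
proof (cases k)
  case 0 then show ?thesis using assms by (simp add: linear_continuous_on)
next
  case (Suc j)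
  then show ?thesis
    using Ck_on_Suc_I[OF assms(2), of f "\<lambda>x. f" j] assms(1)
    by (simp del: Ck_on.simps add: bounded_linear_imp_has_derivative)
qed

lemma Ck_on_linear_compose:
  assumes "bounded_linear h" "open S" "Ck_on k S f" shows "Ck_on k S (\<lambda>x. h (f x))"
  using assms(3)
proof (induction k arbitrary: f)
  case 0 then show ?case
    using continuous_on_compose2[OF linear_continuous_on[OF assms(1), of UNIV]] by auto
next
  case (Suc k)
  show ?case
  proof (rule Ck_on_Suc_I[OF assms(2)])
    show "((\<lambda>x. h (f x)) has_derivative (\<lambda>v. h (frechet_derivative f (at x) v))) (at x)"
      if "x \<in> S" for x
      using bounded_linear.has_derivative[OF assms(1) Ck_on_has_derivative[OF Suc.prems that]] .
  qed (use Suc in auto)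
qed

lemma Ck_on_add:
  assumes "open S" "Ck_on k S f" "Ck_on k S g" shows "Ck_on k S (\<lambda>x. f x + g x)"
  using assms(2,3)
proof (induction k arbitrary: f g)
  case 0 then show ?case by (auto intro: continuous_intros)
next
  case (Suc k)
  show ?case
  proof (rule Ck_on_Suc_I[OF assms(1)])
    show "((\<lambda>x. f x + g x) has_derivative
      (\<lambda>v. frechet_derivative f (at x) v + frechet_derivative g (at x) v)) (at x)"
      if "x \<in> S" for x
      using has_derivative_add[OF Ck_on_has_derivative[OF Suc.prems(1) that]
        Ck_on_has_derivative[OF Suc.prems(2) that]] .
  qed (use Suc in auto)
qed

lemma Ck_on_minus: "open S \<Longrightarrow> Ck_on k S f \<Longrightarrow> Ck_on k S (\<lambda>x. - f x)"
  by (rule Ck_on_linear_compose[OF bounded_linear_minus[OF bounded_linear_ident]])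

lemma Ck_on_diff:
  "open S \<Longrightarrow> Ck_on k S f \<Longrightarrow> Ck_on k S g \<Longrightarrow> Ck_on k S (\<lambda>x. f x - g x)"
  using Ck_on_add[of S k f "\<lambda>x. - g x"] Ck_on_minus[of S k g] by simp

lemma Ck_on_sum:
  assumes "open S" "\<And>i. i \<in> I \<Longrightarrow> Ck_on k S (f i)"
  shows "Ck_on k S (\<lambda>x. \<Sum>i\<in>I. f i x)"
  using assms(2) by (induction I rule: infinite_finite_induct) (auto intro: Ck_on_add[OF assms(1)])

lemma Ck_on_bilinear:
  assumes "bounded_bilinear h" "open S" "Ck_on k S f" "Ck_on k S g"
  shows "Ck_on k S (\<lambda>x. h (f x) (g x))"
  using assms(3,4)
proof (induction k arbitrary: f g)
  case 0 then show ?case by (auto intro: bounded_bilinear.continuous_on[OF assms(1)])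
next
  case (Suc k)
  show ?case
  proof (rule Ck_on_Suc_I[OF assms(2)])
    show "((\<lambda>x. h (f x) (g x)) has_derivative
      (\<lambda>v. h (f x) (frechet_derivative g (at x) v) + h (frechet_derivative f (at x) v) (g x))) (at x)"
      if "x \<in> S" for x
      using bounded_bilinear.FDERIV[OF assms(1) Ck_on_has_derivative[OF Suc.prems(1) that]
        Ck_on_has_derivative[OF Suc.prems(2) that]] .
    show "Ck_on k S (\<lambda>x. h (f x) (frechet_derivative g (at x) v) +
      h (frechet_derivative f (at x) v) (g x))" for v
      by (intro Ck_on_add[OF assms(2)] Suc.IH Ck_on_frechet Suc.prems Ck_on_SucD[OF Suc.prems(1)]
        Ck_on_SucD[OF Suc.prems(2)])
  qed
qed

lemmas Ck_on_scaleR = Ck_on_bilinear[OF bounded_bilinear_scaleR]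
lemmas Ck_on_mult = Ck_on_bilinear[OF bounded_bilinear_mult]
lemmas Ck_on_inner = Ck_on_bilinear[OF bounded_bilinear_inner]

lemma Ck_on_Pair:
  assumes "open S" "Ck_on k S f" "Ck_on k S g"
  shows "Ck_on k S (\<lambda>x. (f x, g x))"
proof -
  have "Ck_on k S (\<lambda>x. (f x, 0) + (0, g x))"
    by (intro Ck_on_add assms Ck_on_linear_compose[of "\<lambda>y. (y, 0)"] Ck_on_linear_compose[of "\<lambda>y. (0, y)"]
       bounded_linear_Pair bounded_linear_ident bounded_linear_zero)
  then show ?thesis by simp
qed

lemmas Ck_on_fst = Ck_on_linear_compose[OF bounded_linear_fst]
lemmas Ck_on_snd = Ck_on_linear_compose[OF bounded_linear_snd]
lemmas Ck_on_ident = Ck_on_linear[OF bounded_linear_ident]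

lemma Ck_on_vec_nth: "open S \<Longrightarrow> Ck_on k S f \<Longrightarrow> Ck_on k S (\<lambda>x. f x $ i)"
  by (rule Ck_on_linear_compose[OF bounded_linear_vec_nth])

lemma Ck_on_vec_lambda:
  assumes "open S" "\<And>i. Ck_on k S (\<lambda>x. f x i :: real)"
  shows "Ck_on k S (\<lambda>x. \<chi> i::'n::finite. f x i)"
proof -
  have "(\<chi> i. f x i) = (\<Sum>i\<in>UNIV. f x i *\<^sub>R axis i 1)" for x
    by (simp add: vec_eq_iff sum_component axis_def if_distrib cong: if_cong)
  then show ?thesis
    by (simp, intro Ck_on_sum Ck_on_scaleR assms Ck_on_const)
qed

lemma linear_euclidean_expand:
  assumes "linear f" shows "f (x::'a::euclidean_space) = (\<Sum>b\<in>Basis. (x \<bullet> b) *\<^sub>R f b)"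
proof -
  have "f x = f (\<Sum>b\<in>Basis. (x \<bullet> b) *\<^sub>R b)" by (simp add: euclidean_representation)
  also have "\<dots> = (\<Sum>b\<in>Basis. (x \<bullet> b) *\<^sub>R f b)"
    using assms by (simp add: linear_sum linear_scale)
  finally show ?thesis .
qed

text \<open>\<open>Ck_on\<close> controls derivatives in fixed directions only, while the chain rule
  evaluates the derivative of \<open>g\<close> in a moving direction. Expanding that direction in
  \<open>Basis\<close> leaves scalars times compositions of one order less, to which the induction
  applies; this is why the middle space is Euclidean.\<close>

lemma Ck_on_compose:
  fixes f :: "'a::real_normed_vector \<Rightarrow> 'b::euclidean_space"
  assumes "open S" "open T" "Ck_on k T g" "Ck_on k S f" "f ` S \<subseteq> T"
  shows "Ck_on k S (\<lambda>x. g (f x))"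
  using assms(3,4)
proof (induction k arbitrary: g)
  case 0 then show ?case using continuous_on_compose2[of T g S f] assms(5) by simp
next
  case (Suc k)
  have *: "Ck_on k S f" by (rule Ck_on_SucD[OF Suc.prems(2)])
  show ?case
  proof (rule Ck_on_Suc_I[OF assms(1)])
    fix x assume x: "x \<in> S"
    have gd: "g differentiable at (f x)" using Suc.prems(1) x assms(5) by auto
    have "((\<lambda>x. g (f x)) has_derivative (\<lambda>v. frechet_derivative g (at (f x)) (frechet_derivative f (at x) v))) (at x)"
      by (rule has_derivative_compose[OF Ck_on_has_derivative[OF Suc.prems(2) x]
        gd[unfolded frechet_derivative_works]])
    then show "((\<lambda>x. g (f x)) has_derivative (\<lambda>v. \<Sum>b\<in>Basis. (frechet_derivative f (at x) v \<bullet> b) *\<^sub>R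
        frechet_derivative g (at (f x)) b)) (at x)"
      by (subst (asm) linear_euclidean_expand[OF linear_frechet_derivative[OF gd]])
  next
    show "Ck_on k S (\<lambda>x. \<Sum>b\<in>Basis. (frechet_derivative f (at x) v \<bullet> b) *\<^sub>R
        frechet_derivative g (at (f x)) b)" for v
      by (intro Ck_on_sum Ck_on_scaleR Ck_on_inner Ck_on_const assms(1) Ck_on_frechet Suc.prems
        Suc.IH[OF _ *])
  qed
qed

text \<open>The basis expansion of the chain rule again, now for an arbitrary moving base point
  \<open>a\<close> and moving direction \<open>b\<close>. Only \<open>f\<close> pays an order of
  smoothness.\<close>

lemma Ck_on_frechet_compose:
  fixes a b :: "'a::real_normed_vector \<Rightarrow> 'b::euclidean_space"
  assumes "open S" "open T" "Ck_on (Suc k) T f" "Ck_on k S a" "a ` S \<subseteq> T" "Ck_on k S b"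
  shows "Ck_on k S (\<lambda>z. frechet_derivative f (at (a z)) (b z))"
proof -
  have "Ck_on k S (\<lambda>z. \<Sum>c\<in>Basis. (b z \<bullet> c) *\<^sub>R frechet_derivative f (at (a z)) c)"
    by (intro Ck_on_sum Ck_on_scaleR Ck_on_inner Ck_on_const assms
        Ck_on_compose[OF assms(1,2) Ck_on_frechet[OF assms(3)] assms(4)])
  then show ?thesis
  proof (rule Ck_on_cong[OF assms(1)])
    fix x assume "x \<in> S"
    then have "f differentiable at (a x)" using assms(3,5) by auto
    from linear_euclidean_expand[OF linear_frechet_derivative[OF this], symmetric]
    show "(\<Sum>c\<in>Basis. (b x \<bullet> c) *\<^sub>R frechet_derivative f (at (a x)) c) =
      frechet_derivative f (at (a x)) (b x)" .
  qed
qed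

text \<open>The derivative of \<open>1 / f\<close> is a product of \<open>f'\<close> and two copies
  of \<open>1 / f\<close> itself, so each order of smoothness of the reciprocal yields the
  next.\<close>

lemma Ck_on_inverse:
  fixes f :: "'a::real_normed_vector \<Rightarrow> real"
  assumes "open S" "Ck_on k S f" "\<And>x. x \<in> S \<Longrightarrow> f x \<noteq> 0"
  shows "Ck_on k S (\<lambda>x. inverse (f x))"
  using assms(2)
proof (induction k)
  case 0 then show ?case using assms(3) by (auto intro!: continuous_intros)
next
  case (Suc k)
  show ?case
  proof (rule Ck_on_Suc_I[OF assms(1)])
    show "((\<lambda>x. inverse (f x)) has_derivative
      (\<lambda>v. - (inverse (f x) * frechet_derivative f (at x) v * inverse (f x)))) (at x)"
      if "x \<in> S" for x
      using Deriv.has_derivative_inverse[OF assms(3)[OF that] Ck_on_has_derivative[OF Suc.prems that]] by simp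
    show "Ck_on k S (\<lambda>x. - (inverse (f x) * frechet_derivative f (at x) v * inverse (f x)))" for v
      by (intro Ck_on_minus Ck_on_mult assms Suc.IH Ck_on_SucD[OF Suc.prems] Ck_on_frechet Suc.prems)
  qed
qed

lemma Ck_on_prod:
  fixes f :: "'i \<Rightarrow> 'a::real_normed_vector \<Rightarrow> real"
  assumes "open S" "\<And>i. i \<in> I \<Longrightarrow> Ck_on k S (f i)"
  shows "Ck_on k S (\<lambda>x. \<Prod>i\<in>I. f i x)"
  using assms(2) by (induction I rule: infinite_finite_induct) (auto intro: Ck_on_mult[OF assms(1)])

lemma Ck_on_det:
  fixes M :: "'a::real_normed_vector \<Rightarrow> real^'n^'n"
  assumes "open S" "\<And>i j. Ck_on k S (\<lambda>x. M x $ i $ j)"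
  shows "Ck_on k S (\<lambda>x. det (M x))"
  unfolding det_def by (intro Ck_on_sum Ck_on_mult Ck_on_prod Ck_on_const assms)

lemma smooth_on_imp_Ck_on: "smooth_on S f \<Longrightarrow> Ck_on k S f" by (simp add: smooth_on_def)

lemma smooth_on_cong: "open S \<Longrightarrow> smooth_on S f \<Longrightarrow> (\<And>x. x \<in> S \<Longrightarrow> f x = g x) \<Longrightarrow> smooth_on S g"
  unfolding smooth_on_def using Ck_on_cong by blast

lemma smooth_on_compose:
  fixes f :: "'a::real_normed_vector \<Rightarrow> 'b::euclidean_space"
  assumes "open S" "open T" "smooth_on T g" "smooth_on S f" "f ` S \<subseteq> T"
  shows "smooth_on S (\<lambda>x. g (f x))"
  using assms Ck_on_compose unfolding smooth_on_def by blast

section \<open>Symmetry of second derivatives\<close>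

lemma frechet_line:
  fixes f :: "'a::real_normed_vector \<Rightarrow> real"
  assumes "f differentiable at (x + t *\<^sub>R u)"
  shows "((\<lambda>t. f (x + t *\<^sub>R u)) has_real_derivative frechet_derivative f (at (x + t *\<^sub>R u)) u) (at t)"
proof -
  have "((\<lambda>t. x + t *\<^sub>R u) has_derivative (\<lambda>h. h *\<^sub>R u)) (at t)"
    by (auto intro!: derivative_eq_intros)
  from has_derivative_compose[OF this assms[unfolded frechet_derivative_works]]
  show ?thesis
    unfolding has_field_derivative_def
    by (rule has_derivative_eq_rhs)
      (simp add: fun_eq_iff linear_scale[OF linear_frechet_derivative[OF assms]] mult.commute)
qed

text \<open>The mean value theorem is used twice: on the increment \<open>\<phi>\<close> in
  direction \<open>u\<close>, then in direction \<open>v\<close> on the derivative so obtained. The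
  second difference on the left is symmetric in \<open>u\<close> and \<open>v\<close>, the order of
  differentiation on the right is not; comparing the two versions gives Schwarz's theorem.\<close>

lemma second_difference_mvt:
  fixes f :: "'a::real_normed_vector \<Rightarrow> real"
  assumes "Ck_on 2 S f" and tp: "t > 0" "s > 0"
    and sub: "\<And>a b. 0 \<le> a \<Longrightarrow> a \<le> t \<Longrightarrow> 0 \<le> b \<Longrightarrow> b \<le> s \<Longrightarrow> x + a *\<^sub>R u + b *\<^sub>R v \<in> S"
  obtains a b where "0 < a" "a < t" "0 < b" "b < s"
    "f (x + t *\<^sub>R u + s *\<^sub>R v) - f (x + t *\<^sub>R u) - f (x + s *\<^sub>R v) + f x
      = t * s * frechet_derivative (\<lambda>z. frechet_derivative f (at z) u) (at (x + a *\<^sub>R u + b *\<^sub>R v)) v"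
proof -
  let ?D = "\<lambda>z. frechet_derivative f (at z) u"
  define \<phi> where "\<phi> = (\<lambda>a. f (x + s *\<^sub>R v + a *\<^sub>R u) - f (x + a *\<^sub>R u))"
  have C: "Ck_on (Suc (Suc 0)) S f" using assms(1) by (simp add: numeral_2_eq_2)
  have df: "f differentiable at z" if "z \<in> S" for z using C that by simp
  have dD: "?D differentiable at z" if "z \<in> S" for z using C that by simp
  have "(\<phi> has_real_derivative ?D (x + s *\<^sub>R v + a *\<^sub>R u) - ?D (x + a *\<^sub>R u)) (at a)"
    if "0 \<le> a" "a \<le> t" for a
    unfolding \<phi>_def using sub[of a s] sub[of a 0] that tp
    by (intro DERIV_diff frechet_line df) (auto simp: algebra_simps)
  from MVT2[OF tp(1) this] obtain a where a: "0 < a" "a < t"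
    "\<phi> t - \<phi> 0 = (t - 0) * (?D (x + s *\<^sub>R v + a *\<^sub>R u) - ?D (x + a *\<^sub>R u))" by blast
  have "((\<lambda>b. ?D (x + a *\<^sub>R u + b *\<^sub>R v)) has_real_derivative
      frechet_derivative ?D (at (x + a *\<^sub>R u + b *\<^sub>R v)) v) (at b)" if "0 \<le> b" "b \<le> s" for b
    using sub[of a b] that a by (intro frechet_line dD) auto
  from MVT2[OF tp(2) this] obtain b where b: "0 < b" "b < s"
    "?D (x + a *\<^sub>R u + s *\<^sub>R v) - ?D (x + a *\<^sub>R u + 0 *\<^sub>R v)
      = (s - 0) * frechet_derivative ?D (at (x + a *\<^sub>R u + b *\<^sub>R v)) v" by blast
  have "\<phi> t - \<phi> 0 = t * s * frechet_derivative ?D (at (x + a *\<^sub>R u + b *\<^sub>R v)) v"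
    using a(3) b(3) by (simp add: add.commute add.left_commute add.assoc)
  then show ?thesis
    using a b by (intro that[of a b]) (auto simp: \<phi>_def algebra_simps)
qed

lemma Ck_on_symmetric:
  fixes f :: "'a::real_normed_vector \<Rightarrow> real"
  assumes "open S" "Ck_on 2 S f" "x \<in> S"
  shows "frechet_derivative (\<lambda>z. frechet_derivative f (at z) u) (at x) v
       = frechet_derivative (\<lambda>z. frechet_derivative f (at z) v) (at x) u"
proof (rule ccontr)
  let ?H = "\<lambda>u v z. frechet_derivative (\<lambda>z. frechet_derivative f (at z) u) (at z) v"
  assume ne: "?H u v x \<noteq> ?H v u x"
  \<comment> \<open>Half the supposed gap: two equal numbers, each within \<open>e\<close> of one of
    the second derivatives, contradict a gap of \<open>2 * e\<close>.\<close>
  define e where "e = \<bar>?H u v x - ?H v u x\<bar> / 2"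
  have e: "e > 0" and e2: "\<bar>?H u v x - ?H v u x\<bar> = 2 * e" using ne by (auto simp: e_def)
  have C: "Ck_on (Suc (Suc 0)) S f" using assms(2) by (simp add: numeral_2_eq_2)
  have "continuous_on S (?H u v)" for u v
    using C by auto
  then have "isCont (?H u v) x" for u v
    using continuous_on_eq_continuous_at assms(1,3) by blast
  then have "\<exists>d>0. \<forall>z. dist z x < d \<longrightarrow> dist (?H u v z) (?H u v x) < e" for u v
    using e unfolding continuous_at_eps_delta by blast
  then obtain d1 d2 where d1: "d1 > 0" "\<And>z. dist z x < d1 \<Longrightarrow> dist (?H u v z) (?H u v x) < e"
    and d2: "d2 > 0" "\<And>z. dist z x < d2 \<Longrightarrow> dist (?H v u z) (?H v u x) < e" by metis
  obtain d3 where d3: "d3 > 0" "ball x d3 \<subseteq> S" using assms(1,3) openE by blast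
  define d where "d = min d1 (min d2 d3)"
  have d: "d > 0" using d1 d2 d3 by (simp add: d_def)
  \<comment> \<open>Chosen so that \<open>t * (norm u + norm v + 1) = d / 2\<close>, which keeps the
    whole parallelogram in the ball of radius \<open>d\<close>; the summand \<open>1\<close> covers
    \<open>u = v = 0\<close>.\<close>
  define t where "t = d / (2 * (norm u + norm v + 1))"
  have nn: "norm u + norm v + 1 > 0" by (smt (verit) norm_ge_zero)
  have t: "t > 0" using d nn by (simp add: t_def)
  have near: "dist (x + a *\<^sub>R u + b *\<^sub>R v) x < d" if "0 \<le> a" "a \<le> t" "0 \<le> b" "b \<le> t" for a b
  proof -
    have "norm (a *\<^sub>R u + b *\<^sub>R v) \<le> t * norm u + t * norm v"
      using that by (intro norm_triangle_le add_mono) (auto intro!: mult_right_mono)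
    also have "\<dots> \<le> t * (norm u + norm v + 1)" using t by (simp add: algebra_simps)
    also have "\<dots> = d / 2" using nn by (simp add: t_def field_simps)
    also have "\<dots> < d" using d by simp
    finally show ?thesis by (simp add: dist_norm add.assoc)
  qed
  have inS: "x + a *\<^sub>R u + b *\<^sub>R v \<in> S" if "0 \<le> a" "a \<le> t" "0 \<le> b" "b \<le> t" for a b
    using near[OF that] d3(2) by (auto simp: d_def dist_commute)
  obtain a b where ab: "0 < a" "a < t" "0 < b" "b < t"
    "f (x + t *\<^sub>R u + t *\<^sub>R v) - f (x + t *\<^sub>R u) - f (x + t *\<^sub>R v) + f x
      = t * t * ?H u v (x + a *\<^sub>R u + b *\<^sub>R v)"
    by (rule second_difference_mvt[OF assms(2) t t inS]) auto
  have inS': "x + a *\<^sub>R v + b *\<^sub>R u \<in> S" if "0 \<le> a" "a \<le> t" "0 \<le> b" "b \<le> t" for a b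
    using inS[of b a] that by (simp add: algebra_simps)
  obtain a' b' where ab': "0 < a'" "a' < t" "0 < b'" "b' < t"
    "f (x + t *\<^sub>R v + t *\<^sub>R u) - f (x + t *\<^sub>R v) - f (x + t *\<^sub>R u) + f x
      = t * t * ?H v u (x + a' *\<^sub>R v + b' *\<^sub>R u)"
    by (rule second_difference_mvt[OF assms(2) t t inS']) auto
  have "t * t * ?H u v (x + a *\<^sub>R u + b *\<^sub>R v) = t * t * ?H v u (x + a' *\<^sub>R v + b' *\<^sub>R u)"
    using ab(5) ab'(5) by (simp add: algebra_simps)
  then have eq: "?H u v (x + a *\<^sub>R u + b *\<^sub>R v) = ?H v u (x + a' *\<^sub>R v + b' *\<^sub>R u)"
    using t by simp
  have "dist (?H u v (x + a *\<^sub>R u + b *\<^sub>R v)) (?H u v x) < e"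
    using near[of a b] ab by (intro d1) (auto simp: d_def)
  moreover have "dist (?H v u (x + a' *\<^sub>R v + b' *\<^sub>R u)) (?H v u x) < e"
    using near[of b' a'] ab' by (intro d2) (auto simp: d_def algebra_simps)
  ultimately show False
    using eq e2 unfolding dist_real_def by linarith
qed

section \<open>Linear ordinary differential equations\<close>

text \<open>The estimate is run on the square of the norm, which is differentiable even where
  \<open>D\<close> vanishes; hence the inner product. From \<open>2ab \<le> a^2 + b^2\<close> one
  gets \<open>E' \<le> (2C + 1) E + \<eta>^2\<close>, and the integrating factor
  \<open>exp (- k * s)\<close> turns this into monotonicity of \<open>\<phi>\<close>.\<close>

lemma gronwall_zero_initial:
  fixes D :: "real \<Rightarrow> 'v::real_inner"
  assumes der: "\<And>s. s \<in> {0..1} \<Longrightarrow> (D has_vector_derivative D' s) (at s within {0..1})"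
    and D0: "D 0 = 0" and nn: "0 \<le> C" "0 \<le> \<eta>"
    and le: "\<And>s. s \<in> {0..1} \<Longrightarrow> norm (D' s) \<le> C * norm (D s) + \<eta>"
    and s: "s \<in> {0..1}"
  shows "norm (D s) \<le> \<eta> * exp (C + 1)"
proof -
  define k where "k = 2 * C + 1"
  define E where "E = (\<lambda>s. D s \<bullet> D s)"
  define \<phi> where "\<phi> = (\<lambda>s. E s * exp (- k * s) - \<eta>\<^sup>2 * s)"
  have Ed: "(E has_real_derivative 2 * (D s \<bullet> D' s)) (at s within {0..1})" if "s \<in> {0..1}" for s
    unfolding E_def has_field_derivative_def
    using has_derivative_inner[OF der[OF that, unfolded has_vector_derivative_def]
        der[OF that, unfolded has_vector_derivative_def]]
    by (rule has_derivative_eq_rhs) (auto simp: fun_eq_iff inner_commute algebra_simps)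
  have Ele: "2 * (D s \<bullet> D' s) \<le> k * E s + \<eta>\<^sup>2" if "s \<in> {0..1}" for s
  proof -
    have "D s \<bullet> D' s \<le> norm (D s) * norm (D' s)" by (rule norm_cauchy_schwarz)
    also have "\<dots> \<le> norm (D s) * (C * norm (D s) + \<eta>)"
      using le[OF that] by (intro mult_left_mono) auto
    finally have "2 * (D s \<bullet> D' s) \<le> 2 * C * (norm (D s))\<^sup>2 + 2 * norm (D s) * \<eta>"
      by (simp add: algebra_simps power2_eq_square)
    also have "2 * norm (D s) * \<eta> \<le> (norm (D s))\<^sup>2 + \<eta>\<^sup>2"
      by (rule sum_squares_bound)
    finally show ?thesis by (simp add: E_def k_def power2_norm_eq_inner algebra_simps)
  qed
  have \<phi>d: "(\<phi> has_real_derivative (2 * (D s \<bullet> D' s) - k * E s) * exp (- k * s) - \<eta>\<^sup>2) (at s within {0..1})"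
    if "s \<in> {0..1}" for s
  proof -
    have e: "((\<lambda>s. exp (- k * s)) has_real_derivative exp (- k * s) * (- k)) (at s within {0..1})"
      by (auto intro!: derivative_eq_intros)
    have l: "((\<lambda>s. \<eta>\<^sup>2 * s) has_real_derivative \<eta>\<^sup>2) (at s within {0..1})"
      by (auto intro!: derivative_eq_intros)
    show ?thesis unfolding \<phi>_def
      using DERIV_diff[OF DERIV_mult[OF Ed[OF that] e] l] by (rule DERIV_cong) (simp add: algebra_simps)
  qed
  have "\<phi> s \<le> \<phi> 0"
  proof (rule DERIV_nonpos_imp_decreasing_open[where f = \<phi> and a = 0 and b = s])
    show "0 \<le> s" using s by simp
    have "continuous_on {0..1} \<phi>"
      using \<phi>d by (intro continuous_on_eq_continuous_within[THEN iffD2] ballI)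
        (blast intro: DERIV_continuous)
    then show "continuous_on {0..s} \<phi>" by (rule continuous_on_subset) (use s in auto)
    fix r assume r: "0 < r" "r < s"
    then have r1: "r \<in> {0..1}" and a: "at r within {0..1} = at r"
      using s by (auto simp: at_within_Icc_at)
    have "(2 * (D r \<bullet> D' r) - k * E r) * exp (- k * r) \<le> \<eta>\<^sup>2 * 1"
      using Ele[OF r1] nn r by (intro mult_mono) (auto simp: k_def intro!: mult_nonpos_nonneg)
    then show "\<exists>y. (\<phi> has_real_derivative y) (at r) \<and> y \<le> 0"
      using \<phi>d[OF r1] a by (intro exI conjI) auto
  qed
  then have "E s * exp (- k * s) \<le> \<eta>\<^sup>2 * s" by (simp add: \<phi>_def E_def D0)
  also have "\<dots> \<le> \<eta>\<^sup>2 * 1" using s by (intro mult_left_mono) auto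
  finally have "E s * exp (- k * s) * exp (k * s) \<le> \<eta>\<^sup>2 * exp (k * s)"
    by (intro mult_right_mono) auto
  then have "E s \<le> \<eta>\<^sup>2 * exp (k * s)" by (simp add: mult.assoc exp_add[symmetric])
  also have "\<dots> \<le> \<eta>\<^sup>2 * exp (2 * (C + 1))"
  proof -
    have "k * s \<le> k * 1" using s nn by (intro mult_left_mono) (auto simp: k_def)
    then show ?thesis by (intro mult_left_mono) (auto simp: k_def)
  qed
  also have "\<dots> = (\<eta> * exp (C + 1))\<^sup>2" using exp_double[of "C + 1"] by (simp add: power_mult_distrib)
  finally have "(norm (D s))\<^sup>2 \<le> (\<eta> * exp (C + 1))\<^sup>2" by (simp add: E_def power2_norm_eq_inner)
  then show ?thesis by (rule power2_le_imp_le) (use nn in auto)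
qed

lemma compact_blinfun_bound:
  fixes L :: "'s::topological_space \<Rightarrow> 'w::real_normed_vector"
  assumes "continuous_on S L" "compact S"
  obtains C where "0 \<le> C" "\<And>s. s \<in> S \<Longrightarrow> norm (L s) \<le> C"
proof -
  have "bounded (L ` S)" using assms compact_continuous_image compact_imp_bounded by blast
  then obtain C where "\<And>s. s \<in> S \<Longrightarrow> norm (L s) \<le> C" unfolding bounded_iff by auto
  then show ?thesis by (intro that[of "max C 0"]) (auto simp: le_max_iff_disj)
qed

lemma linear_ode_unique:
  fixes L :: "real \<Rightarrow> 'v::real_inner \<Rightarrow>\<^sub>L 'v"
  assumes "continuous_on {0..1} L"
    and "\<And>s. s \<in> {0..1} \<Longrightarrow> (V has_vector_derivative L s (V s)) (at s within {0..1})"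
    and "\<And>s. s \<in> {0..1} \<Longrightarrow> (W has_vector_derivative L s (W s)) (at s within {0..1})"
    and "V 0 = W 0" "s \<in> {0..1}"
  shows "V s = W s"
proof -
  obtain C where C: "0 \<le> C" "\<And>s. s \<in> {0..1} \<Longrightarrow> norm (L s) \<le> C"
    by (rule compact_blinfun_bound[OF assms(1)]) auto
  have "norm (V s - W s) \<le> 0 * exp (C + 1)"
  proof (rule gronwall_zero_initial[where D' = "\<lambda>s. L s (V s - W s)"])
    show "((\<lambda>s. V s - W s) has_vector_derivative L s (V s - W s)) (at s within {0..1})"
      if "s \<in> {0..1}" for s
      using has_vector_derivative_diff[OF assms(2,3)[OF that]] by (simp add: blinfun.diff_right)
    show "norm (L s (V s - W s)) \<le> C * norm (V s - W s) + 0" if "s \<in> {0..1}" for s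
      using order_trans[OF norm_blinfun mult_right_mono[OF C(2)[OF that] norm_ge_zero]] by simp
  qed (use assms C in auto)
  then show ?thesis by simp
qed

text \<open>The solution is the series of iterated integrals of \<open>L\<close> applied to
  \<open>v0\<close>. The factorial bound makes the series and its termwise derivative converge
  uniformly on all of \<open>[0,1]\<close>, so no gluing of short-time solutions is needed.\<close>

lemma linear_ode_exists:
  fixes L :: "real \<Rightarrow> 'v::banach \<Rightarrow>\<^sub>L 'v"
  assumes L: "continuous_on {0..1} L"
  shows "\<exists>V. V 0 = v0 \<and> (\<forall>s\<in>{0..1}. (V has_vector_derivative L s (V s)) (at s within {0..1}))"
proof -
  obtain C where C: "0 \<le> C" "\<And>s. s \<in> {0..1} \<Longrightarrow> norm (L s) \<le> C"
    by (rule compact_blinfun_bound[OF L]) auto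
  define f where "f = rec_nat (\<lambda>s. v0) (\<lambda>n F s. integral {0..s} (\<lambda>r. L r (F r)))"
  have f0: "f 0 = (\<lambda>s. v0)" and fS: "f (Suc n) = (\<lambda>s. integral {0..s} (\<lambda>r. L r (f n r)))" for n
    by (simp_all add: f_def)
  have cont: "continuous_on {0..1} (f n)" for n
  proof (induction n)
    case (Suc n)
    have "continuous_on {0..1} (\<lambda>r. L r (f n r))" by (intro continuous_intros L Suc)
    then show ?case unfolding fS by (intro indefinite_integral_continuous_1 integrable_continuous_real)
  qed (simp add: f0)
  have contL: "continuous_on {0..1} (\<lambda>r. L r (f n r))" for n by (intro continuous_intros L cont)
  have der: "(f (Suc n) has_vector_derivative L s (f n s)) (at s within {0..1})" if "s \<in> {0..1}" for s n
    unfolding fS by (rule integral_has_vector_derivative[OF contL that])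
  have bound: "norm (f n s) \<le> norm v0 * (C * s) ^ n / fact n" if "s \<in> {0..1}" for n s
    using that
  proof (induction n arbitrary: s)
    case 0 then show ?case by (simp add: f0)
  next
    case (Suc n)
    let ?g = "\<lambda>r. C * (norm v0 * (C * r) ^ n / fact n)"
    let ?G = "\<lambda>r. norm v0 * (C * r) ^ Suc n / fact (Suc n)"
    have G: "(?g has_integral ?G s - ?G 0) {0..s}"
    proof (rule fundamental_theorem_of_calculus)
      show "0 \<le> s" using Suc.prems by simp
      fix r :: real
      have "(?G has_real_derivative norm v0 * (real (Suc n) * (C * r) ^ n * C) / fact (Suc n)) (at r within {0..s})"
        by (auto intro!: derivative_eq_intros simp del: fact_Suc power_Suc)
      also have "norm v0 * (real (Suc n) * (C * r) ^ n * C) / fact (Suc n) = ?g r"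
        unfolding fact_Suc by (simp add: divide_simps del: of_nat_Suc)
      finally show "(?G has_vector_derivative ?g r) (at r within {0..s})"
        by (simp add: has_real_derivative_iff_has_vector_derivative)
    qed
    have "norm (f (Suc n) s) \<le> integral {0..s} ?g"
      unfolding fS
    proof (rule integral_norm_bound_integral)
      show "(\<lambda>r. L r (f n r)) integrable_on {0..s}"
        by (rule integrable_continuous_real, rule continuous_on_subset[OF contL]) (use Suc.prems in auto)
      show "?g integrable_on {0..s}" using G by blast
      fix r assume "r \<in> {0..s}"
      then have r: "r \<in> {0..1}" using Suc.prems by auto
      have "norm (L r (f n r)) \<le> norm (L r) * norm (f n r)" by (rule norm_blinfun)
      also have "\<dots> \<le> ?g r" using C r Suc.IH[OF r] by (intro mult_mono) auto
      finally show "norm (L r (f n r)) \<le> ?g r" .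
    qed
    also have "integral {0..s} ?g = ?G s" using integral_unique[OF G] by simp
    finally show ?case .
  qed
  have bound1: "norm (f n s) \<le> norm v0 * (C ^ n / fact n)" if "s \<in> {0..1}" for n s
  proof -
    have "(C * s) ^ n \<le> C ^ n" using that C by (intro power_mono) (auto simp: mult_left_le)
    then have "norm v0 * (C * s) ^ n / fact n \<le> norm v0 * C ^ n / fact n"
      by (intro divide_right_mono mult_left_mono) auto
    then show ?thesis using bound[OF that, of n] by simp
  qed
  define V where "V = (\<lambda>s. \<Sum>n. f n s)"
  have sm: "summable (\<lambda>n. norm v0 * (C ^ n / fact n))"
    using summable_exp[of C] by (intro summable_mult) (simp add: divide_inverse mult.commute)
  have unif: "uniform_limit {0..1} (\<lambda>n x. \<Sum>i<n. f i x) V sequentially"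
    unfolding V_def by (rule Weierstrass_m_test[OF bound1 sm]) auto
  have sums: "(\<lambda>n. f n x) sums V x" if "x \<in> {0..1}" for x
    using tendsto_uniform_limitI[OF unif that] by (simp add: sums_def)
  \<comment> \<open>A term differentiates to \<open>L\<close> applied to the preceding term, and the
    constant first term to \<open>0\<close>. So the first \<open>n\<close> derivatives add up to
    \<open>L\<close> of only \<open>n - 1\<close> terms, whence the index shift in the convergence
    estimate below.\<close>
  define f' where "f' = (\<lambda>n x (h::real). case n of 0 \<Rightarrow> 0 | Suc m \<Rightarrow> h *\<^sub>R L x (f m x))"
  have "\<exists>g. \<forall>x\<in>{0..1}. (\<lambda>n. f n x) sums (g x) \<and>
      (g has_derivative (\<lambda>h. h *\<^sub>R L x (V x))) (at x within {0..1})"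
  proof (rule has_derivative_series[where f' = f'])
    show "(f n has_derivative f' n x) (at x within {0..1})" if "x \<in> {0..1}" for n x
      using der[OF that] by (cases n) (auto simp: f'_def f0 has_vector_derivative_def)
    show "(\<lambda>n. f n 0) sums V 0" using sums by simp
    fix e :: real assume e: "e > 0"
    have "\<forall>\<^sub>F n in sequentially. \<forall>x\<in>{0..1}. dist (\<Sum>i<n. f i x) (V x) < e / (C + 1)"
      using unif C e by (auto simp: uniform_limit_iff)
    then have "\<forall>\<^sub>F n in sequentially. \<forall>x\<in>{0..1}. dist (\<Sum>i<n - 1. f i x) (V x) < e / (C + 1)"
      unfolding eventually_sequentially by (metis Suc_diff_1 diff_is_0_eq le_diff_conv less_Suc_eq_le not_gr_zero add_diff_cancel_right' diff_le_mono)
    moreover have "\<forall>\<^sub>F n in sequentially. n \<ge> (1::nat)" by (rule eventually_ge_at_top)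
    ultimately show "\<forall>\<^sub>F n in sequentially. \<forall>x\<in>{0..1}. \<forall>h.
      norm ((\<Sum>i<n. f' i x h) - h *\<^sub>R L x (V x)) \<le> e * norm h"
    proof eventually_elim
      case (elim n)
      show ?case
      proof (intro ballI allI)
        fix x h :: real assume x: "x \<in> {0..1}"
        obtain m where m: "n = Suc m" using elim(2) by (cases n) auto
        have "(\<Sum>i<n. f' i x h) = (\<Sum>i<m. h *\<^sub>R L x (f i x))"
          unfolding m sum.lessThan_Suc_shift by (simp add: f'_def)
        also have "\<dots> = h *\<^sub>R L x (\<Sum>i<m. f i x)" by (simp add: blinfun.sum_right scaleR_sum_right)
        finally have "norm ((\<Sum>i<n. f' i x h) - h *\<^sub>R L x (V x)) = \<bar>h\<bar> * norm (L x ((\<Sum>i<m. f i x) - V x))"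
          by (simp add: blinfun.diff_right scaleR_diff_right[symmetric])
        also have "\<dots> \<le> \<bar>h\<bar> * (norm (L x) * norm ((\<Sum>i<m. f i x) - V x))"
          by (intro mult_left_mono norm_blinfun) auto
        also have "\<dots> \<le> \<bar>h\<bar> * ((C + 1) * (e / (C + 1)))"
          using C(1) C(2)[OF x] elim(1) x m
          by (intro mult_left_mono mult_mono) (auto simp: dist_norm less_imp_le intro: order_trans)
        also have "\<dots> = e * norm h" using C(1) by (simp add: field_simps)
        finally show "norm ((\<Sum>i<n. f' i x h) - h *\<^sub>R L x (V x)) \<le> e * norm h" .
      qed
    qed
  qed auto
  then obtain g where g: "\<And>x. x \<in> {0..1} \<Longrightarrow> (\<lambda>n. f n x) sums (g x)"
    "\<And>x. x \<in> {0..1} \<Longrightarrow> (g has_derivative (\<lambda>h. h *\<^sub>R L x (V x))) (at x within {0..1})" by blast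
  have gV: "g x = V x" if "x \<in> {0..1}" for x using sums_unique2[OF g(1) sums] that by blast
  show ?thesis
  proof (intro exI[of _ g] conjI)
    have "(\<lambda>n. f n 0) = (\<lambda>n. if n = 0 then v0 else 0)"
    proof
      fix n show "f n 0 = (if n = 0 then v0 else 0)" by (cases n) (simp_all add: f0 fS)
    qed
    then have "(\<lambda>n. f n 0) sums v0" using sums_If_finite_set[of "{0}" "\<lambda>_. v0"] by simp
    then show "g 0 = v0" using sums_unique2[OF g(1)[of 0]] by simp
  qed (use g gV in \<open>auto simp: has_vector_derivative_def\<close>)
qed

section \<open>Smooth dependence of linear ODE solutions on parameters\<close>

definition lin_ode_family ::
  "(real \<times> 'p \<Rightarrow> 'v::real_normed_vector \<Rightarrow>\<^sub>L 'v) \<Rightarrow> 'p set \<Rightarrow> 'v \<Rightarrow> (real \<Rightarrow> 'p \<Rightarrow> 'v) \<Rightarrow> bool" where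
  "lin_ode_family L S v0 V \<longleftrightarrow> (\<forall>l\<in>S. V 0 l = v0 \<and>
     (\<forall>s\<in>{0..1}. ((\<lambda>s. V s l) has_vector_derivative L (s, l) (V s l)) (at s within {0..1})))"

lemma lin_ode_family_exists:
  fixes L :: "real \<times> 'p::topological_space \<Rightarrow> 'v::banach \<Rightarrow>\<^sub>L 'v"
  assumes "continuous_on ({0..1} \<times> S) L"
  shows "\<exists>V. lin_ode_family L S v0 V"
proof -
  have "\<exists>v. v 0 = v0 \<and> (\<forall>s\<in>{0..1}. (v has_vector_derivative L (s, l) (v s)) (at s within {0..1}))"
    if "l \<in> S" for l
  proof -
    have "continuous_on {0..1} (\<lambda>s. L (s, l))"
      by (rule continuous_on_compose2[OF assms]) (use that in \<open>auto intro!: continuous_intros\<close>)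
    from linear_ode_exists[OF this, of v0] show ?thesis .
  qed
  then have "\<forall>l\<in>S. \<exists>v. v 0 = v0 \<and> (\<forall>s\<in>{0..1}. (v has_vector_derivative L (s, l) (v s)) (at s within {0..1}))"
    by blast
  from bchoice[OF this] obtain v where "\<forall>l\<in>S. v l 0 = v0 \<and>
    (\<forall>s\<in>{0..1}. (v l has_vector_derivative L (s, l) (v l s)) (at s within {0..1}))" ..
  then show ?thesis unfolding lin_ode_family_def by (intro exI[of _ "\<lambda>s l. v l s"])
qed

text \<open>Compactness of \<open>[0,1]\<close> keeps \<open>L (s, l)\<close> close to
  \<open>L (s, l0)\<close> for all \<open>s\<close> at once; the difference of the two solutions
  starts at \<open>0\<close> and is driven by this small discrepancy, so Gronwall bounds it.\<close>

lemma lin_ode_family_continuous_uniform: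
  fixes L :: "real \<times> 'p::metric_space \<Rightarrow> 'v::real_inner \<Rightarrow>\<^sub>L 'v"
  assumes L: "continuous_on ({0..1} \<times> S) L" and S: "open S" and V: "lin_ode_family L S v0 V"
    and l0: "l0 \<in> S" and e: "e > 0"
  obtains d where "d > 0" "ball l0 d \<subseteq> S"
    "\<And>l s. l \<in> ball l0 d \<Longrightarrow> s \<in> {0..1} \<Longrightarrow> norm (V s l - V s l0) \<le> e"
proof -
  have Vd: "((\<lambda>s. V s l) has_vector_derivative L (s, l) (V s l)) (at s within {0..1})"
    if "l \<in> S" "s \<in> {0..1}" for s l using V that unfolding lin_ode_family_def by blast
  have V0: "V 0 l = v0" if "l \<in> S" for l using V that unfolding lin_ode_family_def by blast
  have "continuous_on {0..1} (\<lambda>s. L (s, l0))"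
    by (rule continuous_on_compose2[OF L]) (use l0 in \<open>auto intro!: continuous_intros\<close>)
  then obtain C where C: "0 \<le> C" "\<And>s. s \<in> {0..1} \<Longrightarrow> norm (L (s, l0)) \<le> C"
    by (rule compact_blinfun_bound) auto
  have "continuous_on {0..1} (\<lambda>s. V s l0)"
    by (rule continuous_on_vector_derivative) (rule Vd[OF l0])
  then obtain B where B: "0 \<le> B" "\<And>s. s \<in> {0..1} \<Longrightarrow> norm (V s l0) \<le> B"
    by (rule compact_blinfun_bound) auto
  \<comment> \<open>The entry \<open>1\<close> bounds the perturbed coefficient by
    \<open>C + 1\<close>. Gronwall then gives at most \<open>\<epsilon> * B * exp (C + 2)\<close>,
    which the other entry keeps below \<open>e\<close>; \<open>B + 1\<close> avoids a division by
    zero.\<close>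
  define \<epsilon> where "\<epsilon> = min 1 (e / ((B + 1) * exp (C + 2)))"
  have eps: "\<epsilon> > 0" "\<epsilon> \<le> 1" using e B(1) by (auto simp: \<epsilon>_def intro!: divide_pos_pos mult_pos_pos)
  have "continuous_on (S \<times> {0..1}) (\<lambda>(l, s). L (s, l))"
    unfolding split_beta by (rule continuous_on_compose2[OF L]) (auto intro!: continuous_intros)
  from continuous_on_prod_compactE[OF this compact_Icc l0 eps(1)]
  obtain X where X: "l0 \<in> X" "open X" "\<forall>l\<in>X \<inter> S. \<forall>s\<in>{0..1}. dist (L (s, l)) (L (s, l0)) \<le> \<epsilon>"
    unfolding split_conv .
  obtain d where d: "d > 0" "ball l0 d \<subseteq> X \<inter> S"
    using openE[OF open_Int[OF X(2) S]] X(1) l0 by blast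
  show ?thesis
  proof (rule that[OF d(1)])
    show "ball l0 d \<subseteq> S" using d by auto
    fix l s assume l: "l \<in> ball l0 d" and s: "s \<in> {0..1::real}"
    have lS: "l \<in> S" using l d by auto
    have "l \<in> X \<inter> S" using l d by auto
    then have dL: "norm (L (s, l) - L (s, l0)) \<le> \<epsilon>" if "s \<in> {0..1}" for s
      using X(3) that by (auto simp: dist_norm)
    have "norm (V s l - V s l0) \<le> (\<epsilon> * B) * exp ((C + 1) + 1)"
    proof (rule gronwall_zero_initial[where D' = "\<lambda>s. L (s, l) (V s l) - L (s, l0) (V s l0)", OF _ _ _ _ _ s])
      show "((\<lambda>s. V s l - V s l0) has_vector_derivative L (s, l) (V s l) - L (s, l0) (V s l0))
        (at s within {0..1})" if "s \<in> {0..1}" for s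
        by (intro has_vector_derivative_diff Vd lS l0 that)
      show "norm (L (s, l) (V s l) - L (s, l0) (V s l0)) \<le> (C + 1) * norm (V s l - V s l0) + \<epsilon> * B"
        if s: "s \<in> {0..1}" for s
      proof -
        have "L (s, l) (V s l) - L (s, l0) (V s l0) =
          L (s, l0) (V s l - V s l0) + (L (s, l) - L (s, l0)) (V s l - V s l0) + (L (s, l) - L (s, l0)) (V s l0)"
          by (simp add: blinfun.diff_left blinfun.diff_right)
        also have "norm \<dots> \<le> norm (L (s, l0)) * norm (V s l - V s l0)
          + norm (L (s, l) - L (s, l0)) * norm (V s l - V s l0) + norm (L (s, l) - L (s, l0)) * norm (V s l0)"
          by (intro norm_triangle_le add_mono norm_blinfun order_refl)
        also have "\<dots> \<le> C * norm (V s l - V s l0) + 1 * norm (V s l - V s l0) + \<epsilon> * B"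
          using C(2)[OF s] dL[OF s] eps B s
          by (intro add_mono mult_right_mono mult_mono) (auto intro: order_trans)
        finally show ?thesis by (simp add: algebra_simps)
      qed
    qed (use C B eps V0 lS l0 in auto)
    also have "\<dots> \<le> \<epsilon> * ((B + 1) * exp (C + 2))"
      using eps B by (simp add: mult.assoc add.assoc)
    also have "\<dots> \<le> (e / ((B + 1) * exp (C + 2))) * ((B + 1) * exp (C + 2))"
      using B by (intro mult_right_mono) (auto simp: \<epsilon>_def)
    also have "\<dots> = e" using B(1) by simp
    finally show "norm (V s l - V s l0) \<le> e" .
  qed
qed

lemma lin_ode_family_continuous:
  fixes L :: "real \<times> 'p::metric_space \<Rightarrow> 'v::real_inner \<Rightarrow>\<^sub>L 'v"
  assumes "continuous_on ({0..1} \<times> S) L" "open S" "lin_ode_family L S v0 V" "s \<in> {0..1}"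
  shows "continuous_on S (V s)"
proof -
  have "isCont (V s) l0" if l0: "l0 \<in> S" for l0
    unfolding continuous_at_eps_delta
  proof (intro allI impI)
    fix e :: real assume e: "e > 0"
    obtain d where d: "d > 0" "ball l0 d \<subseteq> S"
      "\<And>l s. l \<in> ball l0 d \<Longrightarrow> s \<in> {0..1} \<Longrightarrow> norm (V s l - V s l0) \<le> e / 2"
      by (rule lin_ode_family_continuous_uniform[OF assms(1-3) l0, of "e / 2"]) (use e in auto)
    show "\<exists>d>0. \<forall>x'. dist x' l0 < d \<longrightarrow> dist (V s x') (V s l0) < e"
    proof (intro exI[of _ d] conjI allI impI d(1))
      fix x' assume "dist x' l0 < d"
      then have "norm (V s x' - V s l0) \<le> e / 2" by (intro d(3) assms(4)) (simp add: dist_commute)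
      then show "dist (V s x') (V s l0) < e" using e by (simp add: dist_norm)
    qed
  qed
  then show ?thesis by (simp add: continuous_at_imp_continuous_on)
qed

text \<open>The mean value inequality on the segment from \<open>l0\<close> to
  \<open>l0 + h\<close>, where compactness of \<open>[0,1]\<close> keeps the partial derivatives
  near their values at \<open>l0\<close> for every \<open>s\<close> simultaneously. A bound for each
  \<open>s\<close> separately could not be fed into Gronwall.\<close>

lemma uniform_linearization:
  fixes L :: "real \<times> 'p::euclidean_space \<Rightarrow> 'w::real_normed_vector"
  assumes I: "{0..1} \<subseteq> I" and S: "open S" and L: "Ck_on 1 (I \<times> S) L"
    and l0: "l0 \<in> S" and e: "e > 0"
  obtains d where "d > 0" "ball l0 d \<subseteq> S"
    "\<And>s h. s \<in> {0..1} \<Longrightarrow> norm h < d \<Longrightarrow> norm (L (s, l0 + h) - L (s, l0) -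
        (\<Sum>b\<in>Basis. (h \<bullet> b) *\<^sub>R frechet_derivative L (at (s, l0)) (0, b))) \<le> e * norm h"
proof -
  let ?D = "\<lambda>b z. frechet_derivative L (at z) (0, b)"
  have LC: "Ck_on (Suc 0) (I \<times> S) L" using L by simp
  \<comment> \<open>The derivative in direction \<open>h\<close> is a sum of \<open>DIM('p)\<close>
    partial derivatives with weights at most \<open>norm h\<close>; each gets an equal share of
    \<open>e\<close>.\<close>
  define e' where "e' = e / DIM('p)"
  have e': "e' > 0" using e by (simp add: e'_def)
  have "\<exists>X. l0 \<in> X \<and> open X \<and> (\<forall>l\<in>X \<inter> S. \<forall>s\<in>{0..1}. dist (?D b (s, l)) (?D b (s, l0)) \<le> e')" for b
  proof -
    have "continuous_on (I \<times> S) (?D b)" using LC by simp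
    then have "continuous_on (S \<times> {0..1}) (\<lambda>(l, s). ?D b (s, l))"
      unfolding split_beta by (rule continuous_on_compose2) (use I in \<open>auto intro!: continuous_intros\<close>)
    from continuous_on_prod_compactE[OF this compact_Icc l0 e']
    obtain X where "l0 \<in> X" "open X" "\<forall>l\<in>X \<inter> S. \<forall>s\<in>{0..1}. dist (?D b (s, l)) (?D b (s, l0)) \<le> e'"
      unfolding split_conv .
    then show ?thesis by (intro exI[of _ X] conjI)
  qed
  then have "\<forall>b. \<exists>X. l0 \<in> X \<and> open X \<and> (\<forall>l\<in>X \<inter> S. \<forall>s\<in>{0..1}. dist (?D b (s, l)) (?D b (s, l0)) \<le> e')"
    by (intro allI)
  from choice[OF this] obtain X where X0: "\<forall>b. l0 \<in> X b \<and> open (X b) \<and>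
    (\<forall>l\<in>X b \<inter> S. \<forall>s\<in>{0..1}. dist (?D b (s, l)) (?D b (s, l0)) \<le> e')" ..
  then have X: "\<And>b. l0 \<in> X b" "\<And>b. open (X b)"
    "\<And>b l s. l \<in> X b \<inter> S \<Longrightarrow> s \<in> {0..1} \<Longrightarrow> dist (?D b (s, l)) (?D b (s, l0)) \<le> e'"
    by simp_all
  have "open (S \<inter> (\<Inter>b\<in>Basis. X b))" using S X(2) by (intro open_Int open_INT) auto
  then obtain d where d: "d > 0" "ball l0 d \<subseteq> S \<inter> (\<Inter>b\<in>Basis. X b)"
    using openE[of "S \<inter> (\<Inter>b\<in>Basis. X b)" l0] l0 X(1) by blast
  show ?thesis
  proof (rule that[OF d(1)])
    show "ball l0 d \<subseteq> S" using d by auto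
    fix s :: real and h :: 'p assume s: "s \<in> {0..1}" and h: "norm h < d"
    let ?A = "\<Sum>b\<in>Basis. (h \<bullet> b) *\<^sub>R ?D b (s, l0)"
    have seg: "l0 + t *\<^sub>R h \<in> ball l0 d" if "t \<in> {0..1}" for t
    proof -
      have "norm (t *\<^sub>R h) \<le> norm h" using that by (simp add: mult_left_le_one_le)
      then show ?thesis using h by (simp add: dist_norm)
    qed
    have inS: "(s, l0 + t *\<^sub>R h) \<in> I \<times> S" if "t \<in> {0..1}" for t
      using seg[OF that] d s I by auto
    define \<phi> where "\<phi> = (\<lambda>t. L (s, l0 + t *\<^sub>R h) - t *\<^sub>R ?A)"
    have exp: "?D h (s, l0 + t *\<^sub>R h) = (\<Sum>b\<in>Basis. (h \<bullet> b) *\<^sub>R ?D b (s, l0 + t *\<^sub>R h))"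
      if "t \<in> {0..1}" for t
    proof -
      have "L differentiable at (s, l0 + t *\<^sub>R h)" using LC inS[OF that] by simp
      then have "linear (\<lambda>u. ?D u (s, l0 + t *\<^sub>R h))"
        by (intro linear_compose[OF _ linear_frechet_derivative, unfolded o_def] linearI) auto
      from linear_euclidean_expand[OF this] show ?thesis .
    qed
    have "norm (\<phi> 1 - \<phi> 0) \<le> (e * norm h) * norm (1 - 0 :: real)"
    proof (rule differentiable_bound[where S = "{0..1}" and f' = "\<lambda>t k. k *\<^sub>R (?D h (s, l0 + t *\<^sub>R h) - ?A)"])
      fix t :: real assume t: "t \<in> {0..1}"
      have "((\<lambda>t. (s, l0 + t *\<^sub>R h)) has_derivative (\<lambda>k. (0, k *\<^sub>R h))) (at t)"
        by (auto intro!: derivative_eq_intros)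
      from has_derivative_compose[OF this Ck_on_has_derivative[OF LC inS[OF t]]]
      have 1: "((\<lambda>t. L (s, l0 + t *\<^sub>R h)) has_derivative (\<lambda>k. ?D (k *\<^sub>R h) (s, l0 + t *\<^sub>R h))) (at t)" .
      have 2: "?D (k *\<^sub>R h) (s, l0 + t *\<^sub>R h) = k *\<^sub>R ?D h (s, l0 + t *\<^sub>R h)" for k
        using linear_scale[OF linear_frechet_derivative, of L "at (s, l0 + t *\<^sub>R h)" k "(0, h)"] LC inS[OF t] by simp
      have "(\<phi> has_derivative (\<lambda>k. k *\<^sub>R (?D h (s, l0 + t *\<^sub>R h) - ?A))) (at t)"
        unfolding \<phi>_def by (rule derivative_eq_intros 1 refl)+ (simp add: 2 scaleR_diff_right)
      then show "(\<phi> has_derivative (\<lambda>k. k *\<^sub>R (?D h (s, l0 + t *\<^sub>R h) - ?A))) (at t within {0..1})"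
        by (rule has_derivative_at_withinI)
      have "norm (?D h (s, l0 + t *\<^sub>R h) - ?A) \<le> e * norm h"
      proof -
        have "?D h (s, l0 + t *\<^sub>R h) - ?A = (\<Sum>b\<in>Basis. (h \<bullet> b) *\<^sub>R (?D b (s, l0 + t *\<^sub>R h) - ?D b (s, l0)))"
          by (simp add: exp[OF t] sum_subtractf scaleR_diff_right)
        also have "norm \<dots> \<le> (\<Sum>b\<in>(Basis::'p set). norm h * e')"
        proof (rule sum_norm_le)
          fix b :: 'p assume b: "b \<in> Basis"
          have "norm (?D b (s, l0 + t *\<^sub>R h) - ?D b (s, l0)) \<le> e'"
            using X(3)[of "l0 + t *\<^sub>R h" b s] seg[OF t] d b s by (auto simp: dist_norm subset_iff)
          then show "norm ((h \<bullet> b) *\<^sub>R (?D b (s, l0 + t *\<^sub>R h) - ?D b (s, l0))) \<le> norm h * e'"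
            unfolding norm_scaleR using Basis_le_norm[OF b, of h] by (intro mult_mono) auto
        qed
        also have "\<dots> = e * norm h" by (simp add: e'_def)
        finally show ?thesis .
      qed
      then show "onorm (\<lambda>k. k *\<^sub>R (?D h (s, l0 + t *\<^sub>R h) - ?A)) \<le> e * norm h"
        by (intro onorm_le) (simp add: mult.commute mult_left_mono)
    qed auto
    then show "norm (L (s, l0 + h) - L (s, l0) - ?A) \<le> e * norm h"
      by (simp add: \<phi>_def algebra_simps)
  qed
qed

lemma lin_ode_family_has_derivative:
  fixes L :: "real \<times> 'p::euclidean_space \<Rightarrow> 'v::real_inner \<Rightarrow>\<^sub>L 'v"
  assumes I: "{0..1} \<subseteq> I" and S: "open S" and L: "Ck_on 1 (I \<times> S) L"
    and V: "lin_ode_family L S v0 V" and l0: "l0 \<in> S"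
    and W0: "\<And>b. b \<in> Basis \<Longrightarrow> W b 0 = 0"
    and W: "\<And>b s. b \<in> Basis \<Longrightarrow> s \<in> {0..1} \<Longrightarrow> (W b has_vector_derivative
      L (s, l0) (W b s) + frechet_derivative L (at (s, l0)) (0, b) (V s l0)) (at s within {0..1})"
    and s: "s \<in> {0..1}"
  shows "(V s has_derivative (\<lambda>h. \<Sum>b\<in>Basis. (h \<bullet> b) *\<^sub>R W b s)) (at l0)"
proof -
  let ?D = "\<lambda>b z. frechet_derivative L (at z) (0, b)"
  have Lc: "continuous_on ({0..1} \<times> S) L"
    by (rule continuous_on_subset[OF Ck_on_imp_continuous_on[OF L]]) (use I in auto)
  have Dc: "continuous_on (I \<times> S) (?D b)" for b using L by simp
  have Vd: "((\<lambda>s. V s l) has_vector_derivative L (s, l) (V s l)) (at s within {0..1})"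
    if "l \<in> S" "s \<in> {0..1}" for s l using V that unfolding lin_ode_family_def by blast
  have V0: "V 0 l = v0" if "l \<in> S" for l using V that unfolding lin_ode_family_def by blast
  have "continuous_on {0..1} (\<lambda>s. L (s, l0))"
    by (rule continuous_on_compose2[OF Lc]) (use l0 in \<open>auto intro!: continuous_intros\<close>)
  then obtain C where C: "0 \<le> C" "\<And>s. s \<in> {0..1} \<Longrightarrow> norm (L (s, l0)) \<le> C"
    by (rule compact_blinfun_bound) auto
  have "continuous_on {0..1} (\<lambda>s. V s l0)"
    by (rule continuous_on_vector_derivative) (rule Vd[OF l0])
  then obtain B where B: "0 \<le> B" "\<And>s. s \<in> {0..1} \<Longrightarrow> norm (V s l0) \<le> B"
    by (rule compact_blinfun_bound) auto
  have "continuous_on {0..1} (\<lambda>s. \<Sum>b\<in>Basis. norm (?D b (s, l0)))"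
    by (intro continuous_on_sum continuous_on_norm continuous_on_compose2[OF Dc])
      (use l0 I in \<open>auto intro!: continuous_intros\<close>)
  then obtain K where K: "0 \<le> K" "\<And>s. s \<in> {0..1} \<Longrightarrow> norm (\<Sum>b\<in>Basis. norm (?D b (s, l0))) \<le> K"
    by (rule compact_blinfun_bound) auto
  have "\<exists>d>0. \<forall>h. norm h < d \<longrightarrow>
      norm (V s (l0 + h) - V s l0 - (\<Sum>b\<in>Basis. (h \<bullet> b) *\<^sub>R W b s)) \<le> e * norm h"
    if e: "e > 0" for e
  proof -
    \<comment> \<open>Two errors drive the remainder: change of operator times change of solution,
      at most \<open>(K + 1) * norm h * e1\<close>, and the linearization error of \<open>L\<close>
      on the unperturbed solution, at most \<open>e1 * norm h * B\<close>. Gronwall adds the factor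
      \<open>exp (C + 1)\<close>.\<close>
    define e1 where "e1 = min 1 (e / ((K + 1 + B) * exp (C + 1)))"
    have e1: "e1 > 0" "e1 \<le> 1" using e K B by (auto simp: e1_def intro!: divide_pos_pos mult_pos_pos)
    obtain d1 where d1: "d1 > 0" "ball l0 d1 \<subseteq> S"
      "\<And>s h. s \<in> {0..1} \<Longrightarrow> norm h < d1 \<Longrightarrow> norm (L (s, l0 + h) - L (s, l0) -
        (\<Sum>b\<in>Basis. (h \<bullet> b) *\<^sub>R ?D b (s, l0))) \<le> e1 * norm h"
      by (rule uniform_linearization[OF I S L l0 e1(1)]) blast
    obtain d2 where d2: "d2 > 0" "ball l0 d2 \<subseteq> S"
      "\<And>l s. l \<in> ball l0 d2 \<Longrightarrow> s \<in> {0..1} \<Longrightarrow> norm (V s l - V s l0) \<le> e1"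
      by (rule lin_ode_family_continuous_uniform[OF Lc S V l0 e1(1)]) blast
    show ?thesis
    proof (intro exI[of _ "min d1 d2"] conjI allI impI)
      show "min d1 d2 > 0" using d1 d2 by simp
      fix h :: 'p assume h: "norm h < min d1 d2"
      let ?l = "l0 + h"
      have lS: "?l \<in> S" using h d1(2) by (auto simp: dist_norm)
      have lb: "?l \<in> ball l0 d2" using h by (simp add: dist_norm)
      define R where "R = (\<lambda>s. V s ?l - V s l0 - (\<Sum>b\<in>Basis. (h \<bullet> b) *\<^sub>R W b s))"
      define R' where "R' = (\<lambda>s. L (s, ?l) (V s ?l) - L (s, l0) (V s l0) -
          (\<Sum>b\<in>Basis. (h \<bullet> b) *\<^sub>R (L (s, l0) (W b s) + ?D b (s, l0) (V s l0))))"
      have "norm (R s) \<le> ((K + 1 + B) * e1 * norm h) * exp (C + 1)"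
      proof (rule gronwall_zero_initial[where D' = R', OF _ _ _ _ _ s])
        show "(R has_vector_derivative R' s) (at s within {0..1})" if s: "s \<in> {0..1}" for s
          unfolding R_def R'_def
          by (intro has_vector_derivative_diff Vd[OF lS s] Vd[OF l0 s] has_vector_derivative_sum
              bounded_linear.has_vector_derivative[OF bounded_linear_scaleR_right] W s)
        show "norm (R' s) \<le> C * norm (R s) + (K + 1 + B) * e1 * norm h" if s: "s \<in> {0..1}" for s
        proof -
          let ?A = "\<Sum>b\<in>Basis. (h \<bullet> b) *\<^sub>R ?D b (s, l0)"
          have lin: "norm (L (s, ?l) - L (s, l0) - ?A) \<le> e1 * norm h" using d1(3)[OF s] h by simp
          have "norm ?A \<le> (\<Sum>b\<in>Basis. norm h * norm (?D b (s, l0)))"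
          proof (rule sum_norm_le)
            fix b :: 'p assume "b \<in> Basis"
            then show "norm ((h \<bullet> b) *\<^sub>R ?D b (s, l0)) \<le> norm h * norm (?D b (s, l0))"
              unfolding norm_scaleR using Basis_le_norm[of b h] by (intro mult_right_mono) auto
          qed
          also have "\<dots> = norm h * (\<Sum>b\<in>Basis. norm (?D b (s, l0)))" by (simp add: sum_distrib_left)
          also have "\<dots> \<le> norm h * K" using K(2)[OF s] by (intro mult_left_mono) auto
          finally have A: "norm ?A \<le> K * norm h" by (simp add: mult.commute)
          have "norm (L (s, ?l) - L (s, l0)) \<le> norm (L (s, ?l) - L (s, l0) - ?A) + norm ?A"
            using norm_triangle_ineq[of "L (s, ?l) - L (s, l0) - ?A" ?A] by simp
          also have "\<dots> \<le> 1 * norm h + K * norm h"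
            using lin A mult_right_mono[OF e1(2), of "norm h"] by simp
          finally have dL: "norm (L (s, ?l) - L (s, l0)) \<le> (K + 1) * norm h" by (simp add: algebra_simps)
          have "R' s = L (s, l0) (R s) + (L (s, ?l) - L (s, l0)) (V s ?l - V s l0)
              + (L (s, ?l) - L (s, l0) - ?A) (V s l0)"
            by (simp add: R_def R'_def blinfun.diff_left blinfun.diff_right blinfun.sum_left blinfun.sum_right
                blinfun.scaleR_left blinfun.scaleR_right scaleR_add_right sum.distrib)
          also have "norm \<dots> \<le> norm (L (s, l0)) * norm (R s)
            + norm (L (s, ?l) - L (s, l0)) * norm (V s ?l - V s l0)
            + norm (L (s, ?l) - L (s, l0) - ?A) * norm (V s l0)"
            by (intro norm_triangle_le add_mono norm_blinfun order_refl)
          also have "\<dots> \<le> C * norm (R s) + ((K + 1) * norm h) * e1 + (e1 * norm h) * B"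
            using C(1) C(2)[OF s] d2(3)[OF lb s] dL lin B(1) B(2)[OF s] K(1) e1
            by (intro add_mono mult_mono) auto
          finally show ?thesis by (simp add: algebra_simps)
        qed
        show "R 0 = 0" using V0[OF lS] V0[OF l0] W0 by (simp add: R_def)
      qed (use C K B e1 in auto)
      also have "\<dots> = e1 * ((K + 1 + B) * exp (C + 1)) * norm h" by simp
      also have "\<dots> \<le> (e / ((K + 1 + B) * exp (C + 1))) * ((K + 1 + B) * exp (C + 1)) * norm h"
        using K B by (intro mult_right_mono) (auto simp: e1_def)
      also have "\<dots> = e * norm h" using K B by simp
      finally show "norm (V s ?l - V s l0 - (\<Sum>b\<in>Basis. (h \<bullet> b) *\<^sub>R W b s)) \<le> e * norm h"
        by (simp add: R_def)
    qed
  qed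
  note * = this
  show ?thesis
    unfolding has_derivative_at_alt
  proof (intro conjI allI impI)
    show "bounded_linear (\<lambda>h. \<Sum>b\<in>Basis. (h \<bullet> b) *\<^sub>R W b s)"
      by (intro bounded_linear_sum bounded_linear_scaleR_const bounded_linear_inner_left)
    fix e :: real assume "e > 0"
    from *[OF this] obtain d where "d > 0" "\<And>h. norm h < d \<Longrightarrow>
      norm (V s (l0 + h) - V s l0 - (\<Sum>b\<in>Basis. (h \<bullet> b) *\<^sub>R W b s)) \<le> e * norm h" by blast
    then show "\<exists>d>0. \<forall>y. norm (y - l0) < d \<longrightarrow>
      norm (V s y - V s l0 - (\<Sum>b\<in>Basis. ((y - l0) \<bullet> b) *\<^sub>R W b s)) \<le> e * norm (y - l0)"
      by (intro exI[of _ d]) (metis add.commute diff_add_cancel)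
  qed
qed

text \<open>The diagonal part of a block-triangular operator whose lower-left block is supplied by
  \<open>aug_low\<close>. On pairs (solution, parameter derivative) their sum drives the first
  component by the ODE and the second by its variational equation; splitting it keeps each part
  linear in its block.\<close>

definition aug_diag :: "('v::real_normed_vector \<Rightarrow>\<^sub>L 'v) \<Rightarrow> ('v \<times> 'v) \<Rightarrow>\<^sub>L ('v \<times> 'v)" where
  "aug_diag M = ((Blinfun (\<lambda>a. (a, 0)) o\<^sub>L M) o\<^sub>L Blinfun fst) + ((Blinfun (\<lambda>a. (0, a)) o\<^sub>L M) o\<^sub>L Blinfun snd)"

definition aug_low :: "('v::real_normed_vector \<Rightarrow>\<^sub>L 'v) \<Rightarrow> ('v \<times> 'v) \<Rightarrow>\<^sub>L ('v \<times> 'v)" where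
  "aug_low N = (Blinfun (\<lambda>a. (0, a)) o\<^sub>L N) o\<^sub>L Blinfun fst"

lemma aug_apply:
  "blinfun_apply (aug_diag M + aug_low N) w = (M (fst w), M (snd w) + N (fst w))"
  by (simp add: aug_diag_def aug_low_def blinfun.add_left bounded_linear_Blinfun_apply
      bounded_linear_fst bounded_linear_snd bounded_linear_Pair bounded_linear_ident bounded_linear_zero
      blinfun_compose.rep_eq)

lemma bounded_linear_aug_low: "bounded_linear aug_low"
  unfolding aug_low_def
  by (intro bounded_linear_compose[OF bounded_bilinear.bounded_linear_left[OF bounded_bilinear_blinfun_compose]
        bounded_bilinear.bounded_linear_right[OF bounded_bilinear_blinfun_compose]])

lemma bounded_linear_aug_diag: "bounded_linear aug_diag"
  unfolding aug_diag_def
  by (intro bounded_linear_add bounded_linear_compose[OF bounded_bilinear.bounded_linear_left[OF bounded_bilinear_blinfun_compose]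
        bounded_bilinear.bounded_linear_right[OF bounded_bilinear_blinfun_compose]])

text \<open>One degree of smoothness for \<open>L\<close> on \<open>'v\<close> is traded for the doubled state space \<open>'v \<times> 'v\<close>, so
  an induction over the degree is not typable; degree \<open>3\<close> is reached by instantiating three times.\<close>

lemma lin_ode_family_Ck_step:
  fixes L :: "real \<times> 'p::euclidean_space \<Rightarrow> 'v::euclidean_space \<Rightarrow>\<^sub>L 'v"
  assumes IH: "\<And>(L' :: real \<times> 'p \<Rightarrow> ('v \<times> 'v) \<Rightarrow>\<^sub>L ('v \<times> 'v)) v0' V'.
      Ck_on k (I \<times> S) L' \<Longrightarrow> lin_ode_family L' S v0' V' \<Longrightarrow> Ck_on k S (V' s)"
    and I: "{0..1} \<subseteq> I" "open I" and S: "open S" and L: "Ck_on (Suc k) (I \<times> S) L"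
    and V: "lin_ode_family L S v0 V" and s: "s \<in> {0..1}"
  shows "Ck_on (Suc k) S (V s)"
proof -
  let ?D = "\<lambda>b z. frechet_derivative L (at z) (0, b)"
  \<comment> \<open>The system for a solution together with its derivative in direction
    \<open>b\<close>. It is started at \<open>(v0, 0)\<close> since the initial value does not
    depend on the parameter.\<close>
  define L' where "L' = (\<lambda>b z. aug_diag (L z) + aug_low (?D b z))"
  have o: "open (I \<times> S)" by (intro open_Times I S)
  have CL': "Ck_on k (I \<times> S) (L' b)" for b
    unfolding L'_def
    by (intro Ck_on_add[OF o] Ck_on_linear_compose[OF bounded_linear_aug_diag o]
        Ck_on_linear_compose[OF bounded_linear_aug_low o] Ck_on_frechet L Ck_on_SucD[OF L])
  have "\<exists>V'. lin_ode_family (L' b) S (v0, 0) V'" for b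
    by (intro lin_ode_family_exists continuous_on_subset[OF Ck_on_imp_continuous_on[OF CL']])
      (use I in auto)
  then obtain V' where V': "\<And>b. lin_ode_family (L' b) S (v0, 0) (V' b)" by metis
  have L1: "Ck_on 1 (I \<times> S) L" using Ck_on_le[OF L, of 1] by simp
  \<comment> \<open>By uniqueness the first component is the given \<open>V\<close>; only after this
    identification is the second component a solution of the variational equation along
    \<open>V\<close>.\<close>
  have fstV': "fst (V' b s l) = V s l" if l: "l \<in> S" and s: "s \<in> {0..1}" for b s l
  proof (rule linear_ode_unique[where L = "\<lambda>s. L (s, l)", OF _ _ _ _ s])
    show "continuous_on {0..1} (\<lambda>s. L (s, l))"
      by (rule continuous_on_compose2[OF Ck_on_imp_continuous_on[OF L]])
        (use l I in \<open>auto intro!: continuous_intros\<close>)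
    fix s :: real assume s: "s \<in> {0..1}"
    have "((\<lambda>s. V' b s l) has_vector_derivative L' b (s, l) (V' b s l)) (at s within {0..1})"
      using V'[of b] l s unfolding lin_ode_family_def by blast
    from bounded_linear.has_vector_derivative[OF bounded_linear_fst this]
    show "((\<lambda>s. fst (V' b s l)) has_vector_derivative L (s, l) (fst (V' b s l))) (at s within {0..1})"
      by (simp add: L'_def aug_apply)
    show "((\<lambda>s. V s l) has_vector_derivative L (s, l) (V s l)) (at s within {0..1})"
      using V l s unfolding lin_ode_family_def by blast
  qed (use V V'[of b] l in \<open>auto simp: lin_ode_family_def\<close>)
  show ?thesis
  proof (rule Ck_on_Suc_I[OF S])
    fix l assume l: "l \<in> S"
    show "(V s has_derivative (\<lambda>h. \<Sum>b\<in>Basis. (h \<bullet> b) *\<^sub>R snd (V' b s l))) (at l)"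
    proof (rule lin_ode_family_has_derivative[OF I(1) S L1 V l _ _ s, where W = "\<lambda>b s. snd (V' b s l)"])
      fix b :: 'p
      show "snd (V' b 0 l) = 0" using V'[of b] l by (auto simp: lin_ode_family_def)
      fix s :: real assume s: "s \<in> {0..1}"
      have "((\<lambda>s. V' b s l) has_vector_derivative L' b (s, l) (V' b s l)) (at s within {0..1})"
        using V'[of b] l s unfolding lin_ode_family_def by blast
      from bounded_linear.has_vector_derivative[OF bounded_linear_snd this]
      show "((\<lambda>s. snd (V' b s l)) has_vector_derivative
          L (s, l) (snd (V' b s l)) + ?D b (s, l) (V s l)) (at s within {0..1})"
        by (simp add: L'_def aug_apply fstV'[OF l s])
    qed
  next
    show "Ck_on k S (\<lambda>l. \<Sum>b\<in>Basis. (h \<bullet> b) *\<^sub>R snd (V' b s l))" for h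
      by (intro Ck_on_sum[OF S] Ck_on_scaleR[OF S] Ck_on_const Ck_on_snd[OF S] IH[OF CL' V'])
  qed
qed

lemma lin_ode_family_C0:
  fixes L :: "real \<times> 'p::euclidean_space \<Rightarrow> 'v::euclidean_space \<Rightarrow>\<^sub>L 'v"
  assumes "{0..1} \<subseteq> I" "open I" "open S" "s \<in> {0..1}" "Ck_on 0 (I \<times> S) L" "lin_ode_family L S v0 V"
  shows "Ck_on 0 S (V s)"
proof -
  have "continuous_on ({0..1} \<times> S) L"
    using assms(1,5) by (auto intro: continuous_on_subset)
  from lin_ode_family_continuous[OF this assms(3,6,4)] show ?thesis by simp
qed

lemma lin_ode_family_C1:
  fixes L :: "real \<times> 'p::euclidean_space \<Rightarrow> 'v::euclidean_space \<Rightarrow>\<^sub>L 'v"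
  assumes "{0..1} \<subseteq> I" "open I" "open S" "s \<in> {0..1}" "Ck_on (Suc 0) (I \<times> S) L" "lin_ode_family L S v0 V"
  shows "Ck_on (Suc 0) S (V s)"
  by (rule lin_ode_family_Ck_step[OF lin_ode_family_C0[OF assms(1-4)]]) (use assms in blast)+

lemma lin_ode_family_C2:
  fixes L :: "real \<times> 'p::euclidean_space \<Rightarrow> 'v::euclidean_space \<Rightarrow>\<^sub>L 'v"
  assumes "{0..1} \<subseteq> I" "open I" "open S" "s \<in> {0..1}" "Ck_on (Suc (Suc 0)) (I \<times> S) L" "lin_ode_family L S v0 V"
  shows "Ck_on (Suc (Suc 0)) S (V s)"
  by (rule lin_ode_family_Ck_step[OF lin_ode_family_C1[OF assms(1-4)]]) (use assms in blast)+

lemma lin_ode_family_C3: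
  fixes L :: "real \<times> 'p::euclidean_space \<Rightarrow> 'v::euclidean_space \<Rightarrow>\<^sub>L 'v"
  assumes "{0..1} \<subseteq> I" "open I" "open S" "s \<in> {0..1}" "Ck_on 3 (I \<times> S) L" "lin_ode_family L S v0 V"
  shows "Ck_on 3 S (V s)"
  unfolding numeral_3_eq_3
  by (rule lin_ode_family_Ck_step[OF lin_ode_family_C2[OF assms(1-4)]])
    (use assms in \<open>simp_all only: numeral_3_eq_3\<close>)

text \<open>Integration is a special linear ODE: with the nilpotent
  \<open>N (a, b) = (0, a)\<close>, the solution of \<open>V' = f N V\<close> started at
  \<open>(1, 0)\<close> has the integral of \<open>f\<close> as second component. Differentiation
  under the integral sign thus comes from smooth dependence on parameters.\<close>

lemma Ck_on_integral:
  fixes f :: "real \<times> 'p::euclidean_space \<Rightarrow> real"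
  assumes I: "{0..1} \<subseteq> I" "open I" and S: "open S" and f: "Ck_on 3 (I \<times> S) f"
  shows "Ck_on 3 S (\<lambda>l. integral {0..1} (\<lambda>s. f (s, l)))"
proof -
  define N :: "(real \<times> real) \<Rightarrow>\<^sub>L (real \<times> real)" where "N = Blinfun (\<lambda>w. (0, fst w))"
  have N: "N w = (0, fst w)" for w
    unfolding N_def
    by (simp add: bounded_linear_Blinfun_apply bounded_linear_Pair bounded_linear_zero bounded_linear_fst)
  define V where "V = (\<lambda>s l. (1::real, integral {0..s} (\<lambda>r. f (r, l))))"
  have "lin_ode_family (\<lambda>z. f z *\<^sub>R N) S (1, 0) V"
    unfolding lin_ode_family_def
  proof (intro ballI conjI)
    fix l assume l: "l \<in> S"
    show "V 0 l = (1, 0)" by (simp add: V_def)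
    fix s :: real assume s: "s \<in> {0..1}"
    have "continuous_on {0..1} (\<lambda>r. f (r, l))"
      by (rule continuous_on_compose2[OF Ck_on_imp_continuous_on[OF f]])
        (use l I in \<open>auto intro!: continuous_intros\<close>)
    from has_vector_derivative_Pair[OF has_vector_derivative_const[of 1] integral_has_vector_derivative[OF this s]]
    show "((\<lambda>s. V s l) has_vector_derivative (f (s, l) *\<^sub>R N) (V s l)) (at s within {0..1})"
      by (simp add: V_def blinfun.scaleR_left N)
  qed
  moreover have "Ck_on 3 (I \<times> S) (\<lambda>z. f z *\<^sub>R N)"
    by (intro Ck_on_scaleR open_Times I S f Ck_on_const)
  ultimately have "Ck_on 3 S (V 1)" by (intro lin_ode_family_C3[OF I S]) auto
  from Ck_on_snd[OF S this] show ?thesis by (simp add: V_def)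
qed

section \<open>Iterated directional derivatives\<close>

definition pdir :: "'v::real_normed_vector \<Rightarrow> ('v \<Rightarrow> 'w::real_normed_vector) \<Rightarrow> 'v \<Rightarrow> 'w" where
  "pdir v f = (\<lambda>z. frechet_derivative f (at z) v)"

lemma pdir_eqI: "(f has_derivative f') (at z) \<Longrightarrow> pdir v f z = f' v"
  unfolding pdir_def using frechet_derivative_at by metis

lemma Ck_on_pdir: "Ck_on (Suc k) S f \<Longrightarrow> Ck_on k S (pdir v f)"
  unfolding pdir_def by (rule Ck_on_frechet)

lemma Ck_on_differentiable: "Ck_on k S f \<Longrightarrow> 0 < k \<Longrightarrow> z \<in> S \<Longrightarrow> f differentiable (at z)"
  by (cases k) auto

lemma Ck_on_has_pdir: "Ck_on k S f \<Longrightarrow> 0 < k \<Longrightarrow> z \<in> S \<Longrightarrow> (f has_derivative (\<lambda>v. pdir v f z)) (at z)"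
  unfolding pdir_def using Ck_on_differentiable frechet_derivative_works by blast

lemma pdir_linear: "f differentiable (at z) \<Longrightarrow> linear (\<lambda>v. pdir v f z)"
  unfolding pdir_def by (rule linear_frechet_derivative)

lemma pdir_symmetric:
  fixes f :: "'a::real_normed_vector \<Rightarrow> real"
  shows "open S \<Longrightarrow> Ck_on 2 S f \<Longrightarrow> z \<in> S \<Longrightarrow> pdir u (pdir v f) z = pdir v (pdir u f) z"
  unfolding pdir_def using Ck_on_symmetric by blast

lemma pdir_cong:
  assumes "open S" "Ck_on (Suc k) S f" "z \<in> S" "\<And>y. y \<in> S \<Longrightarrow> f y = g y"
  shows "pdir v f z = pdir v g z"
proof -
  have "(g has_derivative (\<lambda>v. pdir v f z)) (at z)"
    by (rule has_derivative_transform_within_open[OF Ck_on_has_pdir[OF assms(2) _ assms(3)] assms(1,3,4)]) auto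
  from pdir_eqI[OF this] show ?thesis by simp
qed

lemma Ck_on_foldr_pdir: "Ck_on (length vs + k) S f \<Longrightarrow> Ck_on k S (foldr pdir vs f)"
proof (induction vs arbitrary: k)
  case (Cons v vs)
  then show ?case using Ck_on_pdir[OF Cons.IH[of "Suc k"]] by (simp del: Ck_on.simps)
qed simp

lemma pdir_line:
  fixes f :: "'a::real_normed_vector \<Rightarrow> real"
  assumes "f differentiable (at (x + t *\<^sub>R u))"
  shows "((\<lambda>t. f (x + t *\<^sub>R u)) has_real_derivative pdir u f (x + t *\<^sub>R u)) (at t)"
  using frechet_line[OF assms] by (simp add: pdir_def)

lemma Ck_on_has_iter_pd:
  fixes f :: "'a::real_normed_vector \<Rightarrow> real"
  assumes "open S" "z \<in> S" "Ck_on (length vs) S f"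
  shows "has_iter_pd vs f z (foldr pdir vs f z)"
  using assms(2,3)
proof (induction vs arbitrary: z)
  case (Cons v vs)
  have C: "Ck_on (Suc 0) S (foldr pdir vs f)"
    using Cons.prems by (intro Ck_on_foldr_pdir) (simp del: Ck_on.simps)
  have "\<forall>\<^sub>F y in nhds z. has_iter_pd vs f y (foldr pdir vs f y)"
    unfolding eventually_nhds
    using assms(1) Cons.prems Cons.IH Ck_on_SucD[of "length vs" S f] by auto
  moreover have "((\<lambda>t. foldr pdir vs f (z + t *\<^sub>R v)) has_real_derivative foldr pdir (v # vs) f z) (at 0)"
    using pdir_line[of "foldr pdir vs f" z 0 v] Ck_on_differentiable[OF C, of z] Cons.prems by simp
  ultimately show ?case unfolding has_iter_pd.simps(2) by blast
qed simp

section \<open>Polarization\<close>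

lemma symmetric_bilinear_eqI:
  fixes t :: "'v::real_vector \<Rightarrow> 'v \<Rightarrow> real"
  assumes "\<And>a b v. t (a + b) v = t a v + t b v" "\<And>u v. t u v = t v u"
    and "\<And>a b v. t' (a + b) v = t' a v + t' b v" "\<And>u v. t' u v = t' v u"
    and "\<And>v. t v v = t' v v"
  shows "t u v = t' u v"
proof -
  have "t (u + v) (u + v) = t u u + t v v + 2 * t u v"
    "t' (u + v) (u + v) = t' u u + t' v v + 2 * t' u v"
    using assms(1)[of u v "u + v"] assms(1)[of u v u] assms(1)[of u v v]
      assms(3)[of u v "u + v"] assms(3)[of u v u] assms(3)[of u v v] assms(2,4)[of u "u + v"] assms(2,4)[of v "u + v"] assms(2,4)[of v u]
    by linarith+
  then show ?thesis using assms(5)[of "u + v"] assms(5)[of u] assms(5)[of v] by simp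
qed

text \<open>Expanding the cube of \<open>u + v\<close> leaves
  \<open>3 * (t u u v + t u v v)\<close>. Doubling \<open>v\<close> weights the two terms by
  \<open>2\<close> and \<open>4\<close>, which separates them; polarizing \<open>t u u w = 0\<close>
  once more finishes.\<close>

lemma symmetric_trilinear_eq_0:
  fixes t :: "'v::real_vector \<Rightarrow> 'v \<Rightarrow> 'v \<Rightarrow> real"
  assumes add: "\<And>a b v w. t (a + b) v w = t a v w + t b v w"
    and s1: "\<And>u v w. t u v w = t v u w" and s2: "\<And>u v w. t u v w = t u w v"
    and z: "\<And>v. t v v v = 0"
  shows "t u v w = 0"
proof -
  have a2: "t u (a + b) w = t u a w + t u b w" for u a b w
    using add[of a b u w] s1[of u "a + b" w] s1[of u a w] s1[of u b w] by linarith
  have a3: "t u v (a + b) = t u v a + t u v b" for u v a b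
    using a2[of u a b v] s2[of u v "a + b"] s2[of u v a] s2[of u v b] by linarith
  have q: "t u u v = 0" for u v
  proof -
    have c: "t v u u = t u u v" "t u v u = t u u v" "t v u v = t u v v" "t v v u = t u v v" for u v
      using s1[of v u u] s2[of u v u] s1[of v u v] s2[of v v u] s2[of u v v] s1[of u v v] by linarith+
    have *: "t (u + v) (u + v) (u + v) = 3 * t u u v + 3 * t u v v" for u v
      by (simp add: add a2 a3 z[of u] z[of v] c)
    have "t u u v + t u v v = 0" using *[of u v] z[of "u + v"] by linarith
    moreover have "t u u (v + v) = 2 * t u u v" "t u (v + v) (v + v) = 4 * t u v v"
      by (simp_all add: a2 a3)
    ultimately have "t u u v = 0"
      using *[of u "v + v"] z[of "u + (v + v)"] by linarith
    then show ?thesis by simp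
  qed
  have "t (u + v) (u + v) w = 2 * t u v w"
    using s1[of v u w] by (simp add: add a2 q[of u] q[of v])
  then show ?thesis using q by simp
qed

section \<open>Jets along curves\<close>

lemma pdir_expand:
  fixes f :: "'a::euclidean_space \<Rightarrow> 'w::real_normed_vector"
  assumes "f differentiable (at z)"
  shows "pdir v f z = (\<Sum>b\<in>Basis. (v \<bullet> b) *\<^sub>R pdir b f z)"
  using linear_euclidean_expand[OF pdir_linear[OF assms]] .

text \<open>Direction and base point move together; expanding the direction in \<open>Basis\<close>
  turns the expression into a sum of products of real functions. In the first term of the result
  \<open>a t\<close> is a frozen direction while the point moves.\<close>

lemma pdir_along_curve:
  fixes f :: "'e::euclidean_space \<Rightarrow> real"
  assumes T: "open T" "Ck_on 2 T f" "b t \<in> T"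
    and a: "(a has_vector_derivative a') (at t)" and b: "(b has_vector_derivative b') (at t)"
  shows "((\<lambda>t. pdir (a t) f (b t)) has_real_derivative pdir b' (pdir (a t) f) (b t) + pdir a' f (b t)) (at t)"
proof -
  have f2: "Ck_on (Suc 1) T f" using T(2) by (simp add: numeral_2_eq_2)
  have df: "f differentiable (at z)" if "z \<in> T" for z using Ck_on_differentiable[OF f2] that by simp
  have dp: "(pdir i f has_derivative (\<lambda>v. pdir v (pdir i f) (b t))) (at (b t))" for i
    by (rule Ck_on_has_pdir[OF Ck_on_pdir[OF f2] _ T(3)]) simp
  have "((\<lambda>t. pdir i f (b t)) has_real_derivative pdir b' (pdir i f) (b t)) (at t)" for i
    unfolding has_field_derivative_def
    by (rule has_derivative_eq_rhs[OF has_derivative_compose[OF b[unfolded has_vector_derivative_def] dp[of i]]])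
      (simp add: fun_eq_iff linear_scale[OF pdir_linear[OF differentiableI[OF dp]]] mult.commute)
  moreover have "((\<lambda>t. a t \<bullet> i) has_real_derivative a' \<bullet> i) (at t)" for i
    using bounded_linear.has_vector_derivative[OF bounded_linear_inner_left a]
    by (simp add: has_real_derivative_iff_has_vector_derivative)
  ultimately have "((\<lambda>t. \<Sum>i\<in>Basis. (a t \<bullet> i) * pdir i f (b t)) has_real_derivative
    (\<Sum>i\<in>Basis. (a' \<bullet> i) * pdir i f (b t) + pdir b' (pdir i f) (b t) * (a t \<bullet> i))) (at t)"
    by (intro DERIV_sum DERIV_mult)
  moreover have "(\<Sum>i\<in>Basis. (a' \<bullet> i) * pdir i f (b t) + pdir b' (pdir i f) (b t) * (a t \<bullet> i))
      = pdir b' (pdir (a t) f) (b t) + pdir a' f (b t)"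
  proof -
    have "(\<lambda>z. \<Sum>i\<in>Basis. (a t \<bullet> i) *\<^sub>R pdir i f z) z = pdir (a t) f z" if "z \<in> T" for z
      using pdir_expand[OF df[OF that], of "a t"] by simp
    then have A: "((\<lambda>z. \<Sum>i\<in>Basis. (a t \<bullet> i) *\<^sub>R pdir i f z) has_derivative (\<lambda>v. pdir v (pdir (a t) f) (b t))) (at (b t))"
      by (intro has_derivative_transform_within_open[OF dp T(1,3)]) simp
    have B: "((\<lambda>z. \<Sum>i\<in>Basis. (a t \<bullet> i) *\<^sub>R pdir i f z) has_derivative
        (\<lambda>v. \<Sum>i\<in>Basis. (a t \<bullet> i) *\<^sub>R pdir v (pdir i f) (b t))) (at (b t))"
      by (intro has_derivative_sum has_derivative_scaleR_right dp)
    have "pdir b' (pdir (a t) f) (b t) = (\<Sum>i\<in>Basis. (a t \<bullet> i) *\<^sub>R pdir b' (pdir i f) (b t))"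
      using fun_cong[OF has_derivative_unique[OF A B], of b'] .
    then show ?thesis
      using pdir_expand[OF df[OF T(3)], of a'] by (simp add: sum.distrib mult.commute)
  qed
  moreover have "(\<Sum>i\<in>Basis. (a s \<bullet> i) * pdir i f (b s)) = pdir (a s) f (b s)" if "b s \<in> T" for s
    using pdir_expand[OF df[OF that], of "a s"] by simp
  moreover have "\<forall>\<^sub>F s in nhds t. b s \<in> T"
  proof -
    have "isCont b t" using b has_vector_derivative_continuous by blast
    then have "\<forall>\<^sub>F s in at t. b s \<in> T"
      using T(1,3) topological_tendstoD[of b "b t" "at t" T] by (auto simp: isCont_def)
    then show ?thesis using T(3) by (auto simp: eventually_at_filter elim!: eventually_mono)
  qed
  ultimately show ?thesis
    by (subst DERIV_cong_ev[OF refl _ refl, of _ "\<lambda>s. \<Sum>i\<in>Basis. (a s \<bullet> i) * pdir i f (b s)"])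
      (auto elim!: eventually_mono)
qed

lemma pdir2_along_curve:
  fixes f :: "'e::euclidean_space \<Rightarrow> real"
  assumes T: "open T" "Ck_on 3 T f" "b t \<in> T"
    and a: "(a has_vector_derivative a') (at t)" and b: "(b has_vector_derivative b') (at t)"
    and c: "(c has_vector_derivative c') (at t)"
  shows "((\<lambda>t. pdir (a t) (pdir (c t) f) (b t)) has_real_derivative
    pdir b' (pdir (a t) (pdir (c t) f)) (b t) + pdir a' (pdir (c t) f) (b t) + pdir (a t) (pdir c' f) (b t)) (at t)"
proof -
  have f3: "Ck_on (Suc 2) T f" using T(2) by (simp add: numeral_3_eq_3)
  have p2: "Ck_on 2 T (pdir i f)" for i by (rule Ck_on_pdir[OF f3])
  then have p2': "Ck_on (Suc 1) T (pdir i f)" for i by (simp add: numeral_2_eq_2)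
  have df: "f differentiable (at z)" if "z \<in> T" for z using Ck_on_differentiable[OF f3] that by simp
  have dp: "(pdir i f has_derivative (\<lambda>v. pdir v (pdir i f) z)) (at z)" if "z \<in> T" for i z
    by (rule Ck_on_has_pdir[OF p2 _ that]) simp
  have dpp: "(pdir u (pdir i f) has_derivative (\<lambda>v. pdir v (pdir u (pdir i f)) z)) (at z)" if "z \<in> T" for u i z
    by (rule Ck_on_has_pdir[OF Ck_on_pdir[OF p2'] _ that]) simp
  have ex: "pdir u (pdir v f) z = (\<Sum>i\<in>Basis. (v \<bullet> i) * pdir u (pdir i f) z)" if z: "z \<in> T" for u v z
  proof -
    have "((\<lambda>z. \<Sum>i\<in>Basis. (v \<bullet> i) *\<^sub>R pdir i f z) has_derivative (\<lambda>u. \<Sum>i\<in>Basis. (v \<bullet> i) *\<^sub>R pdir u (pdir i f) z)) (at z)"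
      by (intro has_derivative_sum has_derivative_scaleR_right dp z)
    from has_derivative_transform_within_open[OF this T(1) z, of "pdir v f"] pdir_expand[OF df, of _ v]
    have "(pdir v f has_derivative (\<lambda>u. \<Sum>i\<in>Basis. (v \<bullet> i) *\<^sub>R pdir u (pdir i f) z)) (at z)" by simp
    from pdir_eqI[OF this] show ?thesis by simp
  qed
  have ex3: "pdir w (pdir u (pdir v f)) z = (\<Sum>i\<in>Basis. (v \<bullet> i) * pdir w (pdir u (pdir i f)) z)" if z: "z \<in> T" for w u v z
  proof -
    have "((\<lambda>z. \<Sum>i\<in>Basis. (v \<bullet> i) *\<^sub>R pdir u (pdir i f) z) has_derivative (\<lambda>w. \<Sum>i\<in>Basis. (v \<bullet> i) *\<^sub>R pdir w (pdir u (pdir i f)) z)) (at z)"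
      by (intro has_derivative_sum has_derivative_scaleR_right dpp z)
    from has_derivative_transform_within_open[OF this T(1) z, of "pdir u (pdir v f)"] ex[of _ u v]
    have "(pdir u (pdir v f) has_derivative (\<lambda>w. \<Sum>i\<in>Basis. (v \<bullet> i) *\<^sub>R pdir w (pdir u (pdir i f)) z)) (at z)" by simp
    from pdir_eqI[OF this] show ?thesis by simp
  qed
  have "((\<lambda>t. pdir (a t) (pdir i f) (b t)) has_real_derivative
      pdir b' (pdir (a t) (pdir i f)) (b t) + pdir a' (pdir i f) (b t)) (at t)" for i
    by (rule pdir_along_curve[OF T(1) p2 T(3) a b])
  moreover have "((\<lambda>t. c t \<bullet> i) has_real_derivative c' \<bullet> i) (at t)" for i
    using bounded_linear.has_vector_derivative[OF bounded_linear_inner_left c]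
    by (simp add: has_real_derivative_iff_has_vector_derivative)
  ultimately have "((\<lambda>t. \<Sum>i\<in>Basis. (c t \<bullet> i) * pdir (a t) (pdir i f) (b t)) has_real_derivative
    (\<Sum>i\<in>Basis. (c' \<bullet> i) * pdir (a t) (pdir i f) (b t) +
      (pdir b' (pdir (a t) (pdir i f)) (b t) + pdir a' (pdir i f) (b t)) * (c t \<bullet> i))) (at t)"
    by (intro DERIV_sum DERIV_mult)
  moreover have "(\<Sum>i\<in>Basis. (c' \<bullet> i) * pdir (a t) (pdir i f) (b t) +
      (pdir b' (pdir (a t) (pdir i f)) (b t) + pdir a' (pdir i f) (b t)) * (c t \<bullet> i))
    = pdir b' (pdir (a t) (pdir (c t) f)) (b t) + pdir a' (pdir (c t) f) (b t) + pdir (a t) (pdir c' f) (b t)"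
    unfolding ex3[OF T(3), of _ _ "c t"] ex[OF T(3), of _ "c t"] ex[OF T(3), of _ c']
    by (simp add: sum.distrib algebra_simps)
  moreover have "\<forall>\<^sub>F s in nhds t. b s \<in> T"
  proof -
    have "isCont b t" using b has_vector_derivative_continuous by blast
    then have "\<forall>\<^sub>F s in at t. b s \<in> T"
      using T(1,3) topological_tendstoD[of b "b t" "at t" T] by (auto simp: isCont_def)
    then show ?thesis using T(3) by (auto simp: eventually_at_filter elim!: eventually_mono)
  qed
  ultimately show ?thesis
    by (subst DERIV_cong_ev[OF refl _ refl, of _ "\<lambda>s. \<Sum>i\<in>Basis. (c s \<bullet> i) * pdir (a s) (pdir i f) (b s)"])
      (auto elim!: eventually_mono simp: ex)
qed

lemma Ck_on_curve_deriv:
  fixes \<gamma> :: "real \<Rightarrow> 'v::real_normed_vector"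
  assumes "Ck_on k J \<gamma>" "0 < k" "t \<in> J"
  shows "(\<gamma> has_vector_derivative pdir 1 \<gamma> t) (at t)"
proof -
  have "\<gamma> differentiable (at t)" using Ck_on_differentiable[OF assms] .
  have "pdir v \<gamma> t = v *\<^sub>R pdir 1 \<gamma> t" for v
    using linear_scale[OF pdir_linear[OF \<open>\<gamma> differentiable (at t)\<close>], of v 1] by simp
  then have "(\<lambda>v. pdir v \<gamma> t) = (\<lambda>h. h *\<^sub>R pdir 1 \<gamma> t)" by (rule ext)
  then show ?thesis using Ck_on_has_pdir[OF assms] unfolding has_vector_derivative_def by simp
qed

text \<open>The chain rule up to third order, with \<open>h\<close> standing for the first
  derivative along the curve. The factor \<open>3\<close> collects one term with the acceleration as
  outer direction and two with it as inner direction, equal by symmetry of second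
  derivatives.\<close>

lemma jets_along_curve:
  fixes f :: "'e::euclidean_space \<Rightarrow> real"
  assumes T: "open T" "Ck_on 3 T f" and J: "open J" "0 \<in> J" and \<gamma>: "Ck_on 3 J \<gamma>" "\<gamma> ` J \<subseteq> T"
    and h: "\<And>t. t \<in> J \<Longrightarrow> ((\<lambda>t. f (\<gamma> t)) has_real_derivative h t) (at t)"
  shows "h 0 = pdir (pdir 1 \<gamma> 0) f (\<gamma> 0)"
    and "(h has_real_derivative pdir (pdir 1 \<gamma> 0) (pdir (pdir 1 \<gamma> 0) f) (\<gamma> 0)
      + pdir (pdir 1 (pdir 1 \<gamma>) 0) f (\<gamma> 0)) (at 0)"
    and "(pdir 1 h has_real_derivative
        pdir (pdir 1 \<gamma> 0) (pdir (pdir 1 \<gamma> 0) (pdir (pdir 1 \<gamma> 0) f)) (\<gamma> 0)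
        + 3 * pdir (pdir 1 \<gamma> 0) (pdir (pdir 1 (pdir 1 \<gamma>) 0) f) (\<gamma> 0)
        + pdir (pdir 1 (pdir 1 (pdir 1 \<gamma>)) 0) f (\<gamma> 0)) (at 0)"
proof -
  have g3: "Ck_on (Suc (Suc (Suc 0))) J \<gamma>" using \<gamma>(1) by (simp add: numeral_3_eq_3)
  have f2: "Ck_on 2 T f" using Ck_on_le[OF T(2), of 2] by simp
  have g1: "(\<gamma> has_vector_derivative pdir 1 \<gamma> t) (at t)" if "t \<in> J" for t
    by (rule Ck_on_curve_deriv[OF g3 _ that]) simp
  have g2: "(pdir 1 \<gamma> has_vector_derivative pdir 1 (pdir 1 \<gamma>) t) (at t)" if "t \<in> J" for t
    by (rule Ck_on_curve_deriv[OF Ck_on_pdir[OF g3] _ that]) simp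
  have g3: "(pdir 1 (pdir 1 \<gamma>) has_vector_derivative pdir 1 (pdir 1 (pdir 1 \<gamma>)) t) (at t)" if "t \<in> J" for t
    by (rule Ck_on_curve_deriv[OF Ck_on_pdir[OF Ck_on_pdir[OF g3]] _ that]) simp
  have gT: "\<gamma> t \<in> T" if "t \<in> J" for t using \<gamma>(2) that by blast
  have h1: "h t = pdir (pdir 1 \<gamma> t) f (\<gamma> t)" if t: "t \<in> J" for t
  proof -
    have df: "(f has_derivative (\<lambda>v. pdir v f (\<gamma> t))) (at (\<gamma> t))"
      by (rule Ck_on_has_pdir[OF f2 _ gT[OF t]]) simp
    have "((\<lambda>t. f (\<gamma> t)) has_derivative (\<lambda>k. pdir (k *\<^sub>R pdir 1 \<gamma> t) f (\<gamma> t))) (at t)"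
      by (rule has_derivative_compose[OF g1[OF t, unfolded has_vector_derivative_def] df])
    then have "((\<lambda>t. f (\<gamma> t)) has_real_derivative pdir (pdir 1 \<gamma> t) f (\<gamma> t)) (at t)"
      unfolding has_field_derivative_def
      by (rule has_derivative_eq_rhs)
        (simp add: fun_eq_iff linear_scale[OF pdir_linear[OF differentiableI[OF df]]] mult.commute)
    from DERIV_unique[OF h[OF t] this] show ?thesis .
  qed
  then show "h 0 = pdir (pdir 1 \<gamma> 0) f (\<gamma> 0)" using J by simp
  define k where "k = (\<lambda>t. pdir (pdir 1 \<gamma> t) (pdir (pdir 1 \<gamma> t) f) (\<gamma> t) + pdir (pdir 1 (pdir 1 \<gamma>) t) f (\<gamma> t))"
  have h2: "(h has_real_derivative k t) (at t)" if t: "t \<in> J" for t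
    unfolding k_def
    by (rule has_field_derivative_transform_within_open[OF pdir_along_curve[OF T(1) f2 gT[OF t] g2[OF t] g1[OF t]] J(1) t])
      (simp add: h1)
  then show "(h has_real_derivative pdir (pdir 1 \<gamma> 0) (pdir (pdir 1 \<gamma> 0) f) (\<gamma> 0)
      + pdir (pdir 1 (pdir 1 \<gamma>) 0) f (\<gamma> 0)) (at 0)" using J(2) by (simp add: k_def)
  have k: "pdir 1 h t = k t" if "t \<in> J" for t
    using pdir_eqI[OF h2[OF that, unfolded has_field_derivative_def], of 1] by simp
  have "(k has_real_derivative
      (pdir (pdir 1 \<gamma> 0) (pdir (pdir 1 \<gamma> 0) (pdir (pdir 1 \<gamma> 0) f)) (\<gamma> 0)
       + pdir (pdir 1 (pdir 1 \<gamma>) 0) (pdir (pdir 1 \<gamma> 0) f) (\<gamma> 0)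
       + pdir (pdir 1 \<gamma> 0) (pdir (pdir 1 (pdir 1 \<gamma>) 0) f) (\<gamma> 0))
     + (pdir (pdir 1 \<gamma> 0) (pdir (pdir 1 (pdir 1 \<gamma>) 0) f) (\<gamma> 0) + pdir (pdir 1 (pdir 1 (pdir 1 \<gamma>)) 0) f (\<gamma> 0))) (at 0)"
    unfolding k_def using J(2)
    by (intro DERIV_add pdir2_along_curve[OF T gT] pdir_along_curve[OF T(1) f2 gT] g1 g2 g3)
  then have "(pdir 1 h has_real_derivative
      (pdir (pdir 1 \<gamma> 0) (pdir (pdir 1 \<gamma> 0) (pdir (pdir 1 \<gamma> 0) f)) (\<gamma> 0)
       + pdir (pdir 1 (pdir 1 \<gamma>) 0) (pdir (pdir 1 \<gamma> 0) f) (\<gamma> 0)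
       + pdir (pdir 1 \<gamma> 0) (pdir (pdir 1 (pdir 1 \<gamma>) 0) f) (\<gamma> 0))
     + (pdir (pdir 1 \<gamma> 0) (pdir (pdir 1 (pdir 1 \<gamma>) 0) f) (\<gamma> 0) + pdir (pdir 1 (pdir 1 (pdir 1 \<gamma>)) 0) f (\<gamma> 0))) (at 0)"
    by (rule has_field_derivative_transform_within_open[OF _ J]) (simp add: k)
  moreover have "pdir (pdir 1 (pdir 1 \<gamma>) 0) (pdir (pdir 1 \<gamma> 0) f) (\<gamma> 0)
      = pdir (pdir 1 \<gamma> 0) (pdir (pdir 1 (pdir 1 \<gamma>) 0) f) (\<gamma> 0)"
    by (rule pdir_symmetric[OF T(1) f2 gT[OF J(2)]])
  ultimately show "(pdir 1 h has_real_derivative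
        pdir (pdir 1 \<gamma> 0) (pdir (pdir 1 \<gamma> 0) (pdir (pdir 1 \<gamma> 0) f)) (\<gamma> 0)
        + 3 * pdir (pdir 1 \<gamma> 0) (pdir (pdir 1 (pdir 1 \<gamma>) 0) f) (\<gamma> 0)
        + pdir (pdir 1 (pdir 1 (pdir 1 \<gamma>)) 0) f (\<gamma> 0)) (at 0)"
    by (elim DERIV_cong) simp
qed

section \<open>Two-point functions near the diagonal\<close>

lemma pdir_slice:
  fixes F :: "'e::euclidean_space \<times> 'e \<Rightarrow> real"
  assumes "F differentiable (at (x, y))"
  shows "pdir v (\<lambda>y. F (x, y)) y = pdir (0, v) F (x, y)"
proof -
  have 1: "((\<lambda>y. (x, y)) has_derivative (\<lambda>v. (0, v))) (at y)"
    by (auto intro!: derivative_eq_intros)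
  have "(F has_derivative (\<lambda>v. pdir v F (x, y))) (at (x, y))"
    using assms unfolding pdir_def frechet_derivative_works .
  from has_derivative_compose[OF 1 this] show ?thesis by (rule pdir_eqI)
qed

lemma open_slice: "open S \<Longrightarrow> open {y. (x, y) \<in> S}"
  using open_vimage[of S "\<lambda>y. (x, y)"] by (simp add: vimage_def continuous_intros)

lemma Ck_on_slice:
  fixes F :: "'e::euclidean_space \<times> 'e \<Rightarrow> real"
  assumes "open S" "Ck_on k S F"
  shows "Ck_on k {y. (x, y) \<in> S} (\<lambda>y. F (x, y))"
  by (rule Ck_on_compose[OF open_slice[OF assms(1)] assms(1,2)])
    (auto intro!: Ck_on_Pair Ck_on_const Ck_on_ident open_slice assms)

lemma pdir_slice2:
  fixes F :: "'e::euclidean_space \<times> 'e \<Rightarrow> real"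
  assumes S: "open S" "Ck_on 2 S F" "(x, y) \<in> S"
  shows "pdir u (pdir v (\<lambda>y. F (x, y))) y = pdir (0, u) (pdir (0, v) F) (x, y)"
proof -
  have F: "Ck_on (Suc (Suc 0)) S F" using S(2) by (simp add: numeral_2_eq_2)
  have "pdir u (pdir v (\<lambda>y. F (x, y))) y = pdir u (\<lambda>y. pdir (0, v) F (x, y)) y"
  proof (rule pdir_cong[OF open_slice[OF S(1)]])
    show "Ck_on (Suc 0) {y. (x, y) \<in> S} (pdir v (\<lambda>y. F (x, y)))"
      by (rule Ck_on_pdir[OF Ck_on_slice[OF S(1) F]])
    show "pdir v (\<lambda>y. F (x, y)) z = pdir (0, v) F (x, z)" if "z \<in> {y. (x, y) \<in> S}" for z
      using pdir_slice[OF Ck_on_differentiable[OF F]] that by simp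
  qed (use S in auto)
  also have "\<dots> = pdir (0, u) (pdir (0, v) F) (x, y)"
    by (rule pdir_slice[OF Ck_on_differentiable[OF Ck_on_pdir[OF F] _ S(3)]]) simp
  finally show ?thesis .
qed

lemma pdir_slice3:
  fixes F :: "'e::euclidean_space \<times> 'e \<Rightarrow> real"
  assumes S: "open S" "Ck_on 3 S F" "(x, y) \<in> S"
  shows "pdir u (pdir v (pdir w (\<lambda>y. F (x, y)))) y = pdir (0, u) (pdir (0, v) (pdir (0, w) F)) (x, y)"
proof -
  have F: "Ck_on (Suc (Suc (Suc 0))) S F" using S(2) by (simp add: numeral_3_eq_3)
  have F2: "Ck_on 2 S F" using Ck_on_le[OF S(2), of 2] by simp
  have "pdir u (pdir v (pdir w (\<lambda>y. F (x, y)))) y = pdir u (\<lambda>y. pdir (0, v) (pdir (0, w) F) (x, y)) y"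
  proof (rule pdir_cong[OF open_slice[OF S(1)]])
    show "Ck_on (Suc 0) {y. (x, y) \<in> S} (pdir v (pdir w (\<lambda>y. F (x, y))))"
      by (rule Ck_on_pdir[OF Ck_on_pdir[OF Ck_on_slice[OF S(1) F]]])
    show "pdir v (pdir w (\<lambda>y. F (x, y))) z = pdir (0, v) (pdir (0, w) F) (x, z)" if "z \<in> {y. (x, y) \<in> S}" for z
      using pdir_slice2[OF S(1) F2] that by simp
  qed (use S in auto)
  also have "\<dots> = pdir (0, u) (pdir (0, v) (pdir (0, w) F)) (x, y)"
    by (rule pdir_slice[OF Ck_on_differentiable[OF Ck_on_pdir[OF Ck_on_pdir[OF F]] _ S(3)]]) simp
  finally show ?thesis .
qed

lemma pdir_add: "f differentiable (at z) \<Longrightarrow> pdir (u + v) f z = pdir u f z + pdir v f z"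
  using linear_add[OF pdir_linear] .

text \<open>The diagonal direction \<open>(u, u)\<close> is the sum of \<open>(u, 0)\<close> and
  \<open>(0, u)\<close>. Knowing a function on the diagonal therefore trades a derivative in the
  first slot for one in the second.\<close>

lemma pdir_diag:
  fixes F :: "'e::euclidean_space \<times> 'e \<Rightarrow> real"
  assumes F: "F differentiable (at (x, x))" and B: "open B" "x \<in> B"
    and eq: "\<And>x. x \<in> B \<Longrightarrow> F (x, x) = \<psi> x" and \<psi>: "(\<psi> has_derivative \<psi>') (at x)"
  shows "pdir (u, 0) F (x, x) = \<psi>' u - pdir (0, u) F (x, x)"
proof -
  have 1: "((\<lambda>y. (y, y)) has_derivative (\<lambda>v. (v, v))) (at x)"
    by (auto intro!: derivative_eq_intros)
  have "(F has_derivative (\<lambda>v. pdir v F (x, x))) (at (x, x))"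
    using F unfolding pdir_def frechet_derivative_works .
  from has_derivative_compose[OF 1 this]
  have A: "((\<lambda>x. F (x, x)) has_derivative (\<lambda>v. pdir (v, v) F (x, x))) (at x)" .
  have "((\<lambda>x. F (x, x)) has_derivative \<psi>') (at x)"
    by (rule has_derivative_transform_within_open[OF \<psi> B]) (simp add: eq)
  from fun_cong[OF has_derivative_unique[OF this A]] have "\<psi>' u = pdir (u, u) F (x, x)" .
  also have "\<dots> = pdir (u, 0) F (x, x) + pdir (0, u) F (x, x)"
    using pdir_add[OF F, of "(u, 0)" "(0, u)"] by simp
  finally show ?thesis by simp
qed

text \<open>At a diagonal point \<open>(x, x)\<close>, \<open>G\<close> is the metric; the curves \<open>\<gamma>\<close> through \<open>x\<close> are arbitrary
  as long as their acceleration enters the third derivative of \<open>F (x, \<gamma> t)\<close> through \<open>3 G \<gamma>' \<gamma>''\<close>.\<close>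

definition jet_data ::
  "('e::euclidean_space \<times> 'e \<Rightarrow> real) \<Rightarrow> ('e \<times> 'e) set \<Rightarrow> 'e \<Rightarrow> ('e \<Rightarrow> 'e \<Rightarrow> real) \<Rightarrow> ('e \<Rightarrow> real) \<Rightarrow> bool" where
  "jet_data F S x G \<Lambda> \<longleftrightarrow> (\<forall>v. \<exists>\<gamma> h J. open J \<and> 0 \<in> J \<and> Ck_on 3 J \<gamma> \<and> \<gamma> 0 = x \<and> pdir 1 \<gamma> 0 = v \<and>
     (\<forall>t\<in>J. (x, \<gamma> t) \<in> S \<and> ((\<lambda>t. F (x, \<gamma> t)) has_real_derivative h t) (at t)) \<and>
     h 0 = 0 \<and> (h has_real_derivative G v v) (at 0) \<and>
     (pdir 1 h has_real_derivative 3 * G v (pdir 1 (pdir 1 \<gamma>) 0) + \<Lambda> v) (at 0))"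

text \<open>The orders are settled in turn. Once the first derivative vanishes in every direction,
  nothing hit by \<open>\<gamma>''\<close> or \<open>\<gamma>'''\<close> through it survives, so
  second order gives \<open>G v v\<close> and, polarized, \<open>G\<close>. At third order both
  sides then contain the same \<open>3 * G v \<gamma>''\<close>, and what is left does not depend on
  the curves.\<close>

lemma jet_data_slices:
  fixes F :: "'e::euclidean_space \<times> 'e \<Rightarrow> real"
  assumes S: "open S" "Ck_on 3 S F" "(x, x) \<in> S" and jd: "jet_data F S x G \<Lambda>"
    and G: "\<And>a b v. G (a + b) v = G a v + G b v" "\<And>u v. G u v = G v u"
  shows "pdir (0, v) F (x, x) = 0" "pdir (0, u) (pdir (0, v) F) (x, x) = G u v"
    "pdir (0, v) (pdir (0, v) (pdir (0, v) F)) (x, x) = \<Lambda> v"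
proof -
  let ?f = "\<lambda>y. F (x, y)" and ?T = "{y. (x, y) \<in> S}"
  have T: "open ?T" "x \<in> ?T" using open_slice[OF S(1)] S(3) by auto
  have f3: "Ck_on 3 ?T ?f" by (rule Ck_on_slice[OF S(1,2)])
  have f2: "Ck_on 2 ?T ?f" using Ck_on_le[OF f3, of 2] by simp
  have F2: "Ck_on 2 S F" using Ck_on_le[OF S(2), of 2] by simp
  have D: "pdir v ?f x = 0 \<and> pdir v (pdir v ?f) x = G v v \<and> (\<exists>w. pdir v (pdir v (pdir v ?f)) x
      = 3 * G v w + \<Lambda> v - 3 * pdir v (pdir w ?f) x)"
    if z: "\<And>v. pdir v ?f x = 0" for v
  proof -
    obtain \<gamma> h J where *: "open J" "0 \<in> J" "Ck_on 3 J \<gamma>" "\<gamma> 0 = x" "pdir 1 \<gamma> 0 = v"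
      "\<forall>t\<in>J. (x, \<gamma> t) \<in> S \<and> ((\<lambda>t. F (x, \<gamma> t)) has_real_derivative h t) (at t)"
      "h 0 = 0" "(h has_real_derivative G v v) (at 0)"
      "(pdir 1 h has_real_derivative 3 * G v (pdir 1 (pdir 1 \<gamma>) 0) + \<Lambda> v) (at 0)"
      using jd[unfolded jet_data_def, THEN spec, of v] by (elim exE conjE) (rule that)
    have g: "\<gamma> ` J \<subseteq> ?T" using *(6) by auto
    have h: "((\<lambda>t. ?f (\<gamma> t)) has_real_derivative h t) (at t)" if "t \<in> J" for t using *(6) that by simp
    note j = jets_along_curve[OF T(1) f3 *(1,2,3) g h, unfolded *(4,5)]
    show ?thesis
      using DERIV_unique[OF j(2) *(8)] DERIV_unique[OF j(3) *(9)] z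
      by (intro conjI exI[of _ "pdir 1 (pdir 1 \<gamma>) 0"]) auto
  qed
  have z: "pdir v ?f x = 0" for v
  proof -
    obtain \<gamma> h J where *: "open J" "0 \<in> J" "Ck_on 3 J \<gamma>" "\<gamma> 0 = x" "pdir 1 \<gamma> 0 = v"
      "\<forall>t\<in>J. (x, \<gamma> t) \<in> S \<and> ((\<lambda>t. F (x, \<gamma> t)) has_real_derivative h t) (at t)" "h 0 = 0"
      using jd[unfolded jet_data_def, THEN spec, of v] by (elim exE conjE) (rule that)
    have g: "\<gamma> ` J \<subseteq> ?T" using *(6) by auto
    have h: "((\<lambda>t. ?f (\<gamma> t)) has_real_derivative h t) (at t)" if "t \<in> J" for t using *(6) that by simp
    show ?thesis using jets_along_curve(1)[OF T(1) f3 *(1,2,3) g h, unfolded *(4,5)] *(7) by simp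
  qed
  show "pdir (0, v) F (x, x) = 0" for v
    using z[of v] pdir_slice[OF Ck_on_differentiable[OF F2 _ S(3)]] by simp
  have f2': "Ck_on (Suc 1) ?T ?f" using f2 by (simp add: numeral_2_eq_2)
  have sym: "pdir u (pdir v ?f) x = pdir v (pdir u ?f) x" for u v
    by (rule pdir_symmetric[OF T(1) f2 T(2)])
  have bil: "pdir u (pdir v ?f) x = G u v" for u v
  proof (rule symmetric_bilinear_eqI[of "\<lambda>u v. pdir u (pdir v ?f) x", OF _ sym G])
    show "pdir (a + b) (pdir v ?f) x = pdir a (pdir v ?f) x + pdir b (pdir v ?f) x" for a b v
      by (rule pdir_add[OF Ck_on_differentiable[OF Ck_on_pdir[OF f2'] _ T(2)]]) simp
  qed (use D[OF z] in auto)
  then show "pdir (0, u) (pdir (0, v) F) (x, x) = G u v" for u v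
    using pdir_slice2[OF S(1) F2 S(3)] by simp
  show "pdir (0, v) (pdir (0, v) (pdir (0, v) F)) (x, x) = \<Lambda> v" for v
    using D[OF z, of v] bil pdir_slice3[OF S] by auto
qed

text \<open>Differentiating known second derivatives along the diagonal expresses every mixed third
  derivative through the derivative of \<open>G\<close> and the pure one, \<open>c\<close>. Symmetry
  of \<open>G\<close> makes \<open>\<Gamma> - \<Gamma>'\<close> symmetric in all three arguments, so
  the cubic form determines \<open>c u v w\<close> as
  \<open>\<Gamma> u v w + \<Gamma>' v w u + \<Gamma>' w u v\<close>, and the sums collapse.\<close>

lemma diagonal_derivatives:
  fixes F :: "'e::euclidean_space \<times> 'e \<Rightarrow> real"
  assumes S: "open S" "Ck_on 3 S F" and B: "open B" "\<And>x. x \<in> B \<Longrightarrow> (x, x) \<in> S"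
    and jd: "\<And>x. x \<in> B \<Longrightarrow> jet_data F S x (G x) (\<lambda>v. \<Gamma> x v v v + 2 * \<Gamma>' x v v v)"
    and G: "\<And>x a b v. x \<in> B \<Longrightarrow> G x (a + b) v = G x a v + G x b v"
      "\<And>x u v. x \<in> B \<Longrightarrow> G x u v = G x v u"
    and \<Gamma>: "\<And>x a b v w. x \<in> B \<Longrightarrow> \<Gamma> x (a + b) v w = \<Gamma> x a v w + \<Gamma> x b v w"
      "\<And>x a b v w. x \<in> B \<Longrightarrow> \<Gamma> x v w (a + b) = \<Gamma> x v w a + \<Gamma> x v w b"
      "\<And>x u v w. x \<in> B \<Longrightarrow> \<Gamma> x u v w = \<Gamma> x v u w"
    and \<Gamma>': "\<And>x a b v w. x \<in> B \<Longrightarrow> \<Gamma>' x (a + b) v w = \<Gamma>' x a v w + \<Gamma>' x b v w"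
      "\<And>x a b v w. x \<in> B \<Longrightarrow> \<Gamma>' x v w (a + b) = \<Gamma>' x v w a + \<Gamma>' x v w b"
      "\<And>x u v w. x \<in> B \<Longrightarrow> \<Gamma>' x u v w = \<Gamma>' x v u w"
    and dG: "\<And>x u v. x \<in> B \<Longrightarrow> ((\<lambda>x. G x u v) has_derivative (\<lambda>k. \<Gamma> x k u v + \<Gamma>' x k v u)) (at x)"
    and x: "x \<in> B"
  shows "pdir (u, 0) (pdir (0, v) F) (x, x) = - G x u v"
    and "pdir (0, u) (pdir (0, v) F) (x, x) = G x u v"
    and "pdir (u, 0) (pdir (v, 0) (pdir (0, w) F)) (x, x) = - \<Gamma> x u v w"
    and "pdir (0, u) (pdir (0, v) (pdir (w, 0) F)) (x, x) = - \<Gamma>' x u v w"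
proof -
  have F: "Ck_on (Suc (Suc (Suc 0))) S F" using S(2) by (simp add: numeral_3_eq_3)
  have p2: "Ck_on 2 S (pdir a F)" for a using Ck_on_pdir[OF F] by (simp add: numeral_2_eq_2)
  have F2: "Ck_on 2 S F" using Ck_on_le[OF S(2), of 2] by simp
  have d1: "pdir a F differentiable (at z)" if "z \<in> S" for a z
    using Ck_on_differentiable[OF p2 _ that] by simp
  have d2: "pdir b (pdir a F) differentiable (at z)" if "z \<in> S" for a b z
    using Ck_on_differentiable[OF Ck_on_pdir[OF Ck_on_pdir[OF F]] _ that] by simp
  note sl = jet_data_slices[OF S(1,2) B(2) jd G(1) G(2)]
  have sl1: "pdir (0, v) F (x, x) = 0" if "x \<in> B" for x v by (rule sl(1)[OF that that that that])
  have sl2: "pdir (0, u) (pdir (0, v) F) (x, x) = G x u v" if "x \<in> B" for x u v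
    by (rule sl(2)[OF that that that that])
  have sl3: "pdir (0, v) (pdir (0, v) (pdir (0, v) F)) (x, x) = \<Gamma> x v v v + 2 * \<Gamma>' x v v v" if "x \<in> B" for x v
    by (rule sl(3)[OF that that that that])
  have p1': "Ck_on (Suc 0) S (pdir b (pdir a F))" for a b using Ck_on_pdir[OF Ck_on_pdir[OF F]] .
  have mixed: "pdir (u, 0) (pdir (0, v) F) (x, x) = - G x u v" if "x \<in> B" for u v x
    using pdir_diag[OF d1[OF B(2)[OF that]] B(1) that sl1 has_derivative_const] sl2[OF that] by simp
  have swap: "pdir c (pdir a (pdir b F)) z = pdir c (pdir b (pdir a F)) z" if "z \<in> S" for a b c z
    by (rule pdir_cong[OF S(1) p1' that]) (rule pdir_symmetric[OF S(1) F2])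
  have swap1: "pdir a (pdir b (pdir c F)) z = pdir b (pdir a (pdir c F)) z" if "z \<in> S" for a b c z
    by (rule pdir_symmetric[OF S(1) p2 that])
  show "pdir (u, 0) (pdir (0, v) F) (x, x) = - G x u v" by (rule mixed[OF x])
  show "pdir (0, u) (pdir (0, v) F) (x, x) = G x u v" by (rule sl2[OF x])
  define c where "c = (\<lambda>u v w. pdir (0, u) (pdir (0, v) (pdir (0, w) F)) (x, x))"
  define \<Lambda> where "\<Lambda> = (\<lambda>u v w. \<Gamma> x u v w + 2 * \<Gamma>' x u v w)"
  \<comment> \<open>\<open>\<Lambda>\<close> is already symmetric in its first two arguments, so the
    cyclic sum is a full symmetrization; \<open>t\<close> is then symmetric and vanishes on
    cubes.\<close>
  define t where "t = (\<lambda>u v w. 3 * c u v w - (\<Lambda> u v w + \<Lambda> v w u + \<Lambda> w u v))"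
  have xS: "(x, x) \<in> S" by (rule B(2)[OF x])
  have cc: "3 * c u v w = \<Lambda> u v w + \<Lambda> v w u + \<Lambda> w u v" for u v w
  proof -
    have "t u v w = 0"
    proof (rule symmetric_trilinear_eq_0[of t])
      show "t (a + b) v w = t a v w + t b v w" for a b v w
        using pdir_add[OF d2[OF xS], of "(0, a)" "(0, b)" "(0, v)" "(0, w)"]
          \<Gamma>(1)[OF x, of a b v] \<Gamma>(2)[OF x, of v w a b] \<Gamma>(1)[OF x, of a b v w] \<Gamma>(3)[OF x, of w]
          \<Gamma>'(1)[OF x, of a b v] \<Gamma>'(2)[OF x, of v w a b] \<Gamma>'(1)[OF x, of a b v w] \<Gamma>'(3)[OF x, of w]
        by (simp add: t_def c_def \<Lambda>_def \<Gamma>(1)[OF x] \<Gamma>'(1)[OF x])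
      show "t u v w = t v u w" for u v w
        using swap1[OF xS, of "(0, u)" "(0, v)" "(0, w)"] \<Gamma>(3)[OF x, of u v w] \<Gamma>(3)[OF x, of v w u] \<Gamma>(3)[OF x, of w u v]
          \<Gamma>'(3)[OF x, of u v w] \<Gamma>'(3)[OF x, of v w u] \<Gamma>'(3)[OF x, of w u v]
        unfolding t_def c_def \<Lambda>_def by linarith
      show "t u v w = t u w v" for u v w
        using swap[OF xS, of "(0, u)" "(0, v)" "(0, w)"] \<Gamma>(3)[OF x, of u v w] \<Gamma>(3)[OF x, of v w u] \<Gamma>(3)[OF x, of w u v]
          \<Gamma>'(3)[OF x, of u v w] \<Gamma>'(3)[OF x, of v w u] \<Gamma>'(3)[OF x, of w u v]
        unfolding t_def c_def \<Lambda>_def by linarith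
      show "t v v v = 0" for v using sl3[OF x, of v] by (simp add: t_def c_def \<Lambda>_def)
    qed
    then show ?thesis by (simp add: t_def)
  qed
  \<comment> \<open>Both sides are derivatives of one function, as \<open>G x u v = G x v u\<close>.
    Rearranged, this is the Codazzi symmetry of \<open>\<Gamma> - \<Gamma>'\<close> in its last two
    arguments.\<close>
  have DGsym: "\<Gamma> x k u v + \<Gamma>' x k v u = \<Gamma> x k v u + \<Gamma>' x k u v" for k u v
  proof -
    have "(\<lambda>k. \<Gamma> x k u v + \<Gamma>' x k v u) = (\<lambda>k. \<Gamma> x k v u + \<Gamma>' x k u v)"
      by (rule has_derivative_unique[OF dG[OF x, of u v]
          has_derivative_transform_within_open[OF dG[OF x, of v u] B(1) x G(2)]])
    then show ?thesis by (rule fun_cong)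
  qed
  have one: "pdir (w, 0) (pdir (0, u) (pdir (0, v) F)) (x, x)
      = (\<Gamma> x w u v + \<Gamma>' x w v u) - c w u v" for u v w
    unfolding c_def by (rule pdir_diag[OF d2[OF xS] B(1) x sl2 dG[OF x]])
  have three: "pdir (0, u) (pdir (0, v) (pdir (w, 0) F)) (x, x) = (\<Gamma> x w u v + \<Gamma>' x w v u) - c w u v" for u v w
    using one[of w u v] swap[OF xS, of "(0, u)" "(0, v)" "(w, 0)"] swap1[OF xS, of "(0, u)" "(w, 0)" "(0, v)"] by simp
  have "((\<lambda>x. - G x v w) has_derivative (\<lambda>k. - (\<Gamma> x k v w + \<Gamma>' x k w v))) (at x)"
    by (rule has_derivative_minus[OF dG[OF x]])
  from pdir_diag[OF d2[OF xS] B(1) x mixed this]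
  have "pdir (u, 0) (pdir (v, 0) (pdir (0, w) F)) (x, x)
      = - (\<Gamma> x u v w + \<Gamma>' x u w v) - pdir (0, u) (pdir (v, 0) (pdir (0, w) F)) (x, x)" .
  also have "pdir (0, u) (pdir (v, 0) (pdir (0, w) F)) (x, x) = (\<Gamma> x v u w + \<Gamma>' x v w u) - c v u w"
    using swap1[OF xS, of "(0, u)" "(v, 0)" "(0, w)"] one[of v u w] by simp
  finally show "pdir (u, 0) (pdir (v, 0) (pdir (0, w) F)) (x, x) = - \<Gamma> x u v w"
    using cc[of v u w] DGsym[of u v w] DGsym[of v u w] DGsym[of w u v]
      \<Gamma>(3)[OF x, of u v w] \<Gamma>(3)[OF x, of v w u] \<Gamma>(3)[OF x, of w u v]
      \<Gamma>'(3)[OF x, of u v w] \<Gamma>'(3)[OF x, of v w u] \<Gamma>'(3)[OF x, of w u v]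
    unfolding \<Lambda>_def by linarith
  show "pdir (0, u) (pdir (0, v) (pdir (w, 0) F)) (x, x) = - \<Gamma>' x u v w"
    using three[of u v w] cc[of w u v] DGsym[of u v w] DGsym[of v u w] DGsym[of w u v]
      \<Gamma>(3)[OF x, of u v w] \<Gamma>(3)[OF x, of v w u] \<Gamma>(3)[OF x, of w u v]
      \<Gamma>'(3)[OF x, of u v w] \<Gamma>'(3)[OF x, of v w u] \<Gamma>'(3)[OF x, of w u v]
    unfolding \<Lambda>_def by linarith
qed

text \<open>\<open>F (x, \<cdot>)\<close> vanishes to first order at \<open>x\<close>, so the second
  derivative at an intermediate point decides the sign. It is assumed positive at \<open>x0\<close>
  only; compactness of the unit sphere spreads this to nearby points, uniformly in the
  direction.\<close>

lemma nonneg_near_diagonal: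
  fixes F :: "'e::euclidean_space \<times> 'e \<Rightarrow> real"
  assumes S: "open S" "Ck_on 2 S F" and B: "open B" "x0 \<in> B" "\<And>x. x \<in> B \<Longrightarrow> (x, x) \<in> S"
    and F0: "\<And>x. x \<in> B \<Longrightarrow> F (x, x) = 0"
    and F1: "\<And>x v. x \<in> B \<Longrightarrow> pdir (0, v) F (x, x) = 0"
    and pos: "\<And>v. v \<noteq> 0 \<Longrightarrow> pdir (0, v) (pdir (0, v) F) (x0, x0) > 0"
  obtains d where "d > 0" "ball x0 d \<times> ball x0 d \<subseteq> S"
    "\<And>x y. x \<in> ball x0 d \<Longrightarrow> y \<in> ball x0 d \<Longrightarrow> F (x, y) \<ge> 0 \<and> (F (x, y) = 0 \<longleftrightarrow> x = y)"
proof -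
  have F: "Ck_on (Suc (Suc 0)) S F" using S(2) by (simp add: numeral_2_eq_2)
  have x0S: "(x0, x0) \<in> S" using B by blast
  let ?H = "\<lambda>u v z. pdir (0, u) (pdir (0, v) F) z"
  define Q where "Q = (\<lambda>(z, u). ?H u u z)"
  \<comment> \<open>Coordinates exhibit \<open>?H u u z\<close> as jointly continuous in point and
    direction, as the compactness argument over the sphere requires.\<close>
  have ex: "?H u v z = (\<Sum>i\<in>Basis. \<Sum>j\<in>Basis. (u \<bullet> i) * (v \<bullet> j) * ?H i j z)" if z: "z \<in> S" for u v z
  proof -
    have lin: "linear (\<lambda>u. ?H u v z)" for v
    proof (rule linearI)
      have d: "pdir (0, v) F differentiable (at z)"
        using Ck_on_differentiable[OF Ck_on_pdir[OF F] _ z] by simp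
      show "?H (a + b) v z = ?H a v z + ?H b v z" for a b
        using pdir_add[OF d, of "(0, a)" "(0, b)"] by simp
      show "?H (r *\<^sub>R a) v z = r *\<^sub>R ?H a v z" for r a
        using linear_scale[OF pdir_linear[OF d], of r "(0, a)"] by simp
    qed
    have "?H u v z = (\<Sum>i\<in>Basis. (u \<bullet> i) * ?H i v z)"
      unfolding real_scaleR_def[symmetric] by (rule linear_euclidean_expand[OF lin])
    also have "\<dots> = (\<Sum>i\<in>Basis. (u \<bullet> i) * (\<Sum>j\<in>Basis. (v \<bullet> j) * ?H i j z))"
    proof (rule sum.cong[OF refl])
      fix i :: 'e
      have "?H i v z = ?H v i z" by (rule pdir_symmetric[OF S z])
      also have "\<dots> = (\<Sum>j\<in>Basis. (v \<bullet> j) * ?H j i z)"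
        unfolding real_scaleR_def[symmetric] by (rule linear_euclidean_expand[OF lin])
      also have "\<dots> = (\<Sum>j\<in>Basis. (v \<bullet> j) * ?H i j z)"
        using pdir_symmetric[OF S z, of _ "(0, i)"] by simp
      finally show "(u \<bullet> i) * ?H i v z = (u \<bullet> i) * (\<Sum>j\<in>Basis. (v \<bullet> j) * ?H i j z)" by simp
    qed
    finally show ?thesis by (simp add: sum_distrib_left mult.assoc)
  qed
  have hc: "continuous_on S (?H i j)" for i j
    using Ck_on_imp_continuous_on[OF Ck_on_pdir[OF Ck_on_pdir[OF F]]] .
  have "continuous_on (S \<times> sphere 0 1) (\<lambda>w. \<Sum>i\<in>Basis. \<Sum>j\<in>Basis. (snd w \<bullet> i) * (snd w \<bullet> j) * ?H i j (fst w))"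
    by (intro continuous_intros continuous_on_compose2[OF hc]) auto
  then have Qc: "continuous_on (S \<times> sphere 0 1) Q"
    by (rule continuous_on_cong[THEN iffD1, rotated -1]) (auto simp: Q_def ex)
  have ne: "sphere (0::'e) 1 \<noteq> {}" by simp
  have "continuous_on (sphere 0 1) (\<lambda>u. Q ((x0, x0), u))"
    by (rule continuous_on_compose2[OF Qc]) (use x0S in \<open>auto intro!: continuous_intros\<close>)
  from continuous_attains_inf[OF compact_sphere ne this]
  obtain u0 where u0: "u0 \<in> sphere 0 1" "\<And>u. u \<in> sphere 0 1 \<Longrightarrow> Q ((x0, x0), u0) \<le> Q ((x0, x0), u)" by blast
  define m where "m = Q ((x0, x0), u0)"
  have "u0 \<noteq> 0" using u0(1) by auto
  then have m: "m > 0" using pos[of u0] by (simp add: m_def Q_def)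
  from m have "m / 2 > 0" by simp
  from continuous_on_prod_compactE[OF Qc compact_sphere x0S this]
  obtain X where X: "(x0, x0) \<in> X" "open X"
    "\<forall>z\<in>X \<inter> S. \<forall>u\<in>sphere 0 1. dist (Q (z, u)) (Q ((x0, x0), u)) \<le> m / 2" .
  have Qpos: "?H u u z > 0" if "z \<in> X \<inter> S" "norm u = 1" for z u
  proof -
    have "dist (Q (z, u)) (Q ((x0, x0), u)) \<le> m / 2" "m \<le> Q ((x0, x0), u)"
      using X(3) that u0(2)[of u] by (auto simp: m_def)
    then have "Q (z, u) > 0" using m unfolding dist_real_def by linarith
    then show ?thesis by (simp add: Q_def)
  qed
  have "open (X \<inter> S)" "(x0, x0) \<in> X \<inter> S" using X S x0S by auto
  then obtain A C where AC: "open A" "open C" "x0 \<in> A" "x0 \<in> C" "A \<times> C \<subseteq> X \<inter> S"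
    by (auto elim!: open_prod_elim)
  have "open (A \<inter> C \<inter> B)" "x0 \<in> A \<inter> C \<inter> B" using AC B by auto
  then obtain d where d: "d > 0" "ball x0 d \<subseteq> A \<inter> C \<inter> B" using openE by blast
  have dXS: "ball x0 d \<times> ball x0 d \<subseteq> X \<inter> S" using d(2) AC(5) by blast
  show ?thesis
  proof (rule that[OF d(1)])
    show "ball x0 d \<times> ball x0 d \<subseteq> S" using dXS by blast
    fix x y assume xy: "x \<in> ball x0 d" "y \<in> ball x0 d"
    have xB: "x \<in> B" using xy d by blast
    show "F (x, y) \<ge> 0 \<and> (F (x, y) = 0 \<longleftrightarrow> x = y)"
    proof (cases "x = y")
      case True then show ?thesis using F0[OF xB] by simp
    next
      case False
      define r where "r = norm (y - x)"
      define u where "u = (y - x) /\<^sub>R r"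
      have r: "r > 0" and u: "norm u = 1" and yu: "y = x + r *\<^sub>R u" using False by (auto simp: r_def u_def)
      have seg: "(x, x) + t *\<^sub>R (0, u) \<in> X \<inter> S" if "0 \<le> t" "t \<le> r" for t
      proof -
        have "x + t *\<^sub>R u = (1 - t / r) *\<^sub>R x + (t / r) *\<^sub>R y" using r by (simp add: yu algebra_simps)
        moreover have "\<dots> \<in> ball x0 d"
          using convexD[OF convex_ball xy, of "1 - t / r" "t / r"] that r by simp
        ultimately show ?thesis using dXS xy by auto
      qed
      \<comment> \<open>Two mean value steps give \<open>F (x, y)\<close> as \<open>r * a\<close>
        times the second derivative at \<open>(x, x + b u)\<close>, where
        \<open>0 < b < a < r\<close>; convexity of the ball keeps that point in the region of
        positivity.\<close>
      have 1: "((\<lambda>t. F ((x, x) + t *\<^sub>R (0, u))) has_real_derivative pdir (0, u) F ((x, x) + t *\<^sub>R (0, u))) (at t)"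
        if "0 \<le> t" "t \<le> r" for t
        using seg[OF that] by (intro pdir_line Ck_on_differentiable[OF F]) auto
      from MVT2[OF r this] obtain a where a: "0 < a" "a < r"
        "F ((x, x) + r *\<^sub>R (0, u)) - F ((x, x) + 0 *\<^sub>R (0, u)) = (r - 0) * pdir (0, u) F ((x, x) + a *\<^sub>R (0, u))" by blast
      have 2: "((\<lambda>t. pdir (0, u) F ((x, x) + t *\<^sub>R (0, u))) has_real_derivative ?H u u ((x, x) + t *\<^sub>R (0, u))) (at t)"
        if "0 \<le> t" "t \<le> a" for t
        using seg[of t] that a by (intro pdir_line Ck_on_differentiable[OF Ck_on_pdir[OF F]]) auto
      from MVT2[OF a(1) this] obtain b where b: "0 < b" "b < a"
        "pdir (0, u) F ((x, x) + a *\<^sub>R (0, u)) - pdir (0, u) F ((x, x) + 0 *\<^sub>R (0, u)) = (a - 0) * ?H u u ((x, x) + b *\<^sub>R (0, u))" by blast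
      have "?H u u ((x, x) + b *\<^sub>R (0, u)) > 0" by (rule Qpos[OF seg u]) (use a b in auto)
      then have "F (x, y) > 0"
        using a b r F0[OF xB] F1[OF xB, of u] by (simp add: yu)
      then show ?thesis using False by simp
    qed
  qed
qed

section \<open>Inverting the exponential map in a chart\<close>

lemma matrix_inv_det_nz:
  fixes A :: "real^'n^'n"
  assumes "det A \<noteq> 0"
  shows "A ** matrix_inv A = mat 1" "matrix_inv A ** A = mat 1"
proof -
  have "\<exists>B. A ** B = mat 1 \<and> B ** A = mat 1"
    using assms unfolding invertible_det_nz[symmetric] invertible_def .
  from someI_ex[OF this] show "A ** matrix_inv A = mat 1" "matrix_inv A ** A = mat 1"
    unfolding matrix_inv_def by blast+
qed

text \<open>Cramer's rule writes the solution as quotients of determinants, that is, of polynomials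
  in the entries.\<close>

lemma Ck_on_matrix_solve:
  fixes M :: "'a::real_normed_vector \<Rightarrow> real^'n^'n" and w :: "'a \<Rightarrow> real^'n"
  assumes S: "open S" and M: "\<And>i j. Ck_on k S (\<lambda>z. M z $ i $ j)" and w: "Ck_on k S w"
    and ne: "\<And>z. z \<in> S \<Longrightarrow> det (M z) \<noteq> 0"
  shows "Ck_on k S (\<lambda>z. matrix_inv (M z) *v w z)"
proof -
  have "Ck_on k S (\<lambda>z. \<chi> l. det (\<chi> i j. if j = l then w z $ i else M z $ i $ j) * inverse (det (M z)))"
  proof (intro Ck_on_vec_lambda[OF S] Ck_on_mult[OF S] Ck_on_inverse[OF S] Ck_on_det[OF S])
    show "Ck_on k S (\<lambda>z. (\<chi> i j. if j = l then w z $ i else M z $ i $ j) $ i $ j)" for l i j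
      using M[of i j] Ck_on_vec_nth[OF S w, of i] by (cases "j = l") simp_all
  qed (use M ne in auto)
  then show ?thesis
  proof (rule Ck_on_cong[OF S])
    fix z assume "z \<in> S"
    then have d: "det (M z) \<noteq> 0" by (rule ne)
    then have "M z ** matrix_inv (M z) = mat 1"
      by (rule matrix_inv_det_nz)
    then have "M z *v (matrix_inv (M z) *v w z) = w z" by (simp add: matrix_vector_mul_assoc)
    then have "matrix_inv (M z) *v w z = (\<chi> l. det (\<chi> i j. if j = l then w z $ i else M z $ i $ j) / det (M z))"
      by (simp add: cramer[OF d])
    then show "(\<chi> l. det (\<chi> i j. if j = l then w z $ i else M z $ i $ j) * inverse (det (M z))) = matrix_inv (M z) *v w z"
      by (simp add: divide_inverse)
  qed
qed

text \<open>\<open>X (x, y)\<close> stands for the initial velocity at \<open>x\<close> of the geodesic from \<open>x\<close> to \<open>y\<close>, in a chart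
  with image \<open>D\<close>; the last assumption describes the beginning of that geodesic.\<close>

locale exp_chart =
  fixes D :: "(real^'n::finite) set" and X :: "(real^'n) \<times> (real^'n) \<Rightarrow> real^'n"
  assumes open_D: "open D"
    and X_smooth: "Ck_on k (D \<times> D) X"
    and X_inj: "x \<in> D \<Longrightarrow> y \<in> D \<Longrightarrow> y' \<in> D \<Longrightarrow> X (x, y) = X (x, y') \<Longrightarrow> y = y'"
    and X_diag: "x \<in> D \<Longrightarrow> X (x, x) = 0"
    and X_start: "x \<in> D \<Longrightarrow> y \<in> D \<Longrightarrow> \<exists>\<gamma>. \<gamma> 0 = x \<and>
        (\<gamma> has_vector_derivative X (x, y)) (at 0 within {0..1}) \<and>
        (\<forall>\<^sub>F s in at 0 within {0..1}. X (x, \<gamma> s) = s *\<^sub>R X (x, y))"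
begin

lemma open_DD: "open (D \<times> D)" by (intro open_Times open_D)

lemma X_has_derivative: "x \<in> D \<Longrightarrow> y \<in> D \<Longrightarrow> (X has_derivative (\<lambda>v. pdir v X (x, y))) (at (x, y))"
  by (rule Ck_on_has_pdir[OF X_smooth[of 1]]) auto

lemma X_snd_has_derivative:
  assumes "x \<in> D" "y \<in> D"
  shows "((\<lambda>y. X (x, y)) has_derivative (\<lambda>v. pdir (0, v) X (x, y))) (at y)"
proof -
  have "((\<lambda>y. (x, y)) has_derivative (\<lambda>v. (0, v))) (at y)"
    by (auto intro!: derivative_eq_intros)
  from has_derivative_compose[OF this X_has_derivative[OF assms]] show ?thesis .
qed

text \<open>Differentiating \<open>X (x, \<gamma> s) = s X (x, y)\<close> at \<open>s = 0\<close>
  shows that the derivative at \<open>x\<close> fixes every value \<open>X (x, y)\<close>. By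
  invariance of domain these values fill a neighbourhood of \<open>0\<close>, and a linear map
  fixing a neighbourhood of \<open>0\<close> is the identity.\<close>

lemma pdir_X_diag:
  assumes x: "x \<in> D" shows "pdir (0, v) X (x, x) = v"
proof -
  have lin: "linear (\<lambda>v. pdir (0, v) X (x, x))"
    by (rule has_derivative_linear[OF X_snd_has_derivative[OF x x]])
  have fixed: "pdir (0, X (x, y)) X (x, x) = X (x, y)" if y: "y \<in> D" for y
  proof -
    obtain \<gamma> where \<gamma>: "\<gamma> 0 = x" "(\<gamma> has_vector_derivative X (x, y)) (at 0 within {0..1})"
      "\<forall>\<^sub>F s in at 0 within {0..1}. X (x, \<gamma> s) = s *\<^sub>R X (x, y)" using X_start[OF x y] by blast
    have "((\<lambda>s. X (x, \<gamma> s)) has_derivative (\<lambda>h. pdir (0, h *\<^sub>R X (x, y)) X (x, x))) (at 0 within {0..1})"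
      using has_derivative_compose[OF \<gamma>(2)[unfolded has_vector_derivative_def], of "\<lambda>y. X (x, y)"]
        X_snd_has_derivative[OF x x] \<gamma>(1) by simp
    then have "((\<lambda>s. X (x, \<gamma> s)) has_vector_derivative pdir (0, X (x, y)) X (x, x)) (at 0 within {0..1})"
      unfolding has_vector_derivative_def
      by (rule has_derivative_eq_rhs) (simp add: fun_eq_iff linear_scale[OF lin])
    moreover have "((\<lambda>s. s *\<^sub>R X (x, y)) has_vector_derivative X (x, y)) (at 0 within {0..1})"
      by (auto intro!: derivative_eq_intros)
    then have "((\<lambda>s. X (x, \<gamma> s)) has_vector_derivative X (x, y)) (at 0 within {0..1})"
      unfolding has_vector_derivative_def
      by (rule has_derivative_transform_eventually)
        (use \<gamma>(3) X_diag[OF x] \<gamma>(1) in \<open>auto elim!: eventually_mono\<close>)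
    ultimately show ?thesis
      by (rule vector_derivative_unique_within[rotated]) (simp add: at_within_Icc_at_right)
  qed
  let ?V = "(\<lambda>y. X (x, y)) ` D"
  have "open ?V"
  proof (rule invariance_of_domain[OF _ open_D])
    show "continuous_on D (\<lambda>y. X (x, y))"
      by (rule continuous_on_compose2[OF Ck_on_imp_continuous_on[OF X_smooth[of 0]]])
        (use x in \<open>auto intro!: continuous_intros\<close>)
    show "inj_on (\<lambda>y. X (x, y)) D" using X_inj[OF x] by (auto intro: inj_onI)
  qed
  moreover have "0 \<in> ?V" using X_diag[OF x] x by (metis image_eqI)
  ultimately obtain r where r: "r > 0" "ball 0 r \<subseteq> ?V" using openE by blast
  define c where "c = r / (2 * (norm v + 1))"
  have np: "norm v + 1 > 0" by (smt (verit) norm_ge_zero)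
  have c: "c > 0" using r np by (simp add: c_def)
  have "norm (c *\<^sub>R v) \<le> c * (norm v + 1)" using c by simp
  also have "\<dots> = r / 2" using np by (simp add: c_def field_simps)
  also have "\<dots> < r" using r by simp
  finally have "c *\<^sub>R v \<in> ?V" using r(2) by (auto simp: subset_iff)
  then have "pdir (0, c *\<^sub>R v) X (x, x) = c *\<^sub>R v" using fixed by auto
  then have "c *\<^sub>R pdir (0, v) X (x, x) = c *\<^sub>R v" using linear_scale[OF lin, of c v] by simp
  then show ?thesis using c by simp
qed

definition jac :: "(real^'n) \<times> (real^'n) \<Rightarrow> real^'n^'n" where
  "jac z = (\<chi> i j. pdir (0, axis j 1) X z $ i)"

lemma jac_apply:
  assumes "z \<in> D \<times> D" shows "jac z *v v = pdir (0, v) X z"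
proof -
  obtain x y where z: "z = (x, y)" "x \<in> D" "y \<in> D" using assms by auto
  have lin: "linear (\<lambda>v. pdir (0, v) X z)"
    unfolding z(1) by (rule has_derivative_linear[OF X_snd_has_derivative[OF z(2,3)]])
  have "jac z = matrix (\<lambda>v. pdir (0, v) X z)" by (simp add: jac_def matrix_def)
  then show ?thesis by (simp add: matrix_works lin linear_matrix_vector_mul_eq)
qed

text \<open>The base point is carried along: \<open>\<Phi> (x, y) = (x, X (x, y))\<close> is
  inverted, so one map \<open>e\<close> serves all base points and is smooth jointly. As injectivity
  is given, invariance of domain yields an open image and a continuous inverse at once;
  differentiability is added afterwards.\<close>

lemma local_inverse:
  assumes x0: "x0 \<in> D"
  obtains \<delta> e where "\<delta> > 0" "ball x0 \<delta> \<subseteq> D"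
    "\<And>x v. x \<in> ball x0 \<delta> \<Longrightarrow> v \<in> ball 0 \<delta> \<Longrightarrow> e (x, v) \<in> D \<and> X (x, e (x, v)) = v"
    "\<And>k. Ck_on k (ball x0 \<delta> \<times> ball 0 \<delta>) e"
proof -
  define \<Phi> where "\<Phi> = (\<lambda>z. (fst z, X z))"
  \<comment> \<open>An injective smooth map may have a non-differentiable inverse; on
    \<open>S\<close> the derivative of \<open>\<Phi>\<close> is invertible as well.\<close>
  define S where "S = {z \<in> D \<times> D. det (jac z) \<noteq> 0}"
  have jacC: "Ck_on k (D \<times> D) (\<lambda>z. jac z $ i $ j)" for i j k
    unfolding jac_def by (simp, intro Ck_on_vec_nth open_DD Ck_on_pdir X_smooth)
  have "continuous_on (D \<times> D) (\<lambda>z. det (jac z))"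
    by (rule Ck_on_imp_continuous_on[OF Ck_on_det[OF open_DD jacC]])
  then have "open ((D \<times> D) \<inter> (\<lambda>z. det (jac z)) -` (- {0}))"
    by (rule continuous_open_preimage[OF _ open_DD]) (simp add: open_Compl)
  moreover have "S = (D \<times> D) \<inter> (\<lambda>z. det (jac z)) -` (- {0})" by (auto simp: S_def)
  ultimately have openS: "open S" by (simp only:)
  have SD: "S \<subseteq> D \<times> D" by (auto simp: S_def)
  have "Ck_on k S \<Phi>" for k
    unfolding \<Phi>_def by (intro Ck_on_Pair Ck_on_fst Ck_on_ident openS Ck_on_subset[OF X_smooth SD])
  then have contP: "continuous_on S \<Phi>" using Ck_on_imp_continuous_on by blast
  have injP: "inj_on \<Phi> S"
  proof (rule inj_onI)
    fix a b assume "a \<in> S" "b \<in> S" "\<Phi> a = \<Phi> b"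
    then show "a = b" using X_inj[of "fst a" "snd a" "snd b"] SD by (cases a; cases b) (auto simp: \<Phi>_def)
  qed
  have openI: "open (\<Phi> ` S)" by (rule invariance_of_domain[OF contP openS injP])
  define \<Psi> where "\<Psi> = inv_into S \<Phi>"
  have contPsi: "continuous_on (\<Phi> ` S) \<Psi>"
    unfolding \<Psi>_def by (rule continuous_on_inverse_open[OF openS contP]) (simp_all add: injP)
  have "(x0, x0) \<in> S"
  proof -
    have "jac (x0, x0) = mat 1"
      using pdir_X_diag[OF x0] by (simp add: jac_def mat_def vec_eq_iff axis_def)
    then show ?thesis using x0 by (simp add: S_def)
  qed
  then have "(x0, 0) \<in> \<Phi> ` S"
    using X_diag[OF x0] by (metis \<Phi>_def fst_conv image_eqI)
  then obtain A C where AC: "open A" "open C" "x0 \<in> A" "0 \<in> C" "A \<times> C \<subseteq> \<Phi> ` S"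
    using openI by (auto elim!: open_prod_elim)
  obtain d1 where d1: "d1 > 0" "ball x0 d1 \<subseteq> A" using AC openE by blast
  obtain d2 where d2: "d2 > 0" "ball 0 d2 \<subseteq> C" using AC openE by blast
  define \<delta> where "\<delta> = min d1 d2"
  define O' where "O' = ball x0 \<delta> \<times> ball (0::real^'n) \<delta>"
  have OI: "O' \<subseteq> \<Phi> ` S" using d1 d2 AC(5) by (auto simp: O'_def \<delta>_def subset_iff)
  have openO: "open O'" by (simp add: O'_def open_Times)
  define e where "e = (\<lambda>w. snd (\<Psi> w))"
  have Psi: "\<Psi> w \<in> S \<and> \<Phi> (\<Psi> w) = w" if "w \<in> O'" for w
    using OI that unfolding \<Psi>_def by (meson f_inv_into_f inv_into_into subsetD)
  have Psie: "\<Psi> w = (fst w, e w)" if "w \<in> O'" for w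
    using Psi[OF that] by (auto simp: \<Phi>_def e_def prod_eq_iff)
  have eS: "(fst w, e w) \<in> S" "X (fst w, e w) = snd w" if "w \<in> O'" for w
    using Psi[OF that] Psie[OF that] by (auto simp: \<Phi>_def prod_eq_iff)
  have der: "(e has_derivative (\<lambda>u. matrix_inv (jac (fst w, e w)) *v (snd u - pdir (fst u, 0) X (fst w, e w)))) (at w)"
    if w: "w \<in> O'" for w
  proof -
    let ?z = "(fst w, e w)"
    let ?f' = "\<lambda>u. (fst u, pdir u X ?z)"
    let ?g' = "\<lambda>u. (fst u, matrix_inv (jac ?z) *v (snd u - pdir (fst u, 0) X ?z))"
    have zD: "?z \<in> D \<times> D" using eS[OF w] SD by blast
    have Xd: "(X has_derivative (\<lambda>v. pdir v X ?z)) (at ?z)" using X_has_derivative zD by auto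
    note lin = has_derivative_linear[OF Xd]
    have "(\<Psi> has_derivative ?g') (at (\<Phi> ?z))"
    proof (rule has_derivative_inverse_dieudonne[OF openS openI contP contPsi])
      show "\<Psi> (\<Phi> x) = x" if "x \<in> S" for x using inv_into_f_f[OF injP that] by (simp add: \<Psi>_def)
      show "?z \<in> S" by (rule eS[OF w])
      show "(\<Phi> has_derivative ?f') (at ?z)"
        unfolding \<Phi>_def by (intro has_derivative_Pair has_derivative_fst has_derivative_ident Xd)
      have "linear ?g'"
      proof (rule linearI)
        fix a b :: "(real^'n) \<times> (real^'n)" and r :: real
        have "pdir (fst a + fst b, 0) X ?z = pdir (fst a, 0) X ?z + pdir (fst b, 0) X ?z"
          using linear_add[OF lin, of "(fst a, 0)" "(fst b, 0)"] by simp
        then show "?g' (a + b) = ?g' a + ?g' b"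
          by (simp add: matrix_vector_mult_add_rdistrib matrix_vector_mult_diff_distrib matrix_vector_right_distrib algebra_simps)
        have "pdir (r *\<^sub>R fst a, 0) X ?z = r *\<^sub>R pdir (fst a, 0) X ?z"
          using linear_scale[OF lin, of r "(fst a, 0)"] by simp
        then have "snd (r *\<^sub>R a) - pdir (fst (r *\<^sub>R a), 0) X ?z = r *\<^sub>R (snd a - pdir (fst a, 0) X ?z)"
          by (simp add: scaleR_diff_right)
        then show "?g' (r *\<^sub>R a) = r *\<^sub>R ?g' a"
          by (simp add: matrix_vector_mult_scaleR)
      qed
      then show "bounded_linear ?g'" by (simp add: linear_conv_bounded_linear)
      have "matrix_inv (jac ?z) ** jac ?z = mat 1"
        using eS(1)[OF w] by (intro matrix_inv_det_nz) (simp add: S_def)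
      then have "matrix_inv (jac ?z) *v pdir (0, c) X ?z = c" for c
        by (simp add: jac_apply[OF zD, symmetric] matrix_vector_mul_assoc)
      moreover have "pdir u X ?z - pdir (fst u, 0) X ?z = pdir (0, snd u) X ?z" for u
        using linear_add[OF lin, of "(fst u, 0)" "(0, snd u)"] by simp
      ultimately show "?g' \<circ> ?f' = id" by (auto simp: fun_eq_iff)
    qed
    moreover have "\<Phi> ?z = w" using Psi[OF w] Psie[OF w] by simp
    ultimately have "(\<Psi> has_derivative ?g') (at w)" by simp
    from has_derivative_snd[OF this] show ?thesis by (simp add: e_def)
  qed
  \<comment> \<open>Bootstrapping: the derivative of \<open>e\<close> at \<open>w\<close> is the
    solution of a linear system whose entries are smooth functions of \<open>(fst w, e w)\<close>,
    so \<open>e\<close> gains one order at a time.\<close>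
  have eC: "Ck_on k O' e" for k
  proof (induction k)
    case 0
    have "continuous_on O' e"
      unfolding e_def by (intro continuous_intros continuous_on_subset[OF contPsi OI])
    then show ?case by simp
  next
    case (Suc k)
    have P: "Ck_on k O' (\<lambda>w. (fst w, e w))"
      by (intro Ck_on_Pair Ck_on_fst Ck_on_ident openO Suc.IH)
    have im: "(\<lambda>w. (fst w, e w)) ` O' \<subseteq> D \<times> D" using eS(1) SD by auto
    show ?case
    proof (rule Ck_on_Suc_I[OF openO der])
      fix u :: "(real^'n) \<times> (real^'n)"
      show "Ck_on k O' (\<lambda>w. matrix_inv (jac (fst w, e w)) *v (snd u - pdir (fst u, 0) X (fst w, e w)))"
      proof (rule Ck_on_matrix_solve[OF openO])
        show "Ck_on k O' (\<lambda>w. jac (fst w, e w) $ i $ j)" for i j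
          by (rule Ck_on_compose[OF openO open_DD jacC P im])
        show "Ck_on k O' (\<lambda>w. snd u - pdir (fst u, 0) X (fst w, e w))"
          by (intro Ck_on_diff[OF openO] Ck_on_const Ck_on_compose[OF openO open_DD Ck_on_pdir[OF X_smooth] P im])
        show "det (jac (fst w, e w)) \<noteq> 0" if "w \<in> O'" for w using eS(1)[OF that] by (simp add: S_def)
      qed
    qed
  qed
  show ?thesis
  proof (rule that[of \<delta> e])
    show "\<delta> > 0" using d1 d2 by (simp add: \<delta>_def)
    show "ball x0 \<delta> \<subseteq> D"
    proof
      fix x assume "x \<in> ball x0 \<delta>"
      then have "(x, 0) \<in> O'" using d1 d2 by (simp add: O'_def \<delta>_def)
      from eS(1)[OF this] show "x \<in> D" using SD by auto
    qed
    show "e (x, v) \<in> D \<and> X (x, e (x, v)) = v" if "x \<in> ball x0 \<delta>" "v \<in> ball 0 \<delta>" for x v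
    proof -
      have "(x, v) \<in> O'" using that unfolding O'_def by blast
      from eS[OF this] SD show ?thesis by auto
    qed
    show "Ck_on k (ball x0 \<delta> \<times> ball 0 \<delta>) e" for k using eC unfolding O'_def .
  qed
qed

end

section \<open>Radial geodesics and parallel transport in a chart\<close>

text \<open>Coefficients are real for the metric and vectors for Christoffel symbols; the value type
  \<open>'w\<close> lets one calculus serve both.\<close>

definition bil :: "('n::finite \<Rightarrow> 'n \<Rightarrow> 'w::real_vector) \<Rightarrow> real^'n \<Rightarrow> real^'n \<Rightarrow> 'w" where
  "bil c u w = (\<Sum>i\<in>UNIV. \<Sum>j\<in>UNIV. (u $ i * w $ j) *\<^sub>R c i j)"

lemma bil_add_left: "bil c (u + u') w = bil c u w + bil c u' w"
  and bil_add_right: "bil c u (w + w') = bil c u w + bil c u w'"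
  and bil_scaleR_left: "bil c (r *\<^sub>R u) w = r *\<^sub>R bil c u w"
  and bil_scaleR_right: "bil c u (r *\<^sub>R w) = r *\<^sub>R bil c u w"
  by (simp_all add: bil_def algebra_simps sum.distrib scaleR_sum_right)

lemma linear_bil_left: "linear (\<lambda>u. bil c u w)" and linear_bil_right: "linear (\<lambda>w. bil c u w)"
  by (simp_all add: linearI bil_add_left bil_add_right bil_scaleR_left bil_scaleR_right)

lemma bil_zero [simp]: "bil c 0 w = 0" "bil c u 0 = 0"
  by (simp_all add: bil_def)

lemma bil_minus_left: "bil c (- u) w = - bil c u w" and bil_minus_right: "bil c u (- w) = - bil c u w"
  by (simp_all add: bil_def sum_negf)

lemma bil_diff_left: "bil c (u - u') w = bil c u w - bil c u' w"
  using bil_add_left[of c u "- u'" w] by (simp add: bil_minus_left)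

lemma bil_axis:
  fixes c :: "'n::finite \<Rightarrow> 'n \<Rightarrow> 'w::real_vector"
  shows "bil c (axis i 1) (axis j 1) = c i j"
proof -
  have *: "(\<Sum>l\<in>UNIV. (r * axis m 1 $ l) *\<^sub>R d l) = r *\<^sub>R d m" for r m and d :: "'n \<Rightarrow> 'w"
  proof -
    have "(\<Sum>l\<in>UNIV. (r * axis m 1 $ l) *\<^sub>R d l) = (\<Sum>l\<in>UNIV. if l = m then r *\<^sub>R d l else 0)"
      by (intro sum.cong refl) (auto simp: axis_def)
    then show ?thesis by simp
  qed
  show ?thesis unfolding bil_def * using *[of 1 i "\<lambda>l. c l j"] by simp
qed

lemma bil_sym: "(\<And>i j. c i j = c j i) \<Longrightarrow> bil c u w = bil c w u"
  unfolding bil_def by (subst sum.swap) (simp add: mult.commute)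

lemma bil_sum_left: "bil c (\<Sum>i\<in>I. f i) w = (\<Sum>i\<in>I. bil c (f i) w)"
  by (rule linear_sum[OF linear_bil_left])

lemma bil_sum_right: "bil c u (\<Sum>i\<in>I. f i) = (\<Sum>i\<in>I. bil c u (f i))"
  by (rule linear_sum[OF linear_bil_right])

lemma vec_expand: "(v::real^'n::finite) = (\<Sum>i\<in>UNIV. v $ i *\<^sub>R axis i 1)"
  by (simp add: vec_eq_iff sum_component axis_def if_distrib cong: if_cong)

lemma Ck_on_bil:
  assumes "open S" "\<And>i j. Ck_on k S (\<lambda>z. c z i j)" "Ck_on k S u" "Ck_on k S w"
  shows "Ck_on k S (\<lambda>z. bil (c z) (u z) (w z))"
  unfolding bil_def by (intro Ck_on_sum Ck_on_scaleR Ck_on_mult Ck_on_vec_nth assms)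

text \<open>An operator is a finite sum of fixed bounded linear maps applied to its columns
  \<open>M b\<close>. Continuity and smoothness of operator-valued maps thus reduce to those of the
  columns.\<close>

lemma Blinfun_expand:
  obtains T :: "'b::euclidean_space \<Rightarrow> 'c::euclidean_space \<Rightarrow> ('b \<Rightarrow>\<^sub>L 'c)"
  where "\<And>b. bounded_linear (T b)" "\<And>M. linear M \<Longrightarrow> Blinfun M = (\<Sum>b\<in>Basis. T b (M b))"
proof -
  define T where "T = (\<lambda>(b::'b) (w::'c). Blinfun (\<lambda>u. (u \<bullet> b) *\<^sub>R w))"
  have ap: "T b w u = (u \<bullet> b) *\<^sub>R w" for b w u
    unfolding T_def
    by (simp add: bounded_linear_Blinfun_apply bounded_linear_scaleR_const bounded_linear_inner_left)
  have "linear (T b)" for b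
    by (rule linearI) (auto intro!: blinfun_eqI simp: ap blinfun.add_left blinfun.scaleR_left scaleR_add_right)
  then have T: "bounded_linear (T b)" for b by (simp add: linear_conv_bounded_linear)
  have "Blinfun M = (\<Sum>b\<in>Basis. T b (M b))" if M: "linear M" for M
  proof (rule blinfun_eqI)
    fix u
    have "blinfun_apply (Blinfun M) u = M u"
      using M by (simp add: bounded_linear_Blinfun_apply linear_conv_bounded_linear)
    also have "\<dots> = (\<Sum>b\<in>Basis. (u \<bullet> b) *\<^sub>R M b)" by (rule linear_euclidean_expand[OF M])
    finally show "Blinfun M u = (\<Sum>b\<in>Basis. T b (M b)) u" by (simp add: blinfun.sum_left ap)
  qed
  then show ?thesis by (rule that[OF T])
qed

lemma Ck_on_Blinfun:
  fixes M :: "'a::real_normed_vector \<Rightarrow> 'b::euclidean_space \<Rightarrow> 'c::euclidean_space"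
  assumes S: "open S" and lin: "\<And>z. z \<in> S \<Longrightarrow> linear (M z)"
    and C: "\<And>b. b \<in> Basis \<Longrightarrow> Ck_on k S (\<lambda>z. M z b)"
  shows "Ck_on k S (\<lambda>z. Blinfun (M z))"
proof -
  obtain T :: "'b \<Rightarrow> 'c \<Rightarrow> ('b \<Rightarrow>\<^sub>L 'c)" where T: "\<And>b. bounded_linear (T b)"
    "\<And>M. linear M \<Longrightarrow> Blinfun M = (\<Sum>b\<in>Basis. T b (M b))" by (rule Blinfun_expand) blast
  have "Ck_on k S (\<lambda>z. \<Sum>b\<in>Basis. T b (M z b))"
    by (intro Ck_on_sum[OF S] Ck_on_linear_compose[OF T(1) S] C)
  then show ?thesis by (rule Ck_on_cong[OF S]) (simp add: T(2)[OF lin])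
qed

lemma continuous_on_Blinfun:
  fixes M :: "'a::topological_space \<Rightarrow> 'b::euclidean_space \<Rightarrow> 'c::euclidean_space"
  assumes lin: "\<And>z. z \<in> S \<Longrightarrow> linear (M z)"
    and C: "\<And>b. b \<in> Basis \<Longrightarrow> continuous_on S (\<lambda>z. M z b)"
  shows "continuous_on S (\<lambda>z. Blinfun (M z))"
proof -
  obtain T :: "'b \<Rightarrow> 'c \<Rightarrow> ('b \<Rightarrow>\<^sub>L 'c)" where T: "\<And>b. bounded_linear (T b)"
    "\<And>M. linear M \<Longrightarrow> Blinfun M = (\<Sum>b\<in>Basis. T b (M b))" by (rule Blinfun_expand) blast
  have "continuous_on S (\<lambda>z. \<Sum>b\<in>Basis. T b (M z b))"
    by (intro continuous_on_sum bounded_linear.continuous_on[OF T(1)] C)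
  then show ?thesis by (subst continuous_on_cong[OF refl T(2)[OF lin]])
qed

lemma linear_eq_on_ball:
  fixes f g :: "'a::real_normed_vector \<Rightarrow> 'b::real_vector"
  assumes "linear f" "linear g" "r > 0" "\<And>v. v \<in> ball 0 r \<Longrightarrow> f v = g v"
  shows "f v = g v"
proof -
  define c where "c = r / (2 * (norm v + 1))"
  have np: "norm v + 1 > 0" by (smt (verit) norm_ge_zero)
  have c: "c > 0" using assms(3) np by (simp add: c_def)
  have "norm (c *\<^sub>R v) \<le> c * (norm v + 1)" using c by simp
  also have "\<dots> = r / 2" using np by (simp add: c_def field_simps)
  also have "\<dots> < r" using assms(3) by simp
  finally have "f (c *\<^sub>R v) = g (c *\<^sub>R v)" by (intro assms(4)) simp
  then show ?thesis using c linear_scale[OF assms(1)] linear_scale[OF assms(2)] by simp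
qed

text \<open>A geodesic from \<open>x\<close> to \<open>y\<close> as seen in the chart, with velocity
  \<open>a\<close>. The geodesic equation is replaced by linear growth of \<open>X\<close> along the
  curve, which already determines its points because \<open>X (x, \<cdot>)\<close> is
  injective.\<close>

definition radial ::
  "(real^'n::finite) set \<Rightarrow> ((real^'n) \<times> (real^'n) \<Rightarrow> real^'n) \<Rightarrow> real^'n \<Rightarrow> real^'n \<Rightarrow>
    (real \<Rightarrow> real^'n) \<Rightarrow> (real \<Rightarrow> real^'n) \<Rightarrow> bool" where
  "radial D X x y \<gamma> a \<longleftrightarrow> (\<forall>s\<in>{0..1}. \<gamma> s \<in> D \<and> X (x, \<gamma> s) = s *\<^sub>R X (x, y) \<and>
     (\<gamma> has_vector_derivative a s) (at s within {0..1}))"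

text \<open>\<open>e (x, \<cdot>)\<close> is the exponential map at \<open>x\<close> read in the
  chart; a common radius \<open>\<delta>\<close> serves base points and velocities.\<close>

locale exp_inverse = exp_chart D X
  for D :: "(real^'n::finite) set" and X +
  fixes x0 :: "real^'n" and \<delta> :: real and e
  assumes delta: "\<delta> > 0" "ball x0 \<delta> \<subseteq> D"
    and e_inv: "x \<in> ball x0 \<delta> \<Longrightarrow> v \<in> ball 0 \<delta> \<Longrightarrow> e (x, v) \<in> D \<and> X (x, e (x, v)) = v"
    and e_smooth: "Ck_on k (ball x0 \<delta> \<times> ball 0 \<delta>) e"
begin

lemma open_O: "open (ball x0 \<delta> \<times> ball (0::real^'n) \<delta>)" by (intro open_Times open_ball)

lemma e_zero: "x \<in> ball x0 \<delta> \<Longrightarrow> e (x, 0) = x"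
  using e_inv[of x 0] X_diag[of x] X_inj[of x "e (x, 0)" x] delta by auto

text \<open>The times at which \<open>e (x, t v)\<close> is controlled. This open set reaches past
  \<open>0\<close> to negative times, so two-sided derivatives at the base point make sense.\<close>

definition dom :: "real^'n \<Rightarrow> real set" where "dom v = {t. t *\<^sub>R v \<in> ball 0 \<delta>}"

lemma open_dom: "open (dom v)"
proof -
  have "dom v = (\<lambda>t. t *\<^sub>R v) -` ball 0 \<delta>" by (auto simp: dom_def)
  then show ?thesis by (auto intro!: open_vimage continuous_intros)
qed

lemma zero_dom: "0 \<in> dom v" using delta by (simp add: dom_def)

lemma dom_D: "t \<in> dom v \<Longrightarrow> t *\<^sub>R v \<in> ball 0 \<delta>" by (simp add: dom_def)

lemma unit_dom: "v \<in> ball 0 \<delta> \<Longrightarrow> s \<in> {0..1} \<Longrightarrow> s \<in> dom v"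
  using mult_left_le_one_le[of "norm v" s] by (auto simp: dom_def)

lemma curve_smooth:
  assumes "x \<in> ball x0 \<delta>" shows "Ck_on k (dom v) (\<lambda>t. e (x, t *\<^sub>R v))"
  by (rule Ck_on_compose[OF open_dom open_O e_smooth])
    (use assms in \<open>auto intro!: Ck_on_Pair Ck_on_const Ck_on_scaleR Ck_on_ident open_dom dest: dom_D\<close>)

lemma curve_D: "x \<in> ball x0 \<delta> \<Longrightarrow> t \<in> dom v \<Longrightarrow> e (x, t *\<^sub>R v) \<in> D"
  and curve_X: "x \<in> ball x0 \<delta> \<Longrightarrow> t \<in> dom v \<Longrightarrow> X (x, e (x, t *\<^sub>R v)) = t *\<^sub>R v"
  using e_inv dom_D by blast+

lemma e_differentiable: "x \<in> ball x0 \<delta> \<Longrightarrow> v \<in> ball 0 \<delta> \<Longrightarrow> e differentiable (at (x, v))"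
  using Ck_on_differentiable[OF e_smooth[of 1]] by simp

lemma curve_pdir:
  assumes "x \<in> ball x0 \<delta>" "t \<in> dom v"
  shows "pdir 1 (\<lambda>t. e (x, t *\<^sub>R v)) t = pdir (0, v) e (x, t *\<^sub>R v)"
proof -
  have 1: "((\<lambda>t. (x, t *\<^sub>R v)) has_derivative (\<lambda>k. (0, k *\<^sub>R v))) (at t)"
    by (auto intro!: derivative_eq_intros)
  have "(e has_derivative (\<lambda>u. pdir u e (x, t *\<^sub>R v))) (at (x, t *\<^sub>R v))"
    using e_differentiable[OF assms(1) dom_D[OF assms(2)]] unfolding pdir_def frechet_derivative_works .
  from pdir_eqI[OF has_derivative_compose[OF 1 this], of 1] show ?thesis by simp
qed

lemma curve_velocity:
  assumes "x \<in> ball x0 \<delta>" "t \<in> dom v"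
  shows "((\<lambda>t. e (x, t *\<^sub>R v)) has_vector_derivative pdir (0, v) e (x, t *\<^sub>R v)) (at t)"
  using Ck_on_curve_deriv[OF curve_smooth[OF assms(1), of 1 v] _ assms(2)] curve_pdir[OF assms] by simp

text \<open>The identity \<open>X (x, e (x, t v)) = t v\<close> is differentiated at
  \<open>t = 0\<close>, where the derivative of \<open>X\<close> is the identity.\<close>

lemma pdir_e_zero:
  assumes x: "x \<in> ball x0 \<delta>" shows "pdir (0, v) e (x, 0) = v"
proof -
  have xD: "x \<in> D" using x delta by blast
  have "((\<lambda>t. X (x, e (x, t *\<^sub>R v))) has_derivative (\<lambda>k. pdir (0, k *\<^sub>R pdir (0, v) e (x, 0)) X (x, x))) (at 0)"
    using has_derivative_compose[OF curve_velocity[OF x zero_dom, of v, unfolded has_vector_derivative_def],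
        of "\<lambda>y. X (x, y)" "\<lambda>u. pdir (0, u) X (x, x)"]
      X_snd_has_derivative[OF xD xD] e_zero[OF x] by simp
  moreover have "((\<lambda>t. X (x, e (x, t *\<^sub>R v))) has_derivative (\<lambda>k. k *\<^sub>R v)) (at 0)"
  proof (rule has_derivative_transform_within_open[OF _ open_dom[of v] zero_dom])
    show "((\<lambda>t. t *\<^sub>R v) has_derivative (\<lambda>k. k *\<^sub>R v)) (at 0)" by (auto intro!: derivative_eq_intros)
  qed (simp add: curve_X[OF x])
  ultimately have "(\<lambda>k. pdir (0, k *\<^sub>R pdir (0, v) e (x, 0)) X (x, x)) = (\<lambda>k. k *\<^sub>R v)"
    by (rule has_derivative_unique)
  from fun_cong[OF this, of 1] pdir_X_diag[OF xD] show ?thesis by simp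
qed

lemma curve_radial:
  assumes "x \<in> ball x0 \<delta>" "y \<in> D" "X (x, y) \<in> ball 0 \<delta>"
  shows "radial D X x y (\<lambda>s. e (x, s *\<^sub>R X (x, y))) (\<lambda>s. pdir (0, X (x, y)) e (x, s *\<^sub>R X (x, y)))"
  unfolding radial_def
  using curve_D[OF assms(1) unit_dom[OF assms(3)]] curve_X[OF assms(1) unit_dom[OF assms(3)]]
    has_vector_derivative_at_within[OF curve_velocity[OF assms(1) unit_dom[OF assms(3)]]] by blast

lemma pdir_e_scale:
  assumes "x \<in> ball x0 \<delta>" "v \<in> ball 0 \<delta>"
  shows "pdir (0, r *\<^sub>R w) e (x, v) = r *\<^sub>R pdir (0, w) e (x, v)"
  using linear_scale[OF pdir_linear[OF e_differentiable[OF assms]], of r "(0, w)"] by simp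

text \<open>Half the radius leaves room for times in \<open>{-2<..<2}\<close>, an open interval
  around \<open>[0,1]\<close> as two-sided smoothness in \<open>(s, x, v)\<close> requires:
  \<open>s v\<close> still lies in the ball of radius \<open>\<delta>\<close>.\<close>

abbreviation param :: "((real^'n) \<times> (real^'n)) set" where "param \<equiv> ball x0 \<delta> \<times> ball 0 (\<delta> / 2)"

lemma open_param: "open param" by (intro open_Times open_ball)

lemma open_I_param: "open ({-2<..<2::real} \<times> param)" by (intro open_Times open_ball open_greaterThanLessThan)

lemma param_in: "z \<in> {-2<..<2::real} \<times> param \<Longrightarrow> (fst (snd z), fst z *\<^sub>R snd (snd z)) \<in> ball x0 \<delta> \<times> ball 0 \<delta>"
proof -
  assume z: "z \<in> {-2<..<2::real} \<times> param"
  have "\<bar>fst z\<bar> * norm (snd (snd z)) \<le> 2 * norm (snd (snd z))"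
    using z by (intro mult_right_mono) auto
  also have "\<dots> < \<delta>" using z by auto
  finally show ?thesis using z by auto
qed

lemma Ck_param_point: "Ck_on k ({-2<..<2::real} \<times> param) (\<lambda>z. (fst (snd z), fst z *\<^sub>R snd (snd z)))"
  by (intro Ck_on_Pair Ck_on_scaleR Ck_on_fst Ck_on_snd Ck_on_ident open_I_param)

lemma Ck_param_e: "Ck_on k ({-2<..<2::real} \<times> param) (\<lambda>z. e (fst (snd z), fst z *\<^sub>R snd (snd z)))"
  by (rule Ck_on_compose[OF open_I_param open_O e_smooth Ck_param_point]) (rule image_subsetI, rule param_in)

lemma Ck_param_velocity:
  "Ck_on k ({-2<..<2::real} \<times> param) (\<lambda>z. pdir (0, snd (snd z)) e (fst (snd z), fst z *\<^sub>R snd (snd z)))"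
  unfolding pdir_def
proof (rule Ck_on_frechet_compose[OF open_I_param open_O e_smooth Ck_param_point])
  show "(\<lambda>z. (fst (snd z), fst z *\<^sub>R snd (snd z))) ` ({-2<..<2::real} \<times> param) \<subseteq> ball x0 \<delta> \<times> ball 0 \<delta>"
    using param_in by (rule image_subsetI)
qed (intro Ck_on_Pair Ck_on_const Ck_on_snd Ck_on_ident open_I_param)

end

lemma exp_inverse_shrink:
  assumes "exp_inverse D X x0 \<delta> e" "0 < \<delta>'" "\<delta>' \<le> \<delta>"
  shows "exp_inverse D X x0 \<delta>' e"
proof -
  interpret exp_inverse D X x0 \<delta> e by fact
  have sub: "ball x0 \<delta>' \<subseteq> ball x0 \<delta>" "ball (0::real^'a) \<delta>' \<subseteq> ball 0 \<delta>" using assms(3) by auto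
  show ?thesis
  proof
    show "ball x0 \<delta>' \<subseteq> D" using sub delta by blast
    show "Ck_on k (ball x0 \<delta>' \<times> ball 0 \<delta>') e" for k
      by (rule Ck_on_subset[OF e_smooth]) (use sub in blast)
    show "e (x, v) \<in> D \<and> X (x, e (x, v)) = v" if "x \<in> ball x0 \<delta>'" "v \<in> ball 0 \<delta>'" for x v
      by (rule e_inv) (use sub that in blast)+
  qed (rule assms(2))
qed

lemma (in exp_chart) exp_inverse_exists: "x0 \<in> D \<Longrightarrow> \<exists>\<delta> e. exp_inverse D X x0 \<delta> e"
proof -
  assume "x0 \<in> D"
  then obtain \<delta> e where "\<delta> > 0" "ball x0 \<delta> \<subseteq> D"
    "\<And>x v. x \<in> ball x0 \<delta> \<Longrightarrow> v \<in> ball 0 \<delta> \<Longrightarrow> e (x, v) \<in> D \<and> X (x, e (x, v)) = v"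
    "\<And>k. Ck_on k (ball x0 \<delta> \<times> ball 0 \<delta>) e" by (rule local_inverse) blast
  then have "exp_inverse D X x0 \<delta> e" by unfold_locales blast+
  then show ?thesis by blast
qed

text \<open>\<open>Gm\<close> are the metric coefficients, \<open>C1\<close> and \<open>C2\<close> the Christoffel symbols of the two dual
  connections, \<open>X1\<close> and \<open>X2\<close> their inverse exponential maps, and \<open>P x y w\<close> is the inner product of \<open>w\<close>
  with \<open>\<Pi>\<^sub>y(x)\<close>. It is known only if the geodesic of the second connection stays in the chart.\<close>

locale dual_chart = E1: exp_chart D X1 + E2: exp_chart D X2
  for D :: "(real^'n::finite) set" and X1 X2 +
  fixes Gm :: "'n \<Rightarrow> 'n \<Rightarrow> real^'n \<Rightarrow> real" and C1 C2 :: "'n \<Rightarrow> 'n \<Rightarrow> real^'n \<Rightarrow> real^'n"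
    and P :: "real^'n \<Rightarrow> real^'n \<Rightarrow> real^'n \<Rightarrow> real"
  assumes Gm_smooth: "Ck_on m D (Gm i j)" and C1_smooth: "Ck_on m D (C1 i j)"
    and Gm_sym: "x \<in> D \<Longrightarrow> Gm i j x = Gm j i x"
    and C1_sym: "x \<in> D \<Longrightarrow> C1 i j x = C1 j i x" and C2_sym: "x \<in> D \<Longrightarrow> C2 i j x = C2 j i x"
    and Gm_pos: "x \<in> D \<Longrightarrow> u \<noteq> 0 \<Longrightarrow> bil (\<lambda>i j. Gm i j x) u u > 0"
    and Gm_dual: "x \<in> D \<Longrightarrow> pdir (axis k 1) (Gm i j) x =
      bil (\<lambda>i j. Gm i j x) (C1 k i x) (axis j 1) + bil (\<lambda>i j. Gm i j x) (axis i 1) (C2 k j x)"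
    and X1_geodesic: "x \<in> D \<Longrightarrow> y \<in> D \<Longrightarrow> radial D X1 x y \<gamma> a \<Longrightarrow>
      (a has_vector_derivative - bil (\<lambda>i j. C1 i j x) (a 0) (a 0)) (at 0 within {0..1})"
    and P_eq: "x \<in> D \<Longrightarrow> y \<in> D \<Longrightarrow> radial D X2 x y \<gamma> a \<Longrightarrow> V 0 = X1 (x, y) \<Longrightarrow>
      (\<And>s. s \<in> {0..1} \<Longrightarrow> (V has_vector_derivative - bil (\<lambda>i j. C1 i j (\<gamma> s)) (a s) (V s)) (at s within {0..1}))
      \<Longrightarrow> P x y w = bil (\<lambda>i j. Gm i j y) (V 1) w"
begin

abbreviation G :: "real^'n \<Rightarrow> real^'n \<Rightarrow> real^'n \<Rightarrow> real" where "G x \<equiv> bil (\<lambda>i j. Gm i j x)"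
abbreviation \<Gamma>1 :: "real^'n \<Rightarrow> real^'n \<Rightarrow> real^'n \<Rightarrow> real^'n" where "\<Gamma>1 x \<equiv> bil (\<lambda>i j. C1 i j x)"
abbreviation \<Gamma>2 :: "real^'n \<Rightarrow> real^'n \<Rightarrow> real^'n \<Rightarrow> real^'n" where "\<Gamma>2 x \<equiv> bil (\<lambda>i j. C2 i j x)"

text \<open>Duality of the two connections for coordinate fields, extended to vectors
  \<open>a\<close>, \<open>b\<close> of constant components; the sums only carry out this
  multilinear extension.\<close>

lemma G_has_derivative:
  assumes x: "x \<in> D"
  shows "((\<lambda>x. G x a b) has_derivative (\<lambda>u. G x (\<Gamma>1 x u a) b + G x a (\<Gamma>2 x u b))) (at x)"
proof -
  have d: "(Gm i j has_derivative (\<lambda>u. pdir u (Gm i j) x)) (at x)" for i j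
    by (rule Ck_on_has_pdir[OF Gm_smooth[of 1] _ x]) simp
  have "((\<lambda>x. G x a b) has_derivative (\<lambda>u. \<Sum>i\<in>UNIV. \<Sum>j\<in>UNIV. (a $ i * b $ j) *\<^sub>R pdir u (Gm i j) x)) (at x)"
    unfolding bil_def by (intro has_derivative_sum has_derivative_scaleR_right d)
  moreover have "(\<Sum>i\<in>UNIV. \<Sum>j\<in>UNIV. (a $ i * b $ j) *\<^sub>R pdir u (Gm i j) x)
      = G x (\<Gamma>1 x u a) b + G x a (\<Gamma>2 x u b)" for u
  proof -
    have pu: "pdir u (Gm i j) x = (\<Sum>k\<in>UNIV. u $ k * (G x (C1 k i x) (axis j 1) + G x (axis i 1) (C2 k j x)))" for i j
    proof -
      have lin: "linear (\<lambda>u. pdir u (Gm i j) x)" by (rule has_derivative_linear[OF d])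
      have "pdir u (Gm i j) x = pdir (\<Sum>k\<in>UNIV. u $ k *\<^sub>R axis k 1) (Gm i j) x"
        using vec_expand[of u] by simp
      also have "\<dots> = (\<Sum>k\<in>UNIV. u $ k *\<^sub>R pdir (axis k 1) (Gm i j) x)"
        by (simp add: linear_sum[OF lin] linear_scale[OF lin])
      finally show ?thesis by (simp add: Gm_dual[OF x])
    qed
    have b: "G x w b = (\<Sum>j\<in>UNIV. b $ j * G x w (axis j 1))" for w
      by (subst vec_expand[of b]) (simp add: bil_sum_right bil_scaleR_right)
    have a: "G x a w = (\<Sum>i\<in>UNIV. a $ i * G x (axis i 1) w)" for w
      by (subst vec_expand[of a]) (simp add: bil_sum_left bil_scaleR_left)
    have 1: "G x (\<Gamma>1 x u a) b = (\<Sum>k\<in>UNIV. \<Sum>i\<in>UNIV. (u $ k * a $ i) * (\<Sum>j\<in>UNIV. b $ j * G x (C1 k i x) (axis j 1)))"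
      by (simp add: bil_def[of "\<lambda>i j. C1 i j x"] bil_sum_left bil_scaleR_left b[of "C1 k i x" for k i])
    have 2: "G x a (\<Gamma>2 x u b) = (\<Sum>k\<in>UNIV. \<Sum>j\<in>UNIV. (u $ k * b $ j) * (\<Sum>i\<in>UNIV. a $ i * G x (axis i 1) (C2 k j x)))"
      by (simp add: bil_def[of "\<lambda>i j. C2 i j x"] bil_sum_right bil_scaleR_right a[of "C2 k j x" for k j])
    have L: "(\<Sum>i\<in>UNIV. \<Sum>j\<in>UNIV. (a $ i * b $ j) *\<^sub>R pdir u (Gm i j) x)
      = (\<Sum>i\<in>UNIV. \<Sum>j\<in>UNIV. \<Sum>k\<in>UNIV. u $ k * a $ i * b $ j * G x (C1 k i x) (axis j 1))
      + (\<Sum>i\<in>UNIV. \<Sum>j\<in>UNIV. \<Sum>k\<in>UNIV. u $ k * a $ i * b $ j * G x (axis i 1) (C2 k j x))"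
      by (simp add: pu sum_distrib_left sum.distrib[symmetric] algebra_simps)
    have "(\<Sum>i\<in>UNIV. \<Sum>j\<in>UNIV. \<Sum>k\<in>UNIV. u $ k * a $ i * b $ j * G x (C1 k i x) (axis j 1))
        = (\<Sum>i\<in>UNIV. \<Sum>k\<in>UNIV. \<Sum>j\<in>UNIV. u $ k * a $ i * b $ j * G x (C1 k i x) (axis j 1))"
      by (rule sum.cong[OF refl]) (rule sum.swap)
    also have "\<dots> = G x (\<Gamma>1 x u a) b"
      unfolding 1 by (subst sum.swap) (simp add: sum_distrib_left mult.assoc)
    finally have A: "(\<Sum>i\<in>UNIV. \<Sum>j\<in>UNIV. \<Sum>k\<in>UNIV. u $ k * a $ i * b $ j * G x (C1 k i x) (axis j 1)) = G x (\<Gamma>1 x u a) b" .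
    have "(\<Sum>i\<in>UNIV. \<Sum>j\<in>UNIV. \<Sum>k\<in>UNIV. u $ k * a $ i * b $ j * G x (axis i 1) (C2 k j x))
        = (\<Sum>j\<in>UNIV. \<Sum>i\<in>UNIV. \<Sum>k\<in>UNIV. u $ k * a $ i * b $ j * G x (axis i 1) (C2 k j x))"
      by (rule sum.swap)
    also have "\<dots> = (\<Sum>j\<in>UNIV. \<Sum>k\<in>UNIV. \<Sum>i\<in>UNIV. u $ k * a $ i * b $ j * G x (axis i 1) (C2 k j x))"
      by (rule sum.cong[OF refl]) (rule sum.swap)
    also have "\<dots> = G x a (\<Gamma>2 x u b)"
      unfolding 2 by (subst sum.swap) (simp add: sum_distrib_left mult_ac)
    finally show ?thesis using L A by simp
  qed
  ultimately show ?thesis by simp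
qed

text \<open>Along the geodesic \<open>\<gamma> t = e (x, t v)\<close> the function
  \<open>X1 (x, \<gamma> t) = t v\<close> has zero second derivative. The chain rule splits it into
  the second derivative of \<open>X1\<close> on \<open>(v, v)\<close> plus the acceleration, which
  is \<open>- \<Gamma>1 x v v\<close>.\<close>

lemma X1_second:
  assumes x: "x \<in> D"
  shows "pdir v (pdir v (\<lambda>y. X1 (x, y) $ i)) x = \<Gamma>1 x v v $ i"
proof -
  obtain \<delta> e where "exp_inverse D X1 x \<delta> e" using E1.exp_inverse_exists[OF x] by blast
  then interpret E: exp_inverse D X1 x \<delta> e .
  have xb: "x \<in> ball x \<delta>" using E.delta by simp
  define \<gamma> where "\<gamma> = (\<lambda>t. e (x, t *\<^sub>R v))"
  \<comment> \<open>The geodesic equation is available only for curves reaching an endpoint at time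
    \<open>1\<close>, so \<open>v\<close> is shrunk into the ball. Both sides are quadratic in the
    velocity, and \<open>c\<close> cancels.\<close>
  define c where "c = \<delta> / (2 * (norm v + 1))"
  have np: "norm v + 1 > 0" by (smt (verit) norm_ge_zero)
  have c: "c > 0" using E.delta np by (simp add: c_def)
  have "norm (c *\<^sub>R v) \<le> c * (norm v + 1)" using c by simp
  also have "\<dots> = \<delta> / 2" using np by (simp add: c_def field_simps)
  also have "\<dots> < \<delta>" using E.delta by simp
  finally have cv: "c *\<^sub>R v \<in> ball 0 \<delta>" by simp
  define y where "y = e (x, c *\<^sub>R v)"
  have y: "y \<in> D" "X1 (x, y) = c *\<^sub>R v" using E.e_inv[OF xb cv] by (auto simp: y_def)
  have C: "Ck_on 3 (E.dom v) \<gamma>" unfolding \<gamma>_def by (rule E.curve_smooth[OF xb])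
  then have C3: "Ck_on (Suc (Suc (Suc 0))) (E.dom v) \<gamma>" by (simp add: numeral_3_eq_3)
  have g0: "pdir 1 \<gamma> 0 = v" "\<gamma> 0 = x"
    using E.curve_pdir[OF xb E.zero_dom] E.pdir_e_zero[OF xb] E.e_zero[OF xb] by (simp_all add: \<gamma>_def)
  have cdom: "c * s \<in> E.dom v" if "s \<in> {0..1}" for s
    using E.unit_dom[OF cv that] by (simp add: E.dom_def mult.commute)
  have w: "pdir 1 (pdir 1 \<gamma>) 0 = - \<Gamma>1 x v v"
  proof -
    have "radial D X1 x y (\<lambda>s. e (x, s *\<^sub>R X1 (x, y))) (\<lambda>s. pdir (0, X1 (x, y)) e (x, s *\<^sub>R X1 (x, y)))"
      by (rule E.curve_radial[OF xb y(1)]) (use cv y in simp)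
    from X1_geodesic[OF x y(1) this]
    have 1: "((\<lambda>s. pdir (0, c *\<^sub>R v) e (x, s *\<^sub>R c *\<^sub>R v)) has_vector_derivative - \<Gamma>1 x (c *\<^sub>R v) (c *\<^sub>R v)) (at 0 within {0..1})"
      using E.pdir_e_zero[OF xb] by (simp add: y(2))
    have eq: "pdir (0, c *\<^sub>R v) e (x, s *\<^sub>R c *\<^sub>R v) = c *\<^sub>R pdir 1 \<gamma> (c * s)" if s: "s \<in> {0..1}" for s
      using E.pdir_e_scale[OF xb E.dom_D[OF cdom[OF s]], of c v] E.curve_pdir[OF xb cdom[OF s]]
      by (simp add: \<gamma>_def mult.commute)
    have "(pdir 1 \<gamma> has_vector_derivative pdir 1 (pdir 1 \<gamma>) 0) (at (c * 0))"
      using Ck_on_curve_deriv[OF Ck_on_pdir[OF C3] _ E.zero_dom] by simp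
    moreover have "((\<lambda>s. c * s) has_vector_derivative c) (at 0 within {0..1})"
      by (auto intro!: derivative_eq_intros)
    ultimately have "((\<lambda>s. pdir 1 \<gamma> (c * s)) has_vector_derivative c *\<^sub>R pdir 1 (pdir 1 \<gamma>) 0) (at 0 within {0..1})"
      using vector_diff_chain_within[of "\<lambda>s. c * s" c 0 "{0..1}" "pdir 1 \<gamma>"] has_vector_derivative_at_within
      by (fastforce simp: o_def)
    then have "((\<lambda>s. c *\<^sub>R pdir 1 \<gamma> (c * s)) has_vector_derivative c *\<^sub>R c *\<^sub>R pdir 1 (pdir 1 \<gamma>) 0) (at 0 within {0..1})"
      by (rule bounded_linear.has_vector_derivative[OF bounded_linear_scaleR_right])
    then have 2: "((\<lambda>s. pdir (0, c *\<^sub>R v) e (x, s *\<^sub>R c *\<^sub>R v)) has_vector_derivative c *\<^sub>R c *\<^sub>R pdir 1 (pdir 1 \<gamma>) 0) (at 0 within {0..1})"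
      by (rule has_vector_derivative_transform[rotated -1]) (use eq in auto)
    have "c *\<^sub>R c *\<^sub>R pdir 1 (pdir 1 \<gamma>) 0 = - \<Gamma>1 x (c *\<^sub>R v) (c *\<^sub>R v)"
      by (rule vector_derivative_unique_within[OF _ 2 1]) (simp add: at_within_Icc_at_right)
    then have "c *\<^sub>R c *\<^sub>R pdir 1 (pdir 1 \<gamma>) 0 = c *\<^sub>R c *\<^sub>R (- \<Gamma>1 x v v)"
      by (simp add: bil_scaleR_left bil_scaleR_right)
    then show ?thesis using c by (metis less_irrefl scaleR_cancel_left)
  qed
  let ?f = "\<lambda>y. X1 (x, y) $ i"
  have f3: "Ck_on 3 D ?f"
    by (intro Ck_on_vec_nth E1.open_D Ck_on_compose[OF E1.open_D E1.open_DD E1.X_smooth]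
        Ck_on_Pair Ck_on_const Ck_on_ident) (use x in auto)
  have f1: "pdir u ?f x = u $ i" for u
    using pdir_eqI[OF bounded_linear.has_derivative[OF bounded_linear_vec_nth E1.X_snd_has_derivative[OF x x]], of u i]
      E1.pdir_X_diag[OF x] by simp
  have h: "((\<lambda>t. ?f (\<gamma> t)) has_real_derivative v $ i) (at t)" if t: "t \<in> E.dom v" for t
  proof (rule has_field_derivative_transform_within_open[OF _ E.open_dom t])
    show "((\<lambda>t. t * v $ i) has_real_derivative v $ i) (at t)" by (auto intro!: derivative_eq_intros)
  qed (simp add: \<gamma>_def E.curve_X[OF xb])
  have im: "\<gamma> ` E.dom v \<subseteq> D" using E.curve_D[OF xb] by (auto simp: \<gamma>_def)
  from jets_along_curve(2)[OF E1.open_D f3 E.open_dom E.zero_dom C im h]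
  have "((\<lambda>t. v $ i) has_real_derivative pdir v (pdir v ?f) x + pdir (- \<Gamma>1 x v v) ?f x) (at 0)"
    by (simp add: g0 w)
  from DERIV_unique[OF this DERIV_const] show ?thesis by (simp add: f1)
qed

end

section \<open>Transport of a coordinate frame along geodesics of the second connection\<close>

locale dual_chart_at = dual_chart D X1 X2 Gm C1 C2 P + E: exp_inverse D X2 x0 \<delta> e2
  for D :: "(real^'n::finite) set" and X1 X2 Gm C1 C2 P x0 \<delta> e2
begin

text \<open>The coefficient of the transport equation of the first connection along the geodesic
  \<open>s \<mapsto> e2 (x, s v)\<close> of the second, at \<open>(s, x, v)\<close>. As an
  operator-valued map it fits the linear ODE theory.\<close>

definition coeff :: "real \<times> (real^'n) \<times> (real^'n) \<Rightarrow> (real^'n) \<Rightarrow>\<^sub>L (real^'n)" where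
  "coeff z = Blinfun (\<lambda>u. - \<Gamma>1 (e2 (fst (snd z), fst z *\<^sub>R snd (snd z)))
     (pdir (0, snd (snd z)) e2 (fst (snd z), fst z *\<^sub>R snd (snd z))) u)"

lemma linear_minus_bil: "linear (\<lambda>u. - bil c w u)"
  by (rule linearI) (simp_all add: bil_add_right bil_scaleR_right)

lemma coeff_apply: "coeff (s, x, v) u = - \<Gamma>1 (e2 (x, s *\<^sub>R v)) (pdir (0, v) e2 (x, s *\<^sub>R v)) u"
proof -
  have "bounded_linear (\<lambda>u. - \<Gamma>1 y w u)" for y w
    using linear_minus_bil[of "\<lambda>i j. C1 i j y" w] by (simp add: linear_conv_bounded_linear)
  then show ?thesis by (simp add: coeff_def bounded_linear_Blinfun_apply)
qed

lemma Ck_coeff: "Ck_on k ({-2<..<2} \<times> E.param) coeff"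
  unfolding coeff_def
proof (rule Ck_on_Blinfun[OF E.open_I_param linear_minus_bil])
  fix b :: "real^'n"
  show "Ck_on k ({-2<..<2} \<times> E.param) (\<lambda>z. - \<Gamma>1 (e2 (fst (snd z), fst z *\<^sub>R snd (snd z)))
     (pdir (0, snd (snd z)) e2 (fst (snd z), fst z *\<^sub>R snd (snd z))) b)"
  proof (intro Ck_on_minus[OF E.open_I_param] Ck_on_bil[OF E.open_I_param] Ck_on_const E.Ck_param_velocity)
    show "Ck_on k ({-2<..<2} \<times> E.param) (\<lambda>z. C1 i j (e2 (fst (snd z), fst z *\<^sub>R snd (snd z))))" for i j
    proof (rule Ck_on_compose[OF E.open_I_param E1.open_D C1_smooth E.Ck_param_e], rule image_subsetI)
      fix z :: "real \<times> (real^'n) \<times> (real^'n)" assume "z \<in> {-2<..<2} \<times> E.param"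
      from E.param_in[OF this] E.e_inv show "e2 (fst (snd z), fst z *\<^sub>R snd (snd z)) \<in> D" by blast
    qed
  qed
qed

text \<open>The \<open>j\<close>-th coordinate vector transported up to time \<open>s\<close>. The
  choice of the family is harmless, since smoothness in the parameters holds for every family of
  solutions.\<close>

definition transport :: "'n \<Rightarrow> real \<Rightarrow> (real^'n) \<times> (real^'n) \<Rightarrow> real^'n" where
  "transport j = (SOME V. lin_ode_family coeff E.param (axis j 1) V)"

lemma transport: "lin_ode_family coeff E.param (axis j 1) (transport j)"
proof -
  have "\<exists>V. lin_ode_family coeff E.param (axis j 1) V"
    by (rule lin_ode_family_exists[OF continuous_on_subset[OF Ck_on_imp_continuous_on[OF Ck_coeff]]]) auto
  then show ?thesis unfolding transport_def by (rule someI_ex)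
qed

lemma transport_0: "l \<in> E.param \<Longrightarrow> transport j 0 l = axis j 1"
  using transport[of j] unfolding lin_ode_family_def by blast

lemma transport_deriv: "l \<in> E.param \<Longrightarrow> s \<in> {0..1} \<Longrightarrow>
    ((\<lambda>s. transport j s l) has_vector_derivative coeff (s, l) (transport j s l)) (at s within {0..1})"
  using transport[of j] unfolding lin_ode_family_def by blast

lemma Ck_transport: "Ck_on 3 E.param (transport j 1)"
  by (rule lin_ode_family_C3[OF _ _ E.open_param _ Ck_coeff transport]) auto

lemma param_scale:
  assumes "(x, v) \<in> E.param" "\<tau> \<in> {0..1}" shows "(x, \<tau> *\<^sub>R v) \<in> E.param"
proof -
  have "\<tau> * norm v \<le> norm v" using assms(2) by (simp add: mult_left_le_one_le)
  also have "\<dots> < \<delta> / 2" using assms(1) by simp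
  finally show ?thesis using assms by simp
qed

text \<open>Initial velocity \<open>\<tau> v\<close> traverses the geodesic of \<open>v\<close> up
  to time \<open>\<tau>\<close>, and both transports solve the same linear ODE. Dependence on
  \<open>v\<close> along a ray thereby becomes dependence on time.\<close>

lemma transport_scale:
  assumes l: "(x, v) \<in> E.param" and \<tau>: "\<tau> \<in> {0..1}"
  shows "transport j 1 (x, \<tau> *\<^sub>R v) = transport j \<tau> (x, v)"
proof -
  have l': "(x, \<tau> *\<^sub>R v) \<in> E.param" by (rule param_scale[OF l \<tau>])
  have "transport j 1 (x, \<tau> *\<^sub>R v) = transport j (\<tau> * 1) (x, v)"
  proof (rule linear_ode_unique[where L = "\<lambda>s. coeff (s, x, \<tau> *\<^sub>R v)" and s = 1
        and V = "\<lambda>s. transport j s (x, \<tau> *\<^sub>R v)" and W = "\<lambda>s. transport j (\<tau> * s) (x, v)"])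
    show "continuous_on {0..1} (\<lambda>s. coeff (s, x, \<tau> *\<^sub>R v))"
      by (rule continuous_on_compose2[OF Ck_on_imp_continuous_on[OF Ck_coeff]])
        (use l' in \<open>auto intro!: continuous_intros\<close>)
    fix s :: real assume s: "s \<in> {0..1}"
    show "((\<lambda>s. transport j s (x, \<tau> *\<^sub>R v)) has_vector_derivative
        coeff (s, x, \<tau> *\<^sub>R v) (transport j s (x, \<tau> *\<^sub>R v))) (at s within {0..1})"
      by (rule transport_deriv[OF l' s])
    have ts: "\<tau> * s \<in> {0..1}" using s \<tau> by (auto simp: mult_le_one)
    have sub: "(\<lambda>s. \<tau> * s) ` {0..1} \<subseteq> {0..1}" using \<tau> by (auto simp: mult_le_one)
    have "((\<lambda>s. \<tau> * s) has_vector_derivative \<tau>) (at s within {0..1})"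
      by (auto intro!: derivative_eq_intros)
    from vector_diff_chain_within[OF this has_vector_derivative_within_subset[OF transport_deriv[OF l ts] sub]]
    have "((\<lambda>s. transport j (\<tau> * s) (x, v)) has_vector_derivative
        \<tau> *\<^sub>R coeff (\<tau> * s, x, v) (transport j (\<tau> * s) (x, v))) (at s within {0..1})" by (simp add: o_def)
    moreover have "pdir (0, \<tau> *\<^sub>R v) e2 (x, s *\<^sub>R \<tau> *\<^sub>R v) = \<tau> *\<^sub>R pdir (0, v) e2 (x, s *\<^sub>R \<tau> *\<^sub>R v)"
      by (rule E.pdir_e_scale) (use E.param_in[of "(s, x, \<tau> *\<^sub>R v)"] l' s in auto)
    ultimately show "((\<lambda>s. transport j (\<tau> * s) (x, v)) has_vector_derivative
        coeff (s, x, \<tau> *\<^sub>R v) (transport j (\<tau> * s) (x, v))) (at s within {0..1})"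
      by (simp add: coeff_apply bil_scaleR_left mult.commute)
  qed (use transport_0[OF l] transport_0[OF l'] in auto)
  then show ?thesis by simp
qed

lemma transport_zero: "x \<in> ball x0 \<delta> \<Longrightarrow> transport j 1 (x, 0) = axis j 1"
  using transport_scale[of x 0 0 j] transport_0[of "(x, 0)" j] E.delta(1) by simp

text \<open>By the scaling law the derivative along a ray is the time derivative at
  \<open>0\<close>, which the ODE supplies. This covers small \<open>v\<close>; linearity covers the
  rest.\<close>

lemma transport_pdir_zero:
  assumes x: "x \<in> ball x0 \<delta>"
  shows "pdir (0, v) (transport j 1) (x, 0) = - \<Gamma>1 x v (axis j 1)"
proof -
  have l0: "(x, 0) \<in> E.param" using x E.delta by simp
  have d: "(transport j 1 has_derivative (\<lambda>u. pdir u (transport j 1) (x, 0))) (at (x, 0))"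
    by (rule Ck_on_has_pdir[OF Ck_transport _ l0]) simp
  note lin = has_derivative_linear[OF d]
  show ?thesis
  proof (rule linear_eq_on_ball[where r = "\<delta> / 2" and f = "\<lambda>v. pdir (0, v) (transport j 1) (x, 0)"])
    show "linear (\<lambda>v. pdir (0, v) (transport j 1) (x, 0))"
      using linear_compose[OF _ lin, of "\<lambda>v. (0, v)"] by (simp add: o_def linearI)
    show "linear (\<lambda>v. - \<Gamma>1 x v (axis j 1))"
      by (rule linearI) (simp_all add: bil_add_left bil_scaleR_left)
    fix v :: "real^'n" assume v: "v \<in> ball 0 (\<delta> / 2)"
    then have l: "(x, v) \<in> E.param" using x by simp
    have "((\<lambda>t. (x, t *\<^sub>R v)) has_derivative (\<lambda>k. (0, k *\<^sub>R v))) (at 0 within {0..1})"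
      by (auto intro!: derivative_eq_intros)
    from has_derivative_compose[OF this, of "transport j 1" "\<lambda>u. pdir u (transport j 1) (x, 0)"] d
    have "((\<lambda>t. transport j 1 (x, t *\<^sub>R v)) has_derivative (\<lambda>k. pdir (0, k *\<^sub>R v) (transport j 1) (x, 0))) (at 0 within {0..1})"
      by simp
    moreover have "pdir (0, k *\<^sub>R v) (transport j 1) (x, 0) = k *\<^sub>R pdir (0, v) (transport j 1) (x, 0)" for k
      using linear_scale[OF lin, of k "(0, v)"] by simp
    ultimately have 1: "((\<lambda>t. transport j 1 (x, t *\<^sub>R v)) has_vector_derivative pdir (0, v) (transport j 1) (x, 0)) (at 0 within {0..1})"
      unfolding has_vector_derivative_def by simp
    have "((\<lambda>t. transport j t (x, v)) has_vector_derivative coeff (0, x, v) (transport j 0 (x, v))) (at 0 within {0..1})"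
      by (rule transport_deriv[OF l]) simp
    then have 2: "((\<lambda>t. transport j 1 (x, t *\<^sub>R v)) has_vector_derivative coeff (0, x, v) (transport j 0 (x, v))) (at 0 within {0..1})"
      by (rule has_vector_derivative_transform[rotated -1]) (use transport_scale[OF l] in auto)
    have "pdir (0, v) (transport j 1) (x, 0) = coeff (0, x, v) (transport j 0 (x, v))"
      by (rule vector_derivative_unique_within[OF _ 1 2]) (simp add: at_within_Icc_at_right)
    then show "pdir (0, v) (transport j 1) (x, 0) = - \<Gamma>1 x v (axis j 1)"
      by (simp add: transport_0[OF l] coeff_apply E.e_zero[OF x] E.pdir_e_zero[OF x])
  qed (use E.delta in simp)
qed

text \<open>The components of \<open>\<Pi>\<^sub>y(x)\<close> for \<open>z = (x, y)\<close>: the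
  initial velocity for the first connection is expanded in the coordinate basis, and the basis is
  transported along the geodesic of the second.\<close>

definition Pif :: "(real^'n) \<times> (real^'n) \<Rightarrow> real^'n" where
  "Pif z = (\<Sum>j\<in>UNIV. X1 z $ j *\<^sub>R transport j 1 (fst z, X2 z))"

text \<open>Pairs close enough that the geodesic of the second connection is
  \<open>e2 (x, s X2 (x, y))\<close> and hence stays in the chart; only there is \<open>P\<close>
  known to be given by \<open>Pif\<close>.\<close>

definition near :: "((real^'n) \<times> (real^'n)) set" where
  "near = {z \<in> D \<times> D. (fst z, X2 z) \<in> E.param}"

lemma near_preimage:
  fixes f :: "(real^'n) \<times> (real^'n) \<Rightarrow> (real^'n) \<times> (real^'n)"
  assumes "Ck_on 0 (D \<times> D) f" "open T" shows "open {z \<in> D \<times> D. f z \<in> T}"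
proof -
  have "{z \<in> D \<times> D. f z \<in> T} = (D \<times> D) \<inter> f -` T" by auto
  then show ?thesis using continuous_open_preimage[OF _ E1.open_DD assms(2), of f] assms(1) by simp
qed

lemma open_near: "open near"
  unfolding near_def
  by (intro near_preimage Ck_on_Pair E1.open_DD Ck_on_fst Ck_on_ident E2.X_smooth E.open_param)

lemma near_DD: "near \<subseteq> D \<times> D" by (auto simp: near_def)

lemma Ck_Pif: "Ck_on 3 near Pif"
  unfolding Pif_def
proof (intro Ck_on_sum[OF open_near] Ck_on_scaleR[OF open_near] Ck_on_vec_nth[OF open_near])
  show "Ck_on 3 near X1" by (rule Ck_on_subset[OF E1.X_smooth near_DD])
  show "Ck_on 3 near (\<lambda>z. transport j 1 (fst z, X2 z))" for j
  proof (rule Ck_on_compose[OF open_near E.open_param Ck_transport])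
    show "Ck_on 3 near (\<lambda>z. (fst z, X2 z))"
      by (intro Ck_on_Pair Ck_on_fst Ck_on_ident open_near Ck_on_subset[OF E2.X_smooth near_DD])
    show "(\<lambda>z. (fst z, X2 z)) ` near \<subseteq> E.param" unfolding near_def by blast
  qed
qed

lemma P_near:
  assumes "(x, y) \<in> near" shows "P x y w = G y (Pif (x, y)) w"
proof -
  have xy: "x \<in> D" "y \<in> D" and l: "(x, X2 (x, y)) \<in> E.param" using assms by (auto simp: near_def)
  have x: "x \<in> ball x0 \<delta>" and v: "X2 (x, y) \<in> ball 0 \<delta>" using l E.delta by auto
  have "P x y w = G y (\<Sum>j\<in>UNIV. X1 (x, y) $ j *\<^sub>R transport j 1 (x, X2 (x, y))) w"
  proof (rule P_eq[OF xy E.curve_radial[OF x xy(2) v],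
        where V = "\<lambda>s. \<Sum>j\<in>UNIV. X1 (x, y) $ j *\<^sub>R transport j s (x, X2 (x, y))"])
    show "(\<Sum>j\<in>UNIV. X1 (x, y) $ j *\<^sub>R transport j 0 (x, X2 (x, y))) = X1 (x, y)"
      using vec_expand[of "X1 (x, y)"] transport_0[OF l] by simp
    fix s :: real assume s: "s \<in> {0..1}"
    have "((\<lambda>s. \<Sum>j\<in>UNIV. X1 (x, y) $ j *\<^sub>R transport j s (x, X2 (x, y))) has_vector_derivative
      (\<Sum>j\<in>UNIV. X1 (x, y) $ j *\<^sub>R coeff (s, x, X2 (x, y)) (transport j s (x, X2 (x, y))))) (at s within {0..1})"
      by (intro has_vector_derivative_sum bounded_linear.has_vector_derivative[OF bounded_linear_scaleR_right]
          transport_deriv[OF l s])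
    then show "((\<lambda>s. \<Sum>j\<in>UNIV. X1 (x, y) $ j *\<^sub>R transport j s (x, X2 (x, y))) has_vector_derivative
      - \<Gamma>1 (e2 (x, s *\<^sub>R X2 (x, y))) (pdir (0, X2 (x, y)) e2 (x, s *\<^sub>R X2 (x, y)))
        (\<Sum>j\<in>UNIV. X1 (x, y) $ j *\<^sub>R transport j s (x, X2 (x, y)))) (at s within {0..1})"
      by (simp add: coeff_apply bil_sum_right bil_scaleR_right sum_negf)
  qed
  then show ?thesis by (simp add: Pif_def)
qed

lemma diag_near: "x \<in> ball x0 \<delta> \<Longrightarrow> (x, x) \<in> near"
  using E.delta E2.X_diag by (auto simp: near_def)

end

section \<open>One-dimensional second-order calculus\<close>

lemma pdir1_mult:
  fixes f g :: "real \<Rightarrow> real"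
  assumes "f differentiable (at t)" "g differentiable (at t)"
  shows "pdir 1 (\<lambda>t. f t * g t) t = pdir 1 f t * g t + f t * pdir 1 g t"
proof -
  have "(f has_derivative (\<lambda>v. pdir v f t)) (at t)" "(g has_derivative (\<lambda>v. pdir v g t)) (at t)"
    using assms unfolding pdir_def frechet_derivative_works by simp_all
  from pdir_eqI[OF has_derivative_mult[OF this], of 1] show ?thesis by simp
qed

lemma pdir2_mult:
  fixes f g :: "real \<Rightarrow> real"
  assumes J: "open J" "t \<in> J" and f: "Ck_on 2 J f" and g: "Ck_on 2 J g"
  shows "pdir 1 (pdir 1 (\<lambda>t. f t * g t)) t
    = pdir 1 (pdir 1 f) t * g t + 2 * pdir 1 f t * pdir 1 g t + f t * pdir 1 (pdir 1 g) t"
proof -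
  have f2: "Ck_on (Suc (Suc 0)) J f" and g2: "Ck_on (Suc (Suc 0)) J g"
    using f g by (simp_all add: numeral_2_eq_2)
  note d = Ck_on_differentiable[OF f2] Ck_on_differentiable[OF g2]
    Ck_on_differentiable[OF Ck_on_pdir[OF f2]] Ck_on_differentiable[OF Ck_on_pdir[OF g2]]
  have C: "Ck_on (Suc 0) J (pdir 1 (\<lambda>t. f t * g t))" by (rule Ck_on_pdir[OF Ck_on_mult[OF J(1) f2 g2]])
  have "pdir 1 (pdir 1 (\<lambda>t. f t * g t)) t = pdir 1 (\<lambda>t. pdir 1 f t * g t + f t * pdir 1 g t) t"
    by (rule pdir_cong[OF J(1) C J(2)]) (simp add: pdir1_mult d)
  also have "\<dots> = pdir 1 (\<lambda>t. pdir 1 f t * g t) t + pdir 1 (\<lambda>t. f t * pdir 1 g t) t"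
  proof -
    have "((\<lambda>t. pdir 1 f t * g t) has_derivative (\<lambda>v. pdir v (\<lambda>t. pdir 1 f t * g t) t)) (at t)"
      "((\<lambda>t. f t * pdir 1 g t) has_derivative (\<lambda>v. pdir v (\<lambda>t. f t * pdir 1 g t) t)) (at t)"
      unfolding pdir_def frechet_derivative_works[symmetric]
      using d J(2) by (auto intro!: differentiable_mult simp: pdir_def)
    from pdir_eqI[OF has_derivative_add[OF this], of 1] show ?thesis .
  qed
  also have "\<dots> = pdir 1 (pdir 1 f) t * g t + 2 * pdir 1 f t * pdir 1 g t + f t * pdir 1 (pdir 1 g) t"
    using d J(2) by (simp add: pdir1_mult)
  finally show ?thesis .
qed

lemma pdir1_sum:
  fixes f :: "'i \<Rightarrow> real \<Rightarrow> real"
  assumes "\<And>i. i \<in> I \<Longrightarrow> f i differentiable (at t)"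
  shows "pdir 1 (\<lambda>t. \<Sum>i\<in>I. f i t) t = (\<Sum>i\<in>I. pdir 1 (f i) t)"
proof -
  have "(f i has_derivative (\<lambda>v. pdir v (f i) t)) (at t)" if "i \<in> I" for i
    using assms[OF that] unfolding pdir_def frechet_derivative_works .
  then have "((\<lambda>t. \<Sum>i\<in>I. f i t) has_derivative (\<lambda>v. \<Sum>i\<in>I. pdir v (f i) t)) (at t)"
    by (intro has_derivative_sum)
  from pdir_eqI[OF this, of 1] show ?thesis .
qed

lemma pdir2_sum:
  fixes f :: "'i \<Rightarrow> real \<Rightarrow> real"
  assumes J: "open J" "t \<in> J" and f: "\<And>i. i \<in> I \<Longrightarrow> Ck_on 2 J (f i)"
  shows "pdir 1 (pdir 1 (\<lambda>t. \<Sum>i\<in>I. f i t)) t = (\<Sum>i\<in>I. pdir 1 (pdir 1 (f i)) t)"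
proof -
  have f2: "Ck_on (Suc (Suc 0)) J (f i)" if "i \<in> I" for i using f[OF that] by (simp add: numeral_2_eq_2)
  have C: "Ck_on (Suc 0) J (pdir 1 (\<lambda>t. \<Sum>i\<in>I. f i t))" by (rule Ck_on_pdir[OF Ck_on_sum[OF J(1) f2]])
  have "pdir 1 (pdir 1 (\<lambda>t. \<Sum>i\<in>I. f i t)) t = pdir 1 (\<lambda>t. \<Sum>i\<in>I. pdir 1 (f i) t) t"
    by (rule pdir_cong[OF J(1) C J(2)]) (rule pdir1_sum, rule Ck_on_differentiable[OF f2], auto)
  also have "\<dots> = (\<Sum>i\<in>I. pdir 1 (pdir 1 (f i)) t)"
    by (rule pdir1_sum) (rule Ck_on_differentiable[OF Ck_on_pdir[OF f2] _ J(2)], auto)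
  finally show ?thesis .
qed

text \<open>Substituting \<open>u = s t\<close> turns the integral into that of
  \<open>\<rho>\<close> from \<open>0\<close> to \<open>t\<close>, for either sign of
  \<open>t\<close>; the fundamental theorem does the rest.\<close>

lemma scaled_integral_deriv:
  fixes \<rho> :: "real \<Rightarrow> real"
  assumes J: "open J" "convex J" "0 \<in> J" and \<rho>: "continuous_on J \<rho>" and t: "t \<in> J"
  shows "((\<lambda>t. integral {0..1} (\<lambda>s. t * \<rho> (s * t))) has_real_derivative \<rho> t) (at t)"
proof -
  obtain d0 where d0: "d0 > 0" "cball 0 d0 \<subseteq> J" using J open_contains_cball by blast
  obtain d1 where d1: "d1 > 0" "cball t d1 \<subseteq> J" using J(1) t open_contains_cball by blast
  define d where "d = min d0 d1"
  \<comment> \<open>The interval from \<open>a\<close> to \<open>b\<close> lies in \<open>J\<close>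
    and contains both \<open>0\<close> and \<open>t\<close> in its interior, so one antiderivative
    \<open>R\<close> serves both ends.\<close>
  define a where "a = min (- d) (t - d)"
  define b where "b = max d (t + d)"
  have d: "d > 0" using d0 d1 by (simp add: d_def)
  have ab: "a < 0" "0 < b" "a < t" "t < b" using d by (auto simp: a_def b_def)
  have "- d \<in> cball 0 d0" "d \<in> cball 0 d0" "t - d \<in> cball t d1" "t + d \<in> cball t d1"
    using d by (auto simp: d_def dist_real_def)
  then have "a \<in> J" "b \<in> J" using d0 d1 by (auto simp: a_def b_def min_def max_def)
  moreover have "is_interval J" using J(2) by (simp add: is_interval_convex_1)
  ultimately have abJ: "{a..b} \<subseteq> J" using mem_is_interval_1_I[of J a b] by auto
  have sub: "s * t \<in> {a<..<b}" if "t \<in> {a<..<b}" "s \<in> {0..1}" for s t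
    using convexD[OF convex_real_interval(8), of 0 a b t "1 - s" s] that ab by simp
  define R where "R = (\<lambda>u. integral {a..u} \<rho>)"
  have R: "(R has_real_derivative \<rho> t) (at t)" if "t \<in> {a<..<b}" for t
  proof -
    have "(R has_vector_derivative \<rho> t) (at t within {a..b})"
      unfolding R_def
      by (rule integral_has_vector_derivative[OF continuous_on_subset[OF \<rho> abJ]]) (use that in auto)
    then show ?thesis
      using that by (simp add: at_within_Icc_at has_real_derivative_iff_has_vector_derivative)
  qed
  have I: "integral {0..1} (\<lambda>s. t * \<rho> (s * t)) = R t - R 0" if t: "t \<in> {a<..<b}" for t
  proof -
    have "((\<lambda>s. t * \<rho> (s * t)) has_integral R (1 * t) - R (0 * t)) {0..1}"
    proof (rule fundamental_theorem_of_calculus)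
      fix s :: real assume s: "s \<in> {0..1}"
      have "((\<lambda>s. R (s * t)) has_real_derivative \<rho> (s * t) * t) (at s)"
        by (rule DERIV_chain2[where f = R and g = "\<lambda>s. s * t"])
          (use R[OF sub[OF t s]] in \<open>auto intro!: derivative_eq_intros\<close>)
      then show "((\<lambda>s. R (s * t)) has_vector_derivative t * \<rho> (s * t)) (at s within {0..1})"
        by (simp add: has_real_derivative_iff_has_vector_derivative mult.commute has_vector_derivative_at_within)
    qed simp
    from integral_unique[OF this] show ?thesis by (simp only: mult_1 mult_zero_left)
  qed
  show ?thesis
  proof (rule has_field_derivative_transform_within_open[of _ _ _ "{a<..<b}"])
    show "((\<lambda>t. R t - R 0) has_real_derivative \<rho> t) (at t)"
      using DERIV_diff[OF R[of t] DERIV_const] ab by simp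
  qed (use I ab in auto)
qed

text \<open>\<open>X\<close> belongs to whichever connection supplies the path of integration and is
  only required to be some \<open>exp_chart\<close>, so one argument covers both two-point
  functions. Regularity comes from writing \<open>F (x, y)\<close> as
  \<open>H (x, X (x, y))\<close>, an integral with parameters.\<close>

lemma (in dual_chart) two_point_jets:
  assumes X: "exp_chart D X" and x0: "x0 \<in> D"
    and F: "\<And>x y \<gamma> a. x \<in> D \<Longrightarrow> y \<in> D \<Longrightarrow> radial D X x y \<gamma> a \<Longrightarrow>
      F (x, y) = integral {0..1} (\<lambda>s. P x (\<gamma> s) (a s))"
  obtains S B where "open S" "Ck_on 3 S F" "open B" "x0 \<in> B" "B \<subseteq> D"
    "\<And>x. x \<in> B \<Longrightarrow> (x, x) \<in> S \<and> F (x, x) = 0 \<and>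
        jet_data F S x (G x) (\<lambda>v. G x (\<Gamma>1 x v v) v + 2 * G x (\<Gamma>2 x v v) v)"
proof -
  obtain \<delta> e2 where "exp_inverse D X2 x0 \<delta> e2" using E2.exp_inverse_exists[OF x0] by blast
  then interpret A: exp_inverse D X2 x0 \<delta> e2 .
  interpret A: dual_chart_at D X1 X2 Gm C1 C2 P x0 \<delta> e2 ..
  interpret X: exp_chart D X by (rule X)
  obtain \<delta>1 e where E0: "exp_inverse D X x0 \<delta>1 e" using X.exp_inverse_exists[OF x0] by blast
  then interpret E0: exp_inverse D X x0 \<delta>1 e .
  have x0b: "x0 \<in> ball x0 \<delta>1" "x0 \<in> ball x0 \<delta>" using E0.delta A.delta by auto
  \<comment> \<open>Two exponential maps meet here: \<open>e\<close> belongs to the path,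
    \<open>A.near\<close> to the geodesics along which \<open>\<Pi>\<close> is transported. The
    radius is shrunk until points on the path satisfy the second requirement too.\<close>
  define T0 where "T0 = (ball x0 \<delta>1 \<times> ball 0 \<delta>1) \<inter> (\<lambda>l. (fst l, e l)) -` A.near"
  have "open T0"
    unfolding T0_def
    by (rule continuous_open_preimage[OF _ E0.open_O A.open_near])
      (intro continuous_intros Ck_on_imp_continuous_on[OF E0.e_smooth])
  moreover have "(x0, 0) \<in> T0"
    using x0b E0.delta(1) E0.e_zero[OF x0b(1)] A.diag_near[OF x0b(2)] by (simp add: T0_def)
  ultimately obtain P1 Q1 where PQ: "open P1" "open Q1" "x0 \<in> P1" "0 \<in> Q1" "P1 \<times> Q1 \<subseteq> T0"
    by (auto elim!: open_prod_elim)
  obtain d1 where d1: "d1 > 0" "ball x0 d1 \<subseteq> P1" using PQ openE by blast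
  obtain d2 where d2: "d2 > 0" "ball 0 d2 \<subseteq> Q1" using PQ openE by blast
  define \<delta>' where "\<delta>' = min (min d1 d2) (min \<delta>1 \<delta>)"
  have \<delta>': "\<delta>' > 0" "\<delta>' \<le> \<delta>1" "\<delta>' \<le> \<delta>" "\<delta>' \<le> d1" "\<delta>' \<le> d2"
    using d1 d2 E0.delta A.delta by (auto simp: \<delta>'_def)
  interpret K: exp_inverse D X x0 \<delta>' e by (rule exp_inverse_shrink[OF E0 \<delta>'(1,2)])
  have nearK: "(x, e (x, v)) \<in> A.near" if "x \<in> ball x0 \<delta>'" "v \<in> ball 0 \<delta>'" for x v
  proof -
    have "(x, v) \<in> P1 \<times> Q1" using that d1 d2 \<delta>' by (auto simp: subset_iff)
    then show ?thesis using PQ(5) by (auto simp: T0_def)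
  qed
  \<comment> \<open>The integrand at time \<open>s\<close> for the path with initial data
    \<open>(x, v)\<close>: the inner product of \<open>\<Pi>\<close> at \<open>e (x, s v)\<close>
    with the velocity there.\<close>
  define \<rho> where "\<rho> = (\<lambda>z :: real \<times> (real^'n) \<times> (real^'n). G (e (fst (snd z), fst z *\<^sub>R snd (snd z)))
      (A.Pif (fst (snd z), e (fst (snd z), fst z *\<^sub>R snd (snd z))))
      (pdir (0, snd (snd z)) e (fst (snd z), fst z *\<^sub>R snd (snd z))))"
  have Ck\<rho>: "Ck_on 3 ({-2<..<2} \<times> K.param) \<rho>"
    unfolding \<rho>_def
  proof (intro Ck_on_bil[OF K.open_I_param] K.Ck_param_velocity)
    show "Ck_on 3 ({-2<..<2} \<times> K.param) (\<lambda>z. Gm i j (e (fst (snd z), fst z *\<^sub>R snd (snd z))))" for i j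
      by (rule Ck_on_compose[OF K.open_I_param E1.open_D Gm_smooth K.Ck_param_e], rule image_subsetI)
        (use K.param_in K.e_inv in blast)
    show "Ck_on 3 ({-2<..<2} \<times> K.param) (\<lambda>z. A.Pif (fst (snd z), e (fst (snd z), fst z *\<^sub>R snd (snd z))))"
      by (rule Ck_on_compose[OF K.open_I_param A.open_near A.Ck_Pif
            Ck_on_Pair[OF K.open_I_param Ck_on_fst[OF K.open_I_param Ck_on_snd[OF K.open_I_param Ck_on_ident[OF K.open_I_param]]] K.Ck_param_e]],
          rule image_subsetI)
        (use K.param_in nearK in blast)
  qed
  define H where "H = (\<lambda>l. integral {0..1} (\<lambda>s. \<rho> (s, l)))"
  have CkH: "Ck_on 3 K.param H"
    unfolding H_def by (rule Ck_on_integral[OF _ _ K.open_param Ck\<rho>]) auto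
  define S where "S = {z \<in> D \<times> D. (fst z, X z) \<in> K.param}"
  have SD: "S \<subseteq> D \<times> D" by (auto simp: S_def)
  have openS: "open S"
    unfolding S_def
    by (intro A.near_preimage Ck_on_Pair E1.open_DD Ck_on_fst Ck_on_ident X.X_smooth K.open_param)
  have pd: "(x, v) \<in> K.param \<Longrightarrow> x \<in> ball x0 \<delta>' \<and> v \<in> ball 0 \<delta>'" for x v using K.delta by auto
  have F_S: "F (x, y) = H (x, X (x, y))" if xy: "(x, y) \<in> S" for x y
  proof -
    let ?v = "X (x, y)"
    have D: "x \<in> D" "y \<in> D" and l: "(x, ?v) \<in> K.param" using xy by (auto simp: S_def)
    have b: "x \<in> ball x0 \<delta>'" "?v \<in> ball 0 \<delta>'" using pd[OF l] by auto
    have "F (x, y) = integral {0..1} (\<lambda>s. P x (e (x, s *\<^sub>R ?v)) (pdir (0, ?v) e (x, s *\<^sub>R ?v)))"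
      by (rule F[OF D K.curve_radial[OF b(1) D(2) b(2)]])
    also have "\<dots> = H (x, ?v)"
      unfolding H_def \<rho>_def
    proof (rule integral_cong)
      fix s :: real assume "s \<in> {0..1}"
      from nearK[OF b(1) K.dom_D[OF K.unit_dom[OF b(2) this]]]
      have "P x (e (x, s *\<^sub>R ?v)) w = G (e (x, s *\<^sub>R ?v)) (A.Pif (x, e (x, s *\<^sub>R ?v))) w" for w
        by (rule A.P_near)
      then show "P x (e (x, s *\<^sub>R ?v)) (pdir (0, ?v) e (x, s *\<^sub>R ?v)) =
        G (e (fst (snd (s, x, ?v)), fst (s, x, ?v) *\<^sub>R snd (snd (s, x, ?v))))
         (A.Pif (fst (snd (s, x, ?v)), e (fst (snd (s, x, ?v)), fst (s, x, ?v) *\<^sub>R snd (snd (s, x, ?v)))))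
         (pdir (0, snd (snd (s, x, ?v))) e (fst (snd (s, x, ?v)), fst (s, x, ?v) *\<^sub>R snd (snd (s, x, ?v))))" by simp
    qed
    finally show ?thesis .
  qed
  have "Ck_on 3 S (\<lambda>z. H (fst z, X z))"
    by (rule Ck_on_compose[OF openS K.open_param CkH Ck_on_Pair[OF openS Ck_on_fst[OF openS Ck_on_ident[OF openS]] Ck_on_subset[OF X.X_smooth SD]]])
      (auto simp only: S_def)
  then have CkF: "Ck_on 3 S F"
    by (rule Ck_on_cong[OF openS]) (use F_S in auto)
  have diagS: "(x, x) \<in> S" if "x \<in> ball x0 \<delta>'" for x
    using that K.delta X.X_diag[of x] by (auto simp: S_def)
  have F0: "F (x, x) = 0" if x: "x \<in> ball x0 \<delta>'" for x
  proof -
    have "pdir (0, 0) e (x, 0) = 0" using K.pdir_e_zero[OF x] by simp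
    then show ?thesis
      using F_S[OF diagS[OF x]] X.X_diag[of x] x K.delta(2)
      by (auto simp: H_def \<rho>_def subset_iff)
  qed
  have jet: "jet_data F S x (G x) (\<lambda>v. G x (\<Gamma>1 x v v) v + 2 * G x (\<Gamma>2 x v v) v)"
    if x: "x \<in> ball x0 \<delta>'" for x
    unfolding jet_data_def
  proof
    fix v :: "real^'n"
    have xD: "x \<in> D" using x K.delta by blast
    have x\<delta>: "x \<in> ball x0 \<delta>" using x \<delta>' by auto
    define J where "J = {t. t *\<^sub>R v \<in> ball 0 (\<delta>' / 2)}"
    have J_dom: "J \<subseteq> K.dom v" using K.delta(1) by (auto simp: J_def K.dom_def)
    have J_eq: "J = (\<lambda>t. t *\<^sub>R v) -` ball 0 (\<delta>' / 2)" by (auto simp: J_def)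
    then have openJ: "open J" by (auto intro!: open_vimage continuous_intros)
    have J0: "0 \<in> J" using K.delta by (simp add: J_def)
    have J01: "s * t \<in> J" if "t \<in> J" "s \<in> {0..1}" for s t
    proof -
      have "norm (s *\<^sub>R t *\<^sub>R v) = s * norm (t *\<^sub>R v)" using that(2) by (simp add: abs_mult)
      also have "\<dots> \<le> norm (t *\<^sub>R v)" using that(2) by (intro mult_left_le_one_le) auto
      finally have "norm (s *\<^sub>R t *\<^sub>R v) \<le> norm (t *\<^sub>R v)" .
      then show ?thesis using that(1) by (simp add: J_def)
    qed
    have "linear (\<lambda>t. t *\<^sub>R v)" by (simp add: linearI scaleR_add_left)
    then have convJ: "convex J"
      using convex_linear_vimage[of "\<lambda>t. t *\<^sub>R v" "ball 0 (\<delta>' / 2)"] J_eq by simp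
    define \<gamma> where "\<gamma> = (\<lambda>t. e (x, t *\<^sub>R v))"
    have Ck\<gamma>: "Ck_on k J \<gamma>" for k unfolding \<gamma>_def by (rule Ck_on_subset[OF K.curve_smooth[OF x] J_dom])
    have \<gamma>D: "\<gamma> t \<in> D" if "t \<in> J" for t using K.curve_D[OF x] J_dom that by (auto simp: \<gamma>_def)
    have \<gamma>X: "X (x, \<gamma> t) = t *\<^sub>R v" if "t \<in> J" for t using K.curve_X[OF x] J_dom that by (auto simp: \<gamma>_def)
    have \<gamma>near: "(x, \<gamma> t) \<in> A.near" if "t \<in> J" for t
      unfolding \<gamma>_def using nearK[OF x K.dom_D] J_dom that by blast
    have \<gamma>0: "\<gamma> 0 = x" "pdir 1 \<gamma> 0 = v"
      using K.curve_pdir[OF x K.zero_dom] K.pdir_e_zero[OF x] K.e_zero[OF x] by (simp_all add: \<gamma>_def)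
    have \<gamma>S: "(x, \<gamma> t) \<in> S" if "t \<in> J" for t
    proof -
      have "t *\<^sub>R v \<in> ball 0 (\<delta>' / 2)" using that unfolding J_def by blast
      then show ?thesis using xD \<gamma>D[OF that] \<gamma>X[OF that] x unfolding S_def by simp
    qed
    define w where "w = pdir 1 (pdir 1 \<gamma>) 0"
    define Y where "Y = (\<lambda>t. A.Pif (x, \<gamma> t))"
    define h where "h = (\<lambda>t. G (\<gamma> t) (Y t) (pdir 1 \<gamma> t))"
    have xg: "Ck_on k J (\<lambda>t. (x, \<gamma> t))" for k by (intro Ck_on_Pair openJ Ck_on_const Ck\<gamma>)
    have CkY: "Ck_on 3 J Y"
      unfolding Y_def by (rule Ck_on_compose[OF openJ A.open_near A.Ck_Pif xg]) (use \<gamma>near in blast)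
    have Ckm: "Ck_on k J (\<lambda>t. Gm i j (\<gamma> t))" for i j k
      by (rule Ck_on_compose[OF openJ E1.open_D Gm_smooth Ck\<gamma>]) (use \<gamma>D in blast)
    have Ckc: "Ck_on k J (\<lambda>t. pdir 1 \<gamma> t $ l)" for k l
      by (intro Ck_on_vec_nth[OF openJ] Ck_on_pdir Ck\<gamma>)
    have CkYk: "Ck_on 2 J (\<lambda>t. Y t $ k)" for k
      by (rule Ck_on_vec_nth[OF openJ Ck_on_le[OF CkY]]) simp
    have h_eq: "h = (\<lambda>t. \<Sum>k\<in>UNIV. \<Sum>l\<in>UNIV. (Y t $ k * pdir 1 \<gamma> t $ l) * Gm k l (\<gamma> t))"
      by (simp add: h_def bil_def)
    have Ckh: "Ck_on 2 J h"
      unfolding h_def by (intro Ck_on_bil[OF openJ] Ckm Ck_on_pdir Ck\<gamma> Ck_on_le[OF CkY]) simp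
    \<comment> \<open>The path from \<open>x\<close> to \<open>\<gamma> t\<close> is
      \<open>s \<mapsto> \<gamma> (s t)\<close> with velocity \<open>t \<gamma>' (s t)\<close>,
      while \<open>\<Pi>\<close> depends on the point alone. Hence \<open>F (x, \<gamma> t)\<close>
      is the integral of \<open>t * h (s * t)\<close>.\<close>
    have Fd: "((\<lambda>t. F (x, \<gamma> t)) has_real_derivative h t) (at t)" if t: "t \<in> J" for t
    proof (rule has_field_derivative_transform_within_open[OF _ openJ t])
      show "((\<lambda>t. integral {0..1} (\<lambda>s. t * h (s * t))) has_real_derivative h t) (at t)"
        by (rule scaled_integral_deriv[OF openJ convJ J0 Ck_on_imp_continuous_on[OF Ckh] t])
      show "integral {0..1} (\<lambda>s. t * h (s * t)) = F (x, \<gamma> t)" if t: "t \<in> J" for t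
      proof -
        have "F (x, \<gamma> t) = H (x, t *\<^sub>R v)" using F_S[OF \<gamma>S[OF t]] \<gamma>X[OF t] by simp
        also have "\<dots> = integral {0..1} (\<lambda>s. t * h (s * t))"
          unfolding H_def
        proof (rule integral_cong)
          fix s :: real assume s: "s \<in> {0..1}"
          have sd: "s * t \<in> K.dom v" using J01[OF t s] J_dom by blast
          have "pdir (0, t *\<^sub>R v) e (x, s *\<^sub>R t *\<^sub>R v) = t *\<^sub>R pdir (0, v) e (x, (s * t) *\<^sub>R v)"
            using K.pdir_e_scale[OF x K.dom_D[OF sd], of t v] by simp
          also have "\<dots> = t *\<^sub>R pdir 1 \<gamma> (s * t)" using K.curve_pdir[OF x sd] by (simp add: \<gamma>_def)
          finally show "\<rho> (s, x, t *\<^sub>R v) = t * h (s * t)"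
            by (simp add: \<rho>_def h_def Y_def \<gamma>_def bil_scaleR_right)
        qed
        finally show ?thesis by simp
      qed
    qed
    \<comment> \<open>\<open>\<alpha>\<close> is the initial velocity and \<open>q\<close> the
      transported frame, so \<open>Y\<close> is a sum of products. As \<open>\<alpha>\<close>
      vanishes at \<open>0\<close>, the second derivative of \<open>q\<close> never enters.\<close>
    define \<alpha> where "\<alpha> = (\<lambda>j t. X1 (x, \<gamma> t) $ j)"
    define q where "q = (\<lambda>j k t. A.transport j 1 (x, X2 (x, \<gamma> t)) $ k)"
    have X1g: "Ck_on k J (\<lambda>t. X1 (x, \<gamma> t))" and X2g: "Ck_on k J (\<lambda>t. X2 (x, \<gamma> t))" for k
      by (rule Ck_on_compose[OF openJ E1.open_DD _ xg]; use xD \<gamma>D E1.X_smooth E2.X_smooth in blast)+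
    have Ck\<alpha>: "Ck_on k J (\<alpha> j)" for j k unfolding \<alpha>_def by (rule Ck_on_vec_nth[OF openJ X1g])
    have Ckq: "Ck_on 2 J (q j k)" for j k
      unfolding q_def
    proof (rule Ck_on_vec_nth[OF openJ Ck_on_compose[OF openJ A.open_param Ck_on_le[OF A.Ck_transport]]])
      show "Ck_on 2 J (\<lambda>t. (x, X2 (x, \<gamma> t)))" by (intro Ck_on_Pair openJ Ck_on_const X2g)
      show "(\<lambda>t. (x, X2 (x, \<gamma> t))) ` J \<subseteq> A.param" using \<gamma>near by (auto simp: A.near_def)
    qed simp
    have \<gamma>d: "(\<gamma> has_vector_derivative v) (at 0)"
      using Ck_on_curve_deriv[OF Ck\<gamma>[of 1] _ J0] \<gamma>0 by simp
    have \<alpha>0: "\<alpha> j 0 = 0" for j using E1.X_diag[OF xD] by (simp add: \<alpha>_def \<gamma>0)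
    \<comment> \<open>At \<open>x\<close> the map \<open>X1 (x, \<cdot>)\<close> has first
      derivative the identity and second derivative \<open>\<Gamma>1\<close>; the acceleration
      \<open>w\<close> of \<open>\<gamma>\<close> passes through the former.\<close>
    have \<alpha>12: "pdir 1 (\<alpha> j) 0 = v $ j \<and> pdir 1 (pdir 1 (\<alpha> j)) 0 = (\<Gamma>1 x v v + w) $ j" for j
    proof -
      let ?f = "\<lambda>y. X1 (x, y) $ j"
      have f3: "Ck_on 3 D ?f"
        by (intro Ck_on_vec_nth E1.open_D Ck_on_compose[OF E1.open_D E1.open_DD E1.X_smooth]
            Ck_on_Pair Ck_on_const Ck_on_ident) (use xD in auto)
      have f1: "pdir u ?f x = u $ j" for u
        using pdir_eqI[OF bounded_linear.has_derivative[OF bounded_linear_vec_nth E1.X_snd_has_derivative[OF xD xD]], of u j]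
          E1.pdir_X_diag[OF xD] by simp
      have hd: "((\<lambda>t. ?f (\<gamma> t)) has_real_derivative pdir 1 (\<alpha> j) t) (at t)" if "t \<in> J" for t
        using Ck_on_curve_deriv[OF Ck\<alpha>[of 1 j] _ that]
        by (simp add: has_real_derivative_iff_has_vector_derivative \<alpha>_def)
      have im: "\<gamma> ` J \<subseteq> D" using \<gamma>D by blast
      note j = jets_along_curve[OF E1.open_D f3 openJ J0 Ck\<gamma> im hd]
      have "pdir 1 (\<alpha> j) 0 = v $ j" using j(1) f1 by (simp add: \<gamma>0)
      moreover have "pdir 1 (pdir 1 (\<alpha> j)) 0 = \<Gamma>1 x v v $ j + w $ j"
        using pdir_eqI[OF j(2)[unfolded has_field_derivative_def], of 1] X1_second[OF xD, of v j] f1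
        by (simp add: \<gamma>0 w_def)
      ultimately show ?thesis by simp
    qed
    have q0: "q j k 0 = axis j 1 $ k" for j k
      using A.transport_zero[OF x\<delta>] E2.X_diag[OF xD] by (simp add: q_def \<gamma>0)
    have q1: "pdir 1 (q j k) 0 = - (\<Gamma>1 x v (axis j 1) $ k)" for j k
    proof -
      have "((\<lambda>t. X2 (x, \<gamma> t)) has_derivative (\<lambda>r. r *\<^sub>R v)) (at 0)"
        using has_derivative_compose[OF \<gamma>d[unfolded has_vector_derivative_def], of "\<lambda>y. X2 (x, y)" "\<lambda>u. u"]
          E2.X_snd_has_derivative[OF xD xD] E2.pdir_X_diag[OF xD] by (simp add: \<gamma>0)
      then have 1: "((\<lambda>t. (x, X2 (x, \<gamma> t))) has_derivative (\<lambda>r. (0, r *\<^sub>R v))) (at 0)"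
        by (intro has_derivative_Pair has_derivative_const)
      have l0: "(x, X2 (x, \<gamma> 0)) \<in> A.param" using x\<delta> A.delta E2.X_diag[OF xD] by (simp add: \<gamma>0)
      have "(A.transport j 1 has_derivative (\<lambda>u. pdir u (A.transport j 1) (x, X2 (x, \<gamma> 0)))) (at (x, X2 (x, \<gamma> 0)))"
        by (rule Ck_on_has_pdir[OF A.Ck_transport _ l0]) simp
      from bounded_linear.has_derivative[OF bounded_linear_vec_nth has_derivative_compose[OF 1 this]]
      have "(q j k has_derivative (\<lambda>r. pdir (0, r *\<^sub>R v) (A.transport j 1) (x, X2 (x, \<gamma> 0)) $ k)) (at 0)"
        unfolding q_def .
      from pdir_eqI[OF this, of 1] show ?thesis
        using A.transport_pdir_zero[OF x\<delta>] E2.X_diag[OF xD] by (simp add: \<gamma>0)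
    qed
    have Y_eq: "(\<lambda>t. Y t $ k) = (\<lambda>t. \<Sum>j\<in>UNIV. \<alpha> j t * q j k t)" for k
      by (simp add: Y_def A.Pif_def \<alpha>_def q_def sum_component)
    note dif\<alpha> = Ck_on_differentiable[OF Ck\<alpha>[of 2] _ J0]
    note difq = Ck_on_differentiable[OF Ckq _ J0]
    have Y0: "Y 0 $ k = 0" for k using fun_cong[OF Y_eq[of k], of 0] \<alpha>0 by simp
    have dsum: "(\<Sum>j\<in>UNIV. u $ j * axis j 1 $ k) = u $ k" for u :: "real^'n" and k
      using arg_cong[OF vec_expand[of u], of "\<lambda>y. y $ k"] by (simp add: sum_component)
    have gsum: "(\<Sum>j\<in>UNIV. u $ j * \<Gamma>1 x v (axis j 1) $ k) = \<Gamma>1 x v u $ k" for u k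
      by (subst (2) vec_expand[of u]) (simp add: bil_sum_right bil_scaleR_right sum_component)
    have Y1: "pdir 1 (\<lambda>t. Y t $ k) 0 = v $ k" for k
    proof -
      have "pdir 1 (\<lambda>t. Y t $ k) 0 = (\<Sum>j\<in>UNIV. pdir 1 (\<lambda>t. \<alpha> j t * q j k t) 0)"
        unfolding Y_eq by (rule pdir1_sum) (simp add: differentiable_mult dif\<alpha> difq)
      also have "\<dots> = (\<Sum>j\<in>UNIV. v $ j * axis j 1 $ k)"
        by (intro sum.cong refl) (simp add: pdir1_mult dif\<alpha> difq \<alpha>0 \<alpha>12 q0)
      finally show ?thesis by (simp add: dsum)
    qed
    \<comment> \<open>Velocity and frame meet in the cross term \<open>2 * \<alpha>' * q'\<close>,
      which contributes \<open>-2 \<Gamma>1 x v v\<close> against the \<open>\<Gamma>1 x v v\<close>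
      of \<open>\<alpha>''\<close>.\<close>
    have Y2: "pdir 1 (pdir 1 (\<lambda>t. Y t $ k)) 0 = (w - \<Gamma>1 x v v) $ k" for k
    proof -
      have "pdir 1 (pdir 1 (\<lambda>t. Y t $ k)) 0 = (\<Sum>j\<in>UNIV. pdir 1 (pdir 1 (\<lambda>t. \<alpha> j t * q j k t)) 0)"
        unfolding Y_eq by (rule pdir2_sum[OF openJ J0]) (intro Ck_on_mult[OF openJ] Ck\<alpha> Ckq)
      also have "\<dots> = (\<Sum>j\<in>UNIV. (\<Gamma>1 x v v + w) $ j * axis j 1 $ k + 2 * v $ j * - (\<Gamma>1 x v (axis j 1) $ k))"
        by (intro sum.cong refl)
          (simp add: pdir2_mult[OF openJ J0 Ck\<alpha> Ckq] \<alpha>0 \<alpha>12[THEN conjunct1] \<alpha>12[THEN conjunct2] q0 q1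
            del: vector_add_component)
      also have "\<dots> = (\<Gamma>1 x v v + w) $ k - 2 * (\<Gamma>1 x v v) $ k"
        by (simp only: sum.distrib dsum mult_minus_right sum_negf mult.assoc sum_distrib_left[symmetric] gsum)
      finally show ?thesis by simp
    qed
    define c where "c = (\<lambda>l t. pdir 1 \<gamma> t $ l)"
    define m where "m = (\<lambda>k l t. Gm k l (\<gamma> t))"
    define y where "y = (\<lambda>k t. Y t $ k)"
    have Ckc': "Ck_on 2 J (c l)" and Ckm': "Ck_on 2 J (m k l)" and Cky: "Ck_on 2 J (y k)" for k l
      unfolding c_def m_def y_def by (rule Ckc Ckm CkYk)+
    have Ckyc: "Ck_on 2 J (\<lambda>t. y k t * c l t)" for k l by (intro Ck_on_mult openJ Cky Ckc')
    have y012: "y k 0 = 0" "pdir 1 (y k) 0 = v $ k" "pdir 1 (pdir 1 (y k)) 0 = (w - \<Gamma>1 x v v) $ k" for k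
      unfolding y_def by (rule Y0 Y1 Y2)+
    have c0: "c l 0 = v $ l" for l by (simp add: c_def \<gamma>0)
    have c1: "pdir 1 (c l) 0 = w $ l" for l
    proof -
      have "(pdir 1 \<gamma> has_vector_derivative w) (at 0)"
        using Ck_on_curve_deriv[OF Ck_on_pdir[OF Ck\<gamma>[of "Suc 1"]] _ J0] by (simp add: w_def)
      from bounded_linear.has_derivative[OF bounded_linear_vec_nth this[unfolded has_vector_derivative_def]]
      have "(c l has_derivative (\<lambda>r. (r *\<^sub>R w) $ l)) (at 0)" unfolding c_def .
      from pdir_eqI[OF this, of 1] show ?thesis by simp
    qed
    have m0: "m k l 0 = Gm k l x" for k l by (simp add: m_def \<gamma>0)
    have Gd: "(Gm k l has_derivative (\<lambda>u. pdir u (Gm k l) x)) (at x)" for k l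
      by (rule Ck_on_has_pdir[OF Gm_smooth[of 1] _ xD]) simp
    have m1: "pdir 1 (m k l) 0 = pdir v (Gm k l) x" for k l
    proof -
      have "(m k l has_derivative (\<lambda>r. pdir (r *\<^sub>R v) (Gm k l) x)) (at 0)"
        unfolding m_def
        by (rule has_derivative_compose[OF \<gamma>d[unfolded has_vector_derivative_def]]) (simp add: \<gamma>0 Gd)
      from pdir_eqI[OF this, of 1] show ?thesis by simp
    qed
    note dify = Ck_on_differentiable[OF Cky _ J0] and difc = Ck_on_differentiable[OF Ckc' _ J0]
      and difm = Ck_on_differentiable[OF Ckm' _ J0] and difyc = Ck_on_differentiable[OF Ckyc _ J0]
    have h_eq': "h = (\<lambda>t. \<Sum>k\<in>UNIV. \<Sum>l\<in>UNIV. (y k t * c l t) * m k l t)"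
      by (simp add: h_eq y_def c_def m_def)
    have yc1: "pdir 1 (\<lambda>t. y k t * c l t) 0 = v $ k * v $ l" for k l
      by (simp add: pdir1_mult dify difc y012 c0)
    have yc2: "pdir 1 (pdir 1 (\<lambda>t. y k t * c l t)) 0 = (w - \<Gamma>1 x v v) $ k * v $ l + 2 * (v $ k * w $ l)" for k l
      by (simp add: pdir2_mult[OF openJ J0 Cky Ckc'] y012 c0 c1 del: vector_minus_component)
    have Cksum: "Ck_on 2 J (\<lambda>t. (y k t * c l t) * m k l t)" for k l
      by (intro Ck_on_mult openJ Ckyc Ckm')
    note difsum = Ck_on_differentiable[OF Cksum _ J0]
    have h0: "h 0 = 0" by (simp add: h_eq' y012)
    have h1: "pdir 1 h 0 = G x v v"
    proof -
      have "pdir 1 h 0 = (\<Sum>k\<in>UNIV. pdir 1 (\<lambda>t. \<Sum>l\<in>UNIV. (y k t * c l t) * m k l t) 0)"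
        unfolding h_eq' by (rule pdir1_sum) (simp add: differentiable_sum difsum)
      also have "\<dots> = (\<Sum>k\<in>UNIV. \<Sum>l\<in>UNIV. pdir 1 (\<lambda>t. (y k t * c l t) * m k l t) 0)"
        by (intro sum.cong refl pdir1_sum difsum) simp
      also have "\<dots> = (\<Sum>k\<in>UNIV. \<Sum>l\<in>UNIV. (v $ k * v $ l) * Gm k l x)"
        by (intro sum.cong refl) (simp add: pdir1_mult difyc difm yc1 y012 m0)
      finally show ?thesis by (simp add: bil_def)
    qed
    \<comment> \<open>As \<open>Y 0 = 0\<close>, neither \<open>\<gamma>'''\<close> nor second
      derivatives of the metric appear. The terms are \<open>G x (w - \<Gamma>1 x v v) v\<close>
      from \<open>Y''\<close>, \<open>2 * G x v w\<close> from the acceleration, and twice the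
      derivative of the metric, which duality splits into \<open>\<Gamma>1\<close> and
      \<open>\<Gamma>2\<close>.\<close>
    have h2: "pdir 1 (pdir 1 h) 0 = 3 * G x v w + (G x (\<Gamma>1 x v v) v + 2 * G x (\<Gamma>2 x v v) v)"
    proof -
      have "pdir 1 (pdir 1 h) 0 = (\<Sum>k\<in>UNIV. pdir 1 (pdir 1 (\<lambda>t. \<Sum>l\<in>UNIV. (y k t * c l t) * m k l t)) 0)"
        unfolding h_eq' by (rule pdir2_sum[OF openJ J0]) (intro Ck_on_sum openJ Cksum)
      also have "\<dots> = (\<Sum>k\<in>UNIV. \<Sum>l\<in>UNIV. pdir 1 (pdir 1 (\<lambda>t. (y k t * c l t) * m k l t)) 0)"
        by (intro sum.cong refl pdir2_sum[OF openJ J0] Cksum)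
      also have "\<dots> = (\<Sum>k\<in>UNIV. \<Sum>l\<in>UNIV. ((w - \<Gamma>1 x v v) $ k * v $ l) * Gm k l x
          + 2 * ((v $ k * w $ l) * Gm k l x) + 2 * ((v $ k * v $ l) * pdir v (Gm k l) x))"
        by (intro sum.cong refl, subst pdir2_mult[OF openJ J0 Ckyc Ckm'])
          (simp only: yc1 yc2 m0 m1 y012(1), simp add: algebra_simps del: vector_minus_component)
      also have "\<dots> = G x (w - \<Gamma>1 x v v) v + 2 * G x v w
          + 2 * (\<Sum>k\<in>UNIV. \<Sum>l\<in>UNIV. (v $ k * v $ l) * pdir v (Gm k l) x)"
        by (simp add: bil_def sum.distrib sum_distrib_left del: vector_minus_component)
      also have "(\<Sum>k\<in>UNIV. \<Sum>l\<in>UNIV. (v $ k * v $ l) * pdir v (Gm k l) x) = G x (\<Gamma>1 x v v) v + G x v (\<Gamma>2 x v v)"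
      proof -
        have "((\<lambda>x. G x v v) has_derivative (\<lambda>u. \<Sum>k\<in>UNIV. \<Sum>l\<in>UNIV. (v $ k * v $ l) *\<^sub>R pdir u (Gm k l) x)) (at x)"
          unfolding bil_def by (intro has_derivative_sum has_derivative_scaleR_right Gd)
        from fun_cong[OF has_derivative_unique[OF this G_has_derivative[OF xD]], of v] show ?thesis by simp
      qed
      finally show ?thesis
        using bil_sym[of "\<lambda>i j. Gm i j x" w v] bil_sym[of "\<lambda>i j. Gm i j x" v "\<Gamma>2 x v v"] Gm_sym[OF xD]
        by (simp add: bil_diff_left)
    qed
    have hd0: "(h has_real_derivative G x v v) (at 0)"
      using Ck_on_curve_deriv[OF Ckh _ J0] h1 by (simp add: has_real_derivative_iff_has_vector_derivative)
    have hd1: "(pdir 1 h has_real_derivative 3 * G x v w + (G x (\<Gamma>1 x v v) v + 2 * G x (\<Gamma>2 x v v) v)) (at 0)"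
    proof -
      have "Ck_on (Suc (Suc 0)) J h" using Ckh by (simp add: numeral_2_eq_2)
      from Ck_on_curve_deriv[OF Ck_on_pdir[OF this, of 1] _ J0]
      have "(pdir 1 h has_vector_derivative pdir 1 (pdir 1 h) 0) (at 0)" by simp
      then show ?thesis unfolding h2 has_real_derivative_iff_has_vector_derivative .
    qed
    show "\<exists>\<gamma> h J. open J \<and> 0 \<in> J \<and> Ck_on 3 J \<gamma> \<and> \<gamma> 0 = x \<and> pdir 1 \<gamma> 0 = v \<and>
     (\<forall>t\<in>J. (x, \<gamma> t) \<in> S \<and> ((\<lambda>t. F (x, \<gamma> t)) has_real_derivative h t) (at t)) \<and>
     h 0 = 0 \<and> (h has_real_derivative G x v v) (at 0) \<and>
     (pdir 1 h has_real_derivative 3 * G x v (pdir 1 (pdir 1 \<gamma>) 0) + (G x (\<Gamma>1 x v v) v + 2 * G x (\<Gamma>2 x v v) v)) (at 0)"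
      using openJ J0 Ck\<gamma> \<gamma>0 \<gamma>S Fd h0 hd0 hd1[unfolded w_def]
      by (intro exI[of _ \<gamma>] exI[of _ h] exI[of _ J] conjI ballI)
  qed
  show ?thesis
    by (rule that[OF openS CkF, of "ball x0 \<delta>'"]) (use K.delta diagS F0 jet in auto)
qed

section \<open>Charts and tangent vectors\<close>

locale smooth_manifold =
  fixes A :: "('a::topological_space, 'n::finite) chart set"
  assumes smooth_structure: "smooth_structure A"
begin

lemma chart_open: "c \<in> A \<Longrightarrow> open (cdom c)"
  and chart_open_image: "c \<in> A \<Longrightarrow> open (cmap c ` cdom c)"
  and chart_homeo: "c \<in> A \<Longrightarrow> homeomorphism (cdom c) (cmap c ` cdom c) (cmap c) (cinv c)"
  using smooth_structure by (auto simp: smooth_structure_def is_chart_def)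

lemma cinv_cmap: "c \<in> A \<Longrightarrow> p \<in> cdom c \<Longrightarrow> cinv c (cmap c p) = p"
  using chart_homeo[of c] by (simp add: homeomorphism_def)

lemma continuous_cmap: "c \<in> A \<Longrightarrow> continuous_on (cdom c) (cmap c)"
  using chart_homeo[of c] by (simp add: homeomorphism_def)

lemma continuous_cinv: "c \<in> A \<Longrightarrow> continuous_on (cmap c ` cdom c) (cinv c)"
  using chart_homeo[of c] by (simp add: homeomorphism_def)

lemma open_image:
  assumes c: "c \<in> A" and W: "open W" shows "open (cmap c ` (W \<inter> cdom c))"
proof -
  have "cmap c ` (W \<inter> cdom c) = (cmap c ` cdom c) \<inter> cinv c -` W"
    using cinv_cmap[OF c] by auto
  then show ?thesis
    using continuous_open_preimage[OF continuous_cinv[OF c] chart_open_image[OF c] W] by simp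
qed

lemma open_overlap: "c \<in> A \<Longrightarrow> c' \<in> A \<Longrightarrow> open (cmap c ` (cdom c \<inter> cdom c'))"
  using open_image[of c "cdom c'"] chart_open by (simp add: Int_commute)

lemma transition_smooth:
  "c \<in> A \<Longrightarrow> c' \<in> A \<Longrightarrow> smooth_on (cmap c ` (cdom c \<inter> cdom c')) (cmap c' \<circ> cinv c)"
  using smooth_structure by (auto simp: smooth_structure_def compatible_def)

lemma transition_has_derivative:
  assumes "c \<in> A" "c' \<in> A" "p \<in> cdom c" "p \<in> cdom c'"
  shows "((cmap c' \<circ> cinv c) has_derivative frechet_derivative (cmap c' \<circ> cinv c) (at (cmap c p))) (at (cmap c p))"
  by (rule Ck_on_has_derivative[OF smooth_on_imp_Ck_on[OF transition_smooth[OF assms(1,2)]]]) (use assms in auto)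

lemma transition_chain:
  assumes c: "c \<in> A" "c' \<in> A" "c'' \<in> A" and p: "p \<in> cdom c" "p \<in> cdom c'" "p \<in> cdom c''"
  shows "frechet_derivative (cmap c'' \<circ> cinv c') (at (cmap c' p)) (frechet_derivative (cmap c' \<circ> cinv c) (at (cmap c p)) u)
    = frechet_derivative (cmap c'' \<circ> cinv c) (at (cmap c p)) u"
proof -
  have eq: "(cmap c' \<circ> cinv c) (cmap c p) = cmap c' p" using cinv_cmap c p by simp
  have "((\<lambda>x. (cmap c'' \<circ> cinv c') ((cmap c' \<circ> cinv c) x)) has_derivative
    (\<lambda>u. frechet_derivative (cmap c'' \<circ> cinv c') (at (cmap c' p)) (frechet_derivative (cmap c' \<circ> cinv c) (at (cmap c p)) u))) (at (cmap c p))"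
    by (rule has_derivative_compose[OF transition_has_derivative[OF c(1,2) p(1,2)]])
      (unfold eq, rule transition_has_derivative[OF c(2,3) p(2,3)])
  then have "((cmap c'' \<circ> cinv c) has_derivative
    (\<lambda>u. frechet_derivative (cmap c'' \<circ> cinv c') (at (cmap c' p)) (frechet_derivative (cmap c' \<circ> cinv c) (at (cmap c p)) u))) (at (cmap c p))"
  proof (rule has_derivative_transform_within_open[OF _ open_overlap[OF c(1,2)]])
    show "cmap c p \<in> cmap c ` (cdom c \<inter> cdom c')" using p by blast
    show "(cmap c'' \<circ> cinv c') ((cmap c' \<circ> cinv c) x) = (cmap c'' \<circ> cinv c) x" if "x \<in> cmap c ` (cdom c \<inter> cdom c')" for x
      using that by (auto simp: cinv_cmap[OF c(1)] cinv_cmap[OF c(2)])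
  qed
  from frechet_derivative_at[OF this] show ?thesis by metis
qed

lemma transition_self:
  assumes c: "c \<in> A" "p \<in> cdom c" shows "frechet_derivative (cmap c \<circ> cinv c) (at (cmap c p)) u = u"
proof -
  have "((cmap c \<circ> cinv c) has_derivative (\<lambda>u. u)) (at (cmap c p))"
  proof (rule has_derivative_transform_within_open[OF has_derivative_ident chart_open_image[OF c(1)]])
    show "x = (cmap c \<circ> cinv c) x" if "x \<in> cmap c ` cdom c" for x using that cinv_cmap[OF c(1)] by auto
  qed (use c in auto)
  from frechet_derivative_at[OF this] show ?thesis by metis
qed

lemma linear_transition:
  "c \<in> A \<Longrightarrow> c' \<in> A \<Longrightarrow> p \<in> cdom c \<Longrightarrow> p \<in> cdom c' \<Longrightarrow>
    linear (frechet_derivative (cmap c' \<circ> cinv c) (at (cmap c p)))"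
  using has_derivative_linear[OF transition_has_derivative] .

lemma tvec_of_chart: "c \<in> A \<Longrightarrow> p \<in> cdom c \<Longrightarrow> tvec_of A c p u c = u"
  by (simp add: tvec_of_def charts_at_def transition_self)

lemma tvec_of_eq: "c' \<in> A \<Longrightarrow> p \<in> cdom c' \<Longrightarrow> tvec_of A c p u c' = frechet_derivative (cmap c' \<circ> cinv c) (at (cmap c p)) u"
  by (simp add: tvec_of_def charts_at_def)

lemma tvec_of_tangent:
  assumes c: "c \<in> A" "p \<in> cdom c" shows "tvec_of A c p u \<in> tangent_space A p"
  unfolding tangent_space_def
proof (intro CollectI conjI ballI allI impI)
  fix c1 c2 assume "c1 \<in> charts_at A p" "c2 \<in> charts_at A p"
  then have 1: "c1 \<in> A" "p \<in> cdom c1" "c2 \<in> A" "p \<in> cdom c2" by (auto simp: charts_at_def)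
  show "tvec_of A c p u c2 = frechet_derivative (cmap c2 \<circ> cinv c1) (at (cmap c1 p)) (tvec_of A c p u c1)"
    using transition_chain[OF c(1) 1(1,3) c(2) 1(2,4)] 1 by (simp add: tvec_of_eq)
qed (simp add: tvec_of_def)

lemma tangent_transition:
  assumes "v \<in> tangent_space A p" "c \<in> A" "c' \<in> A" "p \<in> cdom c" "p \<in> cdom c'"
  shows "v c' = frechet_derivative (cmap c' \<circ> cinv c) (at (cmap c p)) (v c)"
  using assms unfolding tangent_space_def charts_at_def by blast

lemma tangent_off: "v \<in> tangent_space A p \<Longrightarrow> c \<notin> charts_at A p \<Longrightarrow> v c = 0"
  unfolding tangent_space_def by blast

lemma tvec_of_components:
  assumes v: "v \<in> tangent_space A p" and c: "c \<in> A" "p \<in> cdom c"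
  shows "tvec_of A c p (v c) = v"
proof
  fix c'
  show "tvec_of A c p (v c) c' = v c'"
  proof (cases "c' \<in> charts_at A p")
    case True
    then have "c' \<in> A" "p \<in> cdom c'" by (auto simp: charts_at_def)
    then show ?thesis using tangent_transition[OF v c(1) _ c(2)] by (simp add: tvec_of_eq)
  next
    case False then show ?thesis using tangent_off[OF v] by (simp add: tvec_of_def)
  qed
qed

lemma tangent_eqI:
  "v \<in> tangent_space A p \<Longrightarrow> w \<in> tangent_space A p \<Longrightarrow> c \<in> A \<Longrightarrow> p \<in> cdom c \<Longrightarrow> v c = w c \<Longrightarrow> v = w"
  using tvec_of_components by metis

lemma tangent_combination:
  assumes "u \<in> tangent_space A p" "v \<in> tangent_space A p"
  shows "(\<lambda>c. a *\<^sub>R u c + b *\<^sub>R v c) \<in> tangent_space A p"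
  unfolding tangent_space_def
proof (intro CollectI conjI ballI allI impI)
  fix c c' assume "c \<in> charts_at A p" "c' \<in> charts_at A p"
  then have c: "c \<in> A" "c' \<in> A" "p \<in> cdom c" "p \<in> cdom c'" by (auto simp: charts_at_def)
  note lin = linear_transition[OF c]
  show "a *\<^sub>R u c' + b *\<^sub>R v c' = frechet_derivative (cmap c' \<circ> cinv c) (at (cmap c p)) (a *\<^sub>R u c + b *\<^sub>R v c)"
    using tangent_transition[OF assms(1) c] tangent_transition[OF assms(2) c]
    by (simp add: linear_add[OF lin] linear_scale[OF lin])
qed (simp add: tangent_off[OF assms(1)] tangent_off[OF assms(2)])

lemma tangent_add: "u \<in> tangent_space A p \<Longrightarrow> v \<in> tangent_space A p \<Longrightarrow> (\<lambda>c. u c + v c) \<in> tangent_space A p"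
  using tangent_combination[of u p v 1 1] by simp

lemma tangent_scale: "u \<in> tangent_space A p \<Longrightarrow> (\<lambda>c. a *\<^sub>R u c) \<in> tangent_space A p"
  using tangent_combination[of u p u a 0] by simp

lemma tangent_sum:
  assumes "finite I" "I \<noteq> {}" "\<And>i. i \<in> I \<Longrightarrow> u i \<in> tangent_space A p"
  shows "(\<lambda>c. \<Sum>i\<in>I. u i c) \<in> tangent_space A p"
  using assms by (induction I rule: finite_ne_induct) (auto intro: tangent_add)

lemma tvec_of_combination:
  assumes c: "c \<in> A" "p \<in> cdom c"
  shows "tvec_of A c p (a *\<^sub>R u + b *\<^sub>R w) = (\<lambda>c'. a *\<^sub>R tvec_of A c p u c' + b *\<^sub>R tvec_of A c p w c')"
  by (rule tangent_eqI[OF tvec_of_tangent[OF c] tangent_combination[OF tvec_of_tangent[OF c] tvec_of_tangent[OF c]] c])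
    (simp add: tvec_of_chart[OF c])

lemma chart_exists: "\<exists>c. c \<in> charts_at A p"
proof -
  have "(\<Union>c\<in>A. cdom c) = UNIV" using smooth_structure by (simp add: smooth_structure_def)
  then have "p \<in> (\<Union>c\<in>A. cdom c)" by simp
  then show ?thesis by (auto simp only: charts_at_def UN_iff)
qed

lemma coord_field_chart: "c \<in> A \<Longrightarrow> p \<in> cdom c \<Longrightarrow> coord_field A c i p c = axis i 1"
  by (simp add: coord_field_def tvec_of_chart)

lemma coord_field_tangent: "c \<in> A \<Longrightarrow> p \<in> cdom c \<Longrightarrow> coord_field A c i p \<in> tangent_space A p"
  by (simp add: coord_field_def tvec_of_tangent)

section \<open>Smooth functions and vector fields\<close>

text \<open>The definition quantifies over the whole atlas; smoothness of the transition maps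
  reduces it to a single chart containing \<open>W\<close>.\<close>

lemma smooth_fun_on_chart:
  assumes c: "c \<in> A" and W: "open W" "W \<subseteq> cdom c" and f: "smooth_on (cmap c ` W) (f \<circ> cinv c)"
  shows "smooth_fun_on A W f"
  unfolding smooth_fun_on_def
proof
  fix c' assume c': "c' \<in> A"
  have o: "open (cmap c' ` (W \<inter> cdom c'))" by (rule open_image[OF c' W(1)])
  have oW: "open (cmap c ` W)" using open_image[OF c W(1)] W(2) by (simp add: Int_absorb2)
  have "smooth_on (cmap c' ` (W \<inter> cdom c')) (\<lambda>x. (f \<circ> cinv c) ((cmap c \<circ> cinv c') x))"
  proof (rule smooth_on_compose[OF o oW f])
    have "cmap c' ` (W \<inter> cdom c') \<subseteq> cmap c' ` (cdom c' \<inter> cdom c)" using W(2) by blast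
    then show "smooth_on (cmap c' ` (W \<inter> cdom c')) (cmap c \<circ> cinv c')"
      using transition_smooth[OF c' c] Ck_on_subset unfolding smooth_on_def by blast
    show "(cmap c \<circ> cinv c') ` cmap c' ` (W \<inter> cdom c') \<subseteq> cmap c ` W"
      using cinv_cmap[OF c'] by auto
  qed
  then show "smooth_on (cmap c' ` (W \<inter> cdom c')) (f \<circ> cinv c')"
    by (rule smooth_on_cong[OF o]) (use cinv_cmap[OF c'] cinv_cmap[OF c] W(2) in auto)
qed

text \<open>Components in another chart are the Jacobian of the transition applied to those in
  \<open>c\<close>, evaluated at a moving point; the Jacobian is itself smooth.\<close>

lemma smooth_vfield_on_chart:
  assumes c: "c \<in> A" and W: "open W" "W \<subseteq> cdom c" and X: "\<And>p. p \<in> W \<Longrightarrow> X p \<in> tangent_space A p"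
    and sm: "smooth_on (cmap c ` W) (\<lambda>x. X (cinv c x) c)"
  shows "smooth_vfield_on A W X"
  unfolding smooth_vfield_on_def
proof (intro conjI ballI X)
  fix c' assume c': "c' \<in> A"
  have o: "open (cmap c' ` (W \<inter> cdom c'))" by (rule open_image[OF c' W(1)])
  have oW: "open (cmap c ` W)" using open_image[OF c W(1)] W(2) by (simp add: Int_absorb2)
  have sub: "cmap c' ` (W \<inter> cdom c') \<subseteq> cmap c' ` (cdom c' \<inter> cdom c)" using W(2) by blast
  have im: "(cmap c \<circ> cinv c') ` cmap c' ` (W \<inter> cdom c') \<subseteq> cmap c ` W"
    using cinv_cmap[OF c'] by auto
  have im2: "(cmap c \<circ> cinv c') ` cmap c' ` (W \<inter> cdom c') \<subseteq> cmap c ` (cdom c \<inter> cdom c')"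
    using cinv_cmap[OF c'] W(2) by auto
  show "smooth_on (cmap c' ` (W \<inter> cdom c')) (\<lambda>x. X (cinv c' x) c')"
    unfolding smooth_on_def
  proof
    fix k
    have t: "Ck_on k (cmap c' ` (W \<inter> cdom c')) (cmap c \<circ> cinv c')"
      by (rule Ck_on_subset[OF smooth_on_imp_Ck_on[OF transition_smooth[OF c' c]] sub])
    have "Ck_on k (cmap c' ` (W \<inter> cdom c')) (\<lambda>x. frechet_derivative (cmap c' \<circ> cinv c)
        (at ((cmap c \<circ> cinv c') x)) (X (cinv c ((cmap c \<circ> cinv c') x)) c))"
      by (rule Ck_on_frechet_compose[OF o open_overlap[OF c c'] smooth_on_imp_Ck_on[OF transition_smooth[OF c c']] t im2
          Ck_on_compose[OF o oW smooth_on_imp_Ck_on[OF sm] t im]])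
    then show "Ck_on k (cmap c' ` (W \<inter> cdom c')) (\<lambda>x. X (cinv c' x) c')"
    proof (rule Ck_on_cong[OF o])
      fix x assume "x \<in> cmap c' ` (W \<inter> cdom c')"
      then obtain p where p: "p \<in> W" "p \<in> cdom c'" "x = cmap c' p" by blast
      then have pc: "p \<in> cdom c" using W(2) by blast
      show "frechet_derivative (cmap c' \<circ> cinv c) (at ((cmap c \<circ> cinv c') x)) (X (cinv c ((cmap c \<circ> cinv c') x)) c) = X (cinv c' x) c'"
        using tangent_transition[OF X[OF p(1)] c c' pc p(2)] p cinv_cmap[OF c' p(2)] cinv_cmap[OF c pc] by simp
    qed
  qed
qed

lemma coord_field_smooth:
  assumes c: "c \<in> A" and W: "open W" "W \<subseteq> cdom c" shows "smooth_vfield_on A W (coord_field A c i)"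
proof (rule smooth_vfield_on_chart[OF c W])
  show "coord_field A c i p \<in> tangent_space A p" if "p \<in> W" for p
    using coord_field_tangent[OF c] that W by blast
  have oW: "open (cmap c ` W)" using open_image[OF c W(1)] W(2) by (simp add: Int_absorb2)
  have "smooth_on (cmap c ` W) (\<lambda>x. axis i (1::real))" by (simp add: smooth_on_def)
  then show "smooth_on (cmap c ` W) (\<lambda>x. coord_field A c i (cinv c x) c)"
    by (rule smooth_on_cong[OF oW]) (use W coord_field_chart[OF c] cinv_cmap[OF c] in auto)
qed

lemma vfield_chart_smooth:
  assumes "smooth_vfield_on A W X" "c \<in> A" "W \<subseteq> cdom c"
  shows "smooth_on (cmap c ` W) (\<lambda>x. X (cinv c x) c)"
  using assms by (auto simp: smooth_vfield_on_def Int_absorb2)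

lemma vfield_tangent: "smooth_vfield_on A W X \<Longrightarrow> p \<in> W \<Longrightarrow> X p \<in> tangent_space A p"
  by (simp add: smooth_vfield_on_def)

lemma component_smooth:
  assumes "smooth_vfield_on A W X" "c \<in> A" "open W" "W \<subseteq> cdom c"
  shows "smooth_fun_on A W (\<lambda>p. X p c $ j)"
proof (rule smooth_fun_on_chart[OF assms(2-4)])
  have oW: "open (cmap c ` W)" using open_image[OF assms(2,3)] assms(4) by (simp add: Int_absorb2)
  show "smooth_on (cmap c ` W) ((\<lambda>p. X p c $ j) \<circ> cinv c)"
    unfolding smooth_on_def o_def
    by (intro allI Ck_on_vec_nth[OF oW] smooth_on_imp_Ck_on[OF vfield_chart_smooth[OF assms(1,2,4)]])
qed

lemma smooth_vfield_scale:
  assumes c: "c \<in> A" and W: "open W" "W \<subseteq> cdom c" and f: "smooth_fun_on A W f" and X: "smooth_vfield_on A W X"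
  shows "smooth_vfield_on A W (\<lambda>q c. f q *\<^sub>R X q c)"
proof (rule smooth_vfield_on_chart[OF c W])
  have oW: "open (cmap c ` W)" using open_image[OF c W(1)] W(2) by (simp add: Int_absorb2)
  have sf: "smooth_on (cmap c ` W) (\<lambda>x. f (cinv c x))"
    using f[unfolded smooth_fun_on_def, rule_format, OF c] W(2) by (simp add: Int_absorb2 o_def)
  show "smooth_on (cmap c ` W) (\<lambda>x. f (cinv c x) *\<^sub>R X (cinv c x) c)"
    unfolding smooth_on_def
    by (intro allI Ck_on_scaleR[OF oW] smooth_on_imp_Ck_on[OF sf]
        smooth_on_imp_Ck_on[OF vfield_chart_smooth[OF X c W(2)]])
qed (rule tangent_scale[OF vfield_tangent[OF X]])

lemma smooth_vfield_sum:
  assumes c: "c \<in> A" and W: "open W" "W \<subseteq> cdom c" and X: "\<And>i. i \<in> I \<Longrightarrow> smooth_vfield_on A W (X i)"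
    and I: "finite I" "I \<noteq> {}"
  shows "smooth_vfield_on A W (\<lambda>q c. \<Sum>i\<in>I. X i q c)"
proof (rule smooth_vfield_on_chart[OF c W])
  have oW: "open (cmap c ` W)" using open_image[OF c W(1)] W(2) by (simp add: Int_absorb2)
  show "smooth_on (cmap c ` W) (\<lambda>x. \<Sum>i\<in>I. X i (cinv c x) c)"
    unfolding smooth_on_def
    by (intro allI Ck_on_sum[OF oW] smooth_on_imp_Ck_on[OF vfield_chart_smooth[OF X c W(2)]])
qed (rule tangent_sum[OF I], rule vfield_tangent[OF X])

text \<open>The chart chosen inside \<open>dir_deriv\<close> is unknown; the chain rule and the
  transformation of components replace it by the given \<open>c\<close>.\<close>

lemma dir_deriv_chart:
  assumes c: "c \<in> A" "p \<in> cdom c" and v: "v \<in> tangent_space A p"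
    and f: "(f \<circ> cinv c) differentiable (at (cmap c p))"
  shows "dir_deriv A p v f = frechet_derivative (f \<circ> cinv c) (at (cmap c p)) (v c)"
proof -
  define c' where "c' = (SOME c. c \<in> charts_at A p)"
  have "c' \<in> charts_at A p" unfolding c'_def by (rule someI_ex[OF chart_exists])
  then have c': "c' \<in> A" "p \<in> cdom c'" by (auto simp: charts_at_def)
  have eq: "(cmap c \<circ> cinv c') (cmap c' p) = cmap c p" using cinv_cmap c c' by simp
  have "((\<lambda>x. (f \<circ> cinv c) ((cmap c \<circ> cinv c') x)) has_derivative
    (\<lambda>u. frechet_derivative (f \<circ> cinv c) (at (cmap c p)) (frechet_derivative (cmap c \<circ> cinv c') (at (cmap c' p)) u))) (at (cmap c' p))"
    by (rule has_derivative_compose[OF transition_has_derivative[OF c'(1) c(1) c'(2) c(2)]])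
      (unfold eq, rule f[unfolded frechet_derivative_works])
  then have "((f \<circ> cinv c') has_derivative
    (\<lambda>u. frechet_derivative (f \<circ> cinv c) (at (cmap c p)) (frechet_derivative (cmap c \<circ> cinv c') (at (cmap c' p)) u))) (at (cmap c' p))"
  proof (rule has_derivative_transform_within_open[OF _ open_overlap[OF c'(1) c(1)]])
    show "cmap c' p \<in> cmap c' ` (cdom c' \<inter> cdom c)" using c c' by blast
    show "(f \<circ> cinv c) ((cmap c \<circ> cinv c') x) = (f \<circ> cinv c') x" if "x \<in> cmap c' ` (cdom c' \<inter> cdom c)" for x
      using that by (auto simp: cinv_cmap[OF c(1)] cinv_cmap[OF c'(1)])
  qed
  then have "frechet_derivative (f \<circ> cinv c') (at (cmap c' p)) (v c')
    = frechet_derivative (f \<circ> cinv c) (at (cmap c p)) (frechet_derivative (cmap c \<circ> cinv c') (at (cmap c' p)) (v c'))"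
    by (metis frechet_derivative_at)
  also have "frechet_derivative (cmap c \<circ> cinv c') (at (cmap c' p)) (v c') = v c"
    using tangent_transition[OF v c'(1) c(1) c'(2) c(2)] by simp
  finally show ?thesis unfolding dir_deriv_def Let_def c'_def .
qed

end

section \<open>Connections in charts\<close>

locale connection = smooth_manifold A
  for A :: "('a::topological_space, 'n::finite) chart set" +
  fixes nabla :: "('a, 'n) vfield \<Rightarrow> ('a, 'n) vfield \<Rightarrow> ('a, 'n) vfield"
  assumes affine: "affine_connection A nabla"
begin

context
  fixes W :: "'a set" and X Y :: "('a, 'n) vfield"
  assumes W: "open W" and X: "smooth_vfield_on A W X" and Y: "smooth_vfield_on A W Y"
begin

text \<open>All clauses of \<open>affine_connection\<close> share one quantifier over a smooth
  function; the zero function instantiates it for the clauses that mention none.\<close>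

lemma zero_smooth_fun: "smooth_fun_on A W (\<lambda>p. 0)"
  by (simp add: smooth_fun_on_def o_def smooth_on_def)

lemma nabla_smooth: "smooth_vfield_on A W (nabla X Y)"
  using affine W X Y zero_smooth_fun unfolding affine_connection_def by blast

lemma nabla_cong:
  assumes "smooth_vfield_on A W X'" "smooth_vfield_on A W Y'"
    "\<And>p. p \<in> W \<Longrightarrow> X p = X' p" "\<And>p. p \<in> W \<Longrightarrow> Y p = Y' p" "p \<in> W"
  shows "nabla X Y p = nabla X' Y' p"
  using affine W X Y assms zero_smooth_fun unfolding affine_connection_def by blast

lemma nabla_add_left:
  assumes "smooth_vfield_on A W X'" "p \<in> W"
  shows "nabla (\<lambda>q c. X q c + X' q c) Y p = (\<lambda>c. nabla X Y p c + nabla X' Y p c)"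
  using affine W X Y assms zero_smooth_fun unfolding affine_connection_def by blast

lemma nabla_add_right:
  assumes "smooth_vfield_on A W Y'" "p \<in> W"
  shows "nabla X (\<lambda>q c. Y q c + Y' q c) p = (\<lambda>c. nabla X Y p c + nabla X Y' p c)"
  using affine W X Y assms zero_smooth_fun unfolding affine_connection_def by blast

lemma nabla_scale_left:
  assumes "smooth_fun_on A W f" "p \<in> W"
  shows "nabla (\<lambda>q c. f q *\<^sub>R X q c) Y p = (\<lambda>c. f p *\<^sub>R nabla X Y p c)"
  using affine W X Y assms unfolding affine_connection_def by blast

lemma nabla_leibniz:
  assumes "smooth_fun_on A W f" "p \<in> W"
  shows "nabla X (\<lambda>q c. f q *\<^sub>R Y q c) p = (\<lambda>c. dir_deriv A p (X p) f *\<^sub>R Y p c + f p *\<^sub>R nabla X Y p c)"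
  using affine W X Y assms unfolding affine_connection_def by blast

end

lemma nabla_sum_left:
  assumes c: "c \<in> A" and W: "open W" "W \<subseteq> cdom c" and Y: "smooth_vfield_on A W Y"
    and I: "finite I" "I \<noteq> {}" and X: "\<And>i. i \<in> I \<Longrightarrow> smooth_vfield_on A W (X i)" and p: "p \<in> W"
  shows "nabla (\<lambda>q c. \<Sum>i\<in>I. X i q c) Y p = (\<lambda>c. \<Sum>i\<in>I. nabla (X i) Y p c)"
  using I X
proof (induction I rule: finite_ne_induct)
  case (insert x F)
  have "smooth_vfield_on A W (\<lambda>q c. \<Sum>i\<in>F. X i q c)"
    by (rule smooth_vfield_sum[OF c W]) (use insert in auto)
  with insert show ?case using nabla_add_left[OF W(1) _ Y] p by simp
qed simp

lemma nabla_sum_right: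
  assumes c: "c \<in> A" and W: "open W" "W \<subseteq> cdom c" and X: "smooth_vfield_on A W X"
    and I: "finite I" "I \<noteq> {}" and Y: "\<And>i. i \<in> I \<Longrightarrow> smooth_vfield_on A W (Y i)" and p: "p \<in> W"
  shows "nabla X (\<lambda>q c. \<Sum>i\<in>I. Y i q c) p = (\<lambda>c. \<Sum>i\<in>I. nabla X (Y i) p c)"
  using I Y
proof (induction I rule: finite_ne_induct)
  case (insert x F)
  have "smooth_vfield_on A W (\<lambda>q c. \<Sum>i\<in>F. Y i q c)"
    by (rule smooth_vfield_sum[OF c W]) (use insert in auto)
  with insert show ?case using nabla_add_right[OF W(1) X] p by simp
qed simp

lemma vfield_expand:
  assumes c: "c \<in> A" "W \<subseteq> cdom c" and X: "smooth_vfield_on A W X" and p: "p \<in> W"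
  shows "X p = (\<lambda>c'. \<Sum>i\<in>UNIV. X p c $ i *\<^sub>R coord_field A c i p c')"
proof (rule tangent_eqI[OF vfield_tangent[OF X p] tangent_sum])
  show "c \<in> A" "p \<in> cdom c" using c p by auto
  then show "X p c = (\<Sum>i\<in>UNIV. X p c $ i *\<^sub>R coord_field A c i p c)"
    using vec_expand[of "X p c"] by (simp add: coord_field_chart)
  show "(\<lambda>c'. X p c $ i *\<^sub>R coord_field A c i p c') \<in> tangent_space A p" for i
    by (rule tangent_scale[OF coord_field_tangent]) (use c p in auto)
qed auto

text \<open>The expansions of \<open>X\<close> and \<open>Y\<close> in coordinate fields hold only
  over \<open>W\<close>, so locality (\<open>nabla_cong\<close>) must first substitute them.
  Linearity over functions in \<open>X\<close> and the Leibniz rule in \<open>Y\<close> then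
  separate the derivative of the components from the Christoffel part.\<close>

lemma nabla_chart:
  assumes c: "c \<in> A" and W: "open W" "W \<subseteq> cdom c"
    and X: "smooth_vfield_on A W X" and Y: "smooth_vfield_on A W Y" and p: "p \<in> W"
  shows "nabla X Y p c = frechet_derivative (\<lambda>x. Y (cinv c x) c) (at (cmap c p)) (X p c)
      + christoffel A nabla c p (X p c) (Y p c)"
proof -
  let ?d = "coord_field A c"
  have pc: "p \<in> cdom c" using W p by blast
  have d: "smooth_vfield_on A W (?d i)" for i by (rule coord_field_smooth[OF c W])
  have Xs: "smooth_fun_on A W (\<lambda>p. X p c $ i)" for i by (rule component_smooth[OF X c W])
  have Ys: "smooth_fun_on A W (\<lambda>p. Y p c $ i)" for i by (rule component_smooth[OF Y c W])
  have Xd: "smooth_vfield_on A W (\<lambda>q c'. X q c $ i *\<^sub>R ?d i q c')" for i by (rule smooth_vfield_scale[OF c W Xs d])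
  have Yd: "smooth_vfield_on A W (\<lambda>q c'. Y q c $ i *\<^sub>R ?d i q c')" for i by (rule smooth_vfield_scale[OF c W Ys d])
  have XS: "smooth_vfield_on A W (\<lambda>q c'. \<Sum>i\<in>UNIV. X q c $ i *\<^sub>R ?d i q c')" by (rule smooth_vfield_sum[OF c W Xd]) auto
  have YS: "smooth_vfield_on A W (\<lambda>q c'. \<Sum>i\<in>UNIV. Y q c $ i *\<^sub>R ?d i q c')" by (rule smooth_vfield_sum[OF c W Yd]) auto
  have 1: "nabla X (?d j) p = (\<lambda>c'. \<Sum>i\<in>UNIV. X p c $ i *\<^sub>R nabla (?d i) (?d j) p c')" for j
  proof -
    have "nabla X (?d j) p = nabla (\<lambda>q c'. \<Sum>i\<in>UNIV. X q c $ i *\<^sub>R ?d i q c') (?d j) p"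
      by (rule nabla_cong[OF W(1) X d XS d vfield_expand[OF c W(2) X] refl p])
    also have "\<dots> = (\<lambda>c'. \<Sum>i\<in>UNIV. nabla (\<lambda>q c'. X q c $ i *\<^sub>R ?d i q c') (?d j) p c')"
      by (rule nabla_sum_left[OF c W d _ _ Xd p]) auto
    also have "\<dots> = (\<lambda>c'. \<Sum>i\<in>UNIV. X p c $ i *\<^sub>R nabla (?d i) (?d j) p c')"
      by (simp add: nabla_scale_left[OF W(1) d d Xs p])
    finally show ?thesis .
  qed
  have "nabla X Y p = nabla X (\<lambda>q c'. \<Sum>j\<in>UNIV. Y q c $ j *\<^sub>R ?d j q c') p"
    by (rule nabla_cong[OF W(1) X Y X YS refl vfield_expand[OF c W(2) Y] p])
  also have "\<dots> = (\<lambda>c'. \<Sum>j\<in>UNIV. nabla X (\<lambda>q c'. Y q c $ j *\<^sub>R ?d j q c') p c')"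
    by (rule nabla_sum_right[OF c W X _ _ Yd p]) auto
  also have "\<dots> = (\<lambda>c'. \<Sum>j\<in>UNIV. dir_deriv A p (X p) (\<lambda>q. Y q c $ j) *\<^sub>R ?d j p c' + Y p c $ j *\<^sub>R nabla X (?d j) p c')"
    by (simp add: nabla_leibniz[OF W(1) X d Ys p])
  finally have "nabla X Y p c = (\<Sum>j\<in>UNIV. dir_deriv A p (X p) (\<lambda>q. Y q c $ j) *\<^sub>R axis j 1)
      + (\<Sum>j\<in>UNIV. Y p c $ j *\<^sub>R nabla X (?d j) p c)"
    by (simp add: sum.distrib coord_field_chart[OF c pc])
  moreover have "(\<Sum>j\<in>UNIV. Y p c $ j *\<^sub>R nabla X (?d j) p c) = christoffel A nabla c p (X p c) (Y p c)"
    unfolding christoffel_def 1 scaleR_sum_right by (subst sum.swap) (simp add: mult.commute)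
  moreover have "(\<Sum>j\<in>UNIV. dir_deriv A p (X p) (\<lambda>q. Y q c $ j) *\<^sub>R axis j 1)
      = frechet_derivative (\<lambda>x. Y (cinv c x) c) (at (cmap c p)) (X p c)"
  proof -
    have "(\<lambda>x. Y (cinv c x) c) differentiable (at (cmap c p))"
      by (rule Ck_on_differentiable[OF smooth_on_imp_Ck_on[OF vfield_chart_smooth[OF Y c W(2)], of 1]]) (use p in auto)
    then have D: "((\<lambda>x. Y (cinv c x) c) has_derivative frechet_derivative (\<lambda>x. Y (cinv c x) c) (at (cmap c p))) (at (cmap c p))"
      by (simp add: frechet_derivative_works)
    have Dj: "(((\<lambda>q. Y q c $ j) \<circ> cinv c) has_derivative (\<lambda>u. frechet_derivative (\<lambda>x. Y (cinv c x) c) (at (cmap c p)) u $ j)) (at (cmap c p))" for j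
      using bounded_linear.has_derivative[OF bounded_linear_vec_nth D] by (simp add: o_def)
    have "dir_deriv A p (X p) (\<lambda>q. Y q c $ j) = frechet_derivative (\<lambda>x. Y (cinv c x) c) (at (cmap c p)) (X p c) $ j" for j
      using dir_deriv_chart[OF c pc vfield_tangent[OF X p], of "\<lambda>q. Y q c $ j"] Dj frechet_derivative_at[OF Dj, symmetric]
      by (auto simp: differentiable_def)
    then show ?thesis using vec_expand[of "frechet_derivative (\<lambda>x. Y (cinv c x) c) (at (cmap c p)) (X p c)"] by simp
  qed
  ultimately show ?thesis by simp
qed

end

section \<open>Curves and their velocities\<close>

context smooth_manifold
begin

lemma C1_velocity:
  assumes "C1_curve A \<sigma>" "c \<in> A" "t \<in> {0..1}" "\<sigma> t \<in> cdom c"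
  shows "((cmap c \<circ> \<sigma>) has_vector_derivative velocity A \<sigma> t c) (at t within {0..1})"
proof -
  have "(cmap c \<circ> \<sigma>) differentiable (at t within {0..1})"
    using assms unfolding C1_curve_def by blast
  then show ?thesis
    using assms by (simp add: velocity_def charts_at_def vector_derivative_works)
qed

lemma velocity_eqI:
  assumes "c \<in> A" "t \<in> {0..1}" "\<sigma> t \<in> cdom c" "((cmap c \<circ> \<sigma>) has_vector_derivative a) (at t within {0..1})"
  shows "velocity A \<sigma> t c = a"
  using vector_derivative_within_closed_interval[of 0 1 t, OF _ assms(2,4)] assms
  by (simp add: velocity_def charts_at_def)

lemma velocity_off: "c \<notin> charts_at A (\<sigma> t) \<Longrightarrow> velocity A \<sigma> t c = 0"
  by (simp add: velocity_def)

lemma C1_continuous: "C1_curve A \<sigma> \<Longrightarrow> continuous_on {0..1} \<sigma>"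
  by (simp add: C1_curve_def)

lemma curve_eventually_in:
  assumes "continuous_on {0..1} \<sigma>" "t \<in> {0..1}" "open W" "\<sigma> t \<in> W"
  shows "\<forall>\<^sub>F s in at t within {0..1}. \<sigma> s \<in> W"
proof -
  have "(\<sigma> \<longlongrightarrow> \<sigma> t) (at t within {0..1})"
    using assms(1,2) by (simp add: continuous_on)
  from topological_tendstoD[OF this assms(3,4)] show ?thesis .
qed

text \<open>The chain rule within \<open>[0,1]\<close>. The value \<open>\<tau> = 0\<close> is
  included and gives a constant curve, from which the vanishing of the inverse exponential on the
  diagonal will follow.\<close>

lemma C1_curve_rescale:
  assumes \<sigma>: "C1_curve A \<sigma>" and \<tau>: "\<tau> \<in> {0..1}" and \<sigma>': "\<And>s. s \<in> {0..1} \<Longrightarrow> \<sigma>' s = \<sigma> (\<tau> * s)"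
  shows "C1_curve A \<sigma>'" and "s \<in> {0..1} \<Longrightarrow> velocity A \<sigma>' s = (\<lambda>c. \<tau> *\<^sub>R velocity A \<sigma> (\<tau> * s) c)"
proof -
  have ts: "\<tau> * s \<in> {0..1}" if "s \<in> {0..1}" for s using that \<tau> by (auto simp: mult_le_one)
  then have sub: "(\<lambda>s. \<tau> * s) ` {0..1} \<subseteq> {0..1}" by blast
  have der: "((cmap c \<circ> \<sigma>') has_vector_derivative \<tau> *\<^sub>R velocity A \<sigma> (\<tau> * s) c) (at s within {0..1})"
    if s: "s \<in> {0..1}" and c: "c \<in> A" "\<sigma>' s \<in> cdom c" for s c
  proof -
    have "((\<lambda>s. \<tau> * s) has_vector_derivative \<tau>) (at s within {0..1})"
      by (auto intro!: derivative_eq_intros)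
    moreover have "\<sigma> (\<tau> * s) \<in> cdom c" using c(2) \<sigma>'[OF s] by simp
    ultimately have "(((cmap c \<circ> \<sigma>) \<circ> (\<lambda>s. \<tau> * s)) has_vector_derivative \<tau> *\<^sub>R velocity A \<sigma> (\<tau> * s) c) (at s within {0..1})"
      by (intro vector_diff_chain_within has_vector_derivative_within_subset[OF C1_velocity[OF \<sigma> c(1) ts[OF s]] sub])
    then show ?thesis
      by (rule has_vector_derivative_transform[rotated -1]) (use s \<sigma>' in auto)
  qed
  have vel: "velocity A \<sigma>' s = (\<lambda>c. \<tau> *\<^sub>R velocity A \<sigma> (\<tau> * s) c)" if s: "s \<in> {0..1}" for s
  proof
    fix c show "velocity A \<sigma>' s c = \<tau> *\<^sub>R velocity A \<sigma> (\<tau> * s) c"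
    proof (cases "c \<in> charts_at A (\<sigma>' s)")
      case True
      then show ?thesis using velocity_eqI[OF _ s _ der[OF s]] by (simp add: charts_at_def)
    next
      case False
      then show ?thesis using \<sigma>'[OF s] by (simp add: velocity_off)
    qed
  qed
  then show "s \<in> {0..1} \<Longrightarrow> velocity A \<sigma>' s = (\<lambda>c. \<tau> *\<^sub>R velocity A \<sigma> (\<tau> * s) c)" .
  show "C1_curve A \<sigma>'"
    unfolding C1_curve_def
  proof (intro conjI ballI impI)
    have "continuous_on {0..1} (\<lambda>s. \<sigma> (\<tau> * s))"
      by (rule continuous_on_compose2[OF C1_continuous[OF \<sigma>] _ sub]) (intro continuous_intros)
    then show "continuous_on {0..1} \<sigma>'" by (rule continuous_on_eq) (simp add: \<sigma>')
    fix c assume c: "c \<in> A"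
    show "(cmap c \<circ> \<sigma>') differentiable at t within {0..1}" if "t \<in> {0..1}" "\<sigma>' t \<in> cdom c" for t
      using der[OF that(1) c that(2)] unfolding has_vector_derivative_def by (rule differentiableI)
    have 1: "continuous_on {t \<in> {0..1}. \<sigma> t \<in> cdom c} (\<lambda>t. velocity A \<sigma> t c)"
      using \<sigma> c unfolding C1_curve_def by blast
    have "continuous_on {t \<in> {0..1}. \<sigma>' t \<in> cdom c} (\<lambda>s. \<tau> *\<^sub>R velocity A \<sigma> (\<tau> * s) c)"
      by (intro continuous_intros continuous_on_compose2[OF 1]) (use ts \<sigma>' in auto)
    then show "continuous_on {t \<in> {0..1}. \<sigma>' t \<in> cdom c} (\<lambda>t. velocity A \<sigma>' t c)"
      by (rule continuous_on_cong[THEN iffD1, OF refl, rotated]) (simp add: vel)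
  qed
qed

end

section \<open>Christoffel symbols, parallel transport and geodesics\<close>

context connection
begin

lemma christoffel_bil: "christoffel A nabla c p = bil (\<lambda>i j. nabla (coord_field A c i) (coord_field A c j) p c)"
  by (simp add: fun_eq_iff christoffel_def bil_def)

lemma nabla_coord_smooth:
  assumes "c \<in> A" "open W" "W \<subseteq> cdom c"
  shows "smooth_vfield_on A W (nabla (coord_field A c i) (coord_field A c j))"
  by (rule nabla_smooth[OF assms(2) coord_field_smooth[OF assms] coord_field_smooth[OF assms]])

lemma christoffel_smooth:
  assumes "c \<in> A" shows "Ck_on k (cmap c ` cdom c) (\<lambda>x. nabla (coord_field A c i) (coord_field A c j) (cinv c x) c)"
  by (rule smooth_on_imp_Ck_on[OF vfield_chart_smooth[OF nabla_coord_smooth[OF assms chart_open[OF assms]] assms]]) auto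

text \<open>The vector \<open>\<nabla>\<close> of \<open>\<partial>\<^sub>j\<close> along
  \<open>\<partial>\<^sub>i\<close> is computed in \<open>c'\<close> twice: by transforming its
  components in \<open>c\<close>, and by the local formula in \<open>c'\<close>, where
  \<open>\<partial>\<^sub>j\<close> has non-constant components, the \<open>j\<close>-th column of
  the Jacobian. Differentiating that column gives the second-derivative term; bilinearity extends
  this to \<open>u\<close>, \<open>w\<close>.\<close>

lemma christoffel_transition:
  assumes c: "c \<in> A" "c' \<in> A" and p: "p \<in> cdom c" "p \<in> cdom c'"
  shows "christoffel A nabla c' p (frechet_derivative (cmap c' \<circ> cinv c) (at (cmap c p)) u)
      (frechet_derivative (cmap c' \<circ> cinv c) (at (cmap c p)) w)
    = frechet_derivative (cmap c' \<circ> cinv c) (at (cmap c p)) (christoffel A nabla c p u w)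
      - (\<Sum>j\<in>UNIV. w $ j *\<^sub>R pdir u (pdir (axis j 1) (cmap c' \<circ> cinv c)) (cmap c p))"
proof -
  let ?\<psi> = "cmap c' \<circ> cinv c" and ?x = "cmap c p" and ?W = "cdom c \<inter> cdom c'"
  let ?D = "frechet_derivative ?\<psi> (at ?x)" and ?d = "coord_field A c"
  have W: "open ?W" "?W \<subseteq> cdom c" "?W \<subseteq> cdom c'" "p \<in> ?W" using c p chart_open[OF c(1)] chart_open[OF c(2)] by auto
  have oc: "open (cmap c ` ?W)" by (rule open_overlap[OF c])
  have x: "?x \<in> cmap c ` ?W" using W(4) by blast
  have C\<psi>: "Ck_on k (cmap c ` ?W) ?\<psi>" for k by (rule smooth_on_imp_Ck_on[OF transition_smooth[OF c]])
  have eq: "?\<psi> ?x = cmap c' p" using cinv_cmap[OF c(1) p(1)] by simp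
  note lin = linear_transition[OF c p]
  have pd: "linear (\<lambda>u. pdir u (pdir (axis j 1) ?\<psi>) ?x)" for j
    by (rule pdir_linear[OF Ck_on_differentiable[OF Ck_on_pdir[OF C\<psi>] _ x, of 1]]) simp
  have basis: "christoffel A nabla c' p (?D (axis i 1)) (?D (axis j 1))
      = ?D (christoffel A nabla c p (axis i 1) (axis j 1)) - pdir (axis i 1) (pdir (axis j 1) ?\<psi>) ?x" for i j
  proof -
    have s: "smooth_vfield_on A ?W (?d i)" for i by (rule coord_field_smooth[OF c(1) W(1,2)])
    define \<Psi> where "\<Psi> = (\<lambda>x. ?d j (cinv c' x) c')"
    have d': "?d i p c' = ?D (axis i 1)" for i
      by (simp add: coord_field_def tvec_of_eq[OF c(2) p(2)])
    have "nabla (?d i) (?d j) p c' = frechet_derivative \<Psi> (at (cmap c' p)) (?D (axis i 1))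
        + christoffel A nabla c' p (?D (axis i 1)) (?D (axis j 1))"
      using nabla_chart[OF c(2) W(1,3) s s W(4), of i j] by (simp add: \<Psi>_def d')
    moreover have "nabla (?d i) (?d j) p c' = ?D (nabla (?d i) (?d j) p c)"
      by (rule tangent_transition[OF vfield_tangent[OF nabla_smooth[OF W(1) s s] W(4)] c p])
    moreover have "nabla (?d i) (?d j) p c = christoffel A nabla c p (axis i 1) (axis j 1)"
      by (simp add: christoffel_bil bil_axis)
    moreover have "frechet_derivative \<Psi> (at (cmap c' p)) (?D (axis i 1)) = pdir (axis i 1) (pdir (axis j 1) ?\<psi>) ?x"
    proof -
      have "Ck_on 1 (cmap c' ` ?W) \<Psi>"
        unfolding \<Psi>_def by (rule smooth_on_imp_Ck_on[OF vfield_chart_smooth[OF s c(2) W(3)]])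
      then have "\<Psi> differentiable (at (cmap c' p))"
        by (rule Ck_on_differentiable) (use W(4) in auto)
      then have D\<Psi>: "(\<Psi> has_derivative frechet_derivative \<Psi> (at (cmap c' p))) (at (?\<psi> ?x))"
        unfolding eq frechet_derivative_works .
      have "((\<lambda>y. \<Psi> (?\<psi> y)) has_derivative (\<lambda>u. frechet_derivative \<Psi> (at (cmap c' p)) (?D u))) (at ?x)"
        by (rule has_derivative_compose[OF transition_has_derivative[OF c p] D\<Psi>])
      then have "(pdir (axis j 1) ?\<psi> has_derivative (\<lambda>u. frechet_derivative \<Psi> (at (cmap c' p)) (?D u))) (at ?x)"
      proof (rule has_derivative_transform_within_open[OF _ oc x])
        fix y assume "y \<in> cmap c ` ?W"
        then obtain q where q: "q \<in> cdom c" "q \<in> cdom c'" "y = cmap c q" by blast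
        show "\<Psi> (?\<psi> y) = pdir (axis j 1) ?\<psi> y"
          using q by (simp add: \<Psi>_def cinv_cmap[OF c(1)] cinv_cmap[OF c(2)] coord_field_def tvec_of_eq[OF c(2)] pdir_def)
      qed
      from pdir_eqI[OF this] show ?thesis by simp
    qed
    ultimately show ?thesis by simp
  qed
  have Dexp: "?D v = (\<Sum>i\<in>UNIV. v $ i *\<^sub>R ?D (axis i 1))" for v
    by (subst vec_expand[of v]) (simp add: linear_sum[OF lin] linear_scale[OF lin])
  have "christoffel A nabla c' p (?D u) (?D w)
    = (\<Sum>i\<in>UNIV. \<Sum>j\<in>UNIV. (u $ i * w $ j) *\<^sub>R christoffel A nabla c' p (?D (axis i 1)) (?D (axis j 1)))"
    unfolding christoffel_bil
    by (subst Dexp[of u], subst Dexp[of w])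
      (simp only: bil_sum_left bil_scaleR_left, simp only: bil_sum_right bil_scaleR_right scaleR_sum_right scaleR_scaleR)
  also have "\<dots> = (\<Sum>i\<in>UNIV. \<Sum>j\<in>UNIV. (u $ i * w $ j) *\<^sub>R ?D (christoffel A nabla c p (axis i 1) (axis j 1)))
      - (\<Sum>i\<in>UNIV. \<Sum>j\<in>UNIV. (u $ i * w $ j) *\<^sub>R pdir (axis i 1) (pdir (axis j 1) ?\<psi>) ?x)"
    by (simp add: basis scaleR_diff_right sum_subtractf)
  also have "(\<Sum>i\<in>UNIV. \<Sum>j\<in>UNIV. (u $ i * w $ j) *\<^sub>R ?D (christoffel A nabla c p (axis i 1) (axis j 1)))
      = ?D (christoffel A nabla c p u w)"
    unfolding christoffel_bil
    by (simp add: bil_axis bil_def[of _ u w] linear_sum[OF lin] linear_scale[OF lin])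
  also have "(\<Sum>i\<in>UNIV. \<Sum>j\<in>UNIV. (u $ i * w $ j) *\<^sub>R pdir (axis i 1) (pdir (axis j 1) ?\<psi>) ?x)
      = (\<Sum>j\<in>UNIV. w $ j *\<^sub>R pdir u (pdir (axis j 1) ?\<psi>) ?x)"
  proof -
    have "pdir u (pdir (axis j 1) ?\<psi>) ?x = (\<Sum>i\<in>UNIV. u $ i *\<^sub>R pdir (axis i 1) (pdir (axis j 1) ?\<psi>) ?x)" for j
      by (subst vec_expand[of u]) (simp add: linear_sum[OF pd] linear_scale[OF pd])
    then show ?thesis by (subst sum.swap) (simp add: scaleR_sum_right mult.commute)
  qed
  finally show ?thesis .
qed

text \<open>\<open>parallel_along\<close> demands the equation in every chart the curve meets. In
  another chart the components are the Jacobian times \<open>v\<close>, and the derivative of the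
  Jacobian along the curve cancels the inhomogeneous term in the transformation of the Christoffel
  symbols.\<close>

lemma parallel_along_chart:
  assumes \<sigma>: "C1_curve A \<sigma>" and c: "c \<in> A" and in_c: "\<And>t. t \<in> {0..1} \<Longrightarrow> \<sigma> t \<in> cdom c"
    and vt: "\<And>t. t \<in> {0..1} \<Longrightarrow> velocity A \<sigma> t \<in> tangent_space A (\<sigma> t)"
    and v: "\<And>t. t \<in> {0..1} \<Longrightarrow> (v has_vector_derivative
        - christoffel A nabla c (\<sigma> t) (velocity A \<sigma> t c) (v t)) (at t within {0..1})"
  shows "parallel_along A nabla \<sigma> (\<lambda>t. tvec_of A c (\<sigma> t) (v t))"
  unfolding parallel_along_def
proof (intro ballI conjI)
  fix t :: real assume t: "t \<in> {0..1}"
  show "tvec_of A c (\<sigma> t) (v t) \<in> tangent_space A (\<sigma> t)" by (rule tvec_of_tangent[OF c in_c[OF t]])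
  fix c' assume "c' \<in> charts_at A (\<sigma> t)"
  then have c': "c' \<in> A" "\<sigma> t \<in> cdom c'" by (auto simp: charts_at_def)
  let ?\<psi> = "cmap c' \<circ> cinv c" and ?p = "\<sigma> t"
  let ?x = "cmap c ?p" and ?W = "cdom c \<inter> cdom c'"
  let ?D = "frechet_derivative ?\<psi> (at ?x)"
  define a where "a = velocity A \<sigma> t c"
  define v' where "v' = - christoffel A nabla c ?p a (v t)"
  have p: "?p \<in> cdom c" by (rule in_c[OF t])
  have C\<psi>: "Ck_on k (cmap c ` ?W) ?\<psi>" for k by (rule smooth_on_imp_Ck_on[OF transition_smooth[OF c c'(1)]])
  have x: "?x \<in> cmap c ` ?W" using p c' by blast
  have \<gamma>d: "((\<lambda>s. cmap c (\<sigma> s)) has_derivative (\<lambda>h. h *\<^sub>R a)) (at t within {0..1})"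
    using C1_velocity[OF \<sigma> c t p] by (simp add: a_def has_vector_derivative_def o_def)
  note lin = linear_transition[OF c c'(1) p c'(2)]
  have Dexp: "frechet_derivative ?\<psi> (at y) u = (\<Sum>i\<in>UNIV. u $ i *\<^sub>R pdir (axis i 1) ?\<psi> y)"
    if "y \<in> cmap c ` ?W" for u y
  proof -
    have l: "linear (\<lambda>u. pdir u ?\<psi> y)"
      by (rule pdir_linear[OF Ck_on_differentiable[OF C\<psi> _ that, of 1]]) simp
    have "pdir u ?\<psi> y = (\<Sum>i\<in>UNIV. u $ i *\<^sub>R pdir (axis i 1) ?\<psi> y)"
      by (subst vec_expand[of u]) (simp add: linear_sum[OF l] linear_scale[OF l])
    then show ?thesis by (simp add: pdir_def)
  qed
  have pd: "((\<lambda>s. pdir (axis i 1) ?\<psi> (cmap c (\<sigma> s))) has_vector_derivative pdir a (pdir (axis i 1) ?\<psi>) ?x) (at t within {0..1})" for i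
  proof -
    have d: "(pdir (axis i 1) ?\<psi> has_derivative (\<lambda>u. pdir u (pdir (axis i 1) ?\<psi>) ?x)) (at ?x)"
      by (rule Ck_on_has_pdir[OF Ck_on_pdir[OF C\<psi>] _ x, of 1]) simp
    show ?thesis
      unfolding has_vector_derivative_def
      using has_derivative_compose[OF \<gamma>d d] linear_scale[OF has_derivative_linear[OF d]] by simp
  qed
  have vd: "((\<lambda>s. v s $ i) has_real_derivative v' $ i) (at t within {0..1})" for i
    using bounded_linear.has_vector_derivative[OF bounded_linear_vec_nth v[OF t]]
    by (simp add: v'_def a_def has_real_derivative_iff_has_vector_derivative)
  have "((\<lambda>s. \<Sum>i\<in>UNIV. v s $ i *\<^sub>R pdir (axis i 1) ?\<psi> (cmap c (\<sigma> s))) has_vector_derivative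
      (\<Sum>i\<in>UNIV. v t $ i *\<^sub>R pdir a (pdir (axis i 1) ?\<psi>) ?x + v' $ i *\<^sub>R pdir (axis i 1) ?\<psi> ?x)) (at t within {0..1})"
    by (intro has_vector_derivative_sum has_vector_derivative_scaleR vd pd)
  also have "(\<Sum>i\<in>UNIV. v t $ i *\<^sub>R pdir a (pdir (axis i 1) ?\<psi>) ?x + v' $ i *\<^sub>R pdir (axis i 1) ?\<psi> ?x)
      = (\<Sum>i\<in>UNIV. v t $ i *\<^sub>R pdir a (pdir (axis i 1) ?\<psi>) ?x) + ?D v'"
    by (simp add: sum.distrib Dexp[OF x])
  also have "\<dots> = - christoffel A nabla c' ?p (?D a) (?D (v t))"
    unfolding christoffel_transition[OF c c'(1) p c'(2)] v'_def by (simp add: linear_neg[OF lin])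
  also have "?D a = velocity A \<sigma> t c'"
    unfolding a_def by (rule tangent_transition[OF vt[OF t] c c'(1) p c'(2), symmetric])
  also have "?D (v t) = tvec_of A c ?p (v t) c'" by (simp add: tvec_of_eq[OF c'])
  finally have F: "((\<lambda>s. \<Sum>i\<in>UNIV. v s $ i *\<^sub>R pdir (axis i 1) ?\<psi> (cmap c (\<sigma> s))) has_vector_derivative
      - christoffel A nabla c' ?p (velocity A \<sigma> t c') (tvec_of A c ?p (v t) c')) (at t within {0..1})" .
  have eqs: "(\<Sum>i\<in>UNIV. v s $ i *\<^sub>R pdir (axis i 1) ?\<psi> (cmap c (\<sigma> s))) = tvec_of A c (\<sigma> s) (v s) c'"
    if "s \<in> {0..1}" "\<sigma> s \<in> cdom c'" for s
    using Dexp[of "cmap c (\<sigma> s)" "v s"] that in_c[OF that(1)] c' by (simp add: tvec_of_eq)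
  have "\<forall>\<^sub>F s in at t within {0..1}. \<sigma> s \<in> cdom c'"
    by (rule curve_eventually_in[OF C1_continuous[OF \<sigma>] t chart_open[OF c'(1)] c'(2)])
  moreover have "\<forall>\<^sub>F s in at t within {0..1}. s \<in> {0..1}" by (simp add: eventually_at_filter)
  ultimately have "\<forall>\<^sub>F s in at t within {0..1}.
      (\<Sum>i\<in>UNIV. v s $ i *\<^sub>R pdir (axis i 1) ?\<psi> (cmap c (\<sigma> s))) = tvec_of A c (\<sigma> s) (v s) c'"
    by eventually_elim (rule eqs)
  then show "((\<lambda>s. tvec_of A c (\<sigma> s) (v s) c') has_vector_derivative
      - christoffel A nabla c' ?p (velocity A \<sigma> t c') (tvec_of A c ?p (v t) c')) (at t within {0..1})"
    using F eqs[OF t c'(2)] unfolding has_vector_derivative_def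
    by (intro has_derivative_transform_eventually[OF F[unfolded has_vector_derivative_def]]) (use t in auto)
qed

text \<open>The definite description in \<open>parallel_transport\<close> needs a unique end value.
  When the whole curve lies in one chart, any parallel field has components solving the same linear
  ODE, so uniqueness there settles it.\<close>

lemma parallel_transport_chart:
  assumes \<sigma>: "C1_curve A \<sigma>" and c: "c \<in> A" and in_c: "\<And>t. t \<in> {0..1} \<Longrightarrow> \<sigma> t \<in> cdom c"
    and vt: "\<And>t. t \<in> {0..1} \<Longrightarrow> velocity A \<sigma> t \<in> tangent_space A (\<sigma> t)"
    and v: "\<And>t. t \<in> {0..1} \<Longrightarrow> (v has_vector_derivative
        - christoffel A nabla c (\<sigma> t) (velocity A \<sigma> t c) (v t)) (at t within {0..1})"
  shows "parallel_transport A nabla \<sigma> (tvec_of A c (\<sigma> 0) (v 0)) = tvec_of A c (\<sigma> 1) (v 1)"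
  unfolding parallel_transport_def
proof (rule the_equality)
  show "\<exists>V. parallel_along A nabla \<sigma> V \<and> V 0 = tvec_of A c (\<sigma> 0) (v 0) \<and> V 1 = tvec_of A c (\<sigma> 1) (v 1)"
    by (intro exI[of _ "\<lambda>t. tvec_of A c (\<sigma> t) (v t)"] conjI parallel_along_chart[OF assms] refl)
  fix w assume "\<exists>V. parallel_along A nabla \<sigma> V \<and> V 0 = tvec_of A c (\<sigma> 0) (v 0) \<and> V 1 = w"
  then obtain V where V: "parallel_along A nabla \<sigma> V" "V 0 = tvec_of A c (\<sigma> 0) (v 0)" "V 1 = w" by blast
  define M where "M = (\<lambda>t u. - christoffel A nabla c (\<sigma> t) (velocity A \<sigma> t c) u)"
  have lin: "linear (M t)" for t
    by (rule linearI) (simp_all add: M_def christoffel_bil bil_add_right bil_scaleR_right)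
  have ap: "blinfun_apply (Blinfun (M t)) u = M t u" for t u
    using lin by (simp add: bounded_linear_Blinfun_apply linear_conv_bounded_linear)
  have "V 1 c = v 1"
  proof (rule linear_ode_unique[where L = "\<lambda>t. Blinfun (M t)" and V = "\<lambda>t. V t c" and W = v])
    show "continuous_on {0..1} (\<lambda>t. Blinfun (M t))"
    proof (rule continuous_on_Blinfun[OF lin])
      fix b :: "real^'n"
      have "continuous_on {0..1} (\<lambda>t. cmap c (\<sigma> t))"
        by (rule continuous_on_compose2[OF continuous_cmap[OF c] C1_continuous[OF \<sigma>]]) (use in_c in blast)
      moreover have "(\<lambda>t. cmap c (\<sigma> t)) ` {0..1} \<subseteq> cmap c ` cdom c" using in_c by blast
      ultimately have "continuous_on {0..1} (\<lambda>t. nabla (coord_field A c i) (coord_field A c j) (cinv c (cmap c (\<sigma> t))) c)" for i j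
        by (rule continuous_on_compose2[OF Ck_on_imp_continuous_on[OF christoffel_smooth[OF c, of 0]]])
      then have 1: "continuous_on {0..1} (\<lambda>t. nabla (coord_field A c i) (coord_field A c j) (\<sigma> t) c)" for i j
        by (rule continuous_on_cong[THEN iffD1, OF refl, rotated]) (simp add: cinv_cmap[OF c in_c])
      have "{t \<in> {0..1}. \<sigma> t \<in> cdom c} = {0..1}" using in_c by auto
      then have "continuous_on {0..1} (\<lambda>t. velocity A \<sigma> t c)"
        using \<sigma> c unfolding C1_curve_def by metis
      then show "continuous_on {0..1} (\<lambda>t. M t b)"
        unfolding M_def christoffel_bil bil_def by (intro continuous_intros 1)
    qed
    show "((\<lambda>t. V t c) has_vector_derivative blinfun_apply (Blinfun (M s)) (V s c)) (at s within {0..1})"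
      if "s \<in> {0..1}" for s
    proof -
      have "((\<lambda>t. V t c) has_vector_derivative - christoffel A nabla c (\<sigma> s) (velocity A \<sigma> s c) (V s c)) (at s within {0..1})"
        using V(1) that c in_c[OF that] unfolding parallel_along_def charts_at_def by blast
      then show ?thesis unfolding ap unfolding M_def .
    qed
    show "(v has_vector_derivative blinfun_apply (Blinfun (M s)) (v s)) (at s within {0..1})"
      if "s \<in> {0..1}" for s
      using v[OF that] unfolding ap unfolding M_def .
    show "V 0 c = v 0" using V(2) tvec_of_chart[OF c in_c[of 0]] by simp
  qed auto
  moreover have "w \<in> tangent_space A (\<sigma> 1)" using V(1,3) unfolding parallel_along_def by force
  ultimately show "w = tvec_of A c (\<sigma> 1) (v 1)"
    using tvec_of_components[of w "\<sigma> 1" c] c in_c[of 1] V(3) by simp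
qed

lemma geodesic_velocity_tangent:
  "geodesic A nabla \<sigma> \<Longrightarrow> t \<in> {0..1} \<Longrightarrow> velocity A \<sigma> t \<in> tangent_space A (\<sigma> t)"
  by (simp add: geodesic_def parallel_along_def)

lemma geodesic_rescale:
  assumes \<sigma>: "geodesic A nabla \<sigma>" and \<tau>: "\<tau> \<in> {0..1}" and \<sigma>': "\<And>s. s \<in> {0..1} \<Longrightarrow> \<sigma>' s = \<sigma> (\<tau> * s)"
  shows "geodesic A nabla \<sigma>'"
proof -
  have C1: "C1_curve A \<sigma>" using \<sigma> by (simp add: geodesic_def)
  have vel: "velocity A \<sigma>' s = (\<lambda>c. \<tau> *\<^sub>R velocity A \<sigma> (\<tau> * s) c)" if "s \<in> {0..1}" for s
    by (rule C1_curve_rescale(2)[OF C1 \<tau> _ that]) (rule \<sigma>')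
  have ts: "\<tau> * s \<in> {0..1}" if "s \<in> {0..1}" for s using that \<tau> by (auto simp: mult_le_one)
  then have sub: "(\<lambda>s. \<tau> * s) ` {0..1} \<subseteq> {0..1}" by blast
  have "parallel_along A nabla \<sigma>' (velocity A \<sigma>')"
    unfolding parallel_along_def
  proof (intro ballI conjI)
    fix t :: real assume t: "t \<in> {0..1}"
    show "velocity A \<sigma>' t \<in> tangent_space A (\<sigma>' t)"
      unfolding vel[OF t] \<sigma>'[OF t] by (rule tangent_scale[OF geodesic_velocity_tangent[OF \<sigma> ts[OF t]]])
    fix c assume c: "c \<in> charts_at A (\<sigma>' t)"
    let ?g = "- christoffel A nabla c (\<sigma> (\<tau> * t)) (velocity A \<sigma> (\<tau> * t) c) (velocity A \<sigma> (\<tau> * t) c)"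
    have 1: "((\<lambda>s. velocity A \<sigma> s c) has_vector_derivative ?g) (at (\<tau> * t) within {0..1})"
      using \<sigma> ts[OF t] c[unfolded \<sigma>'[OF t]] unfolding geodesic_def parallel_along_def by blast
    have 2: "((\<lambda>s. \<tau> * s) has_vector_derivative \<tau>) (at t within {0..1})"
      by (auto intro!: derivative_eq_intros)
    have "((\<lambda>s. velocity A \<sigma> (\<tau> * s) c) has_vector_derivative \<tau> *\<^sub>R ?g) (at t within {0..1})"
      using vector_diff_chain_within[OF 2 has_vector_derivative_within_subset[OF 1 sub]] unfolding o_def .
    from bounded_linear.has_vector_derivative[OF bounded_linear_scaleR_right this, of \<tau>]
    have "((\<lambda>s. \<tau> *\<^sub>R velocity A \<sigma> (\<tau> * s) c) has_vector_derivative
        - christoffel A nabla c (\<sigma>' t) (velocity A \<sigma>' t c) (velocity A \<sigma>' t c)) (at t within {0..1})"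
      by (simp add: vel[OF t] \<sigma>'[OF t] christoffel_bil bil_scaleR_left bil_scaleR_right)
    then show "((\<lambda>s. velocity A \<sigma>' s c) has_vector_derivative
        - christoffel A nabla c (\<sigma>' t) (velocity A \<sigma>' t c) (velocity A \<sigma>' t c)) (at t within {0..1})"
      by (rule has_vector_derivative_transform[rotated -1]) (use t vel in auto)
  qed
  then show ?thesis using C1_curve_rescale(1)[OF C1 \<tau> \<sigma>'] by (simp add: geodesic_def)
qed

end

section \<open>Inverse exponential maps in charts\<close>

text \<open>The consequences of the standing convention for a single connection, so that both
  connections can be treated by the same lemmas.\<close>

locale geodesic_domain = connection A nabla
  for A :: "('a::topological_space, 'n::finite) chart set" and nabla +
  fixes U :: "'a set"
  assumes open_U: "open U"
    and geodesic_unique: "p \<in> U \<Longrightarrow> q \<in> U \<Longrightarrow> \<exists>!\<sigma>. geodesic_from_to A nabla U p q \<sigma>"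
    and exp_inv_inj: "p \<in> U \<Longrightarrow> q \<in> U \<Longrightarrow> q' \<in> U \<Longrightarrow>
      exp_inv A nabla U p q = exp_inv A nabla U p q' \<Longrightarrow> q = q'"
    and exp_inv_smooth: "smooth_exp_inv A nabla U"
begin

abbreviation geo :: "'a \<Rightarrow> 'a \<Rightarrow> real \<Rightarrow> 'a" where "geo \<equiv> the_geodesic A nabla U"

lemma geo: "p \<in> U \<Longrightarrow> q \<in> U \<Longrightarrow> geodesic_from_to A nabla U p q (geo p q)"
  unfolding the_geodesic_def by (rule theI'[OF geodesic_unique])

lemma geo_eqI: "p \<in> U \<Longrightarrow> q \<in> U \<Longrightarrow> geodesic_from_to A nabla U p q \<sigma> \<Longrightarrow> geo p q = \<sigma>"
  unfolding the_geodesic_def by (rule the1_equality[OF geodesic_unique])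

lemma geo_props:
  assumes "p \<in> U" "q \<in> U"
  shows "geodesic A nabla (geo p q)" "C1_curve A (geo p q)" "geo p q 0 = p" "geo p q 1 = q"
    "s \<in> {0..1} \<Longrightarrow> geo p q s \<in> U"
  using geo[OF assms] by (auto simp: geodesic_from_to_def geodesic_def)

lemma exp_inv_tangent: "p \<in> U \<Longrightarrow> q \<in> U \<Longrightarrow> exp_inv A nabla U p q \<in> tangent_space A p"
  using geodesic_velocity_tangent[OF geo_props(1), of p q 0] by (simp add: exp_inv_def geo_props)

text \<open>The part of the geodesic up to time \<open>\<tau>\<close>, rescaled to unit time, is a
  geodesic in \<open>U\<close> to its own endpoint and hence the selected one; its initial velocity
  is scaled by \<open>\<tau>\<close>.\<close>

lemma exp_inv_along:
  assumes p: "p \<in> U" and q: "q \<in> U" and \<tau>: "\<tau> \<in> {0..1}"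
  shows "exp_inv A nabla U p (geo p q \<tau>) = (\<lambda>c. \<tau> *\<^sub>R exp_inv A nabla U p q c)"
proof -
  define \<sigma>' where "\<sigma>' = restrict (\<lambda>s. geo p q (\<tau> * s)) {0..1}"
  have \<sigma>': "\<sigma>' s = geo p q (\<tau> * s)" if "s \<in> {0..1}" for s using that by (simp add: \<sigma>'_def)
  have ts: "\<tau> * s \<in> {0..1}" if "s \<in> {0..1}" for s using that \<tau> by (auto simp: mult_le_one)
  have r: "geo p q \<tau> \<in> U" by (rule geo_props(5)[OF p q \<tau>])
  have "geodesic_from_to A nabla U p (geo p q \<tau>) \<sigma>'"
    unfolding geodesic_from_to_def
  proof (intro conjI)
    show "\<sigma>' \<in> {0..1} \<rightarrow>\<^sub>E U" unfolding \<sigma>'_def using geo_props(5)[OF p q ts] by auto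
    show "geodesic A nabla \<sigma>'" by (rule geodesic_rescale[OF geo_props(1)[OF p q] \<tau> \<sigma>'])
  qed (simp_all add: \<sigma>' geo_props[OF p q])
  then have "geo p (geo p q \<tau>) = \<sigma>'" by (rule geo_eqI[OF p r])
  then have "exp_inv A nabla U p (geo p q \<tau>) = velocity A \<sigma>' 0" by (simp add: exp_inv_def)
  also have "\<dots> = (\<lambda>c. \<tau> *\<^sub>R velocity A (geo p q) (\<tau> * 0) c)"
    by (rule C1_curve_rescale(2)[OF geo_props(2)[OF p q] \<tau>]) (use \<sigma>' in auto)
  finally show ?thesis by (simp add: exp_inv_def)
qed

definition chart_image :: "('a, 'n) chart \<Rightarrow> (real^'n) set" where "chart_image c = cmap c ` (U \<inter> cdom c)"

definition chart_exp_inv :: "('a, 'n) chart \<Rightarrow> (real^'n) \<times> (real^'n) \<Rightarrow> real^'n" where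
  "chart_exp_inv c z = exp_inv A nabla U (cinv c (fst z)) (cinv c (snd z)) c"

lemma chart_imageD:
  assumes "c \<in> A" "x \<in> chart_image c"
  shows "cinv c x \<in> U" "cinv c x \<in> cdom c" "cmap c (cinv c x) = x"
  using assms cinv_cmap[OF assms(1)] by (auto simp: chart_image_def)

lemma chart_exp_inv_along:
  assumes c: "c \<in> A" and xy: "x \<in> chart_image c" "y \<in> chart_image c" and s: "s \<in> {0..1}"
    and sc: "geo (cinv c x) (cinv c y) s \<in> cdom c"
  shows "chart_exp_inv c (x, cmap c (geo (cinv c x) (cinv c y) s)) = s *\<^sub>R chart_exp_inv c (x, y)"
  using exp_inv_along[OF chart_imageD(1)[OF c xy(1)] chart_imageD(1)[OF c xy(2)] s] cinv_cmap[OF c sc]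
  by (simp add: chart_exp_inv_def)

lemma exp_chart_instance:
  assumes c: "c \<in> A" shows "exp_chart (chart_image c) (chart_exp_inv c)"
proof
  show "open (chart_image c)" unfolding chart_image_def by (rule open_image[OF c open_U])
  have "(\<lambda>(x, y). exp_inv A nabla U (cinv c x) (cinv c y) c) = chart_exp_inv c"
    by (auto simp: chart_exp_inv_def)
  then show "Ck_on k (chart_image c \<times> chart_image c) (chart_exp_inv c)" for k
    using exp_inv_smooth c unfolding smooth_exp_inv_def chart_image_def smooth_on_def by metis
next
  fix x y y' assume x: "x \<in> chart_image c" and y: "y \<in> chart_image c" and y': "y' \<in> chart_image c"
    and eq: "chart_exp_inv c (x, y) = chart_exp_inv c (x, y')"
  note D = chart_imageD[OF c]
  have "exp_inv A nabla U (cinv c x) (cinv c y) = exp_inv A nabla U (cinv c x) (cinv c y')"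
    by (rule tangent_eqI[OF exp_inv_tangent[OF D(1)[OF x] D(1)[OF y]] exp_inv_tangent[OF D(1)[OF x] D(1)[OF y']] c D(2)[OF x]])
      (use eq in \<open>simp add: chart_exp_inv_def\<close>)
  then have "cinv c y = cinv c y'" by (rule exp_inv_inj[OF D(1)[OF x] D(1)[OF y] D(1)[OF y']])
  then show "y = y'" using D(3)[OF y] D(3)[OF y'] by metis
next
  fix x assume x: "x \<in> chart_image c"
  note D = chart_imageD[OF c x]
  have "geo (cinv c x) (cinv c x) 0 \<in> cdom c" using D geo_props(3)[OF D(1) D(1)] by simp
  from chart_exp_inv_along[OF c x x _ this] show "chart_exp_inv c (x, x) = 0"
    using D geo_props(3)[OF D(1) D(1)] by simp
next
  fix x y assume x: "x \<in> chart_image c" and y: "y \<in> chart_image c"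
  note Dx = chart_imageD[OF c x] and Dy = chart_imageD[OF c y]
  define \<sigma> where "\<sigma> = geo (cinv c x) (cinv c y)"
  have C1: "C1_curve A \<sigma>" and s0: "\<sigma> 0 = cinv c x" unfolding \<sigma>_def by (rule geo_props[OF Dx(1) Dy(1)])+
  have in0: "\<sigma> 0 \<in> cdom c" using s0 Dx by simp
  show "\<exists>\<gamma>. \<gamma> 0 = x \<and> (\<gamma> has_vector_derivative chart_exp_inv c (x, y)) (at 0 within {0..1}) \<and>
    (\<forall>\<^sub>F s in at 0 within {0..1}. chart_exp_inv c (x, \<gamma> s) = s *\<^sub>R chart_exp_inv c (x, y))"
  proof (intro exI[of _ "cmap c \<circ> \<sigma>"] conjI)
    show "(cmap c \<circ> \<sigma>) 0 = x" using s0 Dx by simp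
    show "((cmap c \<circ> \<sigma>) has_vector_derivative chart_exp_inv c (x, y)) (at 0 within {0..1})"
      using C1_velocity[OF C1 c _ in0] by (simp add: chart_exp_inv_def exp_inv_def \<sigma>_def)
    have "\<forall>\<^sub>F s in at 0 within {0..1}. \<sigma> s \<in> cdom c"
      by (rule curve_eventually_in[OF C1_continuous[OF C1] _ chart_open[OF c] in0]) simp
    moreover have "\<forall>\<^sub>F s in at (0::real) within {0..1}. s \<in> {0..1}" by (simp add: eventually_at_filter)
    ultimately show "\<forall>\<^sub>F s in at 0 within {0..1}. chart_exp_inv c (x, (cmap c \<circ> \<sigma>) s) = s *\<^sub>R chart_exp_inv c (x, y)"
    proof eventually_elim
      case (elim s)
      then show ?case using chart_exp_inv_along[OF c x y, of s] by (simp add: \<sigma>_def)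
    qed
  qed
qed

text \<open>At each time the radial curve and the geodesic have the same inverse exponential
  \<open>s X (x, y)\<close>, and that map is injective in the endpoint. In particular the geodesic
  cannot leave the chart once a radial curve exists.\<close>

lemma radial_geodesic:
  assumes c: "c \<in> A" and x: "x \<in> chart_image c" and y: "y \<in> chart_image c"
    and rad: "radial (chart_image c) (chart_exp_inv c) x y \<gamma> a" and s: "s \<in> {0..1}"
  shows "geo (cinv c x) (cinv c y) s = cinv c (\<gamma> s)" "velocity A (geo (cinv c x) (cinv c y)) s c = a s"
proof -
  note Dx = chart_imageD[OF c x] and Dy = chart_imageD[OF c y]
  have \<gamma>: "geo (cinv c x) (cinv c y) s = cinv c (\<gamma> s)" if s: "s \<in> {0..1}" for s
  proof -
    have g: "\<gamma> s \<in> chart_image c" "chart_exp_inv c (x, \<gamma> s) = s *\<^sub>R chart_exp_inv c (x, y)"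
      using rad s by (auto simp: radial_def)
    have U: "geo (cinv c x) (cinv c y) s \<in> U" by (rule geo_props(5)[OF Dx(1) Dy(1) s])
    have gU: "cinv c (\<gamma> s) \<in> U" by (rule chart_imageD[OF c g(1)])
    have "exp_inv A nabla U (cinv c x) (geo (cinv c x) (cinv c y) s) = exp_inv A nabla U (cinv c x) (cinv c (\<gamma> s))"
      by (rule tangent_eqI[OF exp_inv_tangent[OF Dx(1) U] exp_inv_tangent[OF Dx(1) gU] c Dx(2)])
        (use g(2) exp_inv_along[OF Dx(1) Dy(1) s] in \<open>simp add: chart_exp_inv_def\<close>)
    then show ?thesis by (rule exp_inv_inj[OF Dx(1) U gU])
  qed
  then show "geo (cinv c x) (cinv c y) s = cinv c (\<gamma> s)" using s .
  have gD: "\<gamma> s \<in> chart_image c" if "s \<in> {0..1}" for s using rad that by (auto simp: radial_def)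
  show "velocity A (geo (cinv c x) (cinv c y)) s c = a s"
  proof (rule velocity_eqI[OF c s])
    show "geo (cinv c x) (cinv c y) s \<in> cdom c" using \<gamma>[OF s] chart_imageD(2)[OF c gD[OF s]] by simp
    have "(\<gamma> has_vector_derivative a s) (at s within {0..1})" using rad s by (auto simp: radial_def)
    then show "((cmap c \<circ> geo (cinv c x) (cinv c y)) has_vector_derivative a s) (at s within {0..1})"
      by (rule has_vector_derivative_transform[rotated -1]) (use s \<gamma> chart_imageD(3)[OF c gD] in auto)
  qed
qed

lemma radial_geodesic_equation:
  assumes c: "c \<in> A" and x: "x \<in> chart_image c" and y: "y \<in> chart_image c"
    and rad: "radial (chart_image c) (chart_exp_inv c) x y \<gamma> a" and s: "s \<in> {0..1}"
  shows "(a has_vector_derivative - christoffel A nabla c (cinv c (\<gamma> s)) (a s) (a s)) (at s within {0..1})"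
proof -
  let ?\<sigma> = "geo (cinv c x) (cinv c y)"
  note R = radial_geodesic[OF c x y rad]
  have "\<gamma> s \<in> chart_image c" using rad s by (auto simp: radial_def)
  then have "c \<in> charts_at A (?\<sigma> s)" using R(1)[OF s] c chart_imageD(2)[OF c] by (simp add: charts_at_def)
  then have "((\<lambda>s. velocity A ?\<sigma> s c) has_vector_derivative
      - christoffel A nabla c (?\<sigma> s) (velocity A ?\<sigma> s c) (velocity A ?\<sigma> s c)) (at s within {0..1})"
    using geo_props(1)[OF chart_imageD(1)[OF c x] chart_imageD(1)[OF c y]] s
    unfolding geodesic_def parallel_along_def by blast
  then have "((\<lambda>s. velocity A ?\<sigma> s c) has_vector_derivative
      - christoffel A nabla c (cinv c (\<gamma> s)) (a s) (a s)) (at s within {0..1})"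
    by (simp add: R(1)[OF s] R(2)[OF s])
  then show ?thesis by (rule has_vector_derivative_transform[rotated -1]) (use s R in auto)
qed

end

section \<open>The two divergences\<close>

locale dually_convex_manifold = N1: geodesic_domain A nabla U + N2: geodesic_domain A nabla' U
  for A :: "('a::topological_space, 'n::finite) chart set" and nabla nabla' U +
  fixes g :: "'a \<Rightarrow> ('a, 'n) tvec \<Rightarrow> ('a, 'n) tvec \<Rightarrow> real"
  assumes metric: "riemannian_metric A g"
    and torsion: "torsion_free A nabla" "torsion_free A nabla'"
    and dual: "dual_connections A g nabla nabla'"
begin

lemma g_sym: "u \<in> tangent_space A p \<Longrightarrow> v \<in> tangent_space A p \<Longrightarrow> g p u v = g p v u"
  and g_pos: "u \<in> tangent_space A p \<Longrightarrow> u \<noteq> (\<lambda>c. 0) \<Longrightarrow> g p u u > 0"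
  and g_combination: "u \<in> tangent_space A p \<Longrightarrow> v \<in> tangent_space A p \<Longrightarrow> w \<in> tangent_space A p \<Longrightarrow>
    g p (\<lambda>c. a *\<^sub>R u c + b *\<^sub>R v c) w = a * g p u w + b * g p v w"
  and g_smooth: "open W \<Longrightarrow> smooth_vfield_on A W X \<Longrightarrow> smooth_vfield_on A W Y \<Longrightarrow>
    smooth_fun_on A W (\<lambda>p. g p (X p) (Y p))"
  using metric unfolding riemannian_metric_def by blast+

lemma g_linear_left:
  assumes c: "c \<in> A" "p \<in> cdom c" and w: "w \<in> tangent_space A p"
  shows "linear (\<lambda>u. g p (tvec_of A c p u) w)"
proof (rule linearI)
  show "g p (tvec_of A c p (u + v)) w = g p (tvec_of A c p u) w + g p (tvec_of A c p v) w" for u v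
    using N1.tvec_of_combination[OF c, of 1 u 1 v]
      g_combination[OF N1.tvec_of_tangent[OF c] N1.tvec_of_tangent[OF c] w, of 1 u 1 v] by simp
  show "g p (tvec_of A c p (r *\<^sub>R u)) w = r *\<^sub>R g p (tvec_of A c p u) w" for r u
    using N1.tvec_of_combination[OF c, of r u 0 u]
      g_combination[OF N1.tvec_of_tangent[OF c] N1.tvec_of_tangent[OF c] w, of r u 0 u] by simp
qed

text \<open>The metric axioms state linearity in the first slot only; the second slot is expanded
  after swapping by symmetry.\<close>

lemma g_bil:
  assumes c: "c \<in> A" "p \<in> cdom c"
  shows "g p (tvec_of A c p u) (tvec_of A c p w) = bil (\<lambda>i j. metric_coeff A g c p i j) u w"
proof -
  note T = N1.tvec_of_tangent[OF c]
  have l: "g p (tvec_of A c p u) w = (\<Sum>i\<in>UNIV. u $ i * g p (tvec_of A c p (axis i 1)) w)"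
    if "w \<in> tangent_space A p" for u w
    by (subst vec_expand[of u])
      (simp add: linear_sum[OF g_linear_left[OF c that]] linear_scale[OF g_linear_left[OF c that]])
  have "g p (tvec_of A c p u) (tvec_of A c p w) = (\<Sum>i\<in>UNIV. u $ i * g p (tvec_of A c p w) (tvec_of A c p (axis i 1)))"
    by (rule trans[OF l[OF T[of w], of u]]) (intro sum.cong refl arg_cong2[where f = times] g_sym T)
  also have "\<dots> = (\<Sum>i\<in>UNIV. u $ i * (\<Sum>j\<in>UNIV. w $ j * g p (tvec_of A c p (axis j 1)) (tvec_of A c p (axis i 1))))"
    by (intro sum.cong refl arg_cong2[where f = times] l T)
  also have "\<dots> = bil (\<lambda>i j. metric_coeff A g c p i j) u w"
    unfolding bil_def metric_coeff_def coord_field_def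
    using g_sym[OF T T] by (simp add: sum_distrib_left mult.assoc)
  finally show ?thesis .
qed

lemma g_components:
  assumes c: "c \<in> A" "p \<in> cdom c" and u: "u \<in> tangent_space A p" and w: "w \<in> tangent_space A p"
  shows "g p u w = bil (\<lambda>i j. metric_coeff A g c p i j) (u c) (w c)"
  using g_bil[OF c, of "u c" "w c"] N1.tvec_of_components[OF u c] N1.tvec_of_components[OF w c] by simp

abbreviation D where "D \<equiv> N1.chart_image"

definition chart_P :: "('a, 'n) chart \<Rightarrow> real^'n \<Rightarrow> real^'n \<Rightarrow> real^'n \<Rightarrow> real" where
  "chart_P c x y w = g (cinv c y) (Pi_vec A nabla nabla' U (cinv c x) (cinv c y)) (tvec_of A c (cinv c y) w)"

definition chart_metric :: "('a, 'n) chart \<Rightarrow> 'n \<Rightarrow> 'n \<Rightarrow> real^'n \<Rightarrow> real" where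
  "chart_metric c i j x = metric_coeff A g c (cinv c x) i j"

definition chart_Gamma ::
  "(('a, 'n) vfield \<Rightarrow> ('a, 'n) vfield \<Rightarrow> ('a, 'n) vfield) \<Rightarrow> ('a, 'n) chart \<Rightarrow> 'n \<Rightarrow> 'n \<Rightarrow> real^'n \<Rightarrow> real^'n" where
  "chart_Gamma K c i j x = K (coord_field A c i) (coord_field A c j) (cinv c x) c"

text \<open>Coordinate fields have constant components in their own chart, so their bracket vanishes
  and absence of torsion becomes symmetry of the Christoffel symbols.\<close>

lemma chart_Gamma_sym:
  assumes K: "torsion_free A K" and c: "c \<in> A" and p: "p \<in> cdom c"
  shows "K (coord_field A c i) (coord_field A c j) p c = K (coord_field A c j) (coord_field A c i) p c"
proof -
  have sm: "smooth_vfield_on A (cdom c) (coord_field A c i)" for i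
    by (rule N1.coord_field_smooth[OF c N1.chart_open[OF c]]) simp
  have "(\<lambda>c'. K (coord_field A c i) (coord_field A c j) p c' - K (coord_field A c j) (coord_field A c i) p c')
      = lie_bracket A (coord_field A c i) (coord_field A c j) p"
    using K N1.chart_open[OF c] sm p unfolding torsion_free_def by blast
  from fun_cong[OF this, of c]
  have "K (coord_field A c i) (coord_field A c j) p c - K (coord_field A c j) (coord_field A c i) p c
      = lie_bracket A (coord_field A c i) (coord_field A c j) p c" .
  moreover have "frechet_derivative (\<lambda>x. coord_field A c i (cinv c x) c) (at (cmap c p)) u = 0" for i u
  proof -
    have "((\<lambda>x. coord_field A c i (cinv c x) c) has_derivative (\<lambda>u. 0)) (at (cmap c p))"
    proof (rule has_derivative_transform_within_open[OF has_derivative_const[of "axis i 1"] N1.chart_open_image[OF c]])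
      show "axis i 1 = coord_field A c i (cinv c x) c" if "x \<in> cmap c ` cdom c" for x
        using that N1.coord_field_chart[OF c] N1.cinv_cmap[OF c] by auto
    qed (use p in auto)
    from frechet_derivative_at[OF this] show ?thesis by metis
  qed
  ultimately show ?thesis using c p by (simp add: lie_bracket_def charts_at_def)
qed

text \<open>The bridge from the manifold to the Euclidean analysis: every axiom of
  \<open>dual_chart\<close> is a coordinate form of metric, torsion, duality or geodesic
  properties.\<close>

lemma dual_chart_instance:
  assumes c: "c \<in> A"
  shows "dual_chart (D c) (N1.chart_exp_inv c) (N2.chart_exp_inv c) (chart_metric c)
    (chart_Gamma nabla c) (chart_Gamma nabla' c) (chart_P c)"
proof -
  note I = N1.chart_imageD[OF c]
  have DS: "D c \<subseteq> cmap c ` cdom c" by (auto simp: N1.chart_image_def)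
  interpret X1: exp_chart "D c" "N1.chart_exp_inv c" by (rule N1.exp_chart_instance[OF c])
  interpret X2: exp_chart "D c" "N2.chart_exp_inv c" by (rule N2.exp_chart_instance[OF c])
  have sm: "smooth_vfield_on A (cdom c) (coord_field A c i)" for i
    by (rule N1.coord_field_smooth[OF c N1.chart_open[OF c]]) simp
  have gC: "Ck_on k (cmap c ` cdom c) (chart_metric c i j)" for i j k
  proof -
    have "smooth_fun_on A (cdom c) (\<lambda>p. metric_coeff A g c p i j)"
      unfolding metric_coeff_def by (rule g_smooth[OF N1.chart_open[OF c] sm sm])
    then have "smooth_on (cmap c ` (cdom c \<inter> cdom c)) ((\<lambda>p. metric_coeff A g c p i j) \<circ> cinv c)"
      using c unfolding smooth_fun_on_def by blast
    moreover have "(\<lambda>p. metric_coeff A g c p i j) \<circ> cinv c = chart_metric c i j"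
      by (simp add: fun_eq_iff chart_metric_def)
    ultimately show ?thesis by (simp add: smooth_on_imp_Ck_on)
  qed
  show ?thesis
  proof
    show "Ck_on k (D c) (chart_metric c i j)" for k i j by (rule Ck_on_subset[OF gC DS])
    show "Ck_on k (D c) (chart_Gamma nabla c i j)" for k i j
    proof (rule Ck_on_subset[OF _ DS])
      have "chart_Gamma nabla c i j = (\<lambda>x. nabla (coord_field A c i) (coord_field A c j) (cinv c x) c)"
        by (simp add: fun_eq_iff chart_Gamma_def)
      then show "Ck_on k (cmap c ` cdom c) (chart_Gamma nabla c i j)"
        using N1.christoffel_smooth[OF c] by simp
    qed
  next
    fix x i j assume x: "x \<in> D c"
    show "chart_metric c i j x = chart_metric c j i x"
      unfolding chart_metric_def metric_coeff_def coord_field_def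
      by (rule g_sym[OF N1.tvec_of_tangent[OF c I(2)[OF x]] N1.tvec_of_tangent[OF c I(2)[OF x]]])
    show "chart_Gamma nabla c i j x = chart_Gamma nabla c j i x" "chart_Gamma nabla' c i j x = chart_Gamma nabla' c j i x"
      unfolding chart_Gamma_def by (rule chart_Gamma_sym[OF _ c I(2)[OF x]], rule torsion)+
  next
    fix x and u :: "real^'n" assume x: "x \<in> D c" and u: "u \<noteq> 0"
    have "tvec_of A c (cinv c x) u c \<noteq> 0" using N1.tvec_of_chart[OF c I(2)[OF x]] u by simp
    then have "tvec_of A c (cinv c x) u \<noteq> (\<lambda>c. 0)" by metis
    from g_pos[OF N1.tvec_of_tangent[OF c I(2)[OF x]] this]
    show "bil (\<lambda>i j. chart_metric c i j x) u u > 0"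
      by (simp add: g_bil[OF c I(2)[OF x]] chart_metric_def)
  next
    fix x k i j assume x: "x \<in> D c"
    let ?p = "cinv c x"
    note p = I(2)[OF x]
    have xi: "x \<in> cmap c ` cdom c" using x DS by blast
    have "dir_deriv A ?p (coord_field A c k ?p) (\<lambda>q. g q (coord_field A c i q) (coord_field A c j q)) =
      g ?p (nabla (coord_field A c k) (coord_field A c i) ?p) (coord_field A c j ?p) +
      g ?p (coord_field A c i ?p) (nabla' (coord_field A c k) (coord_field A c j) ?p)"
      using dual N1.chart_open[OF c] sm p unfolding dual_connections_def by blast
    moreover have "dir_deriv A ?p (coord_field A c k ?p) (\<lambda>q. g q (coord_field A c i q) (coord_field A c j q))
        = pdir (axis k 1) (chart_metric c i j) x"
    proof -
      have eq: "(\<lambda>q. g q (coord_field A c i q) (coord_field A c j q)) \<circ> cinv c = chart_metric c i j"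
        by (simp add: fun_eq_iff chart_metric_def metric_coeff_def)
      have "chart_metric c i j differentiable (at (cmap c ?p))"
        using Ck_on_differentiable[OF gC[of 1 i j] _ xi] I(3)[OF x] by simp
      then show ?thesis
        using N1.dir_deriv_chart[OF c p N1.coord_field_tangent[OF c p], of "\<lambda>q. g q (coord_field A c i q) (coord_field A c j q)" k]
        unfolding eq by (simp add: pdir_def I(3)[OF x] N1.coord_field_chart[OF c p])
    qed
    moreover have "nabla (coord_field A c k) (coord_field A c i) ?p \<in> tangent_space A ?p"
      "nabla' (coord_field A c k) (coord_field A c j) ?p \<in> tangent_space A ?p"
      using N1.vfield_tangent[OF N1.nabla_coord_smooth[OF c N1.chart_open[OF c]] p]
        N1.vfield_tangent[OF N2.nabla_coord_smooth[OF c N1.chart_open[OF c]] p] by auto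
    ultimately show "pdir (axis k 1) (chart_metric c i j) x =
      bil (\<lambda>i j. chart_metric c i j x) (chart_Gamma nabla c k i x) (axis j 1) +
      bil (\<lambda>i j. chart_metric c i j x) (axis i 1) (chart_Gamma nabla' c k j x)"
      using g_components[OF c p] N1.coord_field_tangent[OF c p]
      by (simp add: chart_metric_def chart_Gamma_def N1.coord_field_chart[OF c p])
  next
    fix x y \<gamma> a assume x: "x \<in> D c" and y: "y \<in> D c" and r: "radial (D c) (N1.chart_exp_inv c) x y \<gamma> a"
    have g0: "\<gamma> 0 \<in> D c" using r unfolding radial_def by simp
    have "cinv c (\<gamma> 0) = cinv c x"
      using N1.radial_geodesic(1)[OF c x y r, of 0] N1.geo_props(3)[OF I(1)[OF x] I(1)[OF y]] by simp
    from arg_cong[OF this, of "cmap c"] have "\<gamma> 0 = x" unfolding I(3)[OF g0] I(3)[OF x] .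
    with N1.radial_geodesic_equation[OF c x y r, of 0]
    show "(a has_vector_derivative - bil (\<lambda>i j. chart_Gamma nabla c i j x) (a 0) (a 0)) (at 0 within {0..1})"
      by (simp add: N1.christoffel_bil chart_Gamma_def)
  next
    fix x y \<gamma> a V w
    assume x: "x \<in> D c" and y: "y \<in> D c" and r: "radial (D c) (N2.chart_exp_inv c) x y \<gamma> a"
      and V0: "V 0 = N1.chart_exp_inv c (x, y)"
      and V: "\<And>s. s \<in> {0..1} \<Longrightarrow> (V has_vector_derivative
          - bil (\<lambda>i j. chart_Gamma nabla c i j (\<gamma> s)) (a s) (V s)) (at s within {0..1})"
    let ?\<sigma> = "N2.geo (cinv c x) (cinv c y)"
    note R = N2.radial_geodesic[OF c x y r]
    note gp = N2.geo_props[OF I(1)[OF x] I(1)[OF y]]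
    have gD: "\<gamma> s \<in> D c" if "s \<in> {0..1}" for s using r that by (auto simp: radial_def)
    \<comment> \<open>The radial curve is the actual geodesic of \<open>nabla'\<close>, hence lies
      wholly in the chart, where the transport is determined by the ODE for
      \<open>V\<close>.\<close>
    have "parallel_transport A nabla ?\<sigma> (tvec_of A c (?\<sigma> 0) (V 0)) = tvec_of A c (?\<sigma> 1) (V 1)"
    proof (rule N1.parallel_transport_chart[OF gp(2) c])
      show "?\<sigma> t \<in> cdom c" if "t \<in> {0..1}" for t using R(1)[OF that] I(2)[OF gD[OF that]] by simp
      show "velocity A ?\<sigma> t \<in> tangent_space A (?\<sigma> t)" if "t \<in> {0..1}" for t
        by (rule N2.geodesic_velocity_tangent[OF gp(1) that])
      show "(V has_vector_derivative - christoffel A nabla c (?\<sigma> t) (velocity A ?\<sigma> t c) (V t)) (at t within {0..1})"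
        if "t \<in> {0..1}" for t
        using V[OF that] by (simp add: R(1)[OF that] R(2)[OF that] N1.christoffel_bil chart_Gamma_def)
    qed
    moreover have "tvec_of A c (?\<sigma> 0) (V 0) = exp_inv A nabla U (cinv c x) (cinv c y)"
      using N1.tvec_of_components[OF N1.exp_inv_tangent[OF I(1)[OF x] I(1)[OF y]] c I(2)[OF x]]
      by (simp add: gp V0 N1.chart_exp_inv_def)
    ultimately have "Pi_vec A nabla nabla' U (cinv c x) (cinv c y) = tvec_of A c (cinv c y) (V 1)"
      by (simp add: Pi_vec_def gp)
    then show "chart_P c x y w = bil (\<lambda>i j. chart_metric c i j y) (V 1) w"
      by (simp add: chart_P_def g_bil[OF c I(2)[OF y]] chart_metric_def)
  qed
qed

text \<open>\<open>K\<close> selects only the path of integration: \<open>nabla\<close> gives the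
  canonical divergence and \<open>nabla'\<close> the Phi-function, with the same
  \<open>\<Pi>\<close> in both.\<close>

definition divergence ::
  "(('a, 'n) vfield \<Rightarrow> ('a, 'n) vfield \<Rightarrow> ('a, 'n) vfield) \<Rightarrow> 'a \<Rightarrow> 'a \<Rightarrow> real" where
  "divergence K p q = integral {0..1} (\<lambda>t. g (the_geodesic A K U p q t)
     (Pi_vec A nabla nabla' U p (the_geodesic A K U p q t)) (velocity A (the_geodesic A K U p q) t))"

definition chart_divergence where
  "chart_divergence K c = (\<lambda>z. divergence K (cinv c (fst z)) (cinv c (snd z)))"

lemma chart_divergence_jets:
  assumes K: "geodesic_domain A K U" and c: "c \<in> A" and x0: "x0 \<in> D c"
  obtains S B where "open S" "Ck_on 3 S (chart_divergence K c)" "open B" "x0 \<in> B" "B \<subseteq> D c"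
    "\<forall>x\<in>B. (x, x) \<in> S \<and> chart_divergence K c (x, x) = 0 \<and>
      jet_data (chart_divergence K c) S x (bil (\<lambda>i j. chart_metric c i j x))
      (\<lambda>v. bil (\<lambda>i j. chart_metric c i j x) (bil (\<lambda>i j. chart_Gamma nabla c i j x) v v) v
        + 2 * bil (\<lambda>i j. chart_metric c i j x) (bil (\<lambda>i j. chart_Gamma nabla' c i j x) v v) v)"
proof -
  interpret C: dual_chart "D c" "N1.chart_exp_inv c" "N2.chart_exp_inv c" "chart_metric c"
    "chart_Gamma nabla c" "chart_Gamma nabla' c" "chart_P c" by (rule dual_chart_instance[OF c])
  interpret K: geodesic_domain A K U by (rule K)
  have eX: "exp_chart (D c) (K.chart_exp_inv c)" by (rule K.exp_chart_instance[OF c])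
  have F: "chart_divergence K c (x, y) = integral {0..1} (\<lambda>s. chart_P c x (\<gamma> s) (a s))"
    if x: "x \<in> D c" and y: "y \<in> D c" and r: "radial (D c) (K.chart_exp_inv c) x y \<gamma> a" for x y \<gamma> a
    unfolding chart_divergence_def divergence_def
  proof (rule integral_cong)
    fix s :: real assume s: "s \<in> {0..1}"
    note R = K.radial_geodesic[OF c x y r s]
    have gD: "\<gamma> s \<in> D c" using r s by (auto simp: radial_def)
    have "velocity A (K.geo (cinv c x) (cinv c y)) s \<in> tangent_space A (cinv c (\<gamma> s))"
      using K.geodesic_velocity_tangent[OF K.geo_props(1)[OF N1.chart_imageD(1)[OF c x] N1.chart_imageD(1)[OF c y]] s] R(1) by simp
    from N1.tvec_of_components[OF this c N1.chart_imageD(2)[OF c gD]]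
    have "velocity A (K.geo (cinv c x) (cinv c y)) s = tvec_of A c (cinv c (\<gamma> s)) (a s)" using R(2) by simp
    then show "g (K.geo (cinv c (fst (x, y))) (cinv c (snd (x, y))) s)
      (Pi_vec A nabla nabla' U (cinv c (fst (x, y))) (K.geo (cinv c (fst (x, y))) (cinv c (snd (x, y))) s))
      (velocity A (K.geo (cinv c (fst (x, y))) (cinv c (snd (x, y)))) s) = chart_P c x (\<gamma> s) (a s)"
      using R(1) by (simp add: chart_P_def)
  qed
  show ?thesis
    by (rule C.two_point_jets[OF eX x0 F], assumption+) (rule that, auto)
qed

lemma divergence_induces:
  assumes K: "geodesic_domain A K U"
  shows "induces_dual_structure A g nabla nabla' U (divergence K)"
  unfolding induces_dual_structure_def Let_def
proof (intro ballI allI)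
  fix c p and i j k :: 'n assume c: "c \<in> A" and "p \<in> U \<inter> cdom c"
  then have p: "p \<in> U" "p \<in> cdom c" by auto
  interpret C: dual_chart "D c" "N1.chart_exp_inv c" "N2.chart_exp_inv c" "chart_metric c"
    "chart_Gamma nabla c" "chart_Gamma nabla' c" "chart_P c" by (rule dual_chart_instance[OF c])
  define x where "x = cmap c p"
  have xD: "x \<in> D c" using p by (auto simp: x_def N1.chart_image_def)
  have px: "cinv c x = p" unfolding x_def by (rule N1.cinv_cmap[OF c p(2)])
  let ?F = "chart_divergence K c"
  obtain S B where SB0: "open S" "Ck_on 3 S ?F" "open B" "x \<in> B" "B \<subseteq> D c"
    "\<forall>x\<in>B. (x, x) \<in> S \<and> ?F (x, x) = 0 \<and>
        jet_data ?F S x (C.G x) (\<lambda>v. C.G x (C.\<Gamma>1 x v v) v + 2 * C.G x (C.\<Gamma>2 x v v) v)"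
    by (rule chart_divergence_jets[OF K c xD])
  have SB': "\<And>x. x \<in> B \<Longrightarrow> (x, x) \<in> S" "\<And>x. x \<in> B \<Longrightarrow> ?F (x, x) = 0"
    "\<And>x. x \<in> B \<Longrightarrow> jet_data ?F S x (C.G x) (\<lambda>v. C.G x (C.\<Gamma>1 x v v) v + 2 * C.G x (C.\<Gamma>2 x v v) v)"
    using SB0(6) by blast+
  note SB = SB0(1-5) SB'
  have BD: "x \<in> D c" if "x \<in> B" for x using SB(5) that by blast
  have dd: "pdir (u, 0) (pdir (0, v) ?F) (x, x) = - C.G x u v"
    "pdir (0, u) (pdir (0, v) ?F) (x, x) = C.G x u v"
    "pdir (u, 0) (pdir (v, 0) (pdir (0, w) ?F)) (x, x) = - C.G x (C.\<Gamma>1 x u v) w"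
    "pdir (0, u) (pdir (0, v) (pdir (w, 0) ?F)) (x, x) = - C.G x (C.\<Gamma>2 x u v) w" for u v w
  proof -
    have s: "C.G x u v = C.G x v u" "C.\<Gamma>1 x u w = C.\<Gamma>1 x w u" "C.\<Gamma>2 x u w = C.\<Gamma>2 x w u" if "x \<in> B" for x u v w
      by (intro bil_sym C.Gm_sym C.C1_sym C.C2_sym BD[OF that])+
    have h: "((\<lambda>x. C.G x u v) has_derivative (\<lambda>k. C.G x (C.\<Gamma>1 x k u) v + C.G x (C.\<Gamma>2 x k v) u)) (at x)"
      if "x \<in> B" for x u v
    proof -
      have "(\<lambda>k. C.G x (C.\<Gamma>1 x k u) v + C.G x u (C.\<Gamma>2 x k v)) = (\<lambda>k. C.G x (C.\<Gamma>1 x k u) v + C.G x (C.\<Gamma>2 x k v) u)"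
        by (intro ext arg_cong2[where f = "(+)"] refl s(1)[OF that])
      then show ?thesis using C.G_has_derivative[OF BD[OF that], of u v] by simp
    qed
    \<comment> \<open>The trilinear forms are the Christoffel symbols with the last index lowered by
      the metric; evaluated on coordinate vectors they become the connection coefficients.\<close>
    note D = diagonal_derivatives[OF SB(1,2,3,6), where G = C.G and \<Gamma> = "\<lambda>x u v w. C.G x (C.\<Gamma>1 x u v) w"
        and \<Gamma>' = "\<lambda>x u v w. C.G x (C.\<Gamma>2 x u v) w", OF _ SB(8) bil_add_left _ _ _ _ _ _ _ h SB(4)]
    show "pdir (u, 0) (pdir (0, v) ?F) (x, x) = - C.G x u v"
      "pdir (0, u) (pdir (0, v) ?F) (x, x) = C.G x u v"
      "pdir (u, 0) (pdir (v, 0) (pdir (0, w) ?F)) (x, x) = - C.G x (C.\<Gamma>1 x u v) w"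
      "pdir (0, u) (pdir (0, v) (pdir (w, 0) ?F)) (x, x) = - C.G x (C.\<Gamma>2 x u v) w"
      by (rule D; (simp only: bil_add_left bil_add_right; fail | (rule s; assumption) | (rule arg_cong[of _ _ "\<lambda>u. bil _ u _"], rule s, assumption) | assumption))+
  qed
  have f_eq: "(\<lambda>(x, y). divergence K (cinv c x) (cinv c y)) = ?F"
    by (simp add: fun_eq_iff chart_divergence_def)
  have z: "(cmap c p, cmap c p) = (x, x)" by (simp add: x_def)
  have zS: "(x, x) \<in> S" by (rule SB(6)[OF SB(4)])
  have it2: "has_iter_pd [u, v] ?F (x, x) (pdir u (pdir v ?F) (x, x))" for u v
    using Ck_on_has_iter_pd[OF SB(1) zS, of "[u, v]" ?F] Ck_on_le[OF SB(2), of 2]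
    by (simp del: has_iter_pd.simps add: numeral_2_eq_2)
  have it3: "has_iter_pd [u, v, w] ?F (x, x) (pdir u (pdir v (pdir w ?F)) (x, x))" for u v w
    using Ck_on_has_iter_pd[OF SB(1) zS, of "[u, v, w]" ?F] SB(2)
    by (simp del: has_iter_pd.simps add: numeral_3_eq_3)
  have mc: "metric_coeff A g c p i j = C.G x (axis i 1) (axis j 1)" for i j
    by (simp add: bil_axis chart_metric_def px)
  have cc: "g p t (coord_field A c k p) = C.G x (t c) (axis k 1)" if "t \<in> tangent_space A p" for t
    using g_components[OF c p(2) that N1.coord_field_tangent[OF c p(2)]]
    by (simp add: chart_metric_def px N1.coord_field_chart[OF c p(2)])
  have T1: "nabla (coord_field A c i) (coord_field A c j) p \<in> tangent_space A p"
    and T2: "nabla' (coord_field A c i) (coord_field A c j) p \<in> tangent_space A p"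
    using N1.vfield_tangent[OF N1.nabla_coord_smooth[OF c N1.chart_open[OF c]] p(2)]
      N1.vfield_tangent[OF N2.nabla_coord_smooth[OF c N1.chart_open[OF c]] p(2)] by auto
  have c1: "connection_coeff A g nabla c p i j k = C.G x (C.\<Gamma>1 x (axis i 1) (axis j 1)) (axis k 1)"
    using cc[OF T1] by (simp add: connection_coeff_def chart_Gamma_def px
        bil_axis[of "\<lambda>i j. nabla (coord_field A c i) (coord_field A c j) p c"])
  have c2: "connection_coeff A g nabla' c p i j k = C.G x (C.\<Gamma>2 x (axis i 1) (axis j 1)) (axis k 1)"
    using cc[OF T2] by (simp add: connection_coeff_def chart_Gamma_def px
        bil_axis[of "\<lambda>i j. nabla' (coord_field A c i) (coord_field A c j) p c"])
  show "has_iter_pd [dir1 i, dir2 j] (\<lambda>(x, y). divergence K (cinv c x) (cinv c y)) (cmap c p, cmap c p) (- metric_coeff A g c p i j) \<and>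
    has_iter_pd [dir2 i, dir2 j] (\<lambda>(x, y). divergence K (cinv c x) (cinv c y)) (cmap c p, cmap c p) (metric_coeff A g c p i j) \<and>
    has_iter_pd [dir1 i, dir1 j, dir2 k] (\<lambda>(x, y). divergence K (cinv c x) (cinv c y)) (cmap c p, cmap c p)
      (- connection_coeff A g nabla c p i j k) \<and>
    has_iter_pd [dir2 i, dir2 j, dir1 k] (\<lambda>(x, y). divergence K (cinv c x) (cinv c y)) (cmap c p, cmap c p)
      (- connection_coeff A g nabla' c p i j k)"
    unfolding f_eq z mc c1 c2 dir1_def dir2_def
    using it2[of "(axis i 1, 0)" "(0, axis j 1)", unfolded dd(1)]
      it2[of "(0, axis i 1)" "(0, axis j 1)", unfolded dd(2)]
      it3[of "(axis i 1, 0)" "(axis j 1, 0)" "(0, axis k 1)", unfolded dd(3)]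
      it3[of "(0, axis i 1)" "(0, axis j 1)" "(axis k 1, 0)", unfolded dd(4)]
    by (intro conjI)
qed

lemma divergence_local:
  assumes K: "geodesic_domain A K U" and p0: "p0 \<in> U"
  obtains M where "open M" "p0 \<in> M" "M \<subseteq> U"
    "\<forall>p\<in>M. \<forall>q\<in>M. divergence K p q \<ge> 0 \<and> (divergence K p q = 0 \<longleftrightarrow> p = q)"
proof -
  obtain c where "c \<in> charts_at A p0" using N1.chart_exists by blast
  then have c: "c \<in> A" "p0 \<in> cdom c" by (auto simp: charts_at_def)
  interpret C: dual_chart "D c" "N1.chart_exp_inv c" "N2.chart_exp_inv c" "chart_metric c"
    "chart_Gamma nabla c" "chart_Gamma nabla' c" "chart_P c" by (rule dual_chart_instance[OF c(1)])
  define x0 where "x0 = cmap c p0"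
  have xD: "x0 \<in> D c" using p0 c by (auto simp: x0_def N1.chart_image_def)
  let ?F = "chart_divergence K c"
  obtain S B where SB0: "open S" "Ck_on 3 S ?F" "open B" "x0 \<in> B" "B \<subseteq> D c"
    "\<forall>x\<in>B. (x, x) \<in> S \<and> ?F (x, x) = 0 \<and>
        jet_data ?F S x (C.G x) (\<lambda>v. C.G x (C.\<Gamma>1 x v v) v + 2 * C.G x (C.\<Gamma>2 x v v) v)"
    by (rule chart_divergence_jets[OF K c(1) xD])
  have SB': "\<And>x. x \<in> B \<Longrightarrow> (x, x) \<in> S" "\<And>x. x \<in> B \<Longrightarrow> ?F (x, x) = 0"
    "\<And>x. x \<in> B \<Longrightarrow> jet_data ?F S x (C.G x) (\<lambda>v. C.G x (C.\<Gamma>1 x v v) v + 2 * C.G x (C.\<Gamma>2 x v v) v)"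
    using SB0(6) by blast+
  note SB = SB0(1-5) SB'
  have C2: "Ck_on 2 S ?F" using Ck_on_le[OF SB(2), of 2] by simp
  have jets: "pdir (0, v) ?F (x, x) = 0" "pdir (0, v) (pdir (0, v) ?F) (x, x) = C.G x v v" if x: "x \<in> B" for x v
  proof -
    have "x \<in> D c" using x SB(5) by blast
    then have s: "C.G x u v = C.G x v u" for u v by (intro bil_sym C.Gm_sym)
    show "pdir (0, v) ?F (x, x) = 0" "pdir (0, v) (pdir (0, v) ?F) (x, x) = C.G x v v"
      by (rule jet_data_slices[OF SB(1,2) SB(6)[OF x] SB(8)[OF x] bil_add_left s])+
  qed
  obtain d where d: "d > 0" "\<And>x y. x \<in> ball x0 d \<Longrightarrow> y \<in> ball x0 d \<Longrightarrow> ?F (x, y) \<ge> 0 \<and> (?F (x, y) = 0 \<longleftrightarrow> x = y)"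
  proof (rule nonneg_near_diagonal[OF SB(1) C2 SB(3,4,6,7) jets(1)])
    show "0 < pdir (0, v) (pdir (0, v) ?F) (x0, x0)" if "v \<noteq> 0" for v
      using jets(2)[OF SB(4), of v] C.Gm_pos[OF xD that] by simp
  qed auto
  \<comment> \<open>Points whose coordinates lie in the ball: any two of them share the chart
    \<open>c\<close>, so the Euclidean sign statement applies to every pair from
    \<open>M\<close>.\<close>
  define M where "M = (U \<inter> cdom c) \<inter> cmap c -` ball x0 d"
  have o: "open (U \<inter> cdom c)" using N1.open_U N1.chart_open[OF c(1)] by auto
  show ?thesis
  proof (rule that[of M])
    show "open M"
      unfolding M_def
      by (rule continuous_open_preimage[OF continuous_on_subset[OF N1.continuous_cmap[OF c(1)]] o open_ball]) auto
    show "p0 \<in> M" using p0 c d by (simp add: M_def x0_def)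
    show "M \<subseteq> U" by (auto simp: M_def)
  next
    show "\<forall>p\<in>M. \<forall>q\<in>M. divergence K p q \<ge> 0 \<and> (divergence K p q = 0 \<longleftrightarrow> p = q)"
    proof (intro ballI)
      fix p q assume pq: "p \<in> M" "q \<in> M"
      then have "p \<in> cdom c" "q \<in> cdom c" "cmap c p \<in> ball x0 d" "cmap c q \<in> ball x0 d" by (auto simp: M_def)
      moreover from this have "?F (cmap c p, cmap c q) = divergence K p q" "cmap c p = cmap c q \<longleftrightarrow> p = q"
        using N1.cinv_cmap[OF c(1)] by (auto simp: chart_divergence_def) metis
      ultimately show "divergence K p q \<ge> 0 \<and> (divergence K p q = 0 \<longleftrightarrow> p = q)"
        using d(2)[of "cmap c p" "cmap c q"] by simp
    qed
  qed
qed

end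

text \<open>Injectivity of \<open>exp_inv\<close> in the endpoint comes from the diffeomorphism
  clause: on \<open>U\<close> it agrees with an inverse of \<open>exp_map\<close>, so
  \<open>exp_map\<close> recovers the endpoint from the initial velocity.\<close>

lemma geodesic_domainI:
  assumes st: "smooth_structure A" and aff: "affine_connection A K"
    and reg: "regular_dually_convex A nabla nabla' U" and K: "K \<in> {nabla, nabla'}"
  shows "geodesic_domain A K U"
proof -
  interpret connection A K by unfold_locales (rule st, rule aff)
  show ?thesis
  proof
    show "open U" using reg by (simp add: regular_dually_convex_def)
    show "\<exists>!\<sigma>. geodesic_from_to A K U p q \<sigma>" if "p \<in> U" "q \<in> U" for p q
      using reg that K unfolding regular_dually_convex_def dually_convex_def by blast
    show "smooth_exp_inv A K U" using reg K unfolding regular_dually_convex_def by blast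
    fix p q q' assume p: "p \<in> U" and q: "q \<in> U" "q' \<in> U"
      and eq: "exp_inv A K U p q = exp_inv A K U p q'"
    have "\<forall>p\<in>U. \<exists>E. \<forall>D\<in>{nabla, nabla'}. exp_diffeo_on A D p E \<and> U \<subseteq> exp_map A D p ` E \<and>
        (\<forall>q\<in>U. inv_into E (exp_map A D p) q = exp_inv A D U p q)"
      using reg unfolding regular_dually_convex_def by (elim conjE)
    from bspec[OF this p] obtain E where "\<forall>D\<in>{nabla, nabla'}. exp_diffeo_on A D p E \<and>
        U \<subseteq> exp_map A D p ` E \<and> (\<forall>q\<in>U. inv_into E (exp_map A D p) q = exp_inv A D U p q)" ..
    from bspec[OF this K] have E: "U \<subseteq> exp_map A K p ` E"
      "\<forall>q\<in>U. inv_into E (exp_map A K p) q = exp_inv A K U p q" by simp_all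
    have "exp_map A K p (exp_inv A K U p r) = r" if "r \<in> U" for r
      using f_inv_into_f[of r "exp_map A K p" E] E that by auto
    then show "q = q'" using q eq by metis
  qed
qed

theorem mainTheorem5:
  fixes A :: "('a::{t2_space, second_countable_topology}, 'n::finite) chart set"
    and g :: "'a \<Rightarrow> ('a, 'n) tvec \<Rightarrow> ('a, 'n) tvec \<Rightarrow> real"
    and nabla nabla' :: "('a, 'n) vfield \<Rightarrow> ('a, 'n) vfield \<Rightarrow> ('a, 'n) vfield"
    and U :: "'a set"
  assumes "statistical_manifold A g nabla nabla'"
    and "regular_dually_convex A nabla nabla' U"
  shows "(\<exists>N. open N \<and> {(p, p) | p. p \<in> U} \<subseteq> N \<and> N \<subseteq> U \<times> U \<and>
            (\<forall>F \<in> {canonical_divergence A g nabla nabla' U, phi_function A g nabla nabla' U}.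
               \<forall>(p, q) \<in> N. F p q \<ge> 0 \<and> (F p q = 0 \<longleftrightarrow> p = q)))
       \<and> (\<forall>F \<in> {canonical_divergence A g nabla nabla' U, phi_function A g nabla nabla' U}.
            induces_dual_structure A g nabla nabla' U F)"
proof -
  have st: "smooth_structure A" and met: "riemannian_metric A g"
    and aff: "affine_connection A nabla" "affine_connection A nabla'"
    and tor: "torsion_free A nabla" "torsion_free A nabla'" and du: "dual_connections A g nabla nabla'"
    using assms(1) by (auto simp: statistical_manifold_def)
  have K1: "geodesic_domain A nabla U" by (rule geodesic_domainI[OF st aff(1) assms(2)]) simp
  have K2: "geodesic_domain A nabla' U" by (rule geodesic_domainI[OF st aff(2) assms(2)]) simp
  interpret M: dually_convex_manifold A nabla nabla' U g
    by (intro dually_convex_manifold.intro K1 K2 dually_convex_manifold_axioms.intro met tor du)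
  have D: "canonical_divergence A g nabla nabla' U = M.divergence nabla"
    by (simp add: fun_eq_iff canonical_divergence_def M.divergence_def Let_def)
  have P: "phi_function A g nabla nabla' U = M.divergence nabla'"
    by (simp add: fun_eq_iff phi_function_def M.divergence_def Let_def)
  \<comment> \<open>One neighbourhood for both functions at once, obtained by intersecting the two
    neighbourhoods supplied for the paths of \<open>nabla\<close> and \<open>nabla'\<close>.\<close>
  have "\<exists>M. open M \<and> p0 \<in> M \<and> M \<subseteq> U \<and> (\<forall>p\<in>M. \<forall>q\<in>M. \<forall>K\<in>{nabla, nabla'}.
      M.divergence K p q \<ge> 0 \<and> (M.divergence K p q = 0 \<longleftrightarrow> p = q))" if p0: "p0 \<in> U" for p0
  proof -
    obtain M1 where M1: "open M1" "p0 \<in> M1" "M1 \<subseteq> U"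
      "\<forall>p\<in>M1. \<forall>q\<in>M1. M.divergence nabla p q \<ge> 0 \<and> (M.divergence nabla p q = 0 \<longleftrightarrow> p = q)"
      by (rule M.divergence_local[OF K1 p0])
    obtain M2 where M2: "open M2" "p0 \<in> M2" "M2 \<subseteq> U"
      "\<forall>p\<in>M2. \<forall>q\<in>M2. M.divergence nabla' p q \<ge> 0 \<and> (M.divergence nabla' p q = 0 \<longleftrightarrow> p = q)"
      by (rule M.divergence_local[OF K2 p0])
    show ?thesis
      by (rule exI[of _ "M1 \<inter> M2"]) (use M1 M2 in auto)
  qed
  then have "\<forall>p0\<in>U. \<exists>M. open M \<and> p0 \<in> M \<and> M \<subseteq> U \<and> (\<forall>p\<in>M. \<forall>q\<in>M. \<forall>K\<in>{nabla, nabla'}.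
      M.divergence K p q \<ge> 0 \<and> (M.divergence K p q = 0 \<longleftrightarrow> p = q))" by (rule ballI)
  from bchoice[OF this] obtain M where M0: "\<forall>p0\<in>U. open (M p0) \<and> p0 \<in> M p0 \<and> M p0 \<subseteq> U \<and>
      (\<forall>p\<in>M p0. \<forall>q\<in>M p0. \<forall>K\<in>{nabla, nabla'}.
        M.divergence K p q \<ge> 0 \<and> (M.divergence K p q = 0 \<longleftrightarrow> p = q))" ..
  then have M: "\<And>p0. p0 \<in> U \<Longrightarrow> open (M p0)" "\<And>p0. p0 \<in> U \<Longrightarrow> p0 \<in> M p0"
    "\<And>p0. p0 \<in> U \<Longrightarrow> M p0 \<subseteq> U" by simp_all
  \<comment> \<open>Squares rather than \<open>M p \<times> M q\<close>, because the sign is known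
    only for two points of the same \<open>M p\<close>; the union still covers the diagonal.\<close>
  define N where "N = (\<Union>p\<in>U. M p \<times> M p)"
  have "open N" unfolding N_def using M(1) by (intro open_UN ballI open_Times)
  moreover have "{(p, p) | p. p \<in> U} \<subseteq> N" unfolding N_def using M(2) by blast
  moreover have "N \<subseteq> U \<times> U" unfolding N_def using M(3) by blast
  moreover have "M.divergence K p q \<ge> 0 \<and> (M.divergence K p q = 0 \<longleftrightarrow> p = q)"
    if pq: "(p, q) \<in> N" and K: "K \<in> {nabla, nabla'}" for p q K
  proof -
    obtain p0 where "p0 \<in> U" "p \<in> M p0" "q \<in> M p0" using pq by (auto simp: N_def)
    then show ?thesis using M0 K by blast
  qed
  ultimately show ?thesis
    unfolding D P
    using M.divergence_induces[OF K1] M.divergence_induces[OF K2]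
    by (intro conjI exI[of _ N]) auto
qed

end
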